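(* For every $N\in\mathbb{N}$ there is $\epsilon_N>0$ such that for all $\epsilon\in(0,\epsilon_N)$ the essential spectrum $\sigma$ of the linear water-wave problem in the periodic channel $\Pi^\epsilon$, $$-\Delta u=0\ \text{ in }\Pi^\epsilon,\qquad \partial_n u=0\ \text{ a.e. on }\Sigma^\epsilon,\qquad \partial_z u=\lambda u\ \text{ a.e. on }\Gamma^\epsilon ,$$ with spectral parameter $\lambda$, has at least $N$ gaps.
   Context: Geometry. Points are $x=(x_1,x_2,x_3)$, $x'=(x_2,x_3)$, $z=x_3$. Let $\varpi_\bullet\subset\mathbb{R}^3$ be a domain with Lipschitz boundary and compact closure whose intersections with the planes $\{x_1=0\}$ and $\{x_1=1\}$ are simply connected planar domains of positive area containing $P^0=(0,P_2,P_3)$ and $P^1=(1,P_2,P_3)$ respectively, with $P_3<0$. The periodicity cell is the bounded domain $\varpi=\{x\in\varpi_\bullet: x_3<0,\ 0<x_1<1\}$, with translates $\varpi_j=\{x:(x_1-j,x_2,x_3)\in\varpi\}$, $j\in\mathbb{Z}$; its free surface is $\gamma$, the part of $\partial\varpi$ in $\{x_3=0\}$ (of positive area). It is a standing fact that the form $(\nabla u,\nabla v)_{L^2(\varpi)}+(u,v)_{L^2(\gamma)}$ induces a norm equivalent to the $H^1(\varpi)$-norm and that the trace map $H^1(\varpi)\to L^2(\gamma)$ is compact. Let $\theta\subset\mathbb{R}^2$ be a bounded planar domain containing the origin, with $C^2$ boundary, so small that $\{j\}\times\overline{(2\theta+(P_2,P_3))}\subset\partial\varpi$ for $j=0,1$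 and $\sup_{(x_2,x_3)\in\theta}(x_3+P_3)<0$; moreover the set $\{0\}\times\overline\theta+P^0$ has a neighbourhood $N_0$ with $N_0\cap\{x_1=0\}\subset\partial\varpi$ and $N_0\cap\{x_1>0\}\subset\varpi$, and analogously at $P^1$ with $\{x_1=1\}$, $\{x_1<1\}$. For small $\epsilon>0$ the apertures are $\theta_j^\epsilon=\{(j,x'):\epsilon^{-1}(x'-(P_2,P_3))\in\theta\}$, $j\in\mathbb{Z}$. The channel is $\Pi^\epsilon=\bigcup_{j\in\mathbb{Z}}(\varpi_j\cup\theta_j^\epsilon)$, its free surface is $\Gamma^\epsilon=\partial\Pi^\epsilon\cap\{x_3=0\}$, and $\Sigma^\epsilon=\partial\Pi^\epsilon\setminus\overline{\Gamma^\epsilon}$. Spectrum. The problem is understood variationally: $(\nabla u,\nabla v)_{L^2(\Pi^\epsilon)}=\lambda(u,v)_{L^2(\Gamma^\epsilon)}$ for all $v\in H^1(\Pi^\epsilon)$. Equip $H^1(\Pi^\epsilon)$ with the inner product $\langle u,v\rangle=(\nabla u,\nabla v)_{L^2(\Pi^\epsilon)}+(u,v)_{L^2(\Gamma^\epsilon)}$ and let $\mathcal{B}$ be the bounded self-adjoint operator with $\langle\mathcal{B}u,v\rangle=(u,v)_{L^2(\Gamma^\epsilon)}$; then $\lambda\ge 0$ belongs to the essential spectrum $\sigma$ of the problem iff $(1+\lambda)^{-1}$ belongs to the essential spectrum of $\mathcal{B}$. Known description (Floquet–Bloch theory; may be taken as known). For $\eta\in[0,2\pi)$ let $H^1_{\epsilon,\eta}(\varpi)$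 be the space of $u\in H^1(\varpi)$ with $u(0,x')=e^{-i\eta}u(1,x')$ for $(0,x')\in\theta_0^\epsilon$, and let $0\le\Lambda_1^\epsilon(\eta)\le\Lambda_2^\epsilon(\eta)\le\dots\to\infty$ be the eigenvalues (with multiplicity) of the problem $(\nabla U,\nabla V)_{L^2(\varpi)}=\Lambda(U,V)_{L^2(\gamma)}$ for all $V\in H^1_{\epsilon,\eta}(\varpi)$, $U\in H^1_{\epsilon,\eta}(\varpi)$. Then $\eta\mapsto\Lambda_k^\epsilon(\eta)$ is continuous and $2\pi$-periodic and $$\sigma=\bigcup_{k=1}^\infty\Upsilon_k^\epsilon,\qquad \Upsilon_k^\epsilon=\{\Lambda_k^\epsilon(\eta):\eta\in[0,2\pi)\},$$ where the $\Upsilon_k^\epsilon$ (spectral bands) are closed bounded intervals, possibly single points. A gap of $\sigma$ is a nonempty bounded open interval $(a,b)$ with $(a,b)\cap\sigma=\emptyset$ and $a,b\in\sigma$. *)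

theory Defs
  imports "HOL-Analysis.Analysis"
begin

section \<open>Smoothness classes and regular boundaries\<close>

primrec Ck :: "nat \<Rightarrow> ('a::euclidean_space \<Rightarrow> real) \<Rightarrow> bool" where
  "Ck 0 f \<longleftrightarrow> continuous_on UNIV f"
| "Ck (Suc k) f \<longleftrightarrow> (\<forall>x. f differentiable (at x)) \<and>
     (\<forall>e\<in>Basis. Ck k (\<lambda>x. frechet_derivative f (at x) e))"

text \<open>Near each boundary point the set lies strictly below the graph of a function \<open>f\<close> from the
  class \<open>F\<close>, in direction \<open>n\<close>.  Only the values of \<open>f\<close> on the hyperplane orthogonal to \<open>n\<close> are
  used; a Lipschitz or \<open>C\<^sup>k\<close> function on that hyperplane extends to the whole space (constantly
  along \<open>n\<close>), so that taking \<open>F\<close> as a class of functions on the whole space is no restriction.\<close>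

definition boundary_of_class :: "(('a::euclidean_space \<Rightarrow> real) \<Rightarrow> bool) \<Rightarrow> 'a set \<Rightarrow> bool" where
  "boundary_of_class F S \<longleftrightarrow>
     (\<forall>p\<in>frontier S. \<exists>n r f. norm n = 1 \<and> 0 < r \<and> F f \<and>
        (\<forall>x\<in>ball p r. x \<in> S \<longleftrightarrow> x \<bullet> n < f (x - (x \<bullet> n) *\<^sub>R n)))"

definition Lipschitz_boundary :: "'a::euclidean_space set \<Rightarrow> bool" where
  "Lipschitz_boundary = boundary_of_class (\<lambda>f. \<exists>L. L-lipschitz_on UNIV f)"

definition C2_boundary :: "'a::euclidean_space set \<Rightarrow> bool" where
  "C2_boundary = boundary_of_class (Ck 2)"


section \<open>\<open>L\<^sup>2\<close> and \<open>H\<^sup>1\<close>\<close>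

text \<open>Elements of \<open>L\<^sup>2(S)\<close> and \<open>H\<^sup>1(S)\<close> are represented by complex functions on the whole space, whose
  values outside \<open>S\<close> are irrelevant.  Functions are not identified when they agree almost
  everywhere on \<open>S\<close>; instead, equality of elements is expressed below as vanishing of the norm of
  the difference.\<close>

definition L2 :: "'a::euclidean_space set \<Rightarrow> ('a \<Rightarrow> complex) set" where
  "L2 S = {u. u \<in> borel_measurable (lebesgue_on S) \<and>
              integrable (lebesgue_on S) (\<lambda>x. (cmod (u x))\<^sup>2)}"

definition L2_inner :: "'a::euclidean_space set \<Rightarrow> ('a \<Rightarrow> complex) \<Rightarrow> ('a \<Rightarrow> complex) \<Rightarrow> complex" where
  "L2_inner S u v = (\<integral>x. u x * cnj (v x) \<partial>lebesgue_on S)"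

definition L2_norm :: "'a::euclidean_space set \<Rightarrow> ('a \<Rightarrow> complex) \<Rightarrow> real" where
  "L2_norm S u = sqrt (Re (L2_inner S u u))"

definition test_function :: "'a::euclidean_space set \<Rightarrow> ('a \<Rightarrow> real) \<Rightarrow> bool" where
  "test_function \<Omega> \<phi> \<longleftrightarrow> (\<forall>k. Ck k \<phi>) \<and> (\<exists>K. compact K \<and> K \<subseteq> \<Omega> \<and> (\<forall>x. x \<notin> K \<longrightarrow> \<phi> x = 0))"

definition has_weak_derivative ::
    "'a::euclidean_space set \<Rightarrow> 'a \<Rightarrow> ('a \<Rightarrow> complex) \<Rightarrow> ('a \<Rightarrow> complex) \<Rightarrow> bool" where
  "has_weak_derivative \<Omega> e u g \<longleftrightarrow>
     (\<forall>\<phi>. test_function \<Omega> \<phi> \<longrightarrow>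
        (\<integral>x. frechet_derivative \<phi> (at x) e *\<^sub>R u x \<partial>lebesgue_on \<Omega>) =
        - (\<integral>x. \<phi> x *\<^sub>R g x \<partial>lebesgue_on \<Omega>))"

definition H1 :: "'a::euclidean_space set \<Rightarrow> ('a \<Rightarrow> complex) set" where
  "H1 \<Omega> = {u \<in> L2 \<Omega>. \<forall>e\<in>Basis. \<exists>g\<in>L2 \<Omega>. has_weak_derivative \<Omega> e u g}"

definition weak_derivative :: "'a::euclidean_space set \<Rightarrow> 'a \<Rightarrow> ('a \<Rightarrow> complex) \<Rightarrow> 'a \<Rightarrow> complex" where
  "weak_derivative \<Omega> e u = (SOME g. g \<in> L2 \<Omega> \<and> has_weak_derivative \<Omega> e u g)"

definition Dirichlet_form ::
    "'a::euclidean_space set \<Rightarrow> ('a \<Rightarrow> complex) \<Rightarrow> ('a \<Rightarrow> complex) \<Rightarrow> complex" where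
  "Dirichlet_form \<Omega> u v =
     (\<Sum>e\<in>Basis. L2_inner \<Omega> (weak_derivative \<Omega> e u) (weak_derivative \<Omega> e v))"

definition H1_norm :: "'a::euclidean_space set \<Rightarrow> ('a \<Rightarrow> complex) \<Rightarrow> real" where
  "H1_norm \<Omega> u = sqrt (Re (L2_inner \<Omega> u u + Dirichlet_form \<Omega> u u))"


section \<open>Traces on the free surface\<close>

text \<open>A point \<open>x = (x\<^sub>1, x\<^sub>2, x\<^sub>3)\<close> is a nested pair, so that \<open>x' = (x\<^sub>2, x\<^sub>3)\<close> is \<open>snd x\<close>.  Subsets of the
  plane \<open>x\<^sub>3 = 0\<close> are given by their coordinates \<open>(x\<^sub>1, x\<^sub>2)\<close>.\<close>

type_synonym space = "real \<times> real \<times> real"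
type_synonym plane = "real \<times> real"

definition free_surface :: "space set \<Rightarrow> plane set" where
  "free_surface \<Omega> = {(x1, x2). (x1, x2, 0) \<in> frontier \<Omega>}"

text \<open>The trace operator \<open>H\<^sup>1(\<Omega>) \<rightarrow> L\<^sup>2\<close> is the closure of the restriction map on
  \<open>H\<^sup>1(\<Omega>) \<inter> C(closure \<Omega>)\<close>.\<close>

definition has_trace :: "space set \<Rightarrow> (space \<Rightarrow> complex) \<Rightarrow> (plane \<Rightarrow> complex) \<Rightarrow> bool" where
  "has_trace \<Omega> u g \<longleftrightarrow> u \<in> H1 \<Omega> \<and> g \<in> L2 (free_surface \<Omega>) \<and>
     (\<exists>U :: nat \<Rightarrow> space \<Rightarrow> complex.
        (\<forall>n. U n \<in> H1 \<Omega> \<and> continuous_on (closure \<Omega>) (U n)) \<and>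
        (\<lambda>n. H1_norm \<Omega> (\<lambda>x. U n x - u x)) \<longlonglongrightarrow> 0 \<and>
        (\<lambda>n. L2_norm (free_surface \<Omega>) (\<lambda>(x1, x2). U n (x1, x2, 0) - g (x1, x2))) \<longlonglongrightarrow> 0)"

text \<open>The standing fact on the periodicity cell: every \<open>u \<in> H\<^sup>1(\<Omega>)\<close> has a trace,
  \<open>(\<nabla>u, \<nabla>v) + (u, v)\<^bsub>\<gamma>\<^esub>\<close> induces a norm equivalent to the one of \<open>H\<^sup>1(\<Omega>)\<close>, and the trace operator
  is compact.  By the upper bound in the equivalence the trace is unique almost everywhere.\<close>

definition trace_facts :: "space set \<Rightarrow> bool" where
  "trace_facts \<Omega> \<longleftrightarrow>
     (\<forall>u\<in>H1 \<Omega>. \<exists>g. has_trace \<Omega> u g) \<and>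
     (\<exists>c C. 0 < c \<and> 0 < C \<and> (\<forall>u\<in>H1 \<Omega>. \<forall>g. has_trace \<Omega> u g \<longrightarrow>
        c * H1_norm \<Omega> u \<le> sqrt (Re (Dirichlet_form \<Omega> u u + L2_inner (free_surface \<Omega>) g g)) \<and>
        sqrt (Re (Dirichlet_form \<Omega> u u + L2_inner (free_surface \<Omega>) g g)) \<le> C * H1_norm \<Omega> u)) \<and>
     (\<forall>u g M. (\<forall>n::nat. u n \<in> H1 \<Omega> \<and> has_trace \<Omega> (u n) (g n) \<and> H1_norm \<Omega> (u n) \<le> M) \<longrightarrow>
        (\<exists>r h. strict_mono r \<and> h \<in> L2 (free_surface \<Omega>) \<and>
           (\<lambda>n. L2_norm (free_surface \<Omega>) (\<lambda>y. g (r n) y - h y)) \<longlonglongrightarrow> 0))"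


section \<open>The periodic channel\<close>

definition slice :: "space set \<Rightarrow> real \<Rightarrow> plane set" where
  "slice W a = {x'. (a, x') \<in> W}"

definition cell :: "space set \<Rightarrow> space set" where
  "cell W = {(x1, x2, x3). (x1, x2, x3) \<in> W \<and> x3 < 0 \<and> 0 < x1 \<and> x1 < 1}"

definition translated_cell :: "space set \<Rightarrow> int \<Rightarrow> space set" where
  "translated_cell W j = {(x1, x2, x3). (x1 - of_int j, x2, x3) \<in> cell W}"

definition aperture :: "plane \<Rightarrow> plane set \<Rightarrow> real \<Rightarrow> int \<Rightarrow> space set" where
  "aperture P \<theta> \<epsilon> j = {(x1, x'). x1 = of_int j \<and> (1 / \<epsilon>) *\<^sub>R (x' - P) \<in> \<theta>}"

definition channel :: "space set \<Rightarrow> plane \<Rightarrow> plane set \<Rightarrow> real \<Rightarrow> space set" where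
  "channel W P \<theta> \<epsilon> = (\<Union>j. translated_cell W j \<union> aperture P \<theta> \<epsilon> j)"

text \<open>The channel lies on both sides of the walls separating the cells, hence functions that are
  continuous up to its boundary are not dense in \<open>H\<^sup>1\<close>.  As the free surface of the channel is the
  union of the free surfaces of the cells, the trace is taken cell by cell.\<close>

definition channel_trace ::
    "space set \<Rightarrow> plane \<Rightarrow> plane set \<Rightarrow> real \<Rightarrow> (space \<Rightarrow> complex) \<Rightarrow> plane \<Rightarrow> complex" where
  "channel_trace W P \<theta> \<epsilon> u =
     (SOME g. g \<in> L2 (free_surface (channel W P \<theta> \<epsilon>)) \<and>
              (\<forall>j. has_trace (translated_cell W j) u g))"

definition surface_form ::
    "space set \<Rightarrow> plane \<Rightarrow> plane set \<Rightarrow> real \<Rightarrow> (space \<Rightarrow> complex) \<Rightarrow> (space \<Rightarrow> complex) \<Rightarrow> complex" where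
  "surface_form W P \<theta> \<epsilon> u v =
     L2_inner (free_surface (channel W P \<theta> \<epsilon>)) (channel_trace W P \<theta> \<epsilon> u) (channel_trace W P \<theta> \<epsilon> v)"

definition channel_inner ::
    "space set \<Rightarrow> plane \<Rightarrow> plane set \<Rightarrow> real \<Rightarrow> (space \<Rightarrow> complex) \<Rightarrow> (space \<Rightarrow> complex) \<Rightarrow> complex" where
  "channel_inner W P \<theta> \<epsilon> u v =
     Dirichlet_form (channel W P \<theta> \<epsilon>) u v + surface_form W P \<theta> \<epsilon> u v"


section \<open>Essential spectrum\<close>

text \<open>An operator on a Hilbert space of (representatives of) functions is given by a map \<open>A\<close> on the
  space \<open>V\<close> of representatives with inner product \<open>ip\<close>; elements at distance \<open>0\<close> are equal.
  \<open>A\<close> is Fredholm if its kernel is finite-dimensional and its range is closed and of finite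
  codimension, and the essential spectrum of \<open>B\<close> consists of the \<open>\<mu>\<close> for which \<open>B - \<mu>\<close> is not
  Fredholm; for self-adjoint \<open>B\<close> this is the complement in the spectrum of the set of isolated
  eigenvalues of finite multiplicity.\<close>

type_synonym 'a form = "('a \<Rightarrow> complex) \<Rightarrow> ('a \<Rightarrow> complex) \<Rightarrow> complex"

definition form_dist :: "'a form \<Rightarrow> ('a \<Rightarrow> complex) \<Rightarrow> ('a \<Rightarrow> complex) \<Rightarrow> real" where
  "form_dist ip u v = sqrt (Re (ip (\<lambda>x. u x - v x) (\<lambda>x. u x - v x)))"

definition lin_comb :: "(('a \<Rightarrow> complex) \<Rightarrow> complex) \<Rightarrow> ('a \<Rightarrow> complex) set \<Rightarrow> 'a \<Rightarrow> complex" where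
  "lin_comb c F = (\<lambda>x. \<Sum>f\<in>F. c f * f x)"

definition Fredholm ::
    "('a \<Rightarrow> complex) set \<Rightarrow> 'a form \<Rightarrow> (('a \<Rightarrow> complex) \<Rightarrow> ('a \<Rightarrow> complex)) \<Rightarrow> bool" where
  "Fredholm V ip A \<longleftrightarrow>
     (\<exists>F. finite F \<and> F \<subseteq> V \<and>
        (\<forall>u\<in>V. form_dist ip (A u) (\<lambda>_. 0) = 0 \<longrightarrow> (\<exists>c. form_dist ip u (lin_comb c F) = 0))) \<and>
     (\<forall>w v. (\<forall>n::nat. w n \<in> V) \<and> v \<in> V \<and> (\<lambda>n. form_dist ip (A (w n)) v) \<longlonglongrightarrow> 0 \<longrightarrow>
        (\<exists>u\<in>V. form_dist ip (A u) v = 0)) \<and>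
     (\<exists>F. finite F \<and> F \<subseteq> V \<and>
        (\<forall>v\<in>V. \<exists>u\<in>V. \<exists>c. form_dist ip v (\<lambda>x. A u x + lin_comb c F x) = 0))"

definition essential_spectrum ::
    "('a \<Rightarrow> complex) set \<Rightarrow> 'a form \<Rightarrow> (('a \<Rightarrow> complex) \<Rightarrow> ('a \<Rightarrow> complex)) \<Rightarrow> complex set" where
  "essential_spectrum V ip B = {\<mu>. \<not> Fredholm V ip (\<lambda>u x. B u x - \<mu> * u x)}"

definition is_water_wave_operator ::
    "space set \<Rightarrow> plane \<Rightarrow> plane set \<Rightarrow> real \<Rightarrow> ((space \<Rightarrow> complex) \<Rightarrow> (space \<Rightarrow> complex)) \<Rightarrow> bool" where
  "is_water_wave_operator W P \<theta> \<epsilon> B \<longleftrightarrow>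
     (\<forall>u\<in>H1 (channel W P \<theta> \<epsilon>). B u \<in> H1 (channel W P \<theta> \<epsilon>) \<and>
        (\<forall>v\<in>H1 (channel W P \<theta> \<epsilon>). channel_inner W P \<theta> \<epsilon> (B u) v = surface_form W P \<theta> \<epsilon> u v))"

text \<open>The values of \<open>B\<close> are determined up to elements of norm \<open>0\<close>, and the essential spectrum does not
  depend on this choice.  If no such operator existed, the set would be empty.\<close>

definition water_wave_essential_spectrum ::
    "space set \<Rightarrow> plane \<Rightarrow> plane set \<Rightarrow> real \<Rightarrow> real set" where
  "water_wave_essential_spectrum W P \<theta> \<epsilon> =
     {l. 0 \<le> l \<and> (\<exists>B. is_water_wave_operator W P \<theta> \<epsilon> B \<and>
        complex_of_real (1 / (1 + l)) \<in>
          essential_spectrum (H1 (channel W P \<theta> \<epsilon>)) (channel_inner W P \<theta> \<epsilon>) B)}"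

text \<open>A gap \<open>(a, b)\<close> is represented by its pair of end points.\<close>

definition gaps :: "real set \<Rightarrow> (real \<times> real) set" where
  "gaps \<sigma> = {(a, b). a < b \<and> {a<..<b} \<inter> \<sigma> = {} \<and> a \<in> \<sigma> \<and> b \<in> \<sigma>}"

definition has_at_least_gaps :: "nat \<Rightarrow> real set \<Rightarrow> bool" where
  "has_at_least_gaps N \<sigma> \<longleftrightarrow> (\<exists>G \<subseteq> gaps \<sigma>. finite G \<and> card G = N)"

end

theory Submission
  imports Defs
begin

text \<open>A function on the channel is represented by its energy, the pair of its gradient and its trace.
  The energies form a closed subspace \<open>H\<close> of a real Hilbert space, invariant under integer shifts, and
  the water-wave operator becomes the compression to \<open>H\<close> of the orthogonal projection \<open>T\<close> onto the
  trace component.  A shift-invariant subspace of finite dimension is zero, hence \<open>\<lambda>\<close> lies in the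
  essential spectrum iff \<open>1 / (1 + \<lambda>)\<close> is an approximate eigenvalue of this compression.

  Functions that may jump across the apertures have energies in the orthogonal sum \<open>G \<supseteq> H\<close> of the
  translates of the energy space \<open>C\<close> of one cell, and the compression of \<open>T\<close> to \<open>C\<close> has infinitely many
  positive eigenvalues, which accumulate only at \<open>0\<close>.  A point has capacity zero, so functions
  vanishing near the centres of the apertures are dense in \<open>C\<close>; they belong to \<open>H\<close> once \<open>\<epsilon>\<close> is small.
  Together with the compactness of the trace, this bounds \<open>T\<close> on the orthogonal complement of \<open>H\<close> in
  \<open>G\<close> by any given \<open>\<delta> > 0\<close>.  Consequently the approximate eigenvalues of the compression to \<open>H\<close> come
  arbitrarily close to any given eigenvalues of \<open>C\<close> and avoid given points between them.\<close>

section \<open>Closed subspaces of a real Hilbert space\<close>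

text \<open>The channel is unbounded, so compactness of the trace is at hand on a single bounded
  cell only and has to be carried to the channel by shift invariance. Allowing jumps decouples the
  cells: over \<open>G\<close> the spectrum is that of one cell, repeated in every strip, and
  \<open>H\<close> is cut out of \<open>G\<close> by continuity across the small openings. The
  influence of \<epsilon> is thereby a pure change of subspace inside one fixed Hilbert space, and
  the only quantity to estimate is \<open>T\<close> on the complement. No rate in \<epsilon> has to
  be found, since for given N only finitely many positive separations must be preserved. Working
  with gradient and trace instead of the function turns the inner product of the problem into the
  ambient one; the price is that a function must be recovered from its energy, which the norm
  equivalence on a cell provides, with constants common to all translates. The substitution
  \<open>1 / (1 + \<lambda>)\<close> sends the unbounded eigenvalues of the cell to positive numbers
  tending to 0, so N + 1 of them exist for every N.\<close>

lemma norm_le_if_inner_le: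
  assumes "inner x x \<le> c * norm x" "0 \<le> c"
  shows "norm x \<le> c"
proof (cases "x = 0")
  case False
  have "norm x * norm x \<le> c * norm x" using assms
    by (simp add: power2_norm_eq_inner[symmetric] power2_eq_square)
  then show ?thesis using False by simp
qed (use assms in simp)

definition closed_subspace :: "'h::real_inner set \<Rightarrow> bool" where
  "closed_subspace H \<longleftrightarrow> subspace H \<and> closed H"

lemma closed_subspaceD:
  assumes "closed_subspace H"
  shows "0 \<in> H" "x \<in> H \<Longrightarrow> y \<in> H \<Longrightarrow> x + y \<in> H" "x \<in> H \<Longrightarrow> y \<in> H \<Longrightarrow> x - y \<in> H"
    "x \<in> H \<Longrightarrow> c *\<^sub>R x \<in> H" "x \<in> H \<Longrightarrow> - x \<in> H"
  using assms unfolding closed_subspace_def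
  by (simp_all add: subspace_0 subspace_add subspace_diff subspace_scale subspace_neg)

lemma closed_subspace_limit:
  "closed_subspace H \<Longrightarrow> (\<And>n. f n \<in> H) \<Longrightarrow> f \<longlonglongrightarrow> l \<Longrightarrow> l \<in> H"
  unfolding closed_subspace_def by (blast intro: closed_sequentially)

lemma closed_subspace_Int:
  "closed_subspace H \<Longrightarrow> closed_subspace K \<Longrightarrow> closed_subspace (H \<inter> K)"
  by (auto simp: closed_subspace_def subspace_inter)

lemma closed_subspace_orthogonal: "closed_subspace {x. \<forall>e\<in>B. inner x e = 0}"
proof -
  have eq: "{x. \<forall>e\<in>B. inner x e = 0} = (\<Inter>e\<in>B. {x. inner x e = 0})" by auto
  have "closed {x. \<forall>e\<in>B. inner x e = 0}"
    unfolding eq by (intro closed_INT ballI closed_Collect_eq continuous_intros)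
  moreover have "subspace {x. \<forall>e\<in>B. inner x e = 0}"
    by (auto simp: subspace_def inner_add_left)
  ultimately show ?thesis by (simp add: closed_subspace_def)
qed

text \<open>The parallelogram law makes a minimising sequence Cauchy; completeness of the space and
  closedness of \<open>H\<close> then give the minimiser.\<close>

lemma nearest_point_exists:
  fixes H :: "'h::{real_inner,complete_space} set"
  assumes H: "closed_subspace H"
  shows "\<exists>y\<in>H. \<forall>z\<in>H. norm (x - y) \<le> norm (x - z)"
proof -
  define d where "d = Inf ((\<lambda>z. norm (x - z)) ` H)"
  have ne: "H \<noteq> {}" using closed_subspaceD(1)[OF H] by auto
  have bdd: "bdd_below ((\<lambda>z. norm (x - z)) ` H)" by (rule bdd_belowI[of _ 0]) auto
  have d_le: "d \<le> norm (x - z)" if "z \<in> H" for z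
    unfolding d_def using that bdd by (auto intro: cInf_lower)
  have d0: "0 \<le> d" unfolding d_def using ne by (intro cInf_greatest) auto
  have ex: "\<exists>y. y \<in> H \<and> norm (x - y) < d + 1 / real (Suc n)" for n
  proof -
    have "Inf ((\<lambda>z. norm (x - z)) ` H) < d + 1 / real (Suc n)" unfolding d_def by simp
    then show ?thesis using ne bdd by (subst (asm) cInf_less_iff) auto
  qed
  then obtain y where y: "\<And>n. y n \<in> H" "\<And>n. norm (x - y n) < d + 1 / real (Suc n)" by metis
  \<comment> \<open>The midpoint of two members of the sequence lies in \<open>H\<close>, so its
    distance from \<open>x\<close> is at least \<open>d\<close>.\<close>
  have par: "(norm (y m - y n))\<^sup>2 \<le> 2 * (norm (x - y m))\<^sup>2 + 2 * (norm (x - y n))\<^sup>2 - 4 * d\<^sup>2" for m n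
  proof -
    have "(1/2) *\<^sub>R (y m + y n) \<in> H" by (intro closed_subspaceD(2,4)[OF H] y)
    then have "d \<le> norm (x - (1/2) *\<^sub>R (y m + y n))" by (rule d_le)
    then have "d\<^sup>2 \<le> (norm (x - (1/2) *\<^sub>R (y m + y n)))\<^sup>2" using d0 by (intro power_mono) auto
    moreover have "(norm (y m - y n))\<^sup>2 + 4 * (norm (x - (1/2) *\<^sub>R (y m + y n)))\<^sup>2
        = 2 * (norm (x - y m))\<^sup>2 + 2 * (norm (x - y n))\<^sup>2"
      unfolding power2_norm_eq_inner by (simp add: algebra_simps inner_commute)
    ultimately show ?thesis by linarith
  qed
  have lim0: "(\<lambda>n. norm (x - y n)) \<longlonglongrightarrow> d"
  proof (rule tendsto_sandwich[of "\<lambda>_. d" _ _ "\<lambda>n. d + 1 / real (Suc n)"])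
    show "(\<lambda>n. d + 1 / real (Suc n)) \<longlonglongrightarrow> d"
      using tendsto_add[OF tendsto_const LIMSEQ_Suc[OF lim_1_over_n], of d] by simp
  qed (use d_le y less_imp_le[OF y(2)] in auto)
  have "Cauchy y"
  proof (rule CauchyI)
    fix e :: real assume e: "e > 0"
    have "(\<lambda>n. (norm (x - y n))\<^sup>2) \<longlonglongrightarrow> d\<^sup>2" by (intro tendsto_intros lim0)
    then have "eventually (\<lambda>n. (norm (x - y n))\<^sup>2 < d\<^sup>2 + e\<^sup>2 / 4) sequentially"
      using e by (intro order_tendstoD) auto
    then obtain N where N: "\<And>n. n \<ge> N \<Longrightarrow> (norm (x - y n))\<^sup>2 < d\<^sup>2 + e\<^sup>2 / 4"
      by (auto simp: eventually_sequentially)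
    have "norm (y m - y n) < e" if "m \<ge> N" "n \<ge> N" for m n
    proof -
      have "(norm (y m - y n))\<^sup>2 < e\<^sup>2" using par[of m n] N[OF that(1)] N[OF that(2)] by linarith
      then show ?thesis using e by (simp add: power_less_imp_less_base)
    qed
    then show "\<exists>M. \<forall>m\<ge>M. \<forall>n\<ge>M. norm (y m - y n) < e" by blast
  qed
  then obtain l where l: "y \<longlonglongrightarrow> l" 
      using Cauchy_convergent unfolding convergent_def by metis
  have "(\<lambda>n. norm (x - y n)) \<longlonglongrightarrow> norm (x - l)" by (intro tendsto_intros l)
  then have "norm (x - l) = d" using lim0 LIMSEQ_unique by blast
  moreover have "l \<in> H" using closed_subspace_limit[OF H y(1) l] by auto
  ultimately show ?thesis using d_le by auto
qed

lemma orthogonal_projection_exists: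
  fixes H :: "'h::{real_inner,complete_space} set"
  assumes H: "closed_subspace H"
  shows "\<exists>y. y \<in> H \<and> (\<forall>z\<in>H. inner (x - y) z = 0)"
proof -
  obtain y where y: "y \<in> H" "\<And>z. z \<in> H \<Longrightarrow> norm (x - y) \<le> norm (x - z)"
    using nearest_point_exists[OF H] by blast
  have "inner (x - y) z = 0" if z: "z \<in> H" for z
  proof (cases "z = 0")
    case False
    \<comment> \<open>\<open>y + t *\<^sub>R z\<close> is the point closest to \<open>x\<close> on
      the line through \<open>y\<close> in direction \<open>z\<close>; minimality of
      \<open>y\<close> then forces the inner product to vanish.\<close>
    define t where "t = inner (x - y) z / inner z z"
    have "norm (x - y) \<le> norm (x - (y + t *\<^sub>R z))"
      by (intro y closed_subspaceD(2,4)[OF H] z)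
    then have "(norm (x - y))\<^sup>2 \<le> (norm (x - (y + t *\<^sub>R z)))\<^sup>2" by (intro power_mono) auto
    also have "\<dots> = (norm (x - y))\<^sup>2 - 2 * t * inner (x - y) z + t\<^sup>2 * inner z z"
      unfolding power2_norm_eq_inner by (simp add: algebra_simps inner_commute power2_eq_square)
    also have "\<dots> = (norm (x - y))\<^sup>2 - (inner (x - y) z)\<^sup>2 / inner z z"
      using False by (simp add: t_def power2_eq_square field_simps)
    finally have "(inner (x - y) z)\<^sup>2 / inner z z \<le> 0" by simp
    moreover have "0 < inner z z" using False by simp
    ultimately have "(inner (x - y) z)\<^sup>2 \<le> 0" by (simp add: divide_le_eq)
    then show ?thesis by simp
  qed simp
  then show ?thesis using y by blast
qed

text \<open>A total function by choice, so that no closedness proof travels inside terms; for closed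
  subspaces \<open>proj_eqI\<close> identifies the chosen value.\<close>

definition proj :: "'h::{real_inner,complete_space} set \<Rightarrow> 'h \<Rightarrow> 'h" where
  "proj H x = (SOME y. y \<in> H \<and> (\<forall>z\<in>H. inner (x - y) z = 0))"

lemma
  assumes "closed_subspace H"
  shows proj_in: "proj H x \<in> H"
    and proj_orthogonal: "z \<in> H \<Longrightarrow> inner (x - proj H x) z = 0"
  using someI_ex[OF orthogonal_projection_exists[OF assms, of x]] by (auto simp: proj_def)

lemma inner_proj: "closed_subspace H \<Longrightarrow> z \<in> H \<Longrightarrow> inner (proj H x) z = inner x z"
  using proj_orthogonal[of H z x] by (simp add: inner_diff_left)

lemma proj_eqI:
  assumes H: "closed_subspace H" and y: "y \<in> H" and "\<And>z. z \<in> H \<Longrightarrow> inner y z = inner x z"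
  shows "proj H x = y"
proof -
  have m: "proj H x - y \<in> H" by (intro closed_subspaceD(3)[OF H] proj_in H y)
  have "inner (proj H x - y) (proj H x - y) = 0"
    using inner_proj[OF H m, of x] assms(3)[OF m] by (simp add: inner_diff_left)
  then show ?thesis by simp
qed

lemma linear_proj: "closed_subspace H \<Longrightarrow> linear (proj H)"
  by (intro linearI proj_eqI)
    (simp_all add: inner_add_left inner_proj closed_subspaceD(2,4) proj_in)

lemma norm_proj_le: "closed_subspace H \<Longrightarrow> norm (proj H x) \<le> norm x"
proof -
  assume H: "closed_subspace H"
  have "inner (proj H x) (proj H x) = inner x (proj H x)"
    by (rule inner_proj[OF H proj_in[OF H]])
  also have "\<dots> \<le> norm x * norm (proj H x)" by (rule norm_cauchy_schwarz)
  finally show ?thesis by (intro norm_le_if_inner_le) auto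
qed

lemma norm_proj_Pythagoras:
  assumes H: "closed_subspace H"
  shows "(norm x)\<^sup>2 = (norm (proj H x))\<^sup>2 + (norm (x - proj H x))\<^sup>2"
proof -
  have "inner (x - proj H x) (proj H x) = 0" by (intro proj_orthogonal[OF H] proj_in[OF H])
  then show ?thesis unfolding power2_norm_eq_inner
    by (simp add: algebra_simps inner_commute)
qed

text \<open>If the images converge, the lower bound makes the preimages Cauchy, and their limit in
  \<open>H\<close> is mapped to the limit of the images.\<close>

lemma bounded_below_range_closed:
  fixes H :: "'h::{real_inner,complete_space} set"
  assumes H: "closed_subspace H" and D: "bounded_linear D" and c: "c > 0"
    and below: "\<And>x. x \<in> H \<Longrightarrow> c * norm x \<le> norm (D x)"
  shows "closed_subspace (D ` H)"
proof -
  have lin: "linear D" using D by (rule bounded_linear.linear)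
  have lim: "l \<in> D ` H" if f: "\<forall>n. f n \<in> D ` H" and l: "f \<longlonglongrightarrow> l" for f l
  proof -
    have "\<forall>n. \<exists>y. y \<in> H \<and> f n = D y" using f by auto
    then obtain g where g: "\<And>n. g n \<in> H" "\<And>n. f n = D (g n)" by metis
    have "Cauchy f" using l by (rule LIMSEQ_imp_Cauchy)
    have "Cauchy g"
    proof (rule CauchyI)
      fix e :: real assume "e > 0"
      then have ec: "0 < e * c" using c by simp
      obtain M where M: "\<And>m n. m \<ge> M \<Longrightarrow> n \<ge> M \<Longrightarrow> norm (f m - f n) < e * c"
        using CauchyD[OF \<open>Cauchy f\<close> ec] by blast
      have "norm (g m - g n) < e" if "m \<ge> M" "n \<ge> M" for m n
      proof -
        have "c * norm (g m - g n) \<le> norm (D (g m - g n))"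
          by (intro below closed_subspaceD(3)[OF H] g)
        also have "\<dots> = norm (f m - f n)" by (simp add: g linear_diff[OF lin])
        also have "\<dots> < e * c" by (rule M[OF that])
        finally show ?thesis using c by (simp add: mult.commute)
      qed
      then show "\<exists>M. \<forall>m\<ge>M. \<forall>n\<ge>M. norm (g m - g n) < e" by blast
    qed
    then obtain x where x: "g \<longlonglongrightarrow> x" 
      using Cauchy_convergent unfolding convergent_def by metis
    have "f = (\<lambda>n. D (g n))" by (rule ext) (rule g(2))
    with bounded_linear.tendsto[OF D x] have "f \<longlonglongrightarrow> D x" by simp
    then have "l = D x" by (rule LIMSEQ_unique[OF l])
    moreover have "x \<in> H" by (rule closed_subspace_limit[OF H g(1) x])
    ultimately show ?thesis by (rule image_eqI)
  qed
  have "closed (D ` H)" unfolding closed_sequential_limits using lim by blast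
  moreover have "subspace (D ` H)"
    using H unfolding closed_subspace_def by (intro linear_subspace_image[OF lin]) auto
  ultimately show ?thesis unfolding closed_subspace_def by (intro conjI)
qed

text \<open>Cauchy-Schwarz for the semidefinite form \<open>inner (S x) y\<close>, obtained by
  evaluating it at \<open>x - (1 / K) *\<^sub>R S x\<close>. Where the quadratic form of a positive
  operator is small, the vector \<open>S x\<close> itself is small; extremal values of quadratic
  forms thereby become approximate eigenvalues.\<close>

lemma symmetric_pos_norm_le:
  assumes lin: "linear S" and sym: "\<And>x y. x \<in> H \<Longrightarrow> y \<in> H \<Longrightarrow> inner (S x) y = inner x (S y)"
    and H: "subspace H" and SH: "\<And>x. x \<in> H \<Longrightarrow> S x \<in> H"
    and pos: "\<And>x. x \<in> H \<Longrightarrow> 0 \<le> inner (S x) x"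
    and bd: "\<And>x. x \<in> H \<Longrightarrow> inner (S x) x \<le> K * (norm x)\<^sup>2" and K: "K > 0" and x: "x \<in> H"
  shows "(norm (S x))\<^sup>2 \<le> K * inner (S x) x"
proof -
  define t where "t = 1 / K"
  have "0 \<le> inner (S (x - t *\<^sub>R S x)) (x - t *\<^sub>R S x)"
    by (intro pos subspace_diff[OF H] subspace_scale[OF H] SH x)
  also have "\<dots> = inner (S x) x - 2 * t * (norm (S x))\<^sup>2 + t\<^sup>2 * inner (S (S x)) (S x)"
  proof -
    have 1: "inner (S (S x)) x = (norm (S x))\<^sup>2"
      using sym[OF SH[OF x] x] by (simp add: power2_norm_eq_inner)
    have 2: "inner (S x) (S x) = (norm (S x))\<^sup>2" by (simp add: power2_norm_eq_inner)
    have "inner (S (x - t *\<^sub>R S x)) (x - t *\<^sub>R S x)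
      = inner (S x) x - t * inner (S x) (S x) - t * (inner (S (S x)) x - t * inner (S (S x)) (S x))"
      by (simp only: linear_diff[OF lin] linear_scale[OF lin] inner_diff_left inner_diff_right
          inner_scaleR_left inner_scaleR_right) (simp only: right_diff_distrib)
    moreover have "a - t * n - t * (n - t * d) = a - 2 * t * n + t\<^sup>2 * d" for a n d :: real
      by (simp add: algebra_simps power2_eq_square)
    ultimately show ?thesis unfolding 1 2 by simp
  qed
  also have "\<dots> \<le> inner (S x) x - 2 * t * (norm (S x))\<^sup>2 + t\<^sup>2 * (K * (norm (S x))\<^sup>2)"
    using bd[OF SH[OF x]] by (intro add_left_mono mult_left_mono) auto
  also have "\<dots> = inner (S x) x - (norm (S x))\<^sup>2 / K"
    using K by (simp add: t_def field_simps power2_eq_square)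
  finally show ?thesis using K by (simp add: field_simps)
qed

section \<open>Compressions of an orthogonal projection\<close>

locale orthogonal_projector =
  fixes T :: "'h::{real_inner,complete_space} \<Rightarrow> 'h"
  assumes linear_T: "linear T"
    and T_sym: "inner (T x) y = inner x (T y)"
    and T_idem: "T (T x) = T x"
begin

lemma inner_TT: "inner (T x) (T y) = inner (T x) y"
  by (metis T_idem T_sym)

lemma norm_T_le: "norm (T x) \<le> norm x"
proof (rule norm_le_if_inner_le)
  have "inner (T x) (T x) = inner x (T x)" by (metis inner_TT T_sym)
  then show "inner (T x) (T x) \<le> norm x * norm (T x)" by (simp add: norm_cauchy_schwarz)
qed simp

text \<open>The compression of \<open>T\<close> to \<open>H\<close> minus \<open>m\<close>. It is a
  total map, meant to be used on \<open>H\<close>, where it is symmetric and has values in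
  \<open>H\<close>.\<close>

definition shifted :: "'h set \<Rightarrow> real \<Rightarrow> 'h \<Rightarrow> 'h" where
  "shifted H m x = proj H (T x) - m *\<^sub>R x"

text \<open>For the symmetric compression these \<open>m\<close> are exactly the spectrum: if the
  condition fails, the operator is bounded below and hence bijective on \<open>H\<close>
  (\<open>not_approx_eigenvalue_surj\<close>), and \<open>approx_eigenvalue_not_surj\<close> gives
  the converse.\<close>

definition approx_eigenvalue :: "'h set \<Rightarrow> real \<Rightarrow> bool" where
  "approx_eigenvalue H m \<longleftrightarrow> (\<forall>c>0. \<exists>x\<in>H. x \<noteq> 0 \<and> norm (shifted H m x) \<le> c * norm x)"

definition eigenvalue :: "'h set \<Rightarrow> real \<Rightarrow> bool" where
  "eigenvalue H m \<longleftrightarrow> (\<exists>x\<in>H. x \<noteq> 0 \<and> shifted H m x = 0)"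

definition compact_on :: "'h set \<Rightarrow> bool" where
  "compact_on C \<longleftrightarrow> (\<forall>x::nat \<Rightarrow> 'h. (\<forall>n. x n \<in> C \<and> norm (x n) \<le> 1) \<longrightarrow>
     (\<exists>r h. strict_mono r \<and> (\<lambda>n. T (x (r n))) \<longlonglongrightarrow> h))"

lemma compact_on_subset: "compact_on C \<Longrightarrow> K \<subseteq> C \<Longrightarrow> compact_on K"
  unfolding compact_on_def by blast

lemma linear_shifted: "closed_subspace H \<Longrightarrow> linear (shifted H m)"
  unfolding shifted_def
  by (intro linear_compose_sub linear_compose[OF linear_T, of "proj H", unfolded o_def] linear_proj
      linear_compose_scale_right linear_id[unfolded id_def])

lemma norm_shifted_le:
  assumes H: "closed_subspace H"
  shows "norm (shifted H m x) \<le> (1 + \<bar>m\<bar>) * norm x"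
proof -
  have "norm (shifted H m x) \<le> norm (proj H (T x)) + norm (m *\<^sub>R x)"
    unfolding shifted_def by (rule norm_triangle_ineq4)
  also have "norm (proj H (T x)) \<le> norm x"
    using norm_proj_le[OF H, of "T x"] norm_T_le[of x] by linarith
  finally show ?thesis by (simp add: algebra_simps)
qed

lemma bounded_linear_shifted: "closed_subspace H \<Longrightarrow> bounded_linear (shifted H m)"
  using norm_shifted_le[of H m] linear_shifted[of H m]
  by (intro bounded_linear_intro[where K="1 + \<bar>m\<bar>"])
    (auto simp: linear_add linear_scale mult.commute)

lemma shifted_in: "closed_subspace H \<Longrightarrow> x \<in> H \<Longrightarrow> shifted H m x \<in> H"
  unfolding shifted_def by (intro closed_subspaceD(3,4) proj_in)

text \<open>Tested against \<open>H\<close>, the projection disappears. The right-hand side no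
  longer mentions the subspace, which is what allows the compressions to \<open>H\<close> and to a
  larger space to be compared.\<close>

lemma inner_shifted:
  "closed_subspace H \<Longrightarrow> y \<in> H \<Longrightarrow> inner (shifted H m x) y = inner (T x) (T y) - m * inner x y"
  unfolding shifted_def by (simp add: inner_diff_left inner_proj inner_TT)

lemma shifted_sym:
  "closed_subspace H \<Longrightarrow> x \<in> H \<Longrightarrow> y \<in> H \<Longrightarrow> inner (shifted H m x) y = inner x (shifted H m y)"
  by (simp add: inner_shifted[of H y] inner_commute[of x "shifted H m y"] inner_shifted[of H x])
    (simp add: inner_commute)

lemma shifted_add_eq: "shifted H (m + k) x = shifted H m x - k *\<^sub>R x"
  by (simp add: shifted_def algebra_simps)

lemma norm_shifted_leI:
  assumes H: "closed_subspace H" and x: "x \<in> H" and "0 \<le> c"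
    and "\<And>v. v \<in> H \<Longrightarrow> inner (T x) (T v) - m * inner x v \<le> c * norm v"
  shows "norm (shifted H m x) \<le> c"
  using assms(4)[OF shifted_in[OF H x, of m]] inner_shifted[OF H shifted_in[OF H x], of m x m]
  by (intro norm_le_if_inner_le assms(3)) simp

lemma not_approx_eigenvalueD:
  "\<not> approx_eigenvalue H m \<Longrightarrow> \<exists>c>0. \<forall>x\<in>H. c * norm x \<le> norm (shifted H m x)"
  unfolding approx_eigenvalue_def by (metis less_eq_real_def linorder_not_le mult_zero_right norm_ge_zero norm_zero)

lemma approx_eigenvalue_unit:
  assumes H: "closed_subspace H" and "approx_eigenvalue H m" "c > 0"
  obtains x where "x \<in> H" "norm x = 1" "norm (shifted H m x) \<le> c"
proof -
  obtain x where x: "x \<in> H" "x \<noteq> 0" "norm (shifted H m x) \<le> c * norm x"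
    using assms unfolding approx_eigenvalue_def by blast
  show ?thesis
  proof (rule that[of "(1 / norm x) *\<^sub>R x"])
    show "(1 / norm x) *\<^sub>R x \<in> H" by (intro closed_subspaceD(4)[OF H] x)
    show "norm (shifted H m ((1 / norm x) *\<^sub>R x)) \<le> c"
      using x by (simp add: linear_scale[OF linear_shifted[OF H]] field_simps)
  qed (use x in simp)
qed

text \<open>By symmetry a vector of \<open>H\<close> orthogonal to the range lies in the kernel;
  with closed range and trivial kernel nothing is left outside the range.\<close>

lemma shifted_surjI:
  assumes H: "closed_subspace H" and R: "closed_subspace (shifted H m ` H)"
    and inj: "\<And>x. x \<in> H \<Longrightarrow> shifted H m x = 0 \<Longrightarrow> x = 0"
  shows "shifted H m ` H = H"
proof
  let ?R = "shifted H m ` H"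
  show "?R \<subseteq> H" using shifted_in[OF H] by blast
  show "H \<subseteq> ?R"
  proof
    fix v assume v: "v \<in> H"
    define w where "w = v - proj ?R v"
    have wH: "w \<in> H"
      unfolding w_def using proj_in[OF R, of v] shifted_in[OF H] v
      by (intro closed_subspaceD(3)[OF H]) auto
    have "inner (shifted H m w) (shifted H m w) = inner w (shifted H m (shifted H m w))"
      by (intro shifted_sym[OF H] wH shifted_in[OF H])
    also have "\<dots> = 0" unfolding w_def
      by (intro proj_orthogonal[OF R] imageI shifted_in[OF H] wH[unfolded w_def])
    finally have "w = 0" using inj[OF wH] by simp
    then have "v = proj ?R v" by (simp add: w_def)
    then show "v \<in> ?R" using proj_in[OF R, of v] by simp
  qed
qed

lemma not_approx_eigenvalue_surj:
  assumes H: "closed_subspace H" and "\<not> approx_eigenvalue H m"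
  shows "shifted H m ` H = H"
proof -
  obtain c where c: "c > 0" "\<And>x. x \<in> H \<Longrightarrow> c * norm x \<le> norm (shifted H m x)"
    using not_approx_eigenvalueD[OF assms(2)] by blast
  show ?thesis
  proof (rule shifted_surjI[OF H])
    show "closed_subspace (shifted H m ` H)"
      by (rule bounded_below_range_closed[OF H bounded_linear_shifted[OF H] c])
    show "x = 0" if "x \<in> H" "shifted H m x = 0" for x
      using c(2)[OF that(1)] that(2) c(1) by (simp add: mult_le_0_iff)
  qed
qed

text \<open>An elementary substitute for the spectral theorem. With \<open>D = shifted H m\<close>
  and \<open>d\<close> the infimum of \<open>norm (D x)\<close> over unit vectors, the square of
  \<open>D\<close> minus \<open>d\<^sup>2\<close> is positive and not bounded below. It factors as
  \<open>D - d\<close> after \<open>D + d\<close>, so one of \<open>m + d\<close> and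
  \<open>m - d\<close> is an approximate eigenvalue, and \<open>d\<close> is at most \<eta>.\<close>

lemma approx_eigenvalue_near:
  assumes H: "closed_subspace H" and x0: "x0 \<in> H" "x0 \<noteq> 0"
    and le: "norm (shifted H m x0) \<le> \<eta> * norm x0"
  shows "\<exists>k. \<bar>k - m\<bar> \<le> \<eta> \<and> approx_eigenvalue H k"
proof -
  let ?D = "shifted H m"
  note lin = linear_shifted[OF H, of m]
  define N where "N = (\<lambda>x. norm (?D x)) ` {x \<in> H. norm x = 1}"
  define d where "d = Inf N"
  have unit: "(1 / norm x) *\<^sub>R x \<in> {x \<in> H. norm x = 1}" if "x \<in> H" "x \<noteq> 0" for x
    using that by (auto intro: closed_subspaceD(4)[OF H])
  have x0N: "norm (?D ((1 / norm x0) *\<^sub>R x0)) \<in> N" unfolding N_def using unit[OF x0] by blast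
  have bdd: "bdd_below N" unfolding N_def by (rule bdd_belowI[of _ 0]) auto
  have "d \<le> norm (?D ((1 / norm x0) *\<^sub>R x0))" unfolding d_def by (rule cInf_lower[OF x0N bdd])
  also have "\<dots> \<le> \<eta>" using le x0 by (simp add: linear_scale[OF lin] field_simps)
  finally have d\<eta>: "d \<le> \<eta>" .
  have d0: "0 \<le> d" unfolding d_def using x0N by (intro cInf_greatest) (auto simp: N_def)
  have d_le: "d * norm x \<le> norm (?D x)" if "x \<in> H" for x
  proof (cases "x = 0")
    case False
    have "d \<le> norm (?D ((1 / norm x) *\<^sub>R x))" unfolding d_def
      by (rule cInf_lower[OF _ bdd]) (use unit[OF that False] in \<open>auto simp: N_def\<close>)
    then show ?thesis using False by (simp add: linear_scale[OF lin] field_simps)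
  qed simp
  define S where "S x = ?D (?D x) - d\<^sup>2 *\<^sub>R x" for x
  have linS: "linear S" unfolding S_def
    by (intro linear_compose_sub linear_compose[OF lin lin, unfolded o_def]
        linear_compose_scale_right linear_id[unfolded id_def])
  have SS: "inner (S x) y = inner (?D x) (?D y) - d\<^sup>2 * inner x y" if "x \<in> H" "y \<in> H" for x y
    using that shifted_sym[OF H shifted_in[OF H that(1)] that(2)] by (simp add: S_def inner_diff_left)
  have S_norm: "inner (S x) x = (norm (?D x))\<^sup>2 - d\<^sup>2 * (norm x)\<^sup>2" if "x \<in> H" for x
    using SS[OF that that] by (simp add: power2_norm_eq_inner)
  define K where "K = (1 + \<bar>m\<bar>)\<^sup>2"
  have K: "K > 0" unfolding K_def by (intro zero_less_power) linarith
  have Sle: "(norm (S x))\<^sup>2 \<le> K * inner (S x) x" if "x \<in> H" for x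
  proof (rule symmetric_pos_norm_le[OF linS _ _ _ _ _ K that])
    show "inner (S x) y = inner x (S y)" if "x \<in> H" "y \<in> H" for x y
      using SS[OF that] SS[OF that(2,1)] by (simp add: inner_commute)
    show "subspace H" using H by (simp add: closed_subspace_def)
    show "S x \<in> H" if "x \<in> H" for x
      unfolding S_def by (intro closed_subspaceD(3,4)[OF H] shifted_in[OF H] that)
    show "0 \<le> inner (S x) x" if "x \<in> H" for x
      using power_mono[OF d_le[OF that], of 2] d0 S_norm[OF that] by (simp add: power_mult_distrib)
    show "inner (S x) x \<le> K * (norm x)\<^sup>2" if "x \<in> H" for x
      using power_mono[OF norm_shifted_le[OF H, of m x] norm_ge_zero, of 2] S_norm[OF that]
        mult_nonneg_nonneg[OF zero_le_power2[of d] zero_le_power2[of "norm x"]]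
      unfolding power_mult_distrib K_def by linarith
  qed
  have S_fac: "shifted H (m + d) (shifted H (m - d) x) = S x" for x
  proof -
    have a: "shifted H (m - d) x = ?D x + d *\<^sub>R x" by (simp add: shifted_def algebra_simps)
    show ?thesis unfolding a shifted_add_eq linear_add[OF lin] linear_scale[OF lin] S_def
      by (simp add: power2_eq_square scaleR_add_right)
  qed
  have "approx_eigenvalue H (m + d) \<or> approx_eigenvalue H (m - d)"
  proof (rule ccontr)
    assume "\<not> ?thesis"
    then obtain c1 c2 where c: "c1 > 0" "\<And>x. x \<in> H \<Longrightarrow> c1 * norm x \<le> norm (shifted H (m + d) x)"
      "c2 > 0" "\<And>x. x \<in> H \<Longrightarrow> c2 * norm x \<le> norm (shifted H (m - d) x)"
      using not_approx_eigenvalueD by metis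
    have below: "c1 * c2 \<le> norm (S x)" if "x \<in> H" "norm x = 1" for x
    proof -
      have "c1 * c2 \<le> c1 * norm (shifted H (m - d) x)"
        using c(4)[OF that(1)] that(2) c(1) by simp
      also have "\<dots> \<le> norm (S x)"
        using c(2)[OF shifted_in[OF H that(1), of "m - d"]] S_fac by simp
      finally show ?thesis .
    qed
    \<comment> \<open>Chosen so that a unit vector with \<open>(norm (?D x))\<^sup>2\<close> below
      \<open>d\<^sup>2 + e\<close> has \<open>K * inner (S x) x\<close> below
      \<open>(c1 * c2)\<^sup>2\<close>, against the lower bound on
      \<open>norm (S x)\<close>.\<close>
    define e where "e = (c1 * c2)\<^sup>2 / K"
    have e: "e > 0" unfolding e_def using c K by simp
    have "Inf N < sqrt (d\<^sup>2 + e)"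
      using e d0 unfolding d_def[symmetric] by (intro real_less_rsqrt) simp
    then obtain x where x: "x \<in> H" "norm x = 1" "norm (?D x) < sqrt (d\<^sup>2 + e)"
      using x0N bdd by (subst (asm) cInf_less_iff) (auto simp: N_def)
    have "(norm (?D x))\<^sup>2 < d\<^sup>2 + e"
    proof -
      have "sqrt ((norm (?D x))\<^sup>2) < sqrt (d\<^sup>2 + e)" using x(3) by simp
      then show ?thesis by (simp only: real_sqrt_less_iff)
    qed
    then have "K * inner (S x) x < K * e" using S_norm[OF x(1)] x(2) K by simp
    also have "\<dots> = (c1 * c2)\<^sup>2" using K by (simp add: e_def)
    also have "\<dots> \<le> (norm (S x))\<^sup>2" using below[OF x(1,2)] c by (intro power_mono) auto
    finally show False using Sle[OF x(1)] by simp
  qed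
  moreover have "\<bar>m + d - m\<bar> \<le> \<eta>" "\<bar>m - d - m\<bar> \<le> \<eta>" using d\<eta> d0 by auto
  ultimately show ?thesis by blast
qed

text \<open>The same vectors serve nearby parameters, since a change of \<open>m\<close> alters
  \<open>shifted H m x\<close> by that multiple of \<open>x\<close>. Closedness is what puts the end
  points of the gaps into the spectrum.\<close>

lemma closed_approx_eigenvalue:
  assumes H: "closed_subspace H"
  shows "closed {m. approx_eigenvalue H m}"
  unfolding closed_limpt islimpt_approachable
proof (intro allI impI, simp only: mem_Collect_eq)
  fix m assume A: "\<forall>e>0. \<exists>k\<in>{m. approx_eigenvalue H m}. k \<noteq> m \<and> dist k m < e"
  show "approx_eigenvalue H m"
    unfolding approx_eigenvalue_def
  proof (intro allI impI)
    fix c :: real assume c: "c > 0"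
    then obtain k where k: "approx_eigenvalue H k" "\<bar>k - m\<bar> < c / 2"
      using A[rule_format, of "c / 2"] by (auto simp: dist_real_def)
    obtain x where x: "x \<in> H" "norm x = 1" "norm (shifted H k x) \<le> c / 2"
      using approx_eigenvalue_unit[OF H k(1), of "c / 2"] c by auto
    have "norm (shifted H m x) = norm (shifted H k x + (k - m) *\<^sub>R x)"
      by (simp add: shifted_def algebra_simps)
    also have "\<dots> \<le> norm (shifted H k x) + \<bar>k - m\<bar>"
      using norm_triangle_ineq[of "shifted H k x" "(k - m) *\<^sub>R x"] x(2) by simp
    also have "\<dots> \<le> c * norm x" using x k by simp
    finally show "\<exists>x\<in>H. x \<noteq> 0 \<and> norm (shifted H m x) \<le> c * norm x" using x by force
  qed
qed

text \<open>For a unit vector in \<open>H\<close> the number \<open>inner (shifted H m x) x\<close>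
  equals \<open>(norm (T x))\<^sup>2 - m\<close>, and \<open>(norm (T x))\<^sup>2\<close> lies
  between 0 and 1. The upper bound later makes \<open>1 / m - 1\<close> nonnegative.\<close>

lemma approx_eigenvalue_bounds:
  assumes H: "closed_subspace H" and A: "approx_eigenvalue H m"
  shows "0 \<le> m" "m \<le> 1"
proof -
  have *: "\<bar>(norm (T x))\<^sup>2 - m\<bar> \<le> c" if "x \<in> H" "norm x = 1" "norm (shifted H m x) \<le> c" for x c
  proof -
    have "(norm (T x))\<^sup>2 - m = inner (shifted H m x) x"
      using inner_shifted[OF H that(1), of m x] that(2)
      by (simp add: power2_norm_eq_inner[symmetric])
    also have "\<bar>\<dots>\<bar> \<le> norm (shifted H m x) * norm x" by (rule Cauchy_Schwarz_ineq2)
    finally show ?thesis using that by simp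
  qed
  have T1: "(norm (T x))\<^sup>2 \<le> 1" if "norm x = 1" for x
    using power_mono[OF norm_T_le[of x], of 2] that by simp
  show "0 \<le> m"
  proof (rule field_le_epsilon)
    fix e :: real assume "e > 0"
    then obtain x where x: "x \<in> H" "norm x = 1" "norm (shifted H m x) \<le> e"
      using approx_eigenvalue_unit[OF H A] by blast
    then show "0 \<le> m + e" using *[OF x] zero_le_power2[of "norm (T x)"] by linarith
  qed
  show "m \<le> 1"
  proof (rule field_le_epsilon)
    fix e :: real assume "e > 0"
    then obtain x where x: "x \<in> H" "norm x = 1" "norm (shifted H m x) \<le> e"
      using approx_eigenvalue_unit[OF H A] by blast
    then show "m \<le> 1 + e" using *[OF x] T1[OF x(2)] by linarith
  qed
qed

text \<open>Along a subsequence the images under \<open>T\<close> converge; since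
  \<open>m *\<^sub>R x n\<close> differs from \<open>proj C (T (x n))\<close> by a null sequence, it
  converges too, and division by \<open>m\<close> yields a limit of norm 1 in
  \<open>C\<close>.\<close>

lemma approx_eigenvalue_imp_eigenvalue:
  assumes C: "closed_subspace C" "compact_on C" and A: "approx_eigenvalue C m" and m: "m \<noteq> 0"
  shows "eigenvalue C m"
proof -
  have "\<exists>x. x \<in> C \<and> norm x = 1 \<and> norm (shifted C m x) \<le> 1 / real (Suc n)" for n
    using approx_eigenvalue_unit[OF C(1) A, of "1 / real (Suc n)"] by (metis of_nat_0_less_iff zero_less_Suc zero_less_divide_1_iff)
  then obtain x where x: "\<And>n. x n \<in> C" "\<And>n. norm (x n) = 1"
    "\<And>n. norm (shifted C m (x n)) \<le> 1 / real (Suc n)" by metis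
  then obtain r h where r: "strict_mono r" "(\<lambda>n. T (x (r n))) \<longlonglongrightarrow> h"
    using C(2)[unfolded compact_on_def, rule_format, of x] by auto
  have bp: "bounded_linear (proj C)"
    using linear_proj[OF C(1)] norm_proj_le[OF C(1)]
    by (intro bounded_linear_intro[where K=1]) (auto simp: linear_add linear_scale)
  have s0: "(\<lambda>n. shifted C m (x n)) \<longlonglongrightarrow> 0"
    by (rule Lim_null_comparison[OF _ LIMSEQ_Suc[OF lim_1_over_n]]) (use x in auto)
  have s0r: "(\<lambda>n. shifted C m (x (r n))) \<longlonglongrightarrow> 0"
    using LIMSEQ_subseq_LIMSEQ[OF s0 r(1)] by (simp add: o_def)
  define z where "z = (1 / m) *\<^sub>R (proj C h - 0)"
  have "(\<lambda>n. (1 / m) *\<^sub>R (proj C (T (x (r n))) - shifted C m (x (r n)))) \<longlonglongrightarrow> z"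
    unfolding z_def by (intro tendsto_intros bounded_linear.tendsto[OF bp r(2)] s0r)
  then have xz: "(\<lambda>n. x (r n)) \<longlonglongrightarrow> z" using m by (simp add: shifted_def)
  have "z \<in> C" by (rule closed_subspace_limit[OF C(1) x(1) xz])
  moreover have "norm z = 1" using tendsto_norm[OF xz] x(2) LIMSEQ_unique[OF _ tendsto_const] by simp
  moreover have "shifted C m z = 0"
    by (rule LIMSEQ_unique[OF bounded_linear.tendsto[OF bounded_linear_shifted[OF C(1)] xz] s0r])
  ultimately show ?thesis unfolding eigenvalue_def by force
qed

lemma eigenvector_inner:
  "closed_subspace C \<Longrightarrow> shifted C m x = 0 \<Longrightarrow> y \<in> C \<Longrightarrow> inner (T x) (T y) = m * inner x y"
  using inner_shifted[of C y m x] by simp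

text \<open>The images are pairwise at distance at least \<open>sqrt (2 * r)\<close>, so no
  subsequence of them is Cauchy.\<close>

lemma compact_on_orthogonal_False:
  assumes "compact_on C" and x: "\<And>n::nat. x n \<in> C" "\<And>n. norm (x n) = 1"
    and orth: "\<And>i j. i \<noteq> j \<Longrightarrow> inner (T (x i)) (T (x j)) = 0"
    and r: "r > 0" "\<And>n. r \<le> (norm (T (x n)))\<^sup>2"
  shows False
proof -
  obtain s h where s: "strict_mono s" "(\<lambda>n. T (x (s n))) \<longlonglongrightarrow> h"
    using assms(1)[unfolded compact_on_def, rule_format, of x] x by auto
  have "Cauchy (\<lambda>n. T (x (s n)))" using s(2) by (rule LIMSEQ_imp_Cauchy)
  then obtain M where M: "\<And>m n. m \<ge> M \<Longrightarrow> n \<ge> M \<Longrightarrow> norm (T (x (s m)) - T (x (s n))) < sqrt r"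
    using CauchyD[of _ "sqrt r"] r(1) by (metis real_sqrt_gt_zero)
  have "norm (T (x (s M)) - T (x (s (Suc M)))) < sqrt r" by (rule M) auto
  then have "(norm (T (x (s M)) - T (x (s (Suc M)))))\<^sup>2 < r"
  proof -
    assume "norm (T (x (s M)) - T (x (s (Suc M)))) < sqrt r"
    then have "sqrt ((norm (T (x (s M)) - T (x (s (Suc M)))))\<^sup>2) < sqrt r" by simp
    then show ?thesis by (simp only: real_sqrt_less_iff)
  qed
  moreover have "s M \<noteq> s (Suc M)" using s(1) by (metis n_not_Suc_n strict_mono_eq)
  then have "(norm (T (x (s M)) - T (x (s (Suc M)))))\<^sup>2
      = (norm (T (x (s M))))\<^sup>2 + (norm (T (x (s (Suc M)))))\<^sup>2"
    unfolding power2_norm_eq_inner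
    using orth[of "s M" "s (Suc M)"] orth[of "s (Suc M)" "s M"] by (simp add: inner_diff_left inner_diff_right)
  ultimately show False using r(2)[of "s M"] r(2)[of "s (Suc M)"] r(1) by linarith
qed

lemma eigenvalue_unit:
  assumes H: "closed_subspace H" and "eigenvalue H m"
  obtains x where "x \<in> H" "norm x = 1" "shifted H m x = 0"
proof -
  obtain x where x: "x \<in> H" "x \<noteq> 0" "shifted H m x = 0"
    using assms unfolding eigenvalue_def by blast
  show ?thesis
    by (rule that[of "(1 / norm x) *\<^sub>R x"])
      (use x in \<open>auto simp: linear_scale[OF linear_shifted[OF H]] closed_subspaceD(4)[OF H]\<close>)
qed

text \<open>Eigenvectors to distinct eigenvalues have orthogonal images under \<open>T\<close>, of
  squared norm at least \<open>r\<close> when the eigenvectors are normalised; infinitely many of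
  them contradict compactness.\<close>

lemma finite_eigenvalues_above:
  assumes C: "closed_subspace C" "compact_on C" and r: "r > 0"
  shows "finite {m. r \<le> m \<and> eigenvalue C m}"
proof (rule ccontr)
  assume "infinite {m. r \<le> m \<and> eigenvalue C m}"
  then obtain f :: "nat \<Rightarrow> real" where f: "inj f" "range f \<subseteq> {m. r \<le> m \<and> eigenvalue C m}"
    using infinite_countable_subset by blast
  then have "\<exists>x. x \<in> C \<and> norm x = 1 \<and> shifted C (f n) x = 0" for n
    using eigenvalue_unit[OF C(1), of "f n"] by blast
  then obtain x where x: "\<And>n. x n \<in> C" "\<And>n. norm (x n) = 1" "\<And>n. shifted C (f n) (x n) = 0"
    by metis
  have ip: "inner (T (x i)) (T (x j)) = f i * inner (x i) (x j)" for i j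
    by (rule eigenvector_inner[OF C(1) x(3) x(1)])
  show False
  proof (rule compact_on_orthogonal_False[OF C(2) x(1,2) _ r])
    show "inner (T (x i)) (T (x j)) = 0" if "i \<noteq> j" for i j
    proof -
      have "f i * inner (x i) (x j) = f j * inner (x i) (x j)"
        using ip[of i j] ip[of j i] by (simp add: inner_commute)
      moreover have "f i \<noteq> f j" using that f(1) by (auto dest: injD)
      ultimately show ?thesis using ip[of i j] by simp
    qed
    show "r \<le> (norm (T (x n)))\<^sup>2" for n
      using ip[of n n] f(2) x(2)[of n] by (auto simp: power2_norm_eq_inner[symmetric])
  qed
qed

text \<open>The supremum \<open>m\<close> of \<open>(norm (T x))\<^sup>2\<close> over unit vectors
  is the top of the spectrum: \<open>m\<close> minus the compression is positive, its form tends to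
  0 along a maximising sequence, and \<open>symmetric_pos_norm_le\<close> turns this into small
  residual vectors.\<close>

lemma norm_T_sup_approx_eigenvalue:
  assumes K: "closed_subspace K" and k: "k \<in> K" "T k \<noteq> 0"
  shows "\<exists>m>0. approx_eigenvalue K m"
proof -
  define N where "N = (\<lambda>x. (norm (T x))\<^sup>2) ` {x \<in> K. norm x = 1}"
  define m where "m = Sup N"
  have T0: "T 0 = 0" using linear_T by (rule linear_0)
  have k0: "k \<noteq> 0" using k T0 by auto
  have bdd: "bdd_above N" unfolding N_def
  proof (rule bdd_aboveI2)
    fix x assume "x \<in> {x \<in> K. norm x = 1}"
    then show "(norm (T x))\<^sup>2 \<le> 1" using power_mono[OF norm_T_le[of x], of 2] by simp
  qed
  have unit: "(norm (T ((1 / norm x) *\<^sub>R x)))\<^sup>2 \<in> N" if "x \<in> K" "x \<noteq> 0" for x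
    unfolding N_def by (rule imageI) (use that in \<open>auto intro: closed_subspaceD(4)[OF K]\<close>)
  have "0 < (norm (T ((1 / norm k) *\<^sub>R k)))\<^sup>2"
    using k k0 by (simp add: linear_scale[OF linear_T])
  also have "\<dots> \<le> m" unfolding m_def by (rule cSup_upper[OF unit[OF k(1) k0] bdd])
  finally have m: "m > 0" .
  have le: "(norm (T x))\<^sup>2 \<le> m * (norm x)\<^sup>2" if "x \<in> K" for x
  proof (cases "x = 0")
    case False
    have "(norm (T ((1 / norm x) *\<^sub>R x)))\<^sup>2 \<le> m"
      unfolding m_def by (rule cSup_upper[OF unit[OF that False] bdd])
    then show ?thesis using False
      by (simp add: linear_scale[OF linear_T] power_divide field_simps)
  qed (simp add: T0)
  define S where "S x = - shifted K m x" for x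
  have S_norm: "inner (S x) x = m * (norm x)\<^sup>2 - (norm (T x))\<^sup>2" if "x \<in> K" for x
    using inner_shifted[OF K that, of m x] by (simp add: S_def power2_norm_eq_inner)
  \<comment> \<open>The upper bound of the positive form is \<open>m\<close> itself, because the
    nonnegative term \<open>(norm (T x))\<^sup>2\<close> is subtracted from
    \<open>m * (norm x)\<^sup>2\<close>.\<close>
  have S: "(norm (S x))\<^sup>2 \<le> m * inner (S x) x" if "x \<in> K" for x
  proof (rule symmetric_pos_norm_le[OF _ _ _ _ _ _ m that])
    show "linear S" unfolding S_def by (intro linear_compose_neg linear_shifted[OF K])
    show "inner (S x) y = inner x (S y)" if "x \<in> K" "y \<in> K" for x y
      using shifted_sym[OF K that] by (simp add: S_def)
    show "subspace K" using K by (simp add: closed_subspace_def)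
    show "S x \<in> K" if "x \<in> K" for x
      unfolding S_def by (rule closed_subspaceD(5)[OF K shifted_in[OF K that]])
    show "0 \<le> inner (S x) x" if "x \<in> K" for x using le[OF that] S_norm[OF that] by simp
    show "inner (S x) x \<le> m * (norm x)\<^sup>2" if "x \<in> K" for x using S_norm[OF that] by simp
  qed
  have "approx_eigenvalue K m"
    unfolding approx_eigenvalue_def
  proof (intro allI impI)
    fix c :: real assume c: "c > 0"
    have "m - c\<^sup>2 / m < Sup N" unfolding m_def[symmetric] using c m by simp
    then obtain x where x: "x \<in> K" "norm x = 1" "m - c\<^sup>2 / m < (norm (T x))\<^sup>2"
      using unit[OF k(1) k0] bdd by (subst (asm) less_cSup_iff) (auto simp: N_def)
    have "(norm (S x))\<^sup>2 \<le> m * (m - (norm (T x))\<^sup>2)" using S[OF x(1)] S_norm[OF x(1)] x(2) by simp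
    also have "\<dots> \<le> m * (c\<^sup>2 / m)" using x(3) m by (intro mult_left_mono) auto
    also have "\<dots> = c\<^sup>2" using m by simp
    finally have "norm (S x) \<le> c" using c by (auto intro: power2_le_imp_le)
    then show "\<exists>x\<in>K. x \<noteq> 0 \<and> norm (shifted K m x) \<le> c * norm x"
      using x(2) by (intro bexI[OF _ x(1)]) (auto simp: S_def)
  qed
  then show ?thesis using m by blast
qed

text \<open>Finitely many positive eigenvalues would be bounded below by some \<open>r > 0\<close>,
  and a maximal orthonormal set \<open>B\<close> of their eigenvectors would be finite by
  compactness. On the orthogonal complement of \<open>B\<close> in \<open>C\<close> the map
  \<open>T\<close> must vanish, as otherwise its supremum there would yield one more eigenvector; so
  \<open>T\<close> would map \<open>C\<close> into a finite-dimensional span.\<close>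

lemma infinite_eigenvalues:
  assumes C: "closed_subspace C" "compact_on C"
    and inf: "\<And>F. finite F \<Longrightarrow> \<not> T ` C \<subseteq> span F"
  shows "infinite {m. 0 < m \<and> eigenvalue C m}"
proof
  assume fin: "finite {m. 0 < m \<and> eigenvalue C m}"
  \<comment> \<open>Inserting 1 gives \<open>Min\<close> a nonempty set even if there is no positive
    eigenvalue at all.\<close>
  define r where "r = Min (insert 1 {m. 0 < m \<and> eigenvalue C m})"
  have r: "r > 0" unfolding r_def using fin by (subst Min_gr_iff) auto
  have r_le: "r \<le> m" if "0 < m" "eigenvalue C m" for m
    unfolding r_def using fin that by (intro Min_le) auto
  define E where "E = {x \<in> C. norm x = 1 \<and> (\<exists>m>0. shifted C m x = 0)}"
  have Er: "\<exists>m\<ge>r. \<forall>y\<in>C. inner (T x) (T y) = m * inner x y" if "x \<in> E" for x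
  proof -
    have x: "x \<in> C" "norm x = 1" and "\<exists>m. m > 0 \<and> shifted C m x = 0" using that by (simp_all add: E_def)
    then obtain m where m: "m > 0" "shifted C m x = 0" by blast
    have "x \<noteq> 0" using x(2) by auto
    then have "eigenvalue C m" unfolding eigenvalue_def using m(2) x(1) by blast
    then have "r \<le> m" by (rule r_le[OF m(1)])
    then show ?thesis using eigenvector_inner[OF C(1) m(2)] by blast
  qed
  define \<A> where "\<A> = {B. B \<subseteq> E \<and> pairwise orthogonal B}"
  \<comment> \<open>Maximality with respect to inclusion takes care of multiplicities without
    choosing bases of the eigenspaces.\<close>
  have "\<exists>M\<in>\<A>. \<forall>X\<in>\<A>. M \<subseteq> X \<longrightarrow> X = M"
  proof (rule subset_Zorn_nonempty)
    show "\<A> \<noteq> {}" unfolding \<A>_def by (auto intro!: exI[of _ "{}"])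
    fix \<C> assume ne: "\<C> \<noteq> {}" and ch: "subset.chain \<A> \<C>"
    then have sub: "\<C> \<subseteq> \<A>" and tot: "\<And>X Y. X \<in> \<C> \<Longrightarrow> Y \<in> \<C> \<Longrightarrow> X \<subseteq> Y \<or> Y \<subseteq> X"
      by (auto simp: subset_chain_def)
    have "pairwise orthogonal (\<Union>\<C>)"
      unfolding pairwise_def
    proof (intro ballI impI)
      fix x y assume "x \<in> \<Union>\<C>" "y \<in> \<Union>\<C>" and ne: "x \<noteq> y"
      then obtain X Y where XY: "X \<in> \<C>" "x \<in> X" "Y \<in> \<C>" "y \<in> Y" by blast
      then obtain Z where "Z \<in> \<C>" "x \<in> Z" "y \<in> Z" using tot[OF XY(1,3)] by blast
      then show "orthogonal x y" using sub ne unfolding \<A>_def pairwise_def by blast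
    qed
    then show "\<Union>\<C> \<in> \<A>" using sub unfolding \<A>_def by blast
  qed
  then obtain B where B: "B \<subseteq> E" "pairwise orthogonal B"
    and max: "\<And>X. X \<subseteq> E \<Longrightarrow> pairwise orthogonal X \<Longrightarrow> B \<subseteq> X \<Longrightarrow> X = B"
    unfolding \<A>_def by auto
  have BC: "B \<subseteq> C" using B(1) by (auto simp: E_def)
  have Borth: "inner x y = 0" if "x \<in> B" "y \<in> B" "x \<noteq> y" for x y
    using B(2) that by (auto simp: pairwise_def orthogonal_def)
  have B1: "inner x x = 1" if "x \<in> B" for x
    using that B(1) by (auto simp: E_def power2_norm_eq_inner[symmetric])
  have "finite B"
  proof (rule ccontr)
    assume "infinite B"
    then obtain f :: "nat \<Rightarrow> 'h" where f: "inj f" "range f \<subseteq> B" using infinite_countable_subset by blast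
    have fC: "f n \<in> C" for n using f(2) BC by blast
    show False
    proof (rule compact_on_orthogonal_False[OF C(2) fC _ _ r])
      show "norm (f n) = 1" for n using f(2) B(1) by (auto simp: E_def)
      show "inner (T (f i)) (T (f j)) = 0" if "i \<noteq> j" for i j
      proof -
        have "inner (f i) (f j) = 0"
          using f that by (intro Borth) (auto dest: injD)
        moreover have "f i \<in> E" using f(2) B(1) by blast
        ultimately show ?thesis using Er[of "f i"] fC by auto
      qed
      show "r \<le> (norm (T (f n)))\<^sup>2" for n
      proof -
        have "f n \<in> E" "f n \<in> B" using f(2) B(1) by blast+
        then show ?thesis
          using Er[of "f n"] fC[of n] B1[of "f n"] by (auto simp: power2_norm_eq_inner)
      qed
    qed
  qed
  define K where "K = C \<inter> {x. \<forall>e\<in>B. inner x e = 0}"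
  have K: "closed_subspace K"
    unfolding K_def by (intro closed_subspace_Int C closed_subspace_orthogonal)
  have dec: "v - (\<Sum>e\<in>B. inner v e *\<^sub>R e) \<in> K" if "v \<in> C" for v
  proof -
    have "(\<Sum>e\<in>B. inner v e *\<^sub>R e) \<in> C"
      using C(1) BC unfolding closed_subspace_def by (auto intro!: subspace_sum subspace_scale)
    moreover have "inner (v - (\<Sum>e\<in>B. inner v e *\<^sub>R e)) d = 0" if d: "d \<in> B" for d
    proof -
      have "(\<Sum>e\<in>B. inner v e * inner e d) = (\<Sum>e\<in>B. if e = d then inner v d else 0)"
        using d by (intro sum.cong refl) (auto simp: Borth B1)
      also have "\<dots> = inner v d" using \<open>finite B\<close> d by simp
      finally show ?thesis by (simp add: inner_diff_left inner_sum_left)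
    qed
    ultimately show ?thesis using that closed_subspaceD(3)[OF C(1)] by (auto simp: K_def)
  qed
  show False
  proof (cases "\<exists>k\<in>K. T k \<noteq> 0")
    case False
    have "T ` C \<subseteq> span (T ` B)"
    proof safe
      fix v assume v: "v \<in> C"
      have "T (v - (\<Sum>e\<in>B. inner v e *\<^sub>R e)) = 0" using False dec[OF v] by blast
      then have "T v = (\<Sum>e\<in>B. inner v e *\<^sub>R T e)"
        by (simp add: linear_diff[OF linear_T] linear_sum[OF linear_T] linear_scale[OF linear_T])
      also have "\<dots> \<in> span (T ` B)" by (intro span_sum span_scale span_base imageI)
      finally show "T v \<in> span (T ` B)" .
    qed
    then show False using inf[of "T ` B"] \<open>finite B\<close> by simp
  next
    case True
    then obtain k where "k \<in> K" "T k \<noteq> 0" by blast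
    then obtain m where m: "m > 0" "approx_eigenvalue K m"
      using norm_T_sup_approx_eigenvalue[OF K] by blast
    have "compact_on K" using compact_on_subset[OF C(2)] by (auto simp: K_def)
    then have "eigenvalue K m" using approx_eigenvalue_imp_eigenvalue[OF K _ m(2)] m(1) by simp
    then obtain x where x: "x \<in> K" "norm x = 1" "shifted K m x = 0"
      using eigenvalue_unit[OF K] by blast
    have xC: "x \<in> C" using x(1) by (simp add: K_def)
    \<comment> \<open>An eigenvector for \<open>K\<close> is one for \<open>C\<close>: the part of
      \<open>v\<close> along \<open>B\<close> contributes nothing, because for an eigenvector
      \<open>e\<close> in \<open>B\<close> the number \<open>inner (T e) (T x)\<close> is a multiple
      of \<open>inner e x = 0\<close>.\<close>
    have "inner (shifted C m x) v = 0" if v: "v \<in> C" for v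
    proof -
      have k: "v - (\<Sum>e\<in>B. inner v e *\<^sub>R e) \<in> K" by (rule dec[OF v])
      have "inner (shifted C m x) (v - (\<Sum>e\<in>B. inner v e *\<^sub>R e)) = 0"
        using eigenvector_inner[OF K x(3) k] inner_shifted[OF C(1), of "v - (\<Sum>e\<in>B. inner v e *\<^sub>R e)" m x] k
        by (simp add: K_def)
      moreover have "inner (shifted C m x) e = 0" if e: "e \<in> B" for e
      proof -
        have "inner x e = 0" using x(1) e by (simp add: K_def)
        moreover have "inner (T x) (T e) = 0"
          using Er[of e] e B(1) xC \<open>inner x e = 0\<close> by (metis inner_commute mult_zero_right subsetD)
        ultimately show ?thesis using inner_shifted[OF C(1), of e m x] e BC by auto
      qed
      ultimately show ?thesis by (simp add: inner_diff_right inner_sum_right)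
    qed
    then have "shifted C m x = 0" using shifted_in[OF C(1) xC, of m] by (metis inner_eq_zero_iff)
    then have xE: "x \<in> E" using x xC m(1) by (auto simp: E_def)
    have "insert x B = B"
    proof (rule max)
      show "insert x B \<subseteq> E" using xE B(1) by simp
      show "pairwise orthogonal (insert x B)"
        using x(1) B(2) by (auto simp: pairwise_insert K_def orthogonal_def inner_commute)
    qed auto
    then have "x \<in> B" by blast
    then have "inner x x = 0" using x(1) by (simp add: K_def)
    then show False using x(2) by simp
  qed
qed

text \<open>A gliding hump argument, in place of the open mapping theorem.\<close>

lemma approx_eigenvalue_not_surj:
  assumes H: "closed_subspace H" and A: "approx_eigenvalue H m"
  shows "shifted H m ` H \<noteq> H"
proof
  assume surj: "shifted H m ` H = H"
  have "\<exists>x. x \<in> H \<and> norm x = 1 \<and> norm (shifted H m x) \<le> (1/9) ^ n" for n :: nat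
    using approx_eigenvalue_unit[OF H A, of "(1/9)^n"] by (metis zero_less_divide_1_iff zero_less_numeral zero_less_power)
  then obtain x where x: "\<And>n::nat. x n \<in> H" "\<And>n. norm (x n) = 1"
    "\<And>n. norm (shifted H m (x n)) \<le> (1/9) ^ n" by metis
  \<comment> \<open>The sign of the \<open>n\<close>-th increment is chosen so that the inner
    product with \<open>x n\<close> reaches \<open>(1/3)^n\<close> in modulus; all later increments
    together have norm at most \<open>(3/2) * (1/3)^Suc n\<close>, half of that. If the limit were
    \<open>shifted H m u\<close>, the same inner product would be at most
    \<open>norm u * (1/9)^n\<close>.\<close>
  define z where "z = rec_nat (0::'h) (\<lambda>n y.
     if \<bar>inner (y + (1/3)^n *\<^sub>R x n) (x n)\<bar> \<ge> (1/3)^n then y + (1/3)^n *\<^sub>R x n else y - (1/3)^n *\<^sub>R x n)"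
  have z_Suc: "z (Suc n) = (if \<bar>inner (z n + (1/3)^n *\<^sub>R x n) (x n)\<bar> \<ge> (1/3)^n
      then z n + (1/3)^n *\<^sub>R x n else z n - (1/3)^n *\<^sub>R x n)" for n
    by (simp add: z_def)
  have xx: "inner (x n) (x n) = 1" for n using x(2)[of n] by (simp add: power2_norm_eq_inner[symmetric])
  have big: "(1/3)^n \<le> \<bar>inner (z (Suc n)) (x n)\<bar>" for n
  proof -
    define a where "a = inner (z n) (x n)"
    have p: "(1/3::real)^n > 0" by simp
    show ?thesis unfolding z_Suc inner_add_left inner_diff_left inner_scaleR_left xx a_def[symmetric]
      by (cases "(1/3)^n \<le> \<bar>inner (z n + (1/3)^n *\<^sub>R x n) (x n)\<bar>")
        (use p in \<open>auto simp: inner_add_left inner_diff_left xx a_def\<close>)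
  qed
  have step: "norm (z (Suc n) - z n) \<le> (1/3)^n" for n
    by (simp add: z_Suc x)
  have zH: "z n \<in> H" for n
  proof (induction n)
    case 0 show ?case using closed_subspaceD(1)[OF H] by (simp add: z_def)
  next
    case (Suc n) then show ?case
      unfolding z_Suc using closed_subspaceD(2,3)[OF H Suc] closed_subspaceD(4)[OF H x(1)] by auto
  qed
  have tail: "norm (z (k + n) - z n) \<le> (3/2) * (1/3)^n * (1 - (1/3)^k)" for k n
  proof (induction k)
    case (Suc k)
    have "norm (z (Suc k + n) - z n) \<le> norm (z (Suc (k + n)) - z (k + n)) + norm (z (k + n) - z n)"
      using norm_triangle_ineq[of "z (Suc (k + n)) - z (k + n)" "z (k + n) - z n"] by simp
    also have "\<dots> \<le> (1/3)^(k+n) + (3/2) * (1/3)^n * (1 - (1/3)^k)" using step Suc by (intro add_mono)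
    also have "\<dots> = (3/2) * (1/3)^n * (1 - (1/3)^Suc k)" by (simp add: power_add field_simps)
    finally show ?case .
  qed simp
  have tail': "norm (z (k + n) - z n) \<le> (3/2) * (1/3)^n" for k n
    by (rule order_trans[OF tail]) simp
  have "Cauchy z"
  proof (rule CauchyI)
    fix e :: real assume "e > 0"
    then have "\<exists>M. (1/3)^M < e / 4" by (intro real_arch_pow_inv) auto
    then obtain M where M: "(1/3)^M < e / 4" by blast
    have half: "norm (z j - z M) < e / 2" if "j \<ge> M" for j
      using tail'[of "j - M" M] that M \<open>e > 0\<close> by simp
    have "norm (z i - z j) < e" if "i \<ge> M" "j \<ge> M" for i j
      using half[OF that(1)] half[OF that(2)] norm_triangle_ineq4[of "z i - z M" "z j - z M"] by simp
    then show "\<exists>M. \<forall>m\<ge>M. \<forall>n\<ge>M. norm (z m - z n) < e" by blast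
  qed
  then obtain v where v: "z \<longlonglongrightarrow> v" using Cauchy_convergent convergent_def by blast
  have vH: "v \<in> H" by (rule closed_subspace_limit[OF H zH v])
  have v_tail: "norm (v - z n) \<le> (3/2) * (1/3)^n" for n
  proof (rule LIMSEQ_le_const2)
    show "(\<lambda>k. norm (z (k + n) - z n)) \<longlonglongrightarrow> norm (v - z n)"
      by (intro tendsto_intros LIMSEQ_ignore_initial_segment v)
    show "\<exists>N. \<forall>k\<ge>N. norm (z (k + n) - z n) \<le> (3/2) * (1/3)^n" using tail' by blast
  qed
  obtain u where u: "u \<in> H" "shifted H m u = v" using surj vH by (metis imageE)
  have "(1/2) * (1/3)^n \<le> norm u * (1/9)^n" for n
  proof -
    have "(1/3)^n \<le> \<bar>inner (z (Suc n)) (x n)\<bar>" by (rule big)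
    also have "inner (z (Suc n)) (x n) = inner v (x n) - inner (v - z (Suc n)) (x n)"
      by (simp add: inner_diff_left)
    also have "\<bar>\<dots>\<bar> \<le> \<bar>inner v (x n)\<bar> + \<bar>inner (v - z (Suc n)) (x n)\<bar>" by (rule abs_triangle_ineq4)
    also have "\<bar>inner (v - z (Suc n)) (x n)\<bar> \<le> (3/2) * (1/3)^Suc n"
      using Cauchy_Schwarz_ineq2[of "v - z (Suc n)" "x n"] v_tail[of "Suc n"] x(2)[of n] by simp
    also have "inner v (x n) = inner u (shifted H m (x n))"
      using shifted_sym[OF H u(1) x(1), of m n] u(2) by simp
    also have "\<bar>\<dots>\<bar> \<le> norm u * (1/9)^n"
      using Cauchy_Schwarz_ineq2[of u "shifted H m (x n)"] mult_left_mono[OF x(3)[of n] norm_ge_zero[of u]]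
      by linarith
    finally show ?thesis by simp
  qed
  then have "3^n \<le> 2 * norm u" for n
  proof -
    have "(1/2) * (1/3)^n * 9^n \<le> norm u * (1/9)^n * (9::real)^n"
      by (intro mult_right_mono) (use \<open>\<And>n. (1/2) * (1/3)^n \<le> norm u * (1/9)^n\<close> in auto)
    moreover have "(1/3)^n * 9^n = (3::real)^n" "(1/9)^n * 9^n = (1::real)"
      by (simp_all add: power_mult_distrib[symmetric])
    ultimately show ?thesis by (simp add: mult.assoc)
  qed
  moreover have "\<exists>n. 2 * norm u < 3 ^ n" by (rule real_arch_pow) simp
  ultimately show False using linorder_not_le by blast
qed

text \<open>The Fredholm property supplies closedness of the range in the sequential form
  \<open>cl\<close>; here it is turned into a closed image, to which \<open>shifted_surjI\<close>
  applies.\<close>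

lemma closed_range_shifted_surj:
  assumes H: "closed_subspace H" and inj: "\<And>x. x \<in> H \<Longrightarrow> shifted H m x = 0 \<Longrightarrow> x = 0"
    and cl: "\<And>w v. (\<And>n::nat. w n \<in> H) \<Longrightarrow> v \<in> H \<Longrightarrow> (\<lambda>n. shifted H m (w n)) \<longlonglongrightarrow> v \<Longrightarrow> \<exists>u\<in>H. shifted H m u = v"
  shows "shifted H m ` H = H"
proof (rule shifted_surjI[OF H _ inj])
  let ?R = "shifted H m ` H"
  have lim: "l \<in> ?R" if f: "\<forall>n. f n \<in> ?R" and l: "f \<longlonglongrightarrow> l" for f l
  proof -
    have "\<forall>n. \<exists>w. w \<in> H \<and> f n = shifted H m w" using f by blast
    then obtain w where w: "\<And>n. w n \<in> H" "\<And>n. f n = shifted H m (w n)" by metis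
    have fH: "f n \<in> H" for n unfolding w(2) by (rule shifted_in[OF H w(1)])
    have "l \<in> H" by (rule closed_subspace_limit[OF H fH l])
    moreover have "(\<lambda>n. shifted H m (w n)) \<longlonglongrightarrow> l" using l unfolding w(2)[symmetric] .
    ultimately have "\<exists>u\<in>H. shifted H m u = l" by (rule cl[OF w(1)])
    then show ?thesis by blast
  qed
  then have "closed ?R" unfolding closed_sequential_limits by blast
  then show "closed_subspace ?R"
    using H linear_subspace_image[OF linear_shifted[OF H]] unfolding closed_subspace_def by blast
qed

end

section \<open>Gaps\<close>

lemma finite_positive_lower_bound:
  fixes X :: "real set"
  assumes "finite X" "\<And>x. x \<in> X \<Longrightarrow> 0 < x"
  shows "\<exists>d>0. \<forall>x\<in>X. d < x"
proof (intro exI conjI ballI)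
  let ?m = "Min (insert 1 X)"
  have m: "0 < ?m" using assms by (subst Min_gr_iff) auto
  then show "0 < ?m / 2" by simp
  fix x assume "x \<in> X"
  then have "?m \<le> x" using assms by (intro Min_le) auto
  then show "?m / 2 < x" using m by linarith
qed

text \<open>The gap runs from the largest point of \<open>A\<close> below \<open>v\<close> to the
  smallest one above it; closedness of \<open>A\<close> makes both belong to
  \<open>A\<close>.\<close>

lemma gap_containing:
  assumes A: "closed A" and st: "s \<in> A" "t \<in> A" "s < v" "v < t" "v \<notin> A"
  shows "\<exists>a b. (a, b) \<in> gaps A \<and> s \<le> a \<and> a < v \<and> v < b \<and> b \<le> t"
proof -
  let ?L = "A \<inter> {..v}" and ?U = "A \<inter> {v..}"
  have L: "closed ?L" "?L \<noteq> {}" "bdd_above ?L" and U: "closed ?U" "?U \<noteq> {}" "bdd_below ?U"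
    using A st by (auto intro!: closed_Int bdd_above.I2 bdd_below.I2 exI[of _ v]
        simp: less_imp_le bdd_above_def bdd_below_def)
  have a: "Sup ?L \<in> ?L" using closed_contains_Sup[OF L(2,3,1)] .
  have b: "Inf ?U \<in> ?U" using closed_contains_Inf[OF U(2,3,1)] .
  have "Sup ?L < v" "v < Inf ?U" using a b st(5) by (auto simp: less_le)
  moreover have "s \<le> Sup ?L" using st L by (intro cSup_upper) auto
  moreover have "Inf ?U \<le> t" using st U by (intro cInf_lower) auto
  moreover have "{Sup ?L<..<Inf ?U} \<inter> A = {}"
  proof (rule ccontr)
    assume "\<not> ?thesis"
    then obtain x where x: "Sup ?L < x" "x < Inf ?U" "x \<in> A" by auto
    show False
    proof (cases "x \<le> v")
      case True then show False using cSup_upper[of x ?L] L x by auto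
    next
      case False then show False using cInf_lower[of x ?U] U x by auto
    qed
  qed
  ultimately show ?thesis using a b
    by (intro exI[of _ "Sup ?L"] exI[of _ "Inf ?U"]) (simp add: gaps_def)
qed

text \<open>Each \<open>v i\<close> sits in a gap of \<open>A\<close> between \<open>s i\<close> and
  \<open>s (Suc i)\<close>, so these gaps are distinct. The decreasing map from \<open>m\<close> to
  \<open>1 / m - 1\<close> carries them over with end points exchanged; positivity of the end points
  comes from \<open>0 < s 0\<close>, nonnegativity of the images from
  \<open>A \<subseteq> {..1}\<close>.\<close>

lemma has_at_least_gaps_reciprocal:
  assumes A: "closed A" "A \<subseteq> {..1}" and s: "\<And>i. i \<le> N \<Longrightarrow> s i \<in> A" "0 < s 0"
    and v: "\<And>i. i < N \<Longrightarrow> v i \<notin> A \<and> s i < v i \<and> v i < s (Suc i)"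
  shows "has_at_least_gaps N {l. 0 \<le> l \<and> 1 / (1 + l) \<in> A}"
proof -
  have "\<exists>a b. (a, b) \<in> gaps A \<and> s i \<le> a \<and> a < v i \<and> v i < b \<and> b \<le> s (Suc i)" if "i < N" for i
    using gap_containing[OF A(1), of "s i" "s (Suc i)" "v i"] s(1)[of i] s(1)[of "Suc i"] v[OF that] that by auto
  then obtain a b where ab: "\<And>i. i < N \<Longrightarrow> (a i, b i) \<in> gaps A \<and> s i \<le> a i \<and> a i < v i \<and> v i < b i \<and> b i \<le> s (Suc i)"
    by metis
  have s_mono: "s i \<le> s j" if "i \<le> j" "j \<le> N" for i j
    using that
  proof (induction j rule: dec_induct)
    case (step n) then show ?case using v[of n] by auto
  qed simp
  have a0: "0 < a i" if "i < N" for i using ab[OF that] s_mono[of 0 i] s(2) that by auto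
  let ?g = "\<lambda>i. (1 / b i - 1, 1 / a i - 1)"
  have inj: "inj_on ?g {..<N}"
  proof (rule linorder_inj_onI)
    fix i j assume ij: "i < j" "i \<in> {..<N}" "j \<in> {..<N}"
    have "a i < b i" "b i \<le> s (Suc i)" "s (Suc i) \<le> s j" "s j \<le> a j"
      using ab[of i] ab[of j] s_mono[of "Suc i" j] ij by auto
    then have "a i \<noteq> a j" by linarith
    then show "?g i \<noteq> ?g j" by simp
  qed auto
  have gap: "?g i \<in> gaps {l. 0 \<le> l \<and> 1 / (1 + l) \<in> A}" if i: "i < N" for i
  proof -
    have g: "a i \<in> A" "b i \<in> A" "a i < b i" "{a i<..<b i} \<inter> A = {}" and p: "0 < a i" "0 < b i"
      using ab[OF i] a0[OF i] by (auto simp: gaps_def)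
    have "a i \<le> 1" "b i \<le> 1" using A(2) g(1,2) by auto
    then have "0 \<le> 1 / a i - 1" "0 \<le> 1 / b i - 1" using p by (simp_all add: field_simps)
    moreover have "1 / b i - 1 < 1 / a i - 1" using g(3) p by (simp add: frac_less2)
    moreover have "1 / (1 + l) \<notin> A" if "1 / b i - 1 < l" "l < 1 / a i - 1" "0 \<le> l" for l
    proof -
      have "1 / (1 + l) \<in> {a i<..<b i}" using that p by (auto simp: field_simps)
      then show ?thesis using g(4) by blast
    qed
    ultimately show ?thesis using g(1,2) p by (auto simp: gaps_def)
  qed
  show ?thesis
    unfolding has_at_least_gaps_def
    by (rule exI[of _ "?g ` {..<N}"]) (use gap inj in \<open>auto simp: card_image\<close>)
qed

section \<open>Hilbert spaces that split into orthogonal strips permuted by integer shifts\<close>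

locale strip_decomposition = orthogonal_projector T for T :: "'h::{real_inner,complete_space} \<Rightarrow> 'h" +
  fixes S R :: "int \<Rightarrow> 'h \<Rightarrow> 'h"
  assumes linear_S: "linear (S n)"
    and inner_S: "inner (S n x) (S n y) = inner x y"
    and S_S: "S m (S n x) = S (m + n) x"
    and S_0: "S 0 x = x"
    and S_T: "S n (T x) = T (S n x)"
    and linear_R: "linear (R j)"
    and R_sym: "inner (R j x) y = inner x (R j y)"
    and R_R: "R i (R j x) = (if i = j then R j x else 0)"
    and R_T: "R j (T x) = T (R j x)"
    and R_S: "R j (S n x) = S n (R (j - n) x)"
    and Parseval: "((\<lambda>j. (norm (R j x))\<^sup>2) has_sum (norm x)\<^sup>2) UNIV"
begin

lemma norm_S: "norm (S n x) = norm x"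
  unfolding norm_eq_sqrt_inner inner_S ..

lemma inner_S_left: "inner (S n x) y = inner x (S (- n) y)"
  using inner_S[of "- n" "S n x" y] by (simp add: S_S S_0)

text \<open>Invariance is assumed for negative \<open>n\<close> as well, so the shifts map
  \<open>H\<close> onto itself and commute with its orthogonal projection.\<close>

lemma S_proj:
  assumes H: "closed_subspace H" "\<And>n x. x \<in> H \<Longrightarrow> S n x \<in> H"
  shows "proj H (S n x) = S n (proj H x)"
proof (rule proj_eqI[OF H(1)])
  show "S n (proj H x) \<in> H" by (intro H(2) proj_in H(1))
  show "inner (S n (proj H x)) z = inner (S n x) z" if "z \<in> H" for z
    using inner_proj[OF H(1) H(2)[OF that], of x "- n"] by (simp add: inner_S_left)
qed

lemma S_shifted:
  assumes H: "closed_subspace H" "\<And>n x. x \<in> H \<Longrightarrow> S n x \<in> H"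
  shows "shifted H m (S n x) = S n (shifted H m x)"
  unfolding shifted_def
  by (simp add: S_proj[OF H] S_T[symmetric] linear_diff[OF linear_S] linear_scale[OF linear_S])

lemma inner_R_R: "inner (R i x) (R j x) = (if i = j then (norm (R j x))\<^sup>2 else 0)"
proof (cases "i = j")
  case False
  then show ?thesis using R_sym[of i x "R j x"] by (simp add: R_R)
qed (simp add: power2_norm_eq_inner)

lemma inner_R_self: "inner x (R j x) = (norm (R j x))\<^sup>2"
  using R_sym[of j x "R j x"] by (simp add: R_R power2_norm_eq_inner)

lemma norm_partial_sum:
  assumes "finite F"
  shows "(norm (\<Sum>j\<in>F. R j x))\<^sup>2 = (\<Sum>j\<in>F. (norm (R j x))\<^sup>2)"
proof -
  have "inner (\<Sum>j\<in>F. R j x) (\<Sum>j\<in>F. R j x) = (\<Sum>i\<in>F. \<Sum>j\<in>F. inner (R i x) (R j x))"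
    by (simp only: inner_sum_left inner_sum_right) (rule sum.swap)
  also have "\<dots> = (\<Sum>j\<in>F. (norm (R j x))\<^sup>2)" using assms by (simp add: inner_R_R)
  finally show ?thesis by (simp add: power2_norm_eq_inner)
qed

lemma partial_sum_norm:
  assumes "finite F"
  shows "(norm (x - (\<Sum>j\<in>F. R j x)))\<^sup>2 = (norm x)\<^sup>2 - (\<Sum>j\<in>F. (norm (R j x))\<^sup>2)"
proof -
  let ?y = "\<Sum>j\<in>F. R j x"
  have a: "inner x ?y = (\<Sum>j\<in>F. (norm (R j x))\<^sup>2)" by (simp add: inner_sum_right inner_R_self)
  have "(norm (x - ?y))\<^sup>2 = (norm x)\<^sup>2 - inner x ?y - inner x ?y + (norm ?y)\<^sup>2"
    unfolding power2_norm_eq_inner inner_diff_left inner_diff_right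
    by (simp only: inner_commute[of ?y x])
  then show ?thesis unfolding a norm_partial_sum[OF assms] by linarith
qed

lemma norm_partial_sum_le:
  assumes F: "finite F"
  shows "norm (\<Sum>j\<in>F. R j x) \<le> norm x"
proof (rule power2_le_imp_le)
  show "(norm (\<Sum>j\<in>F. R j x))\<^sup>2 \<le> (norm x)\<^sup>2"
    using partial_sum_norm[OF F, of x] zero_le_power2[of "norm (x - (\<Sum>j\<in>F. R j x))"]
    unfolding norm_partial_sum[OF F] by linarith
qed simp

lemma partial_sum_approx:
  assumes "e > 0"
  shows "\<exists>F. finite F \<and> norm (x - (\<Sum>j\<in>F. R j x)) < e"
proof -
  have "\<forall>\<^sub>F F in finite_subsets_at_top UNIV. (norm x)\<^sup>2 - e\<^sup>2 < (\<Sum>j\<in>F. (norm (R j x))\<^sup>2)"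
    by (rule order_tendstoD(1)[OF Parseval[unfolded has_sum_def]]) (use assms in simp)
  then obtain F where F: "finite F" "(norm x)\<^sup>2 - e\<^sup>2 < (\<Sum>j\<in>F. (norm (R j x))\<^sup>2)"
    by (auto simp: eventually_finite_subsets_at_top)
  then have "(norm (x - (\<Sum>j\<in>F. R j x)))\<^sup>2 < e\<^sup>2" using partial_sum_norm[OF F(1), of x] by linarith
  then show ?thesis using F(1) assms by (intro exI[of _ F] conjI power_less_imp_less_base[of _ 2 e]) auto
qed

text \<open>Up to a small error both vectors live in finitely many strips, and a large shift moves
  the strips of the first past those of the second, where the components are orthogonal.\<close>

lemma S_weakly_null:
  assumes "e > 0"
  shows "\<exists>N. \<forall>n\<ge>N. \<bar>inner (S n x) y\<bar> \<le> e"
proof -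
  \<comment> \<open>Tolerance for both truncations, whose joint error is at most
    \<open>d * norm y + norm x * d\<close>; the added 1 keeps the denominator positive.\<close>
  define d where "d = e / (1 + norm x + norm y)"
  have pos: "0 < 1 + norm x + norm y" using norm_ge_zero[of x] norm_ge_zero[of y] by linarith
  then have d: "d > 0" unfolding d_def using assms by simp
  obtain F where F: "finite F" "norm (x - (\<Sum>j\<in>F. R j x)) < d" using partial_sum_approx[OF d] by blast
  obtain G where G: "finite G" "norm (y - (\<Sum>j\<in>G. R j y)) < d" using partial_sum_approx[OF d] by blast
  let ?x = "\<Sum>j\<in>F. R j x" and ?y = "\<Sum>j\<in>G. R j y"
  \<comment> \<open>Larger than every difference \<open>k - j\<close> with \<open>j\<close> in
    \<open>F\<close> and \<open>k\<close> in \<open>G\<close>, so that \<open>j + n\<close> exceeds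
    all of \<open>G\<close> for \<open>n \<ge> N\<close>.\<close>
  define N where "N = Max (insert 0 ((\<lambda>(j, k). k - j) ` (F \<times> G))) + 1"
  have N: "k - j < N" if "j \<in> F" "k \<in> G" for j k
  proof -
    have "k - j \<le> Max (insert 0 ((\<lambda>(j, k). k - j) ` (F \<times> G)))"
      using that F(1) G(1) by (intro Max_ge) force+
    then show ?thesis by (simp add: N_def)
  qed
  have "\<bar>inner (S n x) y\<bar> \<le> e" if n: "n \<ge> N" for n
  proof -
    have orth: "inner (S n (R j x)) (R k y) = 0" if "j \<in> F" "k \<in> G" for j k
    proof -
      have "R k (S n (R j x)) = S n (R (k - n) (R j x))" by (rule R_S)
      also have "\<dots> = 0" using N[OF that] n by (simp add: R_R linear_0[OF linear_S])
      finally show ?thesis by (metis R_sym inner_zero_left)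
    qed
    have "inner (S n ?x) ?y = 0"
      by (simp add: linear_sum[OF linear_S] inner_sum_left inner_sum_right orth)
    then have "inner (S n x) y = inner (S n (x - ?x)) y + inner (S n ?x) (y - ?y)"
      by (simp add: linear_diff[OF linear_S] inner_diff_left inner_diff_right)
    also have "\<bar>\<dots>\<bar> \<le> \<bar>inner (S n (x - ?x)) y\<bar> + \<bar>inner (S n ?x) (y - ?y)\<bar>" by (rule abs_triangle_ineq)
    also have "\<dots> \<le> norm (x - ?x) * norm y + norm ?x * norm (y - ?y)"
      using Cauchy_Schwarz_ineq2[of "S n (x - ?x)" y] Cauchy_Schwarz_ineq2[of "S n ?x" "y - ?y"]
      unfolding norm_S by (rule add_mono)
    also have "\<dots> \<le> d * norm y + norm x * d"
      using F(2) G(2) norm_partial_sum_le[OF F(1), of x] d by (intro add_mono mult_mono) auto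
    also have "\<dots> \<le> d * (1 + norm x + norm y)" using d by (simp add: algebra_simps)
    also have "\<dots> = e" using pos by (simp add: d_def)
    finally show ?thesis .
  qed
  then show ?thesis by blast
qed

text \<open>Diagonal dominance of the Gram matrix: a vanishing combination is paired with the vector
  whose coefficient is largest in modulus, and the remaining terms add up to less than that
  coefficient.\<close>

lemma independent_nearly_orthonormal:
  fixes Y :: "'h set"
  assumes Y: "finite Y" "\<And>v. v \<in> Y \<Longrightarrow> inner v v = 1"
    and e: "\<And>v w. v \<in> Y \<Longrightarrow> w \<in> Y \<Longrightarrow> v \<noteq> w \<Longrightarrow> \<bar>inner v w\<bar> * real (card Y) < 1"
  shows "independent Y"
proof
  assume "dependent Y"
  then obtain u v where u: "v \<in> Y" "u v \<noteq> 0" "(\<Sum>v\<in>Y. u v *\<^sub>R v) = 0"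
    using dependent_finite[OF Y(1)] by auto
  define w where "w = (ARG_MAX (\<lambda>v. \<bar>u v\<bar>) v. v \<in> Y)"
  obtain w where w: "w \<in> Y" "\<And>v. v \<in> Y \<Longrightarrow> \<bar>u v\<bar> \<le> \<bar>u w\<bar>"
  proof -
    have "Max ((\<lambda>v. \<bar>u v\<bar>) ` Y) \<in> (\<lambda>v. \<bar>u v\<bar>) ` Y" using Y(1) u(1) by (intro Max_in) auto
    then obtain w where "w \<in> Y" "\<bar>u w\<bar> = Max ((\<lambda>v. \<bar>u v\<bar>) ` Y)" by auto
    then show ?thesis using that Y(1) by (metis Max_ge finite_imageI imageI)
  qed
  have uw: "\<bar>u w\<bar> > 0" using w(2)[OF u(1)] u(2) by linarith
  have cY: "real (card Y) > 0" using Y(1) u(1) by (simp add: card_gt_0_iff) blast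
  have "0 = inner (\<Sum>v\<in>Y. u v *\<^sub>R v) w" using u(3) by simp
  also have "\<dots> = (\<Sum>v\<in>Y. u v * inner v w)" by (simp add: inner_sum_left)
  also have "\<dots> = u w + (\<Sum>v\<in>Y - {w}. u v * inner v w)"
    using Y w(1) by (simp add: sum.remove)
  finally have "\<bar>u w\<bar> = \<bar>\<Sum>v\<in>Y - {w}. u v * inner v w\<bar>" by linarith
  also have "\<dots> \<le> (\<Sum>v\<in>Y - {w}. \<bar>u v\<bar> * \<bar>inner v w\<bar>)"
    by (rule order_trans[OF sum_abs]) (simp add: abs_mult)
  also have "\<dots> \<le> (\<Sum>v\<in>Y - {w}. \<bar>u w\<bar> * (1 / real (card Y)))"
  proof (rule sum_mono)
    fix v assume v: "v \<in> Y - {w}"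
    then have "\<bar>inner v w\<bar> \<le> 1 / real (card Y)" using e[of v w] w(1) cY by (simp add: field_simps)
    then show "\<bar>u v\<bar> * \<bar>inner v w\<bar> \<le> \<bar>u w\<bar> * (1 / real (card Y))"
      using w(2)[of v] v by (intro mult_mono) auto
  qed
  also have "\<dots> = real (card Y - 1) * (\<bar>u w\<bar> / real (card Y))" using Y(1) w(1) by simp
  also have "\<dots> < real (card Y) * (\<bar>u w\<bar> / real (card Y))"
    using cY uw by (intro mult_strict_right_mono) auto
  also have "\<dots> = \<bar>u w\<bar>" using cY by simp
  finally show False by simp
qed

text \<open>Since shifts tend weakly to 0, a nonzero vector would have arbitrarily many widely
  spaced shifts that are nearly orthonormal, hence independent. This excludes kernels of finite
  positive dimension for operators that commute with the shifts.\<close>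

lemma shift_invariant_finite_dim:
  assumes F: "finite F" and K: "\<And>n. S n x \<in> span F"
  shows "x = 0"
proof (rule ccontr)
  assume "x \<noteq> 0"
  define y where "y = (1 / norm x) *\<^sub>R x"
  have y1: "inner y y = 1" using \<open>x \<noteq> 0\<close>
    by (simp add: y_def power2_norm_eq_inner[symmetric] power2_eq_square)
  have yK: "S n y \<in> span F" for n
    unfolding y_def linear_scale[OF linear_S] by (intro span_scale K)
  \<comment> \<open>One vector more than the span allows; inner products of size
    \<open>1 / (2 * real m)\<close> keep the Gram matrix diagonally dominant.\<close>
  define m where "m = card F + 1"
  obtain N where N: "\<And>n. n \<ge> N \<Longrightarrow> \<bar>inner (S n y) y\<bar> \<le> 1 / (2 * real m)"
    using S_weakly_null[of "1 / (2 * real m)" y y] by (auto simp: m_def)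
  \<comment> \<open>The spacing is made positive, so that \<open>(j - i) * M \<ge> M \<ge> N\<close>
    whenever \<open>i < j\<close>.\<close>
  define M where "M = max N 1"
  let ?f = "\<lambda>i::nat. S (int i * M) y"
  have M: "M \<ge> N" "M \<ge> 1" by (auto simp: M_def)
  have less: "\<bar>inner (?f i) (?f j)\<bar> \<le> 1 / (2 * real m)" if "i < j" for i j
  proof -
    have "inner (?f i) (?f j) = inner y (S (int (j - i) * M) y)"
      using that by (simp add: inner_S_left S_S of_nat_diff algebra_simps)
    also have "\<bar>\<dots>\<bar> = \<bar>inner (S (int (j - i) * M) y) y\<bar>" by (simp add: inner_commute)
    also have "\<dots> \<le> 1 / (2 * real m)"
    proof (rule N)
      have "1 * M \<le> int (j - i) * M" using that M by (intro mult_right_mono) auto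
      then show "N \<le> int (j - i) * M" using M by linarith
    qed
    finally show ?thesis .
  qed
  have ne: "\<bar>inner (?f i) (?f j)\<bar> \<le> 1 / (2 * real m)" if "i \<noteq> j" for i j
    using less[of i j] less[of j i] that by (cases "i < j") (auto simp: inner_commute)
  have m2: "1 / (2 * real m) < 1" by (simp add: m_def)
  have one: "inner (?f i) (?f i) = 1" for i by (simp add: inner_S y1)
  have inj: "inj_on ?f {..<m}"
  proof (rule inj_onI, rule ccontr)
    fix i j assume "?f i = ?f j" "i \<noteq> j"
    then show False using ne[of i j] one[of j] m2 by simp
  qed
  have "independent (?f ` {..<m})"
  proof (rule independent_nearly_orthonormal)
    show "\<bar>inner v w\<bar> * real (card (?f ` {..<m})) < 1"
      if vw: "v \<in> ?f ` {..<m}" "w \<in> ?f ` {..<m}" "v \<noteq> w" for v w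
    proof -
      have "card (?f ` {..<m}) = m" using inj by (simp add: card_image)
      moreover obtain i j where ij: "v = ?f i" "w = ?f j" using vw(1,2) by blast
      moreover have "\<bar>inner v w\<bar> \<le> 1 / (2 * real m)"
        unfolding ij by (rule ne) (use vw(3) ij in blast)
      moreover have "m > 0" by (simp add: m_def)
      ultimately show ?thesis by (simp add: field_simps)
    qed
  qed (use one in auto)
  moreover have "?f ` {..<m} \<subseteq> span F" using yK by auto
  ultimately have "card (?f ` {..<m}) \<le> card F" using independent_span_bound[OF F] by blast
  then show False using inj by (simp add: card_image m_def)
qed

lemma norm_le_if_R_le:
  assumes c: "0 \<le> c" and le: "\<And>j. norm (R j x) \<le> c * norm (R j y)"
  shows "norm x \<le> c * norm y"
proof -
  have "(norm x)\<^sup>2 \<le> c\<^sup>2 * (norm y)\<^sup>2"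
  proof (rule has_sum_mono[OF Parseval has_sum_cmult_right[OF Parseval]])
    show "(norm (R j x))\<^sup>2 \<le> c\<^sup>2 * (norm (R j y))\<^sup>2" for j
      using power_mono[OF le[of j] norm_ge_zero, of 2] by (simp add: power_mult_distrib)
  qed
  then have "(norm x)\<^sup>2 \<le> (c * norm y)\<^sup>2" by (simp add: power_mult_distrib)
  then show ?thesis by (rule power2_le_imp_le) (use c in simp)
qed

text \<open>The orthogonal sum of all integer translates of \<open>C\<close>, the space
  \<open>G\<close> of the overview. A summability condition is already contained in membership in
  the Hilbert space, by \<open>Parseval\<close>.\<close>

definition cell_sum :: "'h set \<Rightarrow> 'h set" where
  "cell_sum C = {x. \<forall>j. S (- j) (R j x) \<in> C}"

lemma norm_R_le: "norm (R j x) \<le> norm x"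
  using norm_partial_sum_le[of "{j}" x] by simp

lemma closed_subspace_cell_sum:
  assumes C: "closed_subspace C"
  shows "closed_subspace (cell_sum C)"
proof -
  have bl: "bounded_linear (\<lambda>x. S (- j) (R j x))" for j
    by (rule bounded_linear_intro[where K=1])
      (simp_all add: norm_S norm_R_le linear_add[OF linear_R] linear_add[OF linear_S]
        linear_scale[OF linear_R] linear_scale[OF linear_S])
  have eq: "cell_sum C = (\<Inter>j. (\<lambda>x. S (- j) (R j x)) -` C)" by (auto simp: cell_sum_def)
  have "closed (cell_sum C)"
    unfolding eq
  proof (intro closed_INT ballI)
    show "closed ((\<lambda>x. S (- j) (R j x)) -` C)" for j
      using C unfolding closed_subspace_def
      by (intro continuous_closed_vimage linear_continuous_at bl) auto
  qed
  moreover have "subspace (cell_sum C)"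
    unfolding cell_sum_def using closed_subspaceD(1,2,4)[OF C]
    by (simp add: subspace_def linear_0[OF linear_S] linear_0[OF linear_R] linear_add[OF linear_S]
        linear_add[OF linear_R] linear_scale[OF linear_S] linear_scale[OF linear_R])
  ultimately show ?thesis by (simp add: closed_subspace_def)
qed

lemma S_in_cell_sum:
  assumes C: "closed_subspace C" "\<And>x. x \<in> C \<Longrightarrow> R 0 x = x" and z: "z \<in> C"
  shows "S j z \<in> cell_sum C"
  unfolding cell_sum_def
proof (intro CollectI allI)
  fix k
  have "R (k - j) z = (if k = j then z else 0)" using R_R[of "k - j" 0 z] C(2)[OF z] by simp
  then have "S (- k) (R k (S j z)) = (if k = j then z else 0)"
    by (simp add: R_S S_S S_0 linear_0[OF linear_S])
  then show "S (- k) (R k (S j z)) \<in> C" using z closed_subspaceD(1)[OF C(1)] by simp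
qed

text \<open>Nothing couples different strips in \<open>cell_sum C\<close>, so its compression acts
  strip by strip as the compression to \<open>C\<close>.\<close>

lemma shifted_cell_sum:
  assumes C: "closed_subspace C" "\<And>x. x \<in> C \<Longrightarrow> R 0 x = x"
  shows "S (- j) (R j (shifted (cell_sum C) m u)) = shifted C m (S (- j) (R j u))"
proof -
  let ?H = "cell_sum C"
  have H: "closed_subspace ?H" by (rule closed_subspace_cell_sum[OF C(1)])
  have "proj C (T (S (- j) (R j u))) = S (- j) (R j (proj ?H (T u)))"
  proof (rule proj_eqI[OF C(1)])
    show "S (- j) (R j (proj ?H (T u))) \<in> C" using proj_in[OF H, of "T u"] by (simp add: cell_sum_def)
    show "inner (S (- j) (R j (proj ?H (T u)))) z = inner (T (S (- j) (R j u))) z" if z: "z \<in> C" for z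
    proof -
      have Sz: "R j (S j z) = S j z" by (simp add: R_S C(2)[OF z])
      have "inner (S (- j) (R j (proj ?H (T u)))) z = inner (proj ?H (T u)) (S j z)"
        by (simp add: inner_S_left R_sym Sz)
      also have "\<dots> = inner (T u) (S j z)" by (rule inner_proj[OF H S_in_cell_sum[OF C z]])
      also have "\<dots> = inner (S (- j) (R j (T u))) z" by (simp add: inner_S_left R_sym Sz)
      finally show ?thesis by (simp add: R_T S_T)
    qed
  qed
  then show ?thesis
    by (simp add: shifted_def linear_diff[OF linear_S] linear_diff[OF linear_R]
        linear_scale[OF linear_S] linear_scale[OF linear_R])
qed

text \<open>A strip component of \<open>w\<close>, moved to strip 0, is orthogonal to every
  \<open>d\<close> in \<open>C\<close> and \<open>H\<close>, because \<open>H\<close> contains the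
  shifts of \<open>d\<close>. The bound assumed on a single cell therefore applies to every
  component, and the components are summed by \<open>norm_le_if_R_le\<close>.\<close>

lemma norm_T_le_cell_sum:
  assumes C: "closed_subspace C" "\<And>x. x \<in> C \<Longrightarrow> R 0 x = x"
    and H: "\<And>n x. x \<in> H \<Longrightarrow> S n x \<in> H"
    and \<delta>: "0 \<le> \<delta>" "\<And>z. z \<in> C \<Longrightarrow> (\<And>d. d \<in> C \<Longrightarrow> d \<in> H \<Longrightarrow> inner z d = 0) \<Longrightarrow> norm (T z) \<le> \<delta> * norm z"
    and w: "w \<in> cell_sum C" "\<And>v. v \<in> H \<Longrightarrow> inner w v = 0"
  shows "norm (T w) \<le> \<delta> * norm w"
proof (rule norm_le_if_R_le[OF \<delta>(1)])
  fix j
  have "norm (T (S (- j) (R j w))) \<le> \<delta> * norm (S (- j) (R j w))"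
  proof (rule \<delta>(2))
    show "S (- j) (R j w) \<in> C" using w(1) by (simp add: cell_sum_def)
    show "inner (S (- j) (R j w)) d = 0" if d: "d \<in> C" "d \<in> H" for d
      using w(2)[OF H[OF d(2), of j]] by (simp add: inner_S_left R_sym R_S C(2)[OF d(1)])
  qed
  then show "norm (R j (T w)) \<le> \<delta> * norm (R j w)"
    by (simp add: S_T[symmetric] norm_S R_T)
qed

text \<open>Let \<open>u\<close> be a unit vector of \<open>H\<close> with small residual, and
  \<open>v\<close> its residual in the larger space, so that \<open>norm v \<ge> c\<close>. If
  \<open>w\<close> is the part of \<open>v\<close> orthogonal to \<open>H\<close>, then
  \<open>(norm v)\<^sup>2\<close> is
  \<open>inner (shifted H m u) (proj H v) + inner (T u) (T w)\<close>; the second term is at most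
  \<open>\<delta> * norm v\<close>, and \<delta> is below \<open>c\<close>.\<close>

lemma shifted_bounded_below:
  assumes C: "closed_subspace C" "\<And>x. x \<in> C \<Longrightarrow> R 0 x = x"
    and H: "closed_subspace H" "\<And>n x. x \<in> H \<Longrightarrow> S n x \<in> H" "H \<subseteq> cell_sum C"
    and \<delta>: "0 \<le> \<delta>" "\<And>z. z \<in> C \<Longrightarrow> (\<And>d. d \<in> C \<Longrightarrow> d \<in> H \<Longrightarrow> inner z d = 0) \<Longrightarrow> norm (T z) \<le> \<delta> * norm z"
    and c: "\<delta> < c" "\<And>x. x \<in> C \<Longrightarrow> c * norm x \<le> norm (shifted C m x)"
  shows "\<not> approx_eigenvalue H m"
proof
  assume "approx_eigenvalue H m"
  \<comment> \<open>With this residual the two terms give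
    \<open>norm v \<le> (c - \<delta>) / 2 + \<delta>\<close>, which is still below
    \<open>c\<close>.\<close>
  then obtain u where u: "u \<in> H" "norm u = 1" "norm (shifted H m u) \<le> (c - \<delta>) / 2"
    using approx_eigenvalue_unit[OF H(1), of m "(c - \<delta>) / 2"] c(1) by auto
  let ?G = "cell_sum C"
  have G: "closed_subspace ?G" by (rule closed_subspace_cell_sum[OF C(1)])
  have uG: "u \<in> ?G" using u(1) H(3) by blast
  define v where "v = shifted ?G m u"
  have vG: "v \<in> ?G" unfolding v_def by (rule shifted_in[OF G uG])
  have "norm u \<le> (1 / c) * norm v"
  proof (rule norm_le_if_R_le)
    show "0 \<le> 1 / c" using c(1) \<delta>(1) by simp
    fix j
    have "S (- j) (R j u) \<in> C" using uG by (simp add: cell_sum_def)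
    then have "c * norm (S (- j) (R j u)) \<le> norm (S (- j) (R j v))"
      unfolding v_def by (subst shifted_cell_sum[OF C]) (auto intro: c(2))
    then show "norm (R j u) \<le> 1 / c * norm (R j v)"
      using c(1) \<delta>(1) by (simp add: norm_S field_simps)
  qed
  then have cv: "c \<le> norm v" using c(1) \<delta>(1) u(2) by (simp add: field_simps)
  define w where "w = v - proj H v"
  have wG: "w \<in> ?G" unfolding w_def using vG proj_in[OF H(1), of v] H(3) closed_subspaceD(3)[OF G] by blast
  have Tw: "norm (T w) \<le> \<delta> * norm w"
    by (rule norm_T_le_cell_sum[OF C H(2) \<delta> wG]) (auto simp: w_def proj_orthogonal[OF H(1)])
  have "(norm w)\<^sup>2 \<le> (norm v)\<^sup>2"
    using norm_proj_Pythagoras[OF H(1), of v] by (simp add: w_def)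
  then have wv: "norm w \<le> norm v" by (rule power2_le_imp_le) simp
  have pv: "proj H v = v - w" by (simp add: w_def)
  have uw: "inner u w = 0" using proj_orthogonal[OF H(1) u(1), of v] by (simp add: w_def inner_commute)
  have "inner (shifted H m u) (proj H v) = inner (T u) (T (v - w)) - m * inner u (v - w)"
    using inner_shifted[OF H(1) proj_in[OF H(1), of v], of m u] unfolding pv .
  also have "\<dots> = inner (shifted ?G m u) v - inner (T u) (T w)"
    using inner_shifted[OF G vG, of m u] uw
    by (simp add: linear_diff[OF linear_T] inner_diff_right)
  also have "\<dots> = (norm v)\<^sup>2 - inner (T u) (T w)"
    unfolding v_def[symmetric] by (simp add: power2_norm_eq_inner)
  finally have eq: "(norm v)\<^sup>2 = inner (shifted H m u) (proj H v) + inner (T u) (T w)" by simp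
  have 1: "inner (shifted H m u) (proj H v) \<le> (c - \<delta>) / 2 * norm v"
    using norm_cauchy_schwarz[of "shifted H m u" "proj H v"]
      mult_mono[OF u(3) norm_proj_le[OF H(1), of v]] c(1) by fastforce
  have 2: "inner (T u) (T w) \<le> \<delta> * norm v"
  proof -
    have "inner (T u) (T w) \<le> norm (T u) * norm (T w)" by (rule norm_cauchy_schwarz)
    also have "\<dots> \<le> 1 * (\<delta> * norm w)" using norm_T_le[of u] u(2) Tw by (intro mult_mono) auto
    also have "\<dots> \<le> \<delta> * norm v" using wv \<delta>(1) by (simp add: mult_left_mono)
    finally show ?thesis .
  qed
  have "norm v * norm v \<le> ((c - \<delta>) / 2 + \<delta>) * norm v"
    using eq 1 2 by (simp add: power2_eq_square distrib_right)
  moreover have "0 < norm v" using cv c(1) \<delta>(1) by linarith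
  ultimately have "norm v \<le> (c - \<delta>) / 2 + \<delta>" by simp
  then show False using cv c(1) by (simp add: field_simps)
qed

text \<open>The projection of a unit eigenvector \<phi> to \<open>H\<close> is almost an
  eigenvector. Its defect \<open>w\<close> satisfies \<open>m * norm w \<le> \<delta>\<close>,
  because \<open>m * (norm w)\<^sup>2\<close> equals \<open>inner (T \<phi>) (T w)\<close> and
  \<open>T w\<close> is small. With \<open>2 * \<delta> \<le> m\<close> the projection keeps norm at
  least 1/2, while its residual is at most \<open>\<delta> / 2\<close>.\<close>

lemma approx_eigenvalue_near_eigenvalue:
  assumes C: "closed_subspace C" "\<And>x. x \<in> C \<Longrightarrow> R 0 x = x"
    and H: "closed_subspace H" "\<And>n x. x \<in> H \<Longrightarrow> S n x \<in> H" "H \<subseteq> cell_sum C"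
    and \<delta>: "0 < \<delta>" "\<And>z. z \<in> C \<Longrightarrow> (\<And>d. d \<in> C \<Longrightarrow> d \<in> H \<Longrightarrow> inner z d = 0) \<Longrightarrow> norm (T z) \<le> \<delta> * norm z"
    and m: "eigenvalue C m" "2 * \<delta> \<le> m"
  shows "\<exists>k. \<bar>k - m\<bar> \<le> \<delta> \<and> approx_eigenvalue H k"
proof -
  let ?G = "cell_sum C"
  have G: "closed_subspace ?G" by (rule closed_subspace_cell_sum[OF C(1)])
  obtain \<phi> where \<phi>: "\<phi> \<in> C" "norm \<phi> = 1" "shifted C m \<phi> = 0" using eigenvalue_unit[OF C(1) m(1)] .
  have \<phi>G: "\<phi> \<in> ?G" using S_in_cell_sum[OF C \<phi>(1), of 0] by (simp add: S_0)
  define w where "w = \<phi> - proj H \<phi>"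
  have pH: "proj H \<phi> \<in> H" by (rule proj_in[OF H(1)])
  have wG: "w \<in> ?G" unfolding w_def using \<phi>G pH H(3) closed_subspaceD(3)[OF G] by blast
  have eig: "inner (T \<phi>) (T z) = m * inner \<phi> z" if z: "z \<in> ?G" for z
  proof -
    have zC: "R 0 z \<in> C" 
    proof -
      have "\<forall>j. S (- j) (R j z) \<in> C" using z unfolding cell_sum_def by simp
      from spec[OF this, of 0] show ?thesis by (simp add: S_0)
    qed
    have "inner (T \<phi>) (T z) = inner (T (R 0 \<phi>)) (T z)" by (simp add: C(2)[OF \<phi>(1)])
    also have "\<dots> = inner (T \<phi>) (T (R 0 z))" by (simp add: R_T[symmetric] R_sym)
    also have "\<dots> = m * inner \<phi> (R 0 z)" by (rule eigenvector_inner[OF C(1) \<phi>(3) zC])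
    also have "inner \<phi> (R 0 z) = inner \<phi> z" by (simp add: R_sym[symmetric] C(2)[OF \<phi>(1)])
    finally show ?thesis .
  qed
  have Tw: "norm (T w) \<le> \<delta> * norm w"
    by (rule norm_T_le_cell_sum[OF C H(2) less_imp_le[OF \<delta>(1)] \<delta>(2) wG])
      (auto simp: w_def proj_orthogonal[OF H(1)])
  have "m * norm w \<le> \<delta>"
  proof (cases "w = 0")
    case False
    have "inner (proj H \<phi>) w = 0"
      using proj_orthogonal[OF H(1) pH, of \<phi>] by (simp add: w_def inner_commute)
    then have "inner w w = inner \<phi> w" by (simp add: w_def inner_diff_left)
    then have "m * (norm w * norm w) = inner (T \<phi>) (T w)"
      unfolding eig[OF wG] by (simp add: power2_norm_eq_inner[symmetric] power2_eq_square)
    also have "\<dots> \<le> norm (T \<phi>) * norm (T w)" by (rule norm_cauchy_schwarz)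
    also have "\<dots> \<le> 1 * (\<delta> * norm w)" using norm_T_le[of \<phi>] \<phi>(2) Tw by (intro mult_mono) auto
    finally have "(m * norm w) * norm w \<le> \<delta> * norm w" by simp
    then show ?thesis using False by simp
  qed (use \<delta> in simp)
  moreover have "2 * \<delta> * norm w \<le> m * norm w" using m(2) by (intro mult_right_mono) auto
  ultimately have "\<delta> * (2 * norm w) \<le> \<delta> * 1" by simp
  then have w2: "norm w \<le> 1 / 2" using \<delta>(1) by (simp add: mult_le_cancel_left_pos)
  have u2: "1 / 2 \<le> norm (proj H \<phi>)"
    using norm_triangle_ineq[of w "proj H \<phi>"] w2 \<phi>(2) by (simp add: w_def)
  have "norm (shifted H m (proj H \<phi>)) \<le> \<delta> / 2"
  proof (rule norm_shifted_leI[OF H(1) pH])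
    fix v assume v: "v \<in> H"
    have "inner (T (proj H \<phi>)) (T v) - m * inner (proj H \<phi>) v
        = (inner (T \<phi>) (T v) - m * inner \<phi> v) - (inner (T w) (T v) - m * inner w v)"
      by (simp add: w_def linear_diff[OF linear_T] inner_diff_left algebra_simps)
    also have "inner (T \<phi>) (T v) - m * inner \<phi> v = 0" using eig v H(3) by auto
    also have "inner w v = 0" unfolding w_def by (rule proj_orthogonal[OF H(1) v])
    finally have "inner (T (proj H \<phi>)) (T v) - m * inner (proj H \<phi>) v = inner (- T w) (T v)" by simp
    also have "\<dots> \<le> norm (- T w) * norm (T v)" by (rule norm_cauchy_schwarz)
    also have "\<dots> \<le> (\<delta> * (1 / 2)) * norm v"
    proof (rule mult_mono)
      have "\<delta> * norm w \<le> \<delta> * (1 / 2)" using w2 \<delta>(1) by (intro mult_left_mono) auto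
      then show "norm (- T w) \<le> \<delta> * (1 / 2)" using Tw by simp
    qed (use norm_T_le \<delta>(1) in auto)
    finally show "inner (T (proj H \<phi>)) (T v) - m * inner (proj H \<phi>) v \<le> \<delta> / 2 * norm v" by simp
  qed (use \<delta>(1) in simp)
  also have "\<delta> / 2 \<le> \<delta> * norm (proj H \<phi>)"
    using mult_left_mono[OF u2, of \<delta>] \<delta>(1) by simp
  finally show ?thesis using approx_eigenvalue_near[OF H(1) pH] u2 by force
qed

text \<open>Otherwise unit vectors \<open>z n\<close> orthogonal to \<open>C\<close> intersected
  with \<open>H (\<epsilon> n)\<close>, with \<open>\<epsilon> n\<close> tending to 0, have images
  that converge along a subsequence to some \<open>h\<close> of norm at least \<delta>. Every
  admissible \<open>d\<close> is eventually orthogonal to \<open>z n\<close>; by density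
  \<open>h\<close> is orthogonal to \<open>T y\<close> for all \<open>y\<close> in \<open>C\<close>,
  hence to itself.\<close>

lemma norm_T_small_on_complement:
  fixes H :: "real \<Rightarrow> 'h set"
  assumes C: "closed_subspace C" "compact_on C"
    and dense: "\<And>y \<eta>. y \<in> C \<Longrightarrow> 0 < \<eta> \<Longrightarrow>
      \<exists>d\<in>C. norm (y - d) \<le> \<eta> \<and> (\<exists>e>0. \<forall>\<epsilon>. 0 < \<epsilon> \<and> \<epsilon> < e \<longrightarrow> d \<in> H \<epsilon>)"
    and \<delta>: "0 < \<delta>"
  shows "\<exists>e>0. \<forall>\<epsilon>. 0 < \<epsilon> \<and> \<epsilon> < e \<longrightarrow>
    (\<forall>z\<in>C. (\<forall>d\<in>C. d \<in> H \<epsilon> \<longrightarrow> inner z d = 0) \<longrightarrow> norm (T z) \<le> \<delta> * norm z)"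
proof (rule ccontr)
  assume neg: "\<not> ?thesis"
  have "\<exists>\<epsilon> z. 0 < \<epsilon> \<and> \<epsilon> < 1 / real (Suc n) \<and> z \<in> C \<and> norm z = 1 \<and>
      (\<forall>d\<in>C. d \<in> H \<epsilon> \<longrightarrow> inner z d = 0) \<and> \<delta> \<le> norm (T z)" for n
  proof -
    have "1 / real (Suc n) > 0" by simp
    then obtain \<epsilon> z where e: "0 < \<epsilon>" "\<epsilon> < 1 / real (Suc n)" and z: "z \<in> C"
      "\<forall>d\<in>C. d \<in> H \<epsilon> \<longrightarrow> inner z d = 0" "\<delta> * norm z < norm (T z)"
      using neg by (meson not_le)
    have "z \<noteq> 0" using z(3) by (auto simp: linear_0[OF linear_T])
    then have nz: "norm z > 0" by simp
    show ?thesis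
    proof (intro exI[of _ \<epsilon>] exI[of _ "(1 / norm z) *\<^sub>R z"] conjI e)
      show "(1 / norm z) *\<^sub>R z \<in> C" by (rule closed_subspaceD(4)[OF C(1) z(1)])
      show "norm ((1 / norm z) *\<^sub>R z) = 1" using nz by simp
      show "\<forall>d\<in>C. d \<in> H \<epsilon> \<longrightarrow> inner ((1 / norm z) *\<^sub>R z) d = 0" using z(2) by simp
      show "\<delta> \<le> norm (T ((1 / norm z) *\<^sub>R z))"
        using z(3) nz by (simp add: linear_scale[OF linear_T] field_simps)
    qed
  qed
  then obtain \<epsilon> z where e: "\<And>n. 0 < \<epsilon> n" "\<And>n. \<epsilon> n < 1 / real (Suc n)"
    and z: "\<And>n. z n \<in> C" "\<And>n. norm (z n) = 1" "\<And>n d. d \<in> C \<Longrightarrow> d \<in> H (\<epsilon> n) \<Longrightarrow> inner (z n) d = 0"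
      "\<And>n. \<delta> \<le> norm (T (z n))"
    by metis
  obtain r h where r: "strict_mono r" "(\<lambda>n. T (z (r n))) \<longlonglongrightarrow> h"
    using C(2)[unfolded compact_on_def, rule_format, of z] z by auto
  have hT: "inner h (T y) = 0" if y: "y \<in> C" for y
  proof -
    have lim: "(\<lambda>n. inner (T (z (r n))) (T y)) \<longlonglongrightarrow> inner h (T y)" by (intro tendsto_intros r)
    have "\<bar>inner h (T y)\<bar> \<le> \<eta>" if \<eta>: "\<eta> > 0" for \<eta>
    proof -
      \<comment> \<open>The \<open>z n\<close> lie in \<open>C\<close> and see only this part of
        \<open>T y\<close>; being in \<open>C\<close>, it can be approximated by an admissible
        \<open>d\<close>.\<close>
      define b where "b = proj C (T y)"
      have b: "b \<in> C" unfolding b_def by (rule proj_in[OF C(1)])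
      obtain d e' where d: "d \<in> C" "norm (b - d) \<le> \<eta>" "e' > 0" "\<And>\<epsilon>. 0 < \<epsilon> \<Longrightarrow> \<epsilon> < e' \<Longrightarrow> d \<in> H \<epsilon>"
        using dense[OF b \<eta>] by blast
      obtain M where M: "1 / real (Suc M) < e'" using d(3) nat_approx_posE by blast
      have "\<bar>inner (T (z (r n))) (T y)\<bar> \<le> \<eta>" if "n \<ge> M" for n
      proof -
        have "r n \<ge> M" using that seq_suble[OF r(1), of n] by simp
        then have "1 / real (Suc (r n)) \<le> 1 / real (Suc M)" by (intro divide_left_mono) auto
        then have "\<epsilon> (r n) < e'" using e(2)[of "r n"] M by linarith
        then have "inner (z (r n)) d = 0" by (intro z(3) d(1,4) e(1))
        moreover have "inner (T (z (r n))) (T y) = inner (T y) (z (r n))"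
          by (metis inner_TT T_sym inner_commute)
        moreover have "inner b (z (r n)) = inner (T y) (z (r n))"
          unfolding b_def by (rule inner_proj[OF C(1) z(1)])
        ultimately have "inner (T (z (r n))) (T y) = inner (b - d) (z (r n))"
          by (simp add: inner_diff_left inner_commute[of d])
        then show ?thesis using Cauchy_Schwarz_ineq2[of "b - d" "z (r n)"] z(2)[of "r n"] d(2) by simp
      qed
      then show ?thesis
        by (intro LIMSEQ_le_const2[OF tendsto_rabs[OF lim]]) blast
    qed
    then have "\<bar>inner h (T y)\<bar> \<le> 0 + e" if "e > 0" for e using that by simp
    then have "\<bar>inner h (T y)\<bar> \<le> 0" by (rule field_le_epsilon)
    then show ?thesis by simp
  qed
  have "(\<lambda>n. inner h (T (z (r n)))) \<longlonglongrightarrow> inner h h" by (intro tendsto_intros r)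
  then have "(\<lambda>n::nat. 0::real) \<longlonglongrightarrow> inner h h" by (simp only: hT[OF z(1)])
  then have "inner h h = 0" by (rule LIMSEQ_unique[OF _ tendsto_const])
  moreover have "\<delta> \<le> norm h"
    by (rule LIMSEQ_le_const[OF tendsto_norm[OF r(2)]]) (use z(4) in blast)
  ultimately show False using \<delta> by simp
qed

text \<open>Eigenvalues of the cell, and points between them that are not eigenvalues, are fixed
  before \<epsilon>. One \<delta> below finitely many positive distances then guarantees, for all
  small \<epsilon>, an approximate eigenvalue near each selected eigenvalue and none at the
  separating points.\<close>

theorem gaps_of_perturbed_cells:
  fixes H :: "real \<Rightarrow> 'h set" and \<epsilon>0 :: real
  assumes C: "closed_subspace C" "\<And>x. x \<in> C \<Longrightarrow> R 0 x = x" "compact_on C"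
      "\<And>F. finite F \<Longrightarrow> \<not> T ` C \<subseteq> span F"
    and \<epsilon>0: "0 < \<epsilon>0"
    and H: "\<And>\<epsilon>. 0 < \<epsilon> \<Longrightarrow> \<epsilon> < \<epsilon>0 \<Longrightarrow> closed_subspace (H \<epsilon>)"
      "\<And>\<epsilon> n x. 0 < \<epsilon> \<Longrightarrow> \<epsilon> < \<epsilon>0 \<Longrightarrow> x \<in> H \<epsilon> \<Longrightarrow> S n x \<in> H \<epsilon>"
      "\<And>\<epsilon>. 0 < \<epsilon> \<Longrightarrow> \<epsilon> < \<epsilon>0 \<Longrightarrow> H \<epsilon> \<subseteq> cell_sum C"
    and dense: "\<And>y \<eta>. y \<in> C \<Longrightarrow> 0 < \<eta> \<Longrightarrow>
      \<exists>d\<in>C. norm (y - d) \<le> \<eta> \<and> (\<exists>e>0. \<forall>\<epsilon>. 0 < \<epsilon> \<and> \<epsilon> < e \<longrightarrow> d \<in> H \<epsilon>)"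
  shows "\<exists>e>0. \<forall>\<epsilon>. 0 < \<epsilon> \<and> \<epsilon> < e \<longrightarrow>
    has_at_least_gaps N {l. 0 \<le> l \<and> approx_eigenvalue (H \<epsilon>) (1 / (1 + l))}"
proof -
  obtain B where B: "finite B" "card B = Suc N" "B \<subseteq> {m. 0 < m \<and> eigenvalue C m}"
    using infinite_arbitrarily_large[OF infinite_eigenvalues[OF C(1,3,4)], of "Suc N"] by blast
  define \<mu> where "\<mu> i = sorted_list_of_set B ! i" for i
  have len: "length (sorted_list_of_set B) = Suc N" using B by simp
  have \<mu>: "0 < \<mu> i" "eigenvalue C (\<mu> i)" if "i \<le> N" for i
  proof -
    have "\<mu> i \<in> set (sorted_list_of_set B)" unfolding \<mu>_def using that len by (intro nth_mem) simp
    then show "0 < \<mu> i" "eigenvalue C (\<mu> i)" using B by auto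
  qed
  have \<mu>_less: "\<mu> i < \<mu> (Suc i)" if "i < N" for i
    using that len strict_sorted_list_of_set[of B] unfolding \<mu>_def
    by (simp add: sorted_wrt_nth_less)
  have "\<exists>v c. \<mu> i < v \<and> v < \<mu> (Suc i) \<and> 0 < c \<and> (\<forall>x\<in>C. c * norm x \<le> norm (shifted C v x))"
    if i: "i < N" for i
  proof -
    \<comment> \<open>The interval is infinite but contains only finitely many eigenvalues, so a
      separating point exists even if further eigenvalues lie between the selected ones.\<close>
    have "finite {m. \<mu> i \<le> m \<and> eigenvalue C m}"
      using finite_eigenvalues_above[OF C(1,3)] \<mu>(1)[of i] i by simp
    moreover have "infinite {\<mu> i<..<\<mu> (Suc i)}" using \<mu>_less[OF i] by simp
    ultimately have "\<exists>v. v \<in> {\<mu> i<..<\<mu> (Suc i)} - {m. \<mu> i \<le> m \<and> eigenvalue C m}"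
      by (metis Diff_eq_empty_iff ex_in_conv finite_subset)
    then obtain v where v: "\<mu> i < v" "v < \<mu> (Suc i)" "\<not> eigenvalue C v" by auto
    then have "\<not> approx_eigenvalue C v"
      using approx_eigenvalue_imp_eigenvalue[OF C(1,3), of v] \<mu>(1)[of i] i by auto
    then show ?thesis using not_approx_eigenvalueD v by blast
  qed
  then obtain v c where vc: "\<And>i. i < N \<Longrightarrow> \<mu> i < v i \<and> v i < \<mu> (Suc i) \<and> 0 < c i"
      "\<And>i x. i < N \<Longrightarrow> x \<in> C \<Longrightarrow> c i * norm x \<le> norm (shifted C (v i) x)"
    by metis
  \<comment> \<open>The \<open>c i\<close> serve \<open>shifted_bounded_below\<close>, the two kinds
    of differences keep the perturbed points on their sides of \<open>v i\<close>, and
    \<open>\<mu> i / 2\<close> provides \<open>2 * \<delta> \<le> \<mu> i\<close>.\<close>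
  define X where "X = (\<lambda>i. c i) ` {..<N} \<union> (\<lambda>i. v i - \<mu> i) ` {..<N} \<union> (\<lambda>i. \<mu> (Suc i) - v i) ` {..<N}
    \<union> (\<lambda>i. \<mu> i / 2) ` {..N}"
  have "\<exists>d>0. \<forall>x\<in>X. d < x"
    by (rule finite_positive_lower_bound) (use vc(1) \<mu>(1) in \<open>auto simp: X_def\<close>)
  then obtain \<delta> where \<delta>: "\<delta> > 0" and \<delta>X: "\<And>x. x \<in> X \<Longrightarrow> \<delta> < x" by blast
  have \<delta>i: "\<delta> < c i" "\<mu> i + \<delta> < v i" "v i < \<mu> (Suc i) - \<delta>" if "i < N" for i
    using \<delta>X[of "c i"] \<delta>X[of "v i - \<mu> i"] \<delta>X[of "\<mu> (Suc i) - v i"] that by (auto simp: X_def)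
  have \<delta>\<mu>: "2 * \<delta> < \<mu> i" if "i \<le> N" for i
    using \<delta>X[of "\<mu> i / 2"] that by (auto simp: X_def)
  obtain e where e: "e > 0" "\<And>\<epsilon> z. 0 < \<epsilon> \<Longrightarrow> \<epsilon> < e \<Longrightarrow> z \<in> C \<Longrightarrow>
      (\<And>d. d \<in> C \<Longrightarrow> d \<in> H \<epsilon> \<Longrightarrow> inner z d = 0) \<Longrightarrow> norm (T z) \<le> \<delta> * norm z"
    using norm_T_small_on_complement[OF C(1,3) dense \<delta>] by metis
  have "has_at_least_gaps N {l. 0 \<le> l \<and> approx_eigenvalue (H \<epsilon>) (1 / (1 + l))}"
    if \<epsilon>: "0 < \<epsilon>" "\<epsilon> < min e \<epsilon>0" for \<epsilon>
  proof -
    have \<epsilon>': "\<epsilon> < e" "\<epsilon> < \<epsilon>0" using \<epsilon> by auto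
    note He = H(1)[OF \<epsilon>(1) \<epsilon>'(2)] H(2)[OF \<epsilon>(1) \<epsilon>'(2)] H(3)[OF \<epsilon>(1) \<epsilon>'(2)]
    have "\<exists>k. \<bar>k - \<mu> i\<bar> \<le> \<delta> \<and> approx_eigenvalue (H \<epsilon>) k" if "i \<le> N" for i
      by (rule approx_eigenvalue_near_eigenvalue[OF C(1,2) He \<delta> e(2)[OF \<epsilon>(1) \<epsilon>'(1)] \<mu>(2)[OF that]])
        (use \<delta>\<mu>[OF that] in auto)
    then obtain s where s: "\<And>i. i \<le> N \<Longrightarrow> \<bar>s i - \<mu> i\<bar> \<le> \<delta> \<and> approx_eigenvalue (H \<epsilon>) (s i)"
      by metis
    have v: "\<not> approx_eigenvalue (H \<epsilon>) (v i)" if "i < N" for i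
      by (rule shifted_bounded_below[OF C(1,2) He less_imp_le[OF \<delta>] e(2)[OF \<epsilon>(1) \<epsilon>'(1)] \<delta>i(1)[OF that] vc(2)[OF that]])
    have "has_at_least_gaps N {l. 0 \<le> l \<and> 1 / (1 + l) \<in> {k. approx_eigenvalue (H \<epsilon>) k}}"
    proof (rule has_at_least_gaps_reciprocal)
      show "closed {k. approx_eigenvalue (H \<epsilon>) k}" by (rule closed_approx_eigenvalue[OF He(1)])
      show "{k. approx_eigenvalue (H \<epsilon>) k} \<subseteq> {..1}" using approx_eigenvalue_bounds[OF He(1)] by auto
      show "s i \<in> {k. approx_eigenvalue (H \<epsilon>) k}" if "i \<le> N" for i using s[OF that] by simp
      show "0 < s 0" using s[of 0] \<delta>\<mu>[of 0] \<delta> by auto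
      show "v i \<notin> {k. approx_eigenvalue (H \<epsilon>) k} \<and> s i < v i \<and> v i < s (Suc i)" if "i < N" for i
        using v[OF that] s[of i] s[of "Suc i"] \<delta>i(2,3)[OF that] that by auto
    qed
    then show ?thesis by simp
  qed
  then show ?thesis using e(1) \<epsilon>0 by (intro exI[of _ "min e \<epsilon>0"]) auto
qed

end

section \<open>The Hilbert space of square integrable functions\<close>

lemma L2_iff: "u \<in> L2 S \<longleftrightarrow> u \<in> borel_measurable (lebesgue_on S) \<and> integrable (lebesgue_on S) (\<lambda>x. (cmod (u x))\<^sup>2)"
  by (simp add: L2_def)

lemma L2D:
  assumes "u \<in> L2 S"
  shows "u \<in> borel_measurable (lebesgue_on S)" "integrable (lebesgue_on S) (\<lambda>x. (cmod (u x))\<^sup>2)"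
  using assms by (auto simp: L2_iff)

lemma L2_bound:
  assumes "u \<in> borel_measurable (lebesgue_on S)" "integrable (lebesgue_on S) g"
    "AE x in lebesgue_on S. (cmod (u x))\<^sup>2 \<le> g x"
  shows "u \<in> L2 S"
proof -
  have "integrable (lebesgue_on S) (\<lambda>x. (cmod (u x))\<^sup>2)"
  proof (rule Bochner_Integration.integrable_bound[OF assms(2)])
    show "(\<lambda>x. (cmod (u x))\<^sup>2) \<in> borel_measurable (lebesgue_on S)" using assms(1) by measurable
    show "AE x in lebesgue_on S. norm ((cmod (u x))\<^sup>2) \<le> norm (g x)"
      using assms(3) by (rule AE_mp) (auto intro!: AE_I2)
  qed
  then show ?thesis using assms(1) by (simp add: L2_iff)
qed

lemma zero_in_L2 [simp]: "(\<lambda>x. 0) \<in> L2 S"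
  by (simp add: L2_iff)

lemma norm_add_square_le: "(norm (a + b))\<^sup>2 \<le> 2 * (norm a)\<^sup>2 + 2 * (norm (b::'b::real_normed_vector))\<^sup>2"
proof -
  have "(norm (a + b))\<^sup>2 \<le> (norm a + norm b)\<^sup>2" by (intro power_mono norm_triangle_ineq) simp
  also have "\<dots> \<le> 2 * (norm a)\<^sup>2 + 2 * (norm b)\<^sup>2" 
    using zero_le_power2[of "norm a - norm b"] by (simp add: power2_eq_square algebra_simps)
  finally show ?thesis .
qed

lemma L2_add: "u \<in> L2 S \<Longrightarrow> v \<in> L2 S \<Longrightarrow> (\<lambda>x. u x + v x) \<in> L2 S"
  by (rule L2_bound[where g="\<lambda>x. 2 * (cmod (u x))\<^sup>2 + 2 * (cmod (v x))\<^sup>2"])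
    (auto simp: L2_iff norm_add_square_le)

lemma L2_scale: "u \<in> L2 S \<Longrightarrow> (\<lambda>x. c * u x) \<in> L2 S"
  by (auto simp: L2_iff norm_mult power_mult_distrib)

lemma L2_scaleR: "u \<in> L2 S \<Longrightarrow> (\<lambda>x. c *\<^sub>R u x) \<in> L2 S"
  using L2_scale[of u S "complex_of_real c"] by (simp add: scaleR_conv_of_real)

lemma L2_uminus: "u \<in> L2 S \<Longrightarrow> (\<lambda>x. - u x) \<in> L2 S"
  by (auto simp: L2_iff)

lemma L2_diff: "u \<in> L2 S \<Longrightarrow> v \<in> L2 S \<Longrightarrow> (\<lambda>x. u x - v x) \<in> L2 S"
  using L2_add[of u S "\<lambda>x. - v x"] L2_uminus[of v S] by simp

lemma L2_integrable_mult:
  assumes "u \<in> L2 S" "v \<in> L2 S"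
  shows "integrable (lebesgue_on S) (\<lambda>x. u x * cnj (v x))"
proof (rule Bochner_Integration.integrable_bound)
  show "integrable (lebesgue_on S) (\<lambda>x. (cmod (u x))\<^sup>2 + (cmod (v x))\<^sup>2)"
    using assms by (auto simp: L2_iff)
  have "(\<lambda>x. cnj (v x)) \<in> borel_measurable (lebesgue_on S)"
    using assms(2) by (intro measurable_compose[of v _ borel cnj] borel_measurable_continuous_onI continuous_intros) (auto simp: L2_iff)
  then show "(\<lambda>x. u x * cnj (v x)) \<in> borel_measurable (lebesgue_on S)"
    using assms(1) by (intro borel_measurable_times) (auto simp: L2_iff)
  have "norm (a * cnj b) \<le> norm ((cmod a)\<^sup>2 + (cmod b)\<^sup>2)" for a b
  proof -
    have "2 * (cmod a * cmod b) \<le> (cmod a)\<^sup>2 + (cmod b)\<^sup>2"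
      using zero_le_power2[of "cmod a - cmod b"] by (simp add: power2_eq_square algebra_simps)
    then have "cmod a * cmod b \<le> (cmod a)\<^sup>2 + (cmod b)\<^sup>2"
      using mult_nonneg_nonneg[OF norm_ge_zero[of a] norm_ge_zero[of b]] by linarith
    then show ?thesis by (simp add: norm_mult)
  qed
  then show "AE x in lebesgue_on S. norm (u x * cnj (v x)) \<le> norm ((cmod (u x))\<^sup>2 + (cmod (v x))\<^sup>2)"
    by simp
qed

lemma L2_inner_cnj: "L2_inner S v u = cnj (L2_inner S u v)"
  unfolding L2_inner_def Bochner_Integration.integral_cnj[symmetric] by (simp add: mult.commute)

lemma L2_inner_add_left:
  "u \<in> L2 S \<Longrightarrow> v \<in> L2 S \<Longrightarrow> w \<in> L2 S \<Longrightarrow> L2_inner S (\<lambda>x. u x + v x) w = L2_inner S u w + L2_inner S v w"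
  unfolding L2_inner_def by (simp add: distrib_right L2_integrable_mult)

lemma L2_inner_scale_left: "L2_inner S (\<lambda>x. c * u x) w = c * L2_inner S u w"
  unfolding L2_inner_def by (simp add: mult.assoc)

lemma L2_inner_self:
  "L2_inner S u u = complex_of_real (\<integral>x. (cmod (u x))\<^sup>2 \<partial>lebesgue_on S)"
  unfolding L2_inner_def complex_norm_square[symmetric] integral_complex_of_real ..

lemma Re_L2_inner_self: "Re (L2_inner S u u) = (\<integral>x. (cmod (u x))\<^sup>2 \<partial>lebesgue_on S)"
  by (simp add: L2_inner_self)

lemma L2_inner_cong_AE:
  assumes "u \<in> L2 S" "v \<in> L2 S" "u' \<in> L2 S" "v' \<in> L2 S"
    and "AE x in lebesgue_on S. u x = u' x" "AE x in lebesgue_on S. v x = v' x"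
  shows "L2_inner S u v = L2_inner S u' v'"
  unfolding L2_inner_def
proof (rule Bochner_Integration.integral_cong_AE)
  show "(\<lambda>x. u x * cnj (v x)) \<in> borel_measurable (lebesgue_on S)"
    "(\<lambda>x. u' x * cnj (v' x)) \<in> borel_measurable (lebesgue_on S)"
    using L2_integrable_mult[OF assms(1,2)] L2_integrable_mult[OF assms(3,4)] by auto
  show "AE x in lebesgue_on S. u x * cnj (v x) = u' x * cnj (v' x)"
    using assms(5,6) by eventually_elim simp
qed

definition lsq_rel :: "('a::euclidean_space \<Rightarrow> complex) \<Rightarrow> ('a \<Rightarrow> complex) \<Rightarrow> bool" where
  "lsq_rel u v \<longleftrightarrow> u \<in> L2 UNIV \<and> v \<in> L2 UNIV \<and> (AE x in lebesgue_on UNIV. u x = v x)"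

text \<open>Square integrable functions on any set \<open>S\<close> are extended by zero, so that one type serves all
  domains.  The type is a real Hilbert space; imaginary parts of forms are recovered by multiplying
  an argument by \<open>\<i>\<close>.\<close>

quotient_type (overloaded) 'a lsq = "'a::euclidean_space \<Rightarrow> complex" / partial: lsq_rel
proof (rule part_equivpI)
  show "\<exists>x::'a \<Rightarrow> complex. lsq_rel x x" by (rule exI[of _ "\<lambda>x. 0"]) (simp add: lsq_rel_def)
  show "symp (lsq_rel :: ('a \<Rightarrow> complex) \<Rightarrow> _)"
    unfolding lsq_rel_def by (intro sympI) (auto elim: AE_mp)
  show "transp (lsq_rel :: ('a \<Rightarrow> complex) \<Rightarrow> _)"
    unfolding lsq_rel_def
  proof (intro transpI, elim conjE, intro conjI)
    fix x y z :: "'a \<Rightarrow> complex"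
    assume "AE t in lebesgue_on UNIV. x t = y t" "AE t in lebesgue_on UNIV. y t = z t"
    then show "AE t in lebesgue_on UNIV. x t = z t" by eventually_elim simp
  qed
qed

instantiation lsq :: (euclidean_space) real_vector
begin

lift_definition zero_lsq :: "'a lsq" is "\<lambda>x. 0" by (simp add: lsq_rel_def)

lift_definition plus_lsq :: "'a lsq \<Rightarrow> 'a lsq \<Rightarrow> 'a lsq" is "\<lambda>u v x. u x + v x"
  unfolding lsq_rel_def by (auto intro: L2_add elim: AE_mp)

lift_definition uminus_lsq :: "'a lsq \<Rightarrow> 'a lsq" is "\<lambda>u x. - u x"
  unfolding lsq_rel_def by (auto intro: L2_uminus)

lift_definition minus_lsq :: "'a lsq \<Rightarrow> 'a lsq \<Rightarrow> 'a lsq" is "\<lambda>u v x. u x - v x"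
  unfolding lsq_rel_def by (auto intro: L2_diff elim: AE_mp)

lift_definition scaleR_lsq :: "real \<Rightarrow> 'a lsq \<Rightarrow> 'a lsq" is "\<lambda>c u x. c *\<^sub>R u x"
  unfolding lsq_rel_def by (auto intro: L2_scaleR)

instance
proof
  fix x y z :: "'a lsq" and a b :: real
  show "x + y + z = x + (y + z)"
    by transfer (auto simp: lsq_rel_def add.assoc intro: L2_add)
  show "x + y = y + x" by transfer (auto simp: lsq_rel_def add.commute intro: L2_add)
  show "0 + x = x" by transfer (auto simp: lsq_rel_def)
  show "- x + x = 0" by transfer (auto simp: lsq_rel_def)
  show "x - y = x + - y" by transfer (auto simp: lsq_rel_def intro: L2_diff)
  show "a *\<^sub>R (x + y) = a *\<^sub>R x + a *\<^sub>R y"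
    by transfer (auto simp: lsq_rel_def scaleR_add_right intro!: L2_add L2_scaleR)
  show "(a + b) *\<^sub>R x = a *\<^sub>R x + b *\<^sub>R x"
    by transfer (auto simp: lsq_rel_def scaleR_add_left intro!: L2_add L2_scaleR)
  show "a *\<^sub>R b *\<^sub>R x = (a * b) *\<^sub>R x"
    by transfer (auto simp: lsq_rel_def intro!: L2_scaleR)
  show "1 *\<^sub>R x = x" by transfer (auto simp: lsq_rel_def)
qed

end

instantiation lsq :: (euclidean_space) real_inner
begin

lift_definition inner_lsq :: "'a lsq \<Rightarrow> 'a lsq \<Rightarrow> real" is "\<lambda>u v. Re (L2_inner UNIV u v)"
  unfolding lsq_rel_def by (auto intro!: arg_cong[where f=Re] L2_inner_cong_AE)

definition norm_lsq :: "'a lsq \<Rightarrow> real" where "norm_lsq u = sqrt (inner u u)"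
definition dist_lsq :: "'a lsq \<Rightarrow> 'a lsq \<Rightarrow> real" where "dist_lsq u v = norm (u - v)"
definition sgn_lsq :: "'a lsq \<Rightarrow> 'a lsq" where "sgn_lsq u = inverse (norm u) *\<^sub>R u"
definition uniformity_lsq :: "('a lsq \<times> 'a lsq) filter" where
  "uniformity_lsq = (INF e\<in>{0<..}. principal {(x, y). dist x y < e})"
definition open_lsq :: "'a lsq set \<Rightarrow> bool" where
  "open_lsq U = (\<forall>x\<in>U. \<forall>\<^sub>F (x', y) in uniformity. x' = x \<longrightarrow> y \<in> U)"

instance
proof
  fix x y z :: "'a lsq" and a b :: real
  show "dist x y = norm (x - y)" by (rule dist_lsq_def)
  show "sgn x = x /\<^sub>R norm x" by (rule sgn_lsq_def)
  show "uniformity = (INF e\<in>{0<..}. principal {(x::'a lsq, y). dist x y < e})" by (rule uniformity_lsq_def)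
  show "open U = (\<forall>x\<in>U. \<forall>\<^sub>F (x', y) in uniformity. x' = x \<longrightarrow> y \<in> U)" for U :: "'a lsq set" by (rule open_lsq_def)
  show "norm x = sqrt (inner x x)" by (rule norm_lsq_def)
  show "inner x y = inner y x"
  proof transfer
    show "Re (L2_inner UNIV u v) = Re (L2_inner UNIV v u)" for u v :: "'a \<Rightarrow> complex"
      using L2_inner_cnj[of UNIV u v] by simp
  qed
  show "inner (x + y) z = inner x z + inner y z"
    by transfer (auto simp: lsq_rel_def L2_inner_add_left)
  show "inner (a *\<^sub>R x) y = a * inner x y"
    by transfer (simp add: scaleR_conv_of_real L2_inner_scale_left)
  show "0 \<le> inner x x" by transfer (simp add: Re_L2_inner_self)
  show "(inner x x = 0) = (x = 0)"
  proof transfer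
    fix u :: "'a \<Rightarrow> complex" assume "lsq_rel u u"
    then have u: "u \<in> L2 UNIV" by (simp add: lsq_rel_def)
    have "(Re (L2_inner UNIV u u) = 0) = (AE x in lebesgue_on UNIV. (cmod (u x))\<^sup>2 = 0)"
      unfolding Re_L2_inner_self by (rule integral_nonneg_eq_0_iff_AE[OF L2D(2)[OF u]]) simp
    then show "(Re (L2_inner UNIV u u) = 0) = lsq_rel u (\<lambda>x. 0)" using u by (simp add: lsq_rel_def)
  qed
qed

end

section \<open>Zero extension, restriction and translation for Lebesgue measure\<close>

lemma lebesgue_on_UNIV: "lebesgue_on UNIV = lebesgue"
  by (intro measure_eqI) (auto simp: sets_restrict_UNIV emeasure_restrict_space)

lemma integrable_cut:
  fixes f :: "'a::euclidean_space \<Rightarrow> 'b::{banach, second_countable_topology}"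
  assumes "S \<in> sets lebesgue"
  shows "integrable lebesgue (\<lambda>x. if x \<in> S then f x else 0) \<longleftrightarrow> integrable (lebesgue_on S) f"
proof -
  have "(\<lambda>x. if x \<in> S then f x else 0) = (\<lambda>x. indicator S x *\<^sub>R f x)" by (auto simp: indicator_def)
  then show ?thesis using assms by (simp add: integrable_restrict_space)
qed

lemma integral_cut:
  fixes f :: "'a::euclidean_space \<Rightarrow> 'b::{banach, second_countable_topology}"
  assumes "S \<in> sets lebesgue"
  shows "(\<integral>x. (if x \<in> S then f x else 0) \<partial>lebesgue) = (\<integral>x. f x \<partial>lebesgue_on S)"
proof -
  have "(\<lambda>x. if x \<in> S then f x else 0) = (\<lambda>x. indicator S x *\<^sub>R f x)" by (auto simp: indicator_def)
  then show ?thesis using assms by (simp add: integral_restrict_space)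
qed

lemma AE_lebesgue_on:
  "S \<in> sets lebesgue \<Longrightarrow> (AE x in lebesgue_on S. P x) \<longleftrightarrow> (AE x in lebesgue. x \<in> S \<longrightarrow> P x)"
  by (simp add: AE_restrict_space_iff)

lemma translation_measurable: "(\<lambda>x::'a::euclidean_space. t + x) \<in> lebesgue \<rightarrow>\<^sub>M lebesgue"
  using lebesgue_affine_measurable[of "\<lambda>_. 1::real" t] by (simp add: euclidean_representation)

text \<open>The affine change of variables with all dilation factors equal to 1.\<close>

lemma distr_lebesgue_translation:
  fixes t :: "'a::euclidean_space"
  shows "distr lebesgue lebesgue (\<lambda>x. t + x) = lebesgue"
proof -
  have T: "(\<lambda>x. t + (\<Sum>j\<in>Basis. (1 * (x \<bullet> j)) *\<^sub>R j)) = (\<lambda>x. t + x)" by (simp add: euclidean_representation)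
  show ?thesis
    using lebesgue_affine_euclidean[where c="\<lambda>_. 1::real" and t=t, unfolded T] by (simp add: density_1)
qed

lemma integrable_translation:
  fixes f :: "'a::euclidean_space \<Rightarrow> 'b::{banach, second_countable_topology}"
  assumes "integrable lebesgue f"
  shows "integrable lebesgue (\<lambda>x. f (t + x))"
  using assms integrable_distr[OF translation_measurable[of t], of f]
  by (simp add: distr_lebesgue_translation)

lemma integral_translation:
  fixes f :: "'a::euclidean_space \<Rightarrow> 'b::{banach, second_countable_topology}"
  assumes "f \<in> borel_measurable lebesgue"
  shows "(\<integral>x. f (t + x) \<partial>lebesgue) = (\<integral>x. f x \<partial>lebesgue)"
  using integral_distr[OF translation_measurable[of t] assms] by (simp add: distr_lebesgue_translation)

lemma AE_translation:
  fixes t :: "'a::euclidean_space"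
  assumes "AE x in lebesgue. P x"
  shows "AE x in lebesgue. P (t + x)"
proof -
  have "AE x in distr lebesgue lebesgue (\<lambda>x. t + x). P x" unfolding distr_lebesgue_translation by (rule assms)
  then show ?thesis by (rule AE_distrD[OF translation_measurable])
qed

lemma cut_in_L2:
  assumes "S \<in> sets lebesgue"
  shows "(\<lambda>x. if x \<in> S then u x else 0) \<in> L2 UNIV \<longleftrightarrow> u \<in> L2 S"
proof -
  have "(\<lambda>x. (cmod (if x \<in> S then u x else 0))\<^sup>2) = (\<lambda>x. if x \<in> S then (cmod (u x))\<^sup>2 else 0)" by auto
  then show ?thesis
    using borel_measurable_if[OF assms, of u] integrable_cut[OF assms, of "\<lambda>x. (cmod (u x))\<^sup>2"]
    by (simp add: L2_iff lebesgue_on_UNIV)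
qed

definition lsq_of :: "'a::euclidean_space set \<Rightarrow> ('a \<Rightarrow> complex) \<Rightarrow> 'a lsq" where
  "lsq_of S u = abs_lsq (\<lambda>x. if x \<in> S then u x else 0)"

lemma lsq_cases:
  obtains f where "f \<in> L2 UNIV" "x = lsq_of UNIV f"
proof (rule that)
  have "lsq_rel (rep_lsq x) (rep_lsq x)" by (rule Quotient_rep_reflp[OF Quotient_lsq])
  then show "rep_lsq x \<in> L2 UNIV" by (simp add: lsq_rel_def)
  show "x = lsq_of UNIV (rep_lsq x)" by (simp add: lsq_of_def Quotient_abs_rep[OF Quotient_lsq])
qed

lemma lsq_representative: "\<exists>f. f \<in> L2 UNIV \<and> x = lsq_of UNIV f"
  by (rule lsq_cases[of x]) blast

lemma lsq_of_cut:
  "S \<in> sets lebesgue \<Longrightarrow> lsq_of S u = lsq_of UNIV (\<lambda>x. if x \<in> S then u x else 0)"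
  by (simp add: lsq_of_def)

context
  fixes S :: "'a::euclidean_space set"
  assumes S: "S \<in> sets lebesgue"
begin

lemma lsq_rel_cut: "u \<in> L2 S \<Longrightarrow> lsq_rel (\<lambda>x. if x \<in> S then u x else 0) (\<lambda>x. if x \<in> S then u x else 0)"
  by (simp add: lsq_rel_def cut_in_L2[OF S])

lemma lsq_of_eq_iff:
  assumes "u \<in> L2 S" "v \<in> L2 S"
  shows "lsq_of S u = lsq_of S v \<longleftrightarrow> (AE x in lebesgue_on S. u x = v x)"
proof -
  have "lsq_of S u = lsq_of S v \<longleftrightarrow> lsq_rel (\<lambda>x. if x \<in> S then u x else 0) (\<lambda>x. if x \<in> S then v x else 0)"
    unfolding lsq_of_def
    using Quotient_rel[OF Quotient_lsq, of "\<lambda>x. if x \<in> S then u x else 0" "\<lambda>x. if x \<in> S then v x else 0"]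
      lsq_rel_cut[OF assms(1)] lsq_rel_cut[OF assms(2)] by argo
  also have "\<dots> \<longleftrightarrow> (AE x in lebesgue. x \<in> S \<longrightarrow> u x = v x)"
    using assms unfolding lsq_rel_def cut_in_L2[OF S] lebesgue_on_UNIV
    by (auto elim: AE_mp)
  finally show ?thesis by (simp add: AE_lebesgue_on[OF S])
qed

lemma lsq_of_add: "u \<in> L2 S \<Longrightarrow> v \<in> L2 S \<Longrightarrow> lsq_of S (\<lambda>x. u x + v x) = lsq_of S u + lsq_of S v"
  unfolding lsq_of_def by (subst plus_lsq.abs_eq) (auto intro!: lsq_rel_cut arg_cong[where f=abs_lsq])

lemma lsq_of_diff: "u \<in> L2 S \<Longrightarrow> v \<in> L2 S \<Longrightarrow> lsq_of S (\<lambda>x. u x - v x) = lsq_of S u - lsq_of S v"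
  unfolding lsq_of_def by (subst minus_lsq.abs_eq) (auto intro!: lsq_rel_cut arg_cong[where f=abs_lsq])

lemma lsq_of_scaleR: "u \<in> L2 S \<Longrightarrow> lsq_of S (\<lambda>x. c *\<^sub>R u x) = c *\<^sub>R lsq_of S u"
  unfolding lsq_of_def by (subst scaleR_lsq.abs_eq) (auto intro!: lsq_rel_cut arg_cong[where f=abs_lsq])

lemma lsq_of_zero: "lsq_of S (\<lambda>x. 0) = 0"
  unfolding lsq_of_def zero_lsq_def by simp

lemma inner_lsq_of:
  assumes "u \<in> L2 S" "v \<in> L2 S"
  shows "inner (lsq_of S u) (lsq_of S v) = Re (L2_inner S u v)"
proof -
  have "inner (lsq_of S u) (lsq_of S v)
      = Re (L2_inner UNIV (\<lambda>x. if x \<in> S then u x else 0) (\<lambda>x. if x \<in> S then v x else 0))"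
    unfolding lsq_of_def by (rule inner_lsq.abs_eq) (intro lsq_rel_cut assms)+
  also have "(\<lambda>x. (if x \<in> S then u x else 0) * cnj (if x \<in> S then v x else 0))
      = (\<lambda>x. if x \<in> S then u x * cnj (v x) else 0)" by auto
  then have "L2_inner UNIV (\<lambda>x. if x \<in> S then u x else 0) (\<lambda>x. if x \<in> S then v x else 0) = L2_inner S u v"
    unfolding L2_inner_def lebesgue_on_UNIV integral_cut[OF S, symmetric] by simp
  finally show ?thesis .
qed

lemma norm_lsq_of: "u \<in> L2 S \<Longrightarrow> norm (lsq_of S u) = L2_norm S u"
  by (simp only: norm_eq_sqrt_inner inner_lsq_of L2_norm_def)

lemma norm_lsq_of_square: "u \<in> L2 S \<Longrightarrow> (norm (lsq_of S u))\<^sup>2 = (\<integral>x. (cmod (u x))\<^sup>2 \<partial>lebesgue_on S)"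
  by (simp only: power2_norm_eq_inner inner_lsq_of Re_L2_inner_self)

lemma L2_UNIV_restrict: "f \<in> L2 UNIV \<Longrightarrow> f \<in> L2 S"
proof -
  assume f: "f \<in> L2 UNIV"
  have "(\<lambda>x. if x \<in> S then f x else 0) \<in> L2 UNIV"
  proof (rule L2_bound[OF _ L2D(2)[OF f]])
    show "(\<lambda>x. if x \<in> S then f x else 0) \<in> borel_measurable (lebesgue_on UNIV)"
      using f S by (auto simp: L2_iff lebesgue_on_UNIV intro!: measurable_If_set)
  qed auto
  then show ?thesis by (simp add: cut_in_L2[OF S])
qed

end

lemma L2_subset:
  assumes "S \<in> sets lebesgue" "T \<in> sets lebesgue" "S \<subseteq> T" "u \<in> L2 T"
  shows "u \<in> L2 S"
proof -
  have "(\<lambda>x. if x \<in> T then u x else 0) \<in> L2 S"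
    by (rule L2_UNIV_restrict[OF assms(1)]) (simp add: cut_in_L2[OF assms(2)] assms(4))
  then have "(\<lambda>x. if x \<in> S then (if x \<in> T then u x else 0) else 0) \<in> L2 UNIV"
    using assms(1) by (simp add: cut_in_L2)
  also have "(\<lambda>x. if x \<in> S then (if x \<in> T then u x else 0) else 0) = (\<lambda>x. if x \<in> S then u x else 0)"
    by (rule ext) (use assms(3) in auto)
  finally show ?thesis using assms(1) by (simp add: cut_in_L2)
qed

section \<open>Completeness of the space of square integrable functions\<close>

lemma nn_integral_L2:
  assumes "f \<in> L2 UNIV" "g \<in> L2 UNIV"
  shows "(\<integral>\<^sup>+x. ennreal ((cmod (f x - g x))\<^sup>2) \<partial>lebesgue) = ennreal ((norm (lsq_of UNIV f - lsq_of UNIV g))\<^sup>2)"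
proof -
  have "(\<integral>\<^sup>+x. ennreal ((cmod (f x - g x))\<^sup>2) \<partial>lebesgue) = ennreal (\<integral>x. (cmod (f x - g x))\<^sup>2 \<partial>lebesgue)"
    using L2D(2)[OF L2_diff[OF assms]] by (intro nn_integral_eq_integral) (auto simp: lebesgue_on_UNIV)
  then show ?thesis using norm_lsq_of_square[OF _ L2_diff[OF assms]] assms
    by (simp add: lsq_of_diff lebesgue_on_UNIV)
qed

text \<open>The weights \<open>2 ^ k\<close> against the bounds \<open>(1/4) ^ k\<close> leave a
  finite integral, so the weighted sum is finite almost everywhere. At such a point the increments
  are bounded by a multiple of \<open>(1 / sqrt 2) ^ k\<close>, and the telescoping series converges
  absolutely.\<close>

lemma AE_convergent_of_fast_Cauchy:
  fixes f :: "nat \<Rightarrow> 'a::euclidean_space \<Rightarrow> complex"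
  assumes f: "\<And>k. f k \<in> borel_measurable lebesgue"
    and fast: "\<And>k. (\<integral>\<^sup>+x. ennreal ((cmod (f (Suc k) x - f k x))\<^sup>2) \<partial>lebesgue) \<le> ennreal ((1/4) ^ k)"
  shows "AE x in lebesgue. convergent (\<lambda>k. f k x)"
proof -
  let ?g = "\<lambda>k x. ennreal (2 ^ k * (cmod (f (Suc k) x - f k x))\<^sup>2)"
  have [measurable]: "f k \<in> borel_measurable lebesgue" for k by (rule f)
  have "(\<integral>\<^sup>+x. (\<Sum>k. ?g k x) \<partial>lebesgue) = (\<Sum>k. \<integral>\<^sup>+x. ?g k x \<partial>lebesgue)"
    by (rule nn_integral_suminf) measurable
  also have "\<dots> \<le> (\<Sum>k. ennreal ((1/2) ^ k))"
  proof (intro suminf_le summableI)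
    fix k
    have "(\<integral>\<^sup>+x. ?g k x \<partial>lebesgue) = ennreal (2^k) * (\<integral>\<^sup>+x. ennreal ((cmod (f (Suc k) x - f k x))\<^sup>2) \<partial>lebesgue)"
      by (subst nn_integral_cmult[symmetric]) (auto simp: ennreal_mult)
    also have "\<dots> \<le> ennreal (2^k) * ennreal ((1/4) ^ k)" by (intro mult_left_mono fast) simp
    also have "\<dots> = ennreal ((1/2)^k)"
      by (simp add: ennreal_mult[symmetric] power_mult_distrib[symmetric])
    finally show "(\<integral>\<^sup>+x. ?g k x \<partial>lebesgue) \<le> ennreal ((1/2) ^ k)" .
  qed
  also have "\<dots> = ennreal (\<Sum>k. (1/2) ^ k)"
    by (intro suminf_ennreal2 summable_geometric) auto
  also have "\<dots> < \<infinity>" by simp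
  finally have "(\<integral>\<^sup>+x. (\<Sum>k. ?g k x) \<partial>lebesgue) \<noteq> \<infinity>" by simp
  then have "AE x in lebesgue. (\<Sum>k. ?g k x) \<noteq> \<infinity>"
    by (intro nn_integral_PInf_AE) measurable
  then show ?thesis
  proof eventually_elim
    fix x assume fin: "(\<Sum>k. ?g k x) \<noteq> \<infinity>"
    define c where "c = enn2real (\<Sum>k. ?g k x)"
    have c: "(\<Sum>k. ?g k x) = ennreal c" using fin by (simp add: c_def less_top)
    have c0: "c \<ge> 0" by (simp add: c_def)
    have "2 ^ k * (cmod (f (Suc k) x - f k x))\<^sup>2 \<le> c" for k
    proof -
      have "?g k x = (\<Sum>k\<in>{k}. ?g k x)" by simp
      also have "\<dots> \<le> (\<Sum>k. ?g k x)" by (rule sum_le_suminf[OF summableI]) auto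
      also have "\<dots> = ennreal c" by (rule c)
      finally have "?g k x \<le> ennreal c" .
      then show ?thesis using c0 by simp
    qed
    moreover have "(sqrt 2 ^ k)\<^sup>2 = (2::real) ^ k" for k
      unfolding power2_eq_square power_mult_distrib[symmetric] by simp
    ultimately have "(sqrt 2 ^ k * cmod (f (Suc k) x - f k x))\<^sup>2 \<le> (sqrt c)\<^sup>2" for k
      using c0 unfolding power_mult_distrib by simp
    then have le: "sqrt 2 ^ k * cmod (f (Suc k) x - f k x) \<le> sqrt c" for k
      by (rule power2_le_imp_le) (use c0 in simp)
    have "summable (\<lambda>k. f (Suc k) x - f k x)"
    proof (rule summable_comparison_test[of _ "\<lambda>k. sqrt c * (1 / sqrt 2) ^ k"])
      show "\<exists>N. \<forall>n\<ge>N. norm (f (Suc n) x - f n x) \<le> sqrt c * (1 / sqrt 2) ^ n"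
        using le by (auto simp: power_divide field_simps)
      show "summable (\<lambda>k. sqrt c * (1 / sqrt 2) ^ k)"
        by (intro summable_mult summable_geometric) simp
    qed
    then have "convergent (\<lambda>n. \<Sum>k<n. f (Suc k) x - f k x)" by (simp add: summable_iff_convergent)
    then have "convergent (\<lambda>n. (f n x - f 0 x) + f 0 x)"
      by (intro convergent_add convergent_const) (simp add: sum_lessThan_telescope[of "\<lambda>k. f k x"])
    then show "convergent (\<lambda>k. f k x)" by simp
  qed
qed

text \<open>Riesz-Fischer: a rapidly converging subsequence has a pointwise limit almost everywhere,
  and Fatou's lemma carries the Cauchy estimate over to that limit, for the whole sequence.\<close>

instance lsq :: (euclidean_space) complete_space
proof
  fix X :: "nat \<Rightarrow> 'a lsq" assume X: "Cauchy X"
  have "\<forall>n. \<exists>f. f \<in> L2 UNIV \<and> X n = lsq_of UNIV f" using lsq_representative by blast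
  from choice[OF this] obtain g where g: "\<And>n. g n \<in> L2 UNIV" "\<And>n. X n = lsq_of UNIV (g n)" by blast
  have gm [measurable]: "g n \<in> borel_measurable lebesgue" for n using L2D(1)[OF g(1)] by (simp add: lebesgue_on_UNIV)
  have "\<exists>M. \<forall>m\<ge>M. \<forall>n\<ge>M. norm (X m - X n) < (1/2) ^ k" for k :: nat
    by (rule CauchyD[OF X]) simp
  then obtain M where M: "\<And>k m n. m \<ge> M k \<Longrightarrow> n \<ge> M k \<Longrightarrow> norm (X m - X n) < (1/2) ^ (k::nat)" by metis
  \<comment> \<open>Partial sums make \<open>r\<close> nondecreasing and at least \<open>M\<close>
    at the same time.\<close>
  define r where "r k = (\<Sum>i\<le>k. M i)" for k
  have r: "M k \<le> r k" "r k \<le> r (Suc k)" for k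
    unfolding r_def by (auto intro: member_le_sum)
  define f where "f k = g (r k)" for k
  have fm [measurable]: "f k \<in> borel_measurable lebesgue" for k by (simp add: f_def gm)
  have conv: "AE x in lebesgue. convergent (\<lambda>k. f k x)"
  proof (rule AE_convergent_of_fast_Cauchy[OF fm])
    fix k
    have "(norm (X (r (Suc k)) - X (r k)))\<^sup>2 \<le> ((1/2)^k)\<^sup>2"
      using M[of k "r (Suc k)" "r k"] r(1)[of k] r(2)[of k] by (intro power_mono) auto
    also have "\<dots> = (1/4)^k" unfolding power2_eq_square power_mult_distrib[symmetric] by simp
    finally show "(\<integral>\<^sup>+x. ennreal ((cmod (f (Suc k) x - f k x))\<^sup>2) \<partial>lebesgue) \<le> ennreal ((1/4) ^ k)"
      unfolding f_def nn_integral_L2[OF g(1) g(1)] g(2)[symmetric] by (rule ennreal_leI)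
  qed
  define h where "h x = lim (\<lambda>k. f k x)" for x
  have hm [measurable]: "h \<in> borel_measurable lebesgue" unfolding h_def by measurable
  have key: "(\<integral>\<^sup>+x. ennreal ((cmod (h x - g n x))\<^sup>2) \<partial>lebesgue) \<le> ennreal (((1/2)^k)\<^sup>2)" if n: "n \<ge> M k" for n k
  proof -
    have "(\<integral>\<^sup>+x. ennreal ((cmod (h x - g n x))\<^sup>2) \<partial>lebesgue)
        = (\<integral>\<^sup>+x. liminf (\<lambda>j. ennreal ((cmod (f j x - g n x))\<^sup>2)) \<partial>lebesgue)"
    proof (rule nn_integral_cong_AE)
      show "AE x in lebesgue. ennreal ((cmod (h x - g n x))\<^sup>2) = liminf (\<lambda>j. ennreal ((cmod (f j x - g n x))\<^sup>2))"
        using conv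
      proof eventually_elim
        fix x assume "convergent (\<lambda>k. f k x)"
        then have "(\<lambda>k. f k x) \<longlonglongrightarrow> h x" unfolding h_def by (simp add: convergent_LIMSEQ_iff)
        then have "(\<lambda>j. ennreal ((cmod (f j x - g n x))\<^sup>2)) \<longlonglongrightarrow> ennreal ((cmod (h x - g n x))\<^sup>2)"
          by (intro tendsto_intros tendsto_ennrealI)
        then show "ennreal ((cmod (h x - g n x))\<^sup>2) = liminf (\<lambda>j. ennreal ((cmod (f j x - g n x))\<^sup>2))"
          by (intro lim_imp_Liminf[symmetric]) auto
      qed
    qed
    also have "\<dots> \<le> liminf (\<lambda>j. \<integral>\<^sup>+x. ennreal ((cmod (f j x - g n x))\<^sup>2) \<partial>lebesgue)"
      by (rule nn_integral_liminf) measurable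
    also have "\<dots> \<le> ennreal (((1/2)^k)\<^sup>2)"
    proof (rule Liminf_le)
      have "(\<integral>\<^sup>+x. ennreal ((cmod (f j x - g n x))\<^sup>2) \<partial>lebesgue) \<le> ennreal (((1/2)^k)\<^sup>2)" if j: "j \<ge> k" for j
      proof -
        have "M k \<le> r j" using j r by (metis lift_Suc_mono_le order_trans)
        then have "norm (X (r j) - X n) < (1/2)^k" using M n by blast
        then have "(norm (X (r j) - X n))\<^sup>2 \<le> ((1/2)^k)\<^sup>2" by (intro power_mono) auto
        then show ?thesis unfolding f_def nn_integral_L2[OF g(1) g(1)] g(2)[symmetric] by (rule ennreal_leI)
      qed
      then show "\<forall>\<^sub>F j in sequentially. (\<integral>\<^sup>+x. ennreal ((cmod (f j x - g n x))\<^sup>2) \<partial>lebesgue) \<le> ennreal (((1/2)^k)\<^sup>2)"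
        by (auto simp: eventually_sequentially)
    qed simp
    finally show ?thesis .
  qed
  have diff: "(\<lambda>x. h x - g n x) \<in> L2 UNIV" if "n \<ge> M k" for n k
    unfolding L2_iff lebesgue_on_UNIV
  proof
    show "integrable lebesgue (\<lambda>x. (cmod (h x - g n x))\<^sup>2)"
      unfolding integrable_iff_bounded using key[OF that] by (auto simp: le_less_trans)
  qed measurable
  have h: "h \<in> L2 UNIV" using L2_add[OF diff[of 0 "M 0"] g(1)[of "M 0"]] by simp
  have "X \<longlonglongrightarrow> lsq_of UNIV h"
  proof (rule LIMSEQ_I)
    fix e :: real assume "e > 0"
    then have "\<exists>k. (1/2)^k < e" by (intro real_arch_pow_inv) auto
    then obtain k where k: "(1/2)^k < e" by blast
    have "norm (X n - lsq_of UNIV h) < e" if "n \<ge> M k" for n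
    proof -
      have "(norm (lsq_of UNIV h - X n))\<^sup>2 \<le> ((1/2)^k)\<^sup>2"
        using key[OF that] unfolding nn_integral_L2[OF h g(1)] g(2)[symmetric] by simp
      then have "norm (lsq_of UNIV h - X n) \<le> (1/2)^k" by (rule power2_le_imp_le) simp
      then show ?thesis using k by (simp add: norm_minus_commute)
    qed
    then have "\<forall>n\<ge>M k. norm (X n - lsq_of UNIV h) < e" by simp
    then show "\<exists>no. \<forall>n\<ge>no. norm (X n - lsq_of UNIV h) < e" by (rule exI)
  qed
  then show "convergent X" unfolding convergent_def by blast
qed

section \<open>Smooth functions\<close>

lemma frechet_derivative_eqI: "(f has_derivative f') (at x) \<Longrightarrow> frechet_derivative f (at x) e = f' e"
  using frechet_derivative_at by metis

lemma Ck_Suc_imp_Ck: "Ck (Suc k) f \<Longrightarrow> Ck k f"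
proof (induction k arbitrary: f)
  case 0
  then show ?case
    by (auto simp: continuous_on_eq_continuous_at intro: differentiable_imp_continuous_within)
next
  case (Suc k)
  then show ?case by simp
qed

lemma Ck_mono: "Ck n f \<Longrightarrow> k \<le> n \<Longrightarrow> Ck k f"
  by (induction n) (auto simp: le_Suc_eq dest: Ck_Suc_imp_Ck simp del: Ck.simps(2))

lemma Ck_continuous: "Ck k f \<Longrightarrow> continuous_on UNIV f"
  using Ck_mono[of k f 0] by simp

lemma Ck_SucI:
  assumes "\<And>x. (f has_derivative f' x) (at x)" "\<And>e. e \<in> Basis \<Longrightarrow> Ck k (\<lambda>x. f' x e)"
  shows "Ck (Suc k) f"
proof -
  have "(\<lambda>x. frechet_derivative f (at x) e) = (\<lambda>x. f' x e)" for e
    using frechet_derivative_eqI[OF assms(1)] by blast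
  then show ?thesis using assms by (auto simp: differentiable_def)
qed

lemma Ck_SucD:
  assumes "Ck (Suc k) f"
  shows "(f has_derivative frechet_derivative f (at x)) (at x)"
    "e \<in> Basis \<Longrightarrow> Ck k (\<lambda>x. frechet_derivative f (at x) e)"
  using assms by (auto simp: frechet_derivative_works[symmetric])

text \<open>Serves functions that agree with a smooth product on one open set and with zero on
  another, the two sets covering everything.\<close>

lemma Ck_local:
  assumes "\<And>x. \<exists>g U. open U \<and> x \<in> U \<and> (\<forall>y\<in>U. f y = g y) \<and> Ck k g"
  shows "Ck k f"
  using assms
proof (induction k arbitrary: f)
  case 0
  have "continuous (at x) f" for x
  proof -
    obtain g U where g: "open U" "x \<in> U" "\<forall>y\<in>U. f y = g y" "continuous_on UNIV g" using 0[of x] by auto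
    have "continuous (at x) g" using g(4) by (simp add: continuous_on_eq_continuous_at)
    moreover have "\<forall>\<^sub>F y in nhds x. g y = f y" using g(1-3) by (auto simp: eventually_nhds)
    ultimately show ?thesis using isCont_cong by blast
  qed
  then show ?case by (simp add: continuous_on_eq_continuous_at)
next
  case (Suc k)
  have D: "\<exists>g U. open U \<and> x \<in> U \<and> Ck (Suc k) g \<and> (\<forall>y\<in>U. (f has_derivative frechet_derivative g (at y)) (at y))" for x
  proof -
    obtain g U where g: "open U" "x \<in> U" "\<forall>y\<in>U. f y = g y" "Ck (Suc k) g" using Suc.prems[of x] by auto
    have "(f has_derivative frechet_derivative g (at y)) (at y)" if y: "y \<in> U" for y
      by (rule has_derivative_transform_within_open[OF Ck_SucD(1)[OF g(4)] g(1) y]) (use g(3) in simp)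
    then show ?thesis using g by blast
  qed
  have "(f has_derivative frechet_derivative f (at x)) (at x)" for x
    using D[of x] frechet_derivative_at by metis
  then show ?case
  proof (rule Ck_SucI)
    fix e :: 'a assume e: "e \<in> Basis"
    show "Ck k (\<lambda>x. frechet_derivative f (at x) e)"
    proof (rule Suc.IH)
      fix x
      obtain g U where g: "open U" "x \<in> U" "Ck (Suc k) g"
        and d: "\<forall>y\<in>U. (f has_derivative frechet_derivative g (at y)) (at y)" using D[of x] by blast
      have "\<forall>y\<in>U. frechet_derivative f (at y) e = frechet_derivative g (at y) e"
        using d frechet_derivative_eqI by blast
      then show "\<exists>h U. open U \<and> x \<in> U \<and> (\<forall>y\<in>U. frechet_derivative f (at y) e = h y) \<and> Ck k h"
        using g Ck_SucD(2)[OF g(3) e]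
        by (intro exI[of _ "\<lambda>y. frechet_derivative g (at y) e"] exI[of _ U]) auto
    qed
  qed
qed

lemma Ck_const: "Ck k (\<lambda>x. c)"
proof (induction k arbitrary: c)
  case (Suc k)
  show ?case by (rule Ck_SucI[OF has_derivative_const Suc])
qed simp

lemma Ck_add: "Ck k f \<Longrightarrow> Ck k g \<Longrightarrow> Ck k (\<lambda>x. f x + g x)"
proof (induction k arbitrary: f g)
  case (Suc k)
  show ?case
    by (rule Ck_SucI[OF has_derivative_add[OF Ck_SucD(1)[OF Suc.prems(1)] Ck_SucD(1)[OF Suc.prems(2)]]])
      (rule Suc.IH[OF Ck_SucD(2)[OF Suc.prems(1)] Ck_SucD(2)[OF Suc.prems(2)]])
qed (simp add: continuous_intros)

lemma Ck_mult: "Ck k f \<Longrightarrow> Ck k g \<Longrightarrow> Ck k (\<lambda>x. f x * g x)"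
proof (induction k arbitrary: f g)
  case (Suc k)
  show ?case
  proof (rule Ck_SucI[OF has_derivative_mult[OF Ck_SucD(1)[OF Suc.prems(1)] Ck_SucD(1)[OF Suc.prems(2)]]])
    fix e :: 'a assume e: "e \<in> Basis"
    show "Ck k (\<lambda>x. f x * frechet_derivative g (at x) e + frechet_derivative f (at x) e * g x)"
      by (intro Ck_add Suc.IH Ck_Suc_imp_Ck[OF Suc.prems(1)] Ck_Suc_imp_Ck[OF Suc.prems(2)]
          Ck_SucD(2)[OF Suc.prems(1) e] Ck_SucD(2)[OF Suc.prems(2) e])
  qed
qed (simp add: continuous_intros)

lemma Ck_uminus: "Ck k f \<Longrightarrow> Ck k (\<lambda>x. - f x)"
  using Ck_mult[OF Ck_const[of k "-1"], of f] by simp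

lemma Ck_diff: "Ck k f \<Longrightarrow> Ck k g \<Longrightarrow> Ck k (\<lambda>x. f x - g x)"
  using Ck_add[OF _ Ck_uminus, of k f g] by simp

lemma Ck_prod: "(\<And>i. i \<in> I \<Longrightarrow> Ck k (f i)) \<Longrightarrow> Ck k (\<lambda>x. \<Prod>i\<in>I. f i x)"
  by (induction I rule: infinite_finite_induct) (auto intro: Ck_mult Ck_const)

text \<open>The derivative is a product of inverses of \<open>f\<close> and a derivative of
  \<open>f\<close>, so the statement is reproduced one order lower.\<close>

lemma Ck_inverse:
  assumes "Ck k f" "\<And>x. f x \<noteq> 0"
  shows "Ck k (\<lambda>x. inverse (f x))"
  using assms
proof (induction k arbitrary: f)
  case (Suc k)
  have c: "Ck k (\<lambda>x. inverse (f x))" by (rule Suc.IH[OF Ck_Suc_imp_Ck[OF Suc.prems(1)] Suc.prems(2)])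
  show ?case
  proof (rule Ck_SucI)
    show "((\<lambda>x. inverse (f x)) has_derivative
        (\<lambda>h. - (inverse (f x) * frechet_derivative f (at x) h * inverse (f x)))) (at x)" for x
      by (rule Deriv.has_derivative_inverse[OF Suc.prems(2) Ck_SucD(1)[OF Suc.prems(1)]])
    fix e :: 'a assume e: "e \<in> Basis"
    show "Ck k (\<lambda>x. - (inverse (f x) * frechet_derivative f (at x) e * inverse (f x)))"
      by (intro Ck_uminus Ck_mult c Ck_SucD(2)[OF Suc.prems(1) e])
  qed
qed (auto intro!: continuous_intros)

lemma Ck_affine: "Ck k f \<Longrightarrow> Ck k (\<lambda>x. f (c *\<^sub>R x + a))"
proof (induction k arbitrary: f)
  case 0
  then have "continuous_on UNIV (f \<circ> (\<lambda>x. c *\<^sub>R x + a))"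
    by (intro continuous_on_compose continuous_intros) (auto intro: continuous_on_subset)
  then show ?case by (simp add: o_def)
next
  case (Suc k)
  show ?case
  proof (rule Ck_SucI)
    show "((\<lambda>x. f (c *\<^sub>R x + a)) has_derivative (\<lambda>h. c * frechet_derivative f (at (c *\<^sub>R x + a)) h)) (at x)" for x
    proof -
      have lin: "linear (frechet_derivative f (at (c *\<^sub>R x + a)))"
        using Ck_SucD(1)[OF Suc.prems] has_derivative_linear by blast
      have "((\<lambda>x. c *\<^sub>R x + a) has_derivative (\<lambda>h. c *\<^sub>R h)) (at x)" by (auto intro!: derivative_eq_intros)
      from has_derivative_compose[OF this Ck_SucD(1)[OF Suc.prems]]
      show ?thesis by (simp add: linear_scale[OF lin])
    qed
    fix e :: 'a assume e: "e \<in> Basis"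
    show "Ck k (\<lambda>x. c * frechet_derivative f (at (c *\<^sub>R x + a)) e)"
      by (intro Ck_mult Ck_const Suc.IH[OF Ck_SucD(2)[OF Suc.prems e]])
  qed
qed

lemma frechet_derivative_affine:
  assumes "Ck (Suc k) f"
  shows "frechet_derivative (\<lambda>x. f (c *\<^sub>R x + a)) (at x) e = c * frechet_derivative f (at (c *\<^sub>R x + a)) e"
proof (rule frechet_derivative_eqI)
  have lin: "linear (frechet_derivative f (at (c *\<^sub>R x + a)))"
    using Ck_SucD(1)[OF assms] has_derivative_linear by blast
  have "((\<lambda>x. c *\<^sub>R x + a) has_derivative (\<lambda>h. c *\<^sub>R h)) (at x)" by (auto intro!: derivative_eq_intros)
  from has_derivative_compose[OF this Ck_SucD(1)[OF assms]]
  show "((\<lambda>x. f (c *\<^sub>R x + a)) has_derivative (\<lambda>h. c * frechet_derivative f (at (c *\<^sub>R x + a)) h)) (at x)"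
    by (simp add: linear_scale[OF lin])
qed

lemma Ck_real_inner:
  fixes h :: "real \<Rightarrow> real" and v :: "'a::euclidean_space"
  assumes "Ck k h"
  shows "Ck k (\<lambda>x. h (x \<bullet> v))"
  using assms
proof (induction k arbitrary: h)
  case 0
  then have "continuous_on UNIV (h \<circ> (\<lambda>x. x \<bullet> v))"
    by (intro continuous_on_compose continuous_intros) (auto intro: continuous_on_subset)
  then show ?case by (simp add: o_def)
next
  case (Suc k)
  show ?case
  proof (rule Ck_SucI)
    show "((\<lambda>x. h (x \<bullet> v)) has_derivative (\<lambda>d. (d \<bullet> v) * frechet_derivative h (at (x \<bullet> v)) 1)) (at x)" for x
    proof -
      have lin: "linear (frechet_derivative h (at (x \<bullet> v)))"
        using Ck_SucD(1)[OF Suc.prems] has_derivative_linear by blast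
      have "((\<lambda>x. x \<bullet> v) has_derivative (\<lambda>d. d \<bullet> v)) (at x)" by (auto intro!: derivative_eq_intros)
      moreover have "frechet_derivative h (at (x \<bullet> v)) (d \<bullet> v) = (d \<bullet> v) * frechet_derivative h (at (x \<bullet> v)) 1" for d
        using linear_scale[OF lin, of "d \<bullet> v" 1] by simp
      ultimately show ?thesis
        using has_derivative_compose[of "\<lambda>x. x \<bullet> v" "\<lambda>d. d \<bullet> v" x UNIV h, OF _ Ck_SucD(1)[OF Suc.prems]]
        by (simp only:)
    qed
    fix e :: 'a
    show "Ck k (\<lambda>x. (e \<bullet> v) * frechet_derivative h (at (x \<bullet> v)) 1)"
      by (rule Ck_mult[OF Ck_const Suc.IH[OF Ck_SucD(2)[OF Suc.prems, of 1]]]) simp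
  qed
qed

lemma Ck_ident: "Ck k (\<lambda>x::real. x)"
proof (cases k)
  case (Suc n)
  show ?thesis unfolding Suc by (rule Ck_SucI[OF has_derivative_ident]) (simp add: Ck_const)
qed simp

lemma Ck_realI:
  assumes "\<And>t::real. (f has_real_derivative f' t) (at t)" "Ck k f'"
  shows "Ck (Suc k) f"
  by (rule Ck_SucI[OF assms(1)[unfolded has_field_derivative_def]]) (use assms(2) in simp)

subsection \<open>A smooth cutoff\<close>

text \<open>The powers of \<open>1 / t\<close> make the family closed under differentiation up to
  linear combinations, so that smoothness of all members is a single induction.\<close>

definition flat_exp :: "nat \<Rightarrow> real \<Rightarrow> real" where
  "flat_exp n t = (if 0 < t then (1 / t) ^ n * exp (- (1 / t)) else 0)"

lemma flat_exp_at_0: "(flat_exp n \<longlongrightarrow> 0) (at 0)"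
proof -
  have "((\<lambda>s::real. s ^ n / exp s) \<longlongrightarrow> 0) at_top" by (rule tendsto_power_div_exp_0)
  then have "((\<lambda>t::real. inverse t ^ n / exp (inverse t)) \<longlongrightarrow> 0) (at_right 0)"
    by (rule filterlim_compose[OF _ filterlim_inverse_at_top_right])
  moreover have "\<forall>\<^sub>F t in at_right 0. inverse t ^ n / exp (inverse t) = flat_exp n t"
    by (auto simp: eventually_at_right_field flat_exp_def exp_minus field_simps intro!: exI[of _ 1])
  ultimately have "(flat_exp n \<longlongrightarrow> 0) (at_right 0)" by (rule Lim_transform_eventually)
  moreover have "(flat_exp n \<longlongrightarrow> 0) (at_left 0)"
    by (rule Lim_transform_eventually[OF tendsto_const])
      (auto simp: eventually_at_left_field flat_exp_def intro!: exI[of _ "-1"])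
  ultimately show ?thesis by (simp add: filterlim_split_at_real)
qed

lemma flat_exp_deriv:
  "(flat_exp n has_real_derivative (flat_exp (n + 2) t - real n * flat_exp (n + 1) t)) (at t)"
proof -
  consider "t < 0" | "t = 0" | "t > 0" by linarith
  then show ?thesis
  proof cases
    case 1
    have "(flat_exp n has_real_derivative 0) (at t)"
      by (rule has_field_derivative_transform_within_open[OF DERIV_const, of "{..<0}"])
        (use 1 in \<open>auto simp: flat_exp_def\<close>)
    then show ?thesis using 1 by (simp add: flat_exp_def)
  next
    case 2
    \<comment> \<open>Away from 0 the difference quotient at 0 is the next member
      \<open>flat_exp (n + 1)\<close>, which tends to 0 as well.\<close>
    have "((\<lambda>h. flat_exp n h / h) \<longlongrightarrow> 0) (at 0)"
      by (rule Lim_transform_eventually[OF flat_exp_at_0[of "n + 1"]])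
        (auto simp: eventually_at_filter flat_exp_def)
    then have "(flat_exp n has_real_derivative 0) (at 0)"
      by (simp add: DERIV_def flat_exp_def[of n 0])
    then show ?thesis using 2 by (simp add: flat_exp_def)
  next
    case 3
    have "((\<lambda>t. (1 / t) ^ n * exp (- (1 / t))) has_real_derivative
        (flat_exp (n + 2) t - real n * flat_exp (n + 1) t)) (at t)"
    proof (cases n)
      case 0
      show ?thesis unfolding 0 using 3
        by (auto intro!: derivative_eq_intros simp: flat_exp_def power2_eq_square field_simps)
    next
      case (Suc m)
      have inv: "((\<lambda>t. 1 / t) has_real_derivative - ((1 / t) * (1 / t))) (at t)"
        using 3 by (auto intro!: derivative_eq_intros simp: field_simps)
      have ex: "((\<lambda>t. exp (- (1 / t))) has_real_derivative exp (- (1 / t)) * (1 / t * (1 / t))) (at t)"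
        using 3 by (auto intro!: derivative_eq_intros simp: field_simps)
      show ?thesis unfolding Suc
        by (rule DERIV_cong[OF DERIV_mult[OF DERIV_power_Suc[OF inv] ex]])
          (use 3 in \<open>simp add: flat_exp_def algebra_simps\<close>)
    qed
    then show ?thesis
      by (rule has_field_derivative_transform_within_open[of _ _ _ "{0<..}"])
        (use 3 in \<open>auto simp: flat_exp_def\<close>)
  qed
qed

lemma Ck_flat_exp: "Ck k (flat_exp n)"
proof (induction k arbitrary: n)
  case 0
  show ?case
    by (auto simp: continuous_on_eq_continuous_at intro: DERIV_isCont[OF flat_exp_deriv])
next
  case (Suc k)
  show ?case
    by (rule Ck_realI[OF flat_exp_deriv]) (intro Ck_diff Ck_mult Ck_const Suc.IH)
qed

text \<open>The denominator is positive because at least one of \<open>t\<close> and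
  \<open>1 - t\<close> is; the quotient is 0 up to 0 and 1 from 1 on.\<close>

definition smooth_step :: "real \<Rightarrow> real" where
  "smooth_step t = flat_exp 0 t * inverse (flat_exp 0 t + flat_exp 0 (1 - t))"

lemma flat_exp_bounds: "0 \<le> flat_exp 0 t" "flat_exp 0 t \<le> 1"
  by (auto simp: flat_exp_def)

lemma smooth_step_denominator: "flat_exp 0 t + flat_exp 0 (1 - t) > 0"
  by (cases "t > 0") (auto simp: flat_exp_def intro: add_pos_nonneg)

lemma smooth_step_bounds: "0 \<le> smooth_step t" "smooth_step t \<le> 1"
  using smooth_step_denominator[of t] flat_exp_bounds[of t] flat_exp_bounds[of "1 - t"]
  by (auto simp: smooth_step_def field_simps)

lemma smooth_step_eq: "t \<le> 0 \<Longrightarrow> smooth_step t = 0" "1 \<le> t \<Longrightarrow> smooth_step t = 1"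
  by (auto simp: smooth_step_def flat_exp_def)

lemma Ck_smooth_step: "Ck k smooth_step"
proof -
  have "Ck k (\<lambda>t. flat_exp 0 (1 - t))" using Ck_affine[OF Ck_flat_exp, of k 0 "-1" 1] by simp
  moreover have "flat_exp 0 t + flat_exp 0 (1 - t) \<noteq> 0" for t using smooth_step_denominator[of t] by simp
  ultimately show ?thesis unfolding smooth_step_def[abs_def]
    by (intro Ck_mult Ck_inverse Ck_add Ck_flat_exp)
qed

text \<open>Equal to 1 where all coordinates are at most 1 in modulus, and to 0 once some coordinate
  reaches 2. Working with cubes makes it a finite product of functions of one coordinate, to which
  \<open>Ck_real_inner\<close> applies.\<close>

definition plateau :: "'a::euclidean_space \<Rightarrow> real" where
  "plateau x = (\<Prod>e\<in>Basis. smooth_step (2 - x \<bullet> e) * smooth_step (2 + x \<bullet> e))"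

lemma Ck_plateau: "Ck k plateau"
proof -
  have "Ck k (\<lambda>t. smooth_step (2 - t))" "Ck k (\<lambda>t. smooth_step (2 + t))"
    using Ck_affine[OF Ck_smooth_step, of k "-1" 2] Ck_affine[OF Ck_smooth_step, of k 1 2]
    by (simp_all add: add.commute)
  then show ?thesis unfolding plateau_def[abs_def]
    by (intro Ck_prod Ck_mult Ck_real_inner[of k "\<lambda>t. smooth_step (2 - t)"] Ck_real_inner[of k "\<lambda>t. smooth_step (2 + t)"])
qed

lemma plateau_bounds: "0 \<le> plateau x" "plateau x \<le> 1"
  unfolding plateau_def
  by (auto intro!: prod_nonneg prod_le_1 mult_le_one mult_nonneg_nonneg smooth_step_bounds)

lemma plateau_eq_1: "(\<And>e. e \<in> Basis \<Longrightarrow> \<bar>x \<bullet> e\<bar> \<le> 1) \<Longrightarrow> plateau x = 1"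
  unfolding plateau_def
proof (rule prod.neutral, intro ballI)
  fix e :: 'a assume "\<And>e. e \<in> Basis \<Longrightarrow> \<bar>x \<bullet> e\<bar> \<le> 1" "e \<in> Basis"
  then have "\<bar>x \<bullet> e\<bar> \<le> 1" by blast
  then have "1 \<le> 2 - x \<bullet> e" "1 \<le> 2 + x \<bullet> e" by linarith+
  then show "smooth_step (2 - x \<bullet> e) * smooth_step (2 + x \<bullet> e) = 1" by (simp add: smooth_step_eq)
qed

lemma plateau_eq_0: "e \<in> Basis \<Longrightarrow> 2 \<le> \<bar>x \<bullet> e\<bar> \<Longrightarrow> plateau x = 0"
proof -
  assume e: "e \<in> Basis" "2 \<le> \<bar>x \<bullet> e\<bar>"
  then have "2 - x \<bullet> e \<le> 0 \<or> 2 + x \<bullet> e \<le> 0" by linarith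
  then have "smooth_step (2 - x \<bullet> e) * smooth_step (2 + x \<bullet> e) = 0" by (auto simp: smooth_step_eq)
  then show ?thesis unfolding plateau_def by (rule prod_zero[OF finite_Basis bexI[OF _ e(1)]])
qed

section \<open>Test functions\<close>

lemma open_sets_lebesgue: "open S \<Longrightarrow> S \<in> sets lebesgue"
  using borel_open sets_completionI_sets sets_lborel by metis

lemma measurable_lebesgue_on_continuous:
  fixes f :: "'a::euclidean_space \<Rightarrow> 'b::euclidean_space"
  shows "continuous_on UNIV f \<Longrightarrow> f \<in> borel_measurable (lebesgue_on S)"
  by (intro measurable_restrict_space1 measurable_completion) (simp add: borel_measurable_continuous_onI)

lemma bounded_of_compact_support:
  fixes f :: "'a::euclidean_space \<Rightarrow> real"
  assumes "continuous_on UNIV f" "compact K" "\<And>x. x \<notin> K \<Longrightarrow> f x = 0"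
  obtains M where "0 \<le> M" "\<And>x. \<bar>f x\<bar> \<le> M"
proof -
  have "compact (f ` K)" using assms(1,2) by (intro compact_continuous_image) (auto intro: continuous_on_subset)
  then obtain M where M: "\<And>y. y \<in> f ` K \<Longrightarrow> norm y \<le> M" using compact_imp_bounded bounded_iff by metis
  show ?thesis
  proof (rule that[of "max M 0"])
    show "\<bar>f x\<bar> \<le> max M 0" for x
    proof (cases "x \<in> K")
      case True
      then have "norm (f x) \<le> M" by (intro M imageI)
      then show ?thesis by simp
    qed (simp add: assms(3))
  qed simp
qed

lemma L2_bounded:
  fixes f :: "'a::euclidean_space \<Rightarrow> complex"
  assumes S: "S \<in> sets lebesgue" and f: "f \<in> borel_measurable (lebesgue_on S)"
    and K: "K \<in> lmeasurable" and M: "\<And>x. x \<in> S \<Longrightarrow> x \<in> K \<Longrightarrow> cmod (f x) \<le> M"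
    and z: "\<And>x. x \<in> S \<Longrightarrow> x \<notin> K \<Longrightarrow> f x = 0"
  shows "f \<in> L2 S"
proof (rule L2_bound[OF f])
  have "S \<inter> K \<in> sets lebesgue" "emeasure lebesgue (S \<inter> K) < \<infinity>"
    using K S emeasure_mono[of "S \<inter> K" K lebesgue] by (auto simp: fmeasurable_def)
  then have "integrable lebesgue (\<lambda>x. indicator (S \<inter> K) x * M\<^sup>2 :: real)"
    by (intro integrable_mult_left integrable_real_indicator)
  also have "(\<lambda>x. indicator (S \<inter> K) x * M\<^sup>2 :: real) = (\<lambda>x. if x \<in> S then indicator K x * M\<^sup>2 else 0)"
    by (auto simp: indicator_def)
  finally show "integrable (lebesgue_on S) (\<lambda>x. indicator K x * M\<^sup>2)"
    unfolding integrable_cut[OF S] .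
  show "AE x in lebesgue_on S. (cmod (f x))\<^sup>2 \<le> indicator K x * M\<^sup>2"
  proof (rule AE_I2)
    fix x assume "x \<in> space (lebesgue_on S)"
    then have "x \<in> S" by simp
    then show "(cmod (f x))\<^sup>2 \<le> indicator K x * M\<^sup>2"
      using power_mono[OF M[of x] norm_ge_zero, of 2] z[of x] by (cases "x \<in> K") auto
  qed
qed

lemma test_functionI:
  "(\<And>k. Ck k \<phi>) \<Longrightarrow> compact K \<Longrightarrow> K \<subseteq> S \<Longrightarrow> (\<And>x. x \<notin> K \<Longrightarrow> \<phi> x = 0) \<Longrightarrow> test_function S \<phi>"
  unfolding test_function_def by blast

lemma test_functionD:
  assumes "test_function S \<phi>"
  shows "Ck k \<phi>" "continuous_on UNIV \<phi>" "e \<in> Basis \<Longrightarrow> continuous_on UNIV (\<lambda>x. frechet_derivative \<phi> (at x) e)"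
    "(\<phi> has_derivative frechet_derivative \<phi> (at x)) (at x)"
proof -
  have C: "Ck k \<phi>" for k using assms by (simp add: test_function_def)
  show "Ck k \<phi>" by (rule C)
  show "continuous_on UNIV \<phi>" by (rule Ck_continuous[OF C])
  show "e \<in> Basis \<Longrightarrow> continuous_on UNIV (\<lambda>x. frechet_derivative \<phi> (at x) e)"
    using Ck_SucD(2)[OF C[of "Suc 0"]] Ck_continuous by blast
  show "(\<phi> has_derivative frechet_derivative \<phi> (at x)) (at x)"
    by (rule Ck_SucD(1)[OF C[of "Suc 0"]])
qed

lemma frechet_derivative_0_outside:
  assumes "closed K" "\<And>x. x \<notin> K \<Longrightarrow> f x = (0::real)" "x \<notin> K"
  shows "frechet_derivative f (at x) e = 0"
proof (rule frechet_derivative_eqI[of f "\<lambda>_. 0"])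
  show "(f has_derivative (\<lambda>_. 0)) (at x)"
    by (rule has_derivative_transform_within_open[OF has_derivative_const, of "- K"])
      (use assms in auto)
qed

lemma test_function_in_L2:
  assumes S: "S \<in> sets lebesgue" and \<phi>: "test_function \<Omega> \<phi>"
  shows "(\<lambda>x. complex_of_real (\<phi> x)) \<in> L2 S"
    "e \<in> Basis \<Longrightarrow> (\<lambda>x. complex_of_real (frechet_derivative \<phi> (at x) e)) \<in> L2 S"
proof -
  obtain K where K: "compact K" "\<And>x. x \<notin> K \<Longrightarrow> \<phi> x = 0" using \<phi> by (auto simp: test_function_def)
  have Kl: "K \<in> lmeasurable" using K(1) by (rule lmeasurable_compact)
  have main: "(\<lambda>x. complex_of_real (f x)) \<in> L2 S" if f: "continuous_on UNIV f" "\<And>x. x \<notin> K \<Longrightarrow> f x = 0" for f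
  proof -
    obtain M where M: "0 \<le> M" "\<And>x. \<bar>f x\<bar> \<le> M" using bounded_of_compact_support[OF f(1) K(1) f(2)] by blast
    show ?thesis
    proof (rule L2_bounded[OF S _ Kl])
      show "(\<lambda>x. complex_of_real (f x)) \<in> borel_measurable (lebesgue_on S)"
        by (intro measurable_lebesgue_on_continuous continuous_on_of_real f)
    qed (use M f(2) in auto)
  qed
  show "(\<lambda>x. complex_of_real (\<phi> x)) \<in> L2 S" by (rule main[OF test_functionD(2)[OF \<phi>] K(2)])
  show "e \<in> Basis \<Longrightarrow> (\<lambda>x. complex_of_real (frechet_derivative \<phi> (at x) e)) \<in> L2 S"
    by (rule main[OF test_functionD(3)[OF \<phi>] frechet_derivative_0_outside[OF compact_imp_closed[OF K(1)] K(2)]])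
qed

lemma integral_scaleR_eq_L2_inner:
  "(\<integral>x. f x *\<^sub>R u x \<partial>lebesgue_on S) = L2_inner S u (\<lambda>x. complex_of_real (f x))"
  unfolding L2_inner_def by (simp add: scaleR_conv_of_real mult.commute)

lemma has_weak_derivative_iff:
  "has_weak_derivative S e u g \<longleftrightarrow> (\<forall>\<phi>. test_function S \<phi> \<longrightarrow>
     L2_inner S u (\<lambda>x. complex_of_real (frechet_derivative \<phi> (at x) e)) = - L2_inner S g (\<lambda>x. complex_of_real (\<phi> x)))"
  unfolding has_weak_derivative_def integral_scaleR_eq_L2_inner ..

lemma test_function_mult:
  assumes \<phi>: "test_function \<Omega> \<phi>" and \<psi>: "\<And>k. Ck k \<psi>"
  shows "test_function \<Omega> (\<lambda>x. \<psi> x * \<phi> x)"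
proof -
  obtain K where "compact K" "K \<subseteq> \<Omega>" "\<And>x. x \<notin> K \<Longrightarrow> \<phi> x = 0"
    using \<phi> unfolding test_function_def by blast
  moreover from this(3) have "x \<notin> K \<Longrightarrow> \<psi> x * \<phi> x = 0" for x by simp
  moreover have "Ck k (\<lambda>x. \<psi> x * \<phi> x)" for k
    using \<phi> \<psi> unfolding test_function_def by (intro Ck_mult) auto
  ultimately show ?thesis by (intro test_functionI)
qed

lemma frechet_derivative_mult_smooth:
  assumes "Ck (Suc 0) f" "Ck (Suc 0) g"
  shows "frechet_derivative (\<lambda>x. f x * g x) (at x) e = f x * frechet_derivative g (at x) e + frechet_derivative f (at x) e * g x"
  by (rule frechet_derivative_eqI[OF has_derivative_mult[OF Ck_SucD(1)[OF assms(1)] Ck_SucD(1)[OF assms(2)]]])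

subsection \<open>The fundamental lemma of the calculus of variations\<close>

text \<open>Supported in the closed box and, as \<open>n\<close> grows, converging boundedly to the
  indicator of the open box; this lets statements about test functions pass to boxes.\<close>

lemma box_test_function:
  fixes a b :: "'a::euclidean_space"
  assumes "cbox a b \<subseteq> S"
  shows "test_function S (\<lambda>x. \<Prod>e\<in>Basis. flat_exp 0 (real n * ((x - a) \<bullet> e)) * flat_exp 0 (real n * ((b - x) \<bullet> e)))"
    (is "test_function S ?\<phi>")
proof -
  have "Ck k (\<lambda>x. flat_exp 0 (real n * ((x - a) \<bullet> e)))" "Ck k (\<lambda>x. flat_exp 0 (real n * ((b - x) \<bullet> e)))" for k e
  proof -
    have "Ck k (\<lambda>t. flat_exp 0 (real n *\<^sub>R t + (- real n * (a \<bullet> e))))"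
      "Ck k (\<lambda>t. flat_exp 0 ((- real n) *\<^sub>R t + real n * (b \<bullet> e)))"
      by (rule Ck_affine[OF Ck_flat_exp])+
    from this[THEN Ck_real_inner, of e]
    show "Ck k (\<lambda>x. flat_exp 0 (real n * ((x - a) \<bullet> e)))" "Ck k (\<lambda>x. flat_exp 0 (real n * ((b - x) \<bullet> e)))"
      by (simp_all add: inner_diff_left right_diff_distrib)
  qed
  then have "Ck k ?\<phi>" for k by (intro Ck_prod Ck_mult)
  then show ?thesis
  proof (rule test_functionI[OF _ compact_cbox assms])
    show "?\<phi> x = 0" if "x \<notin> cbox a b" for x
  proof -
    have "\<exists>e\<in>Basis. \<not> (a \<bullet> e \<le> x \<bullet> e \<and> x \<bullet> e \<le> b \<bullet> e)" using that unfolding mem_box by blast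
    then obtain e where e: "e \<in> Basis" "x \<bullet> e < a \<bullet> e \<or> b \<bullet> e < x \<bullet> e" unfolding de_Morgan_conj not_le by blast
    then have "real n * ((x - a) \<bullet> e) \<le> 0 \<or> real n * ((b - x) \<bullet> e) \<le> 0"
      by (auto simp: inner_diff_left intro: mult_nonneg_nonpos)
    then have "flat_exp 0 (real n * ((x - a) \<bullet> e)) * flat_exp 0 (real n * ((b - x) \<bullet> e)) = 0"
      by (auto simp: flat_exp_def)
    then show ?thesis by (rule prod_zero[OF finite_Basis bexI[OF _ e(1)]])
  qed
  qed
qed

lemma box_test_function_bounds:
  "\<bar>\<Prod>e\<in>Basis. flat_exp 0 (real n * ((x - a) \<bullet> e)) * flat_exp 0 (real n * ((b - x) \<bullet> e))\<bar> \<le> 1"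
proof -
  have "0 \<le> (\<Prod>e\<in>Basis. flat_exp 0 (real n * ((x - a) \<bullet> e)) * flat_exp 0 (real n * ((b - x) \<bullet> e)))"
    by (intro prod_nonneg mult_nonneg_nonneg flat_exp_bounds ballI)
  moreover have "(\<Prod>e\<in>Basis. flat_exp 0 (real n * ((x - a) \<bullet> e)) * flat_exp 0 (real n * ((b - x) \<bullet> e))) \<le> 1"
    by (intro prod_le_1 conjI mult_le_one mult_nonneg_nonneg flat_exp_bounds)
  ultimately show ?thesis by linarith
qed

lemma flat_exp_scaled_tendsto: "(\<lambda>n. flat_exp 0 (real n * t)) \<longlonglongrightarrow> (if 0 < t then 1 else 0)"
proof (cases "0 < t")
  case True
  have "(\<lambda>n. exp (- (1 / real (Suc n) * (1 / t)))) \<longlonglongrightarrow> exp (- (0 * (1 / t)))"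
    by (intro tendsto_intros LIMSEQ_Suc[OF lim_1_over_n])
  then have "(\<lambda>n. flat_exp 0 (real (Suc n) * t)) \<longlonglongrightarrow> 1" using True by (simp add: flat_exp_def)
  then have "(\<lambda>n. flat_exp 0 (real n * t)) \<longlonglongrightarrow> 1" by (rule LIMSEQ_imp_Suc)
  then show ?thesis using True by simp
next
  case False
  then have "flat_exp 0 (real n * t) = 0" for n
    by (auto simp: flat_exp_def not_less mult_nonneg_nonpos)
  then show ?thesis using False by simp
qed

lemma box_test_function_tendsto:
  fixes a b :: "'a::euclidean_space"
  shows "(\<lambda>n. \<Prod>e\<in>Basis. flat_exp 0 (real n * ((x - a) \<bullet> e)) * flat_exp 0 (real n * ((b - x) \<bullet> e)))
    \<longlonglongrightarrow> indicator (box a b) x"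
proof -
  have "(\<lambda>n. \<Prod>e\<in>Basis. flat_exp 0 (real n * ((x - a) \<bullet> e)) * flat_exp 0 (real n * ((b - x) \<bullet> e)))
    \<longlonglongrightarrow> (\<Prod>e\<in>Basis. (if 0 < (x - a) \<bullet> e then 1 else 0) * (if 0 < (b - x) \<bullet> e then 1 else 0))"
    by (intro tendsto_prod tendsto_mult flat_exp_scaled_tendsto)
  also have "(\<Prod>e\<in>Basis. (if 0 < (x - a) \<bullet> e then 1 else 0) * (if 0 < (b - x) \<bullet> e then 1 else 0)) = (indicator (box a b) x :: real)"
  proof (cases "x \<in> box a b")
    case True
    then show ?thesis by (auto simp: mem_box inner_diff_left intro!: prod.neutral)
  next
    case False
    then obtain e where e: "e \<in> Basis" "\<not> (a \<bullet> e < x \<bullet> e \<and> x \<bullet> e < b \<bullet> e)" by (auto simp: mem_box)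
    have "(\<Prod>e\<in>Basis. (if 0 < (x - a) \<bullet> e then 1 else 0) * (if 0 < (b - x) \<bullet> e then 1 else 0)) = (0::real)"
      by (rule prod_zero[OF finite_Basis bexI[OF _ e(1)]]) (use e(2) in \<open>auto simp: inner_diff_left\<close>)
    then show ?thesis using False by simp
  qed
  finally show ?thesis .
qed

text \<open>Boxes generate the Borel sets and are stable under intersection, so the vanishing of the
  integrals spreads to all Borel sets; a density with that property is zero almost
  everywhere.\<close>

lemma AE_zero_of_box_integrals:
  fixes h :: "'a::euclidean_space \<Rightarrow> real"
  assumes h: "integrable lebesgue h" and box: "\<And>a b. (\<integral>x. indicator (box a b) x * h x \<partial>lebesgue) = 0"
  shows "AE x in lebesgue. h x = 0"
proof -
  \<comment> \<open>A Borel representative is taken because the generator argument takes place in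
    the Borel sigma-algebra.\<close>
  obtain h' where h': "h' \<in> borel_measurable lborel" "AE x in lborel. h x = h' x"
    using completion_ex_borel_measurable_real[of h lborel] h by auto
  have AE: "AE x in lebesgue. h x = h' x" using h'(2) by (rule AE_completion)
  have h'l: "h' \<in> borel_measurable lebesgue" using h'(1) by (rule measurable_completion)
  have int: "integrable lebesgue h'"
    using h integrable_cong_AE[OF _ h'l AE] by auto
  then have int': "integrable lborel h'" using h'(1) by (simp add: integrable_completion)
  have set_int: "set_integrable lborel A h'" if "A \<in> sets borel" for A
    unfolding set_integrable_def using that int' by (intro integrable_mult_indicator) auto
  have box': "set_lebesgue_integral lborel (box a b) h' = 0" for a b
  proof -
    have "set_lebesgue_integral lborel (box a b) h' = (\<integral>x. indicator (box a b) x * h' x \<partial>lebesgue)"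
      unfolding set_lebesgue_integral_def real_scaleR_def
      by (rule integral_completion[symmetric]) (use h'(1) in measurable)
    also have "\<dots> = (\<integral>x. indicator (box a b) x * h x \<partial>lebesgue)"
    proof (rule integral_cong_AE)
      show "AE x in lebesgue. indicator (box a b) x * h' x = indicator (box a b) x * h x"
        using AE by eventually_elim simp
      have "box a b \<in> sets lebesgue" by (simp add: open_sets_lebesgue)
      then show "(\<lambda>x. indicator (box a b) x * h' x) \<in> borel_measurable lebesgue"
        "(\<lambda>x. indicator (box a b) x * h x) \<in> borel_measurable lebesgue"
        using h h'l by (auto intro!: borel_measurable_times borel_measurable_indicator)
    qed
    finally show ?thesis using box by simp
  qed
  have zero: "set_lebesgue_integral lborel A h' = 0 \<and> A \<in> sets borel"
    if "A \<in> sigma_sets UNIV (range (\<lambda>(a, b). box a b :: 'a set))" for A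
  proof -
    have "Int_stable (range (\<lambda>(a, b). box a b :: 'a set))" by (auto simp: Int_stable_def box_Int_box)
    moreover have "range (\<lambda>(a, b). box a b :: 'a set) \<subseteq> Pow UNIV" by auto
    ultimately show ?thesis using that
    proof (induction rule: sigma_sets_induct_disjoint)
      case (basic A)
      then show ?case using box' by auto
    next
      case empty
      show ?case by (simp add: set_lebesgue_integral_def)
    next
      case (compl A)
      have A: "A \<in> sets borel" "set_lebesgue_integral lborel A h' = 0" using compl by auto
      \<comment> \<open>Complements call for the integral over the whole space, which is the limit
        of integrals over growing boxes.\<close>
      have "incseq (\<lambda>n. box (- (real n *\<^sub>R One)) (real n *\<^sub>R One :: 'a))"
        by (auto simp: incseq_def intro!: subset_box_imp)
      moreover have "(\<Union>n. box (- (real n *\<^sub>R One)) (real n *\<^sub>R One)) = (UNIV :: 'a set)"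
        by (rule UN_box_eq_UNIV)
      ultimately have "(\<lambda>n. set_lebesgue_integral lborel (box (- (real n *\<^sub>R One)) (real n *\<^sub>R One :: 'a)) h')
          \<longlonglongrightarrow> set_lebesgue_integral lborel UNIV h'"
        using set_integral_cont_up[of "\<lambda>n. box (- (real n *\<^sub>R One)) (real n *\<^sub>R One :: 'a)" lborel h'] set_int[of UNIV]
        by simp
      then have U: "set_lebesgue_integral lborel UNIV h' = 0"
        unfolding box' by (simp add: LIMSEQ_const_iff)
      have "set_lebesgue_integral lborel (A \<union> (UNIV - A)) h'
          = set_lebesgue_integral lborel A h' + set_lebesgue_integral lborel (UNIV - A) h'"
        using A by (intro set_integral_Un set_int) auto
      then show ?case using U A by simp
    next
      case (union A)
      have "set_lebesgue_integral lborel (\<Union>i. A i) h' = (\<Sum>i. set_lebesgue_integral lborel (A i) h')"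
        using union by (intro lebesgue_integral_countable_add set_int) (auto simp: disjoint_family_on_def)
      then show ?case using union by auto
    qed
  qed
  have "AE x in lborel. h' x = 0"
    by (rule sigma_finite_measure.density_zero[OF sigma_finite_lborel int']) (use zero in \<open>auto simp: borel_eq_box\<close>)
  then have "AE x in lebesgue. h' x = 0" by (rule AE_completion)
  with AE show ?thesis by eventually_elim simp
qed

lemma L2_integrable_bounded_set:
  assumes S: "S \<in> sets lebesgue" and K: "K \<in> lmeasurable" "K \<subseteq> S" and u: "u \<in> L2 S"
  shows "integrable lebesgue (\<lambda>x. indicator K x *\<^sub>R u x)"
proof -
  have KS: "K \<in> sets lebesgue" using K(1) by (simp add: fmeasurable_def)
  have uK: "u \<in> L2 K" by (rule L2_subset[OF KS S K(2) u])
  have "(\<lambda>x. 1) \<in> L2 K" by (rule L2_bounded[OF KS _ K(1), of _ 1]) auto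
  from L2_integrable_mult[OF uK this] have "integrable (lebesgue_on K) u" by simp
  then show ?thesis using integrable_restrict_space[of K lebesgue u] KS by simp
qed

text \<open>Dominated convergence along the box test functions gives zero integrals over open boxes
  whose closed box lies in \<open>S\<close>. On each such box the function therefore vanishes almost
  everywhere, and countably many closed boxes cover \<open>S\<close>.\<close>

lemma fundamental_lemma_real:
  fixes f :: "'a::euclidean_space \<Rightarrow> real"
  assumes S: "open S" and u: "(\<lambda>x. complex_of_real (f x)) \<in> L2 S"
    and zero: "\<And>\<phi>. test_function S \<phi> \<Longrightarrow> (\<integral>x. \<phi> x * f x \<partial>lebesgue_on S) = 0"
  shows "AE x in lebesgue_on S. f x = 0"
proof -
  have Sl: "S \<in> sets lebesgue" by (rule open_sets_lebesgue[OF S])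
  have int: "integrable lebesgue (\<lambda>x. indicator K x * f x)" if "K \<in> lmeasurable" "K \<subseteq> S" for K
    using integrable_Re[OF L2_integrable_bounded_set[OF Sl that u]] by simp
  have box: "(\<integral>x. indicator (box a b) x * f x \<partial>lebesgue) = 0" if ab: "cbox a b \<subseteq> S" for a b
  proof -
    let ?\<phi> = "\<lambda>n x. \<Prod>e\<in>Basis. flat_exp 0 (real n * ((x - a) \<bullet> e)) * flat_exp 0 (real n * ((b - x) \<bullet> e))"
    have t: "test_function S (?\<phi> n)" for n by (rule box_test_function[OF ab])
    have z: "?\<phi> n x = 0" if x: "x \<notin> box a b" for n x
    proof -
      obtain e where e: "e \<in> Basis" "x \<bullet> e \<le> a \<bullet> e \<or> b \<bullet> e \<le> x \<bullet> e"
        using x unfolding mem_box by (metis not_le)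
      have "real n * ((x - a) \<bullet> e) \<le> 0 \<or> real n * ((b - x) \<bullet> e) \<le> 0"
        using e(2) by (auto simp: inner_diff_left intro: mult_nonneg_nonpos)
      then have "flat_exp 0 (real n * ((x - a) \<bullet> e)) * flat_exp 0 (real n * ((b - x) \<bullet> e)) = 0"
        by (auto simp: flat_exp_def)
      then show ?thesis by (rule prod_zero[OF finite_Basis bexI[OF _ e(1)]])
    qed
    have bS: "x \<in> S" if "x \<in> box a b" for x using that ab box_subset_cbox by blast
    let ?w = "\<lambda>x. indicator (box a b) x * f x"
    have w: "integrable lebesgue ?w" using bS by (intro int) auto
    have wm: "?w \<in> borel_measurable lebesgue" by (rule borel_measurable_integrable[OF w])
    have eq: "?\<phi> n x * ?w x = (if x \<in> S then ?\<phi> n x * f x else 0)" for n x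
      using z[of x n] bS[of x] by (cases "x \<in> box a b") auto
    have "(\<lambda>n. \<integral>x. ?\<phi> n x * ?w x \<partial>lebesgue) \<longlonglongrightarrow> (\<integral>x. indicator (box a b) x * ?w x \<partial>lebesgue)"
    proof (rule integral_dominated_convergence[where w="\<lambda>x. \<bar>?w x\<bar>"])
      show "integrable lebesgue (\<lambda>x. \<bar>?w x\<bar>)" using w by (rule integrable_abs)
      show "(\<lambda>x. indicator (box a b) x * ?w x) \<in> borel_measurable lebesgue"
        by (rule borel_measurable_times[OF borel_measurable_indicator wm]) (simp add: open_sets_lebesgue)
      show "(\<lambda>x. ?\<phi> n x * ?w x) \<in> borel_measurable lebesgue" for n
        using measurable_lebesgue_on_continuous[OF test_functionD(2)[OF t[of n]], of UNIV]
        by (intro borel_measurable_times[OF _ wm]) (simp add: lebesgue_on_UNIV)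
      show "AE x in lebesgue. (\<lambda>n. ?\<phi> n x * ?w x) \<longlonglongrightarrow> indicator (box a b) x * ?w x"
        by (intro AE_I2 tendsto_mult box_test_function_tendsto tendsto_const)
      show "AE x in lebesgue. norm (?\<phi> n x * ?w x) \<le> \<bar>?w x\<bar>" for n
        using box_test_function_bounds[of n _ a b]
        by (intro AE_I2) (simp only: real_norm_def abs_mult, intro mult_left_le_one_le, auto)
    qed
    moreover have "(\<integral>x. ?\<phi> n x * ?w x \<partial>lebesgue) = 0" for n
      unfolding eq integral_cut[OF Sl] by (rule zero[OF t])
    moreover have "indicator (box a b) x * ?w x = ?w x" for x by (simp add: indicator_def)
    ultimately have "(\<lambda>n::nat. 0) \<longlonglongrightarrow> (\<integral>x. ?w x \<partial>lebesgue)" by (simp only:)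
    then show ?thesis by (rule LIMSEQ_unique[OF _ tendsto_const])
  qed
  have loc: "AE x in lebesgue. x \<in> cbox a b \<longrightarrow> f x = 0" if ab: "cbox a b \<subseteq> S" for a b
  proof -
    have "AE x in lebesgue. indicator (box a b) x * f x = 0"
    proof (rule AE_zero_of_box_integrals)
      show "integrable lebesgue (\<lambda>x. indicator (box a b) x * f x)"
        using ab box_subset_cbox by (intro int) (auto intro: subset_trans)
      fix c d
      \<comment> \<open>The intersection with another box is again a box; when nonempty, its closed
        box stays inside \<open>cbox a b\<close> and hence inside \<open>S\<close>.\<close>
      define m M where "m = (\<Sum>i\<in>Basis. max (a \<bullet> i) (c \<bullet> i) *\<^sub>R i)" and "M = (\<Sum>i\<in>Basis. min (b \<bullet> i) (d \<bullet> i) *\<^sub>R i)"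
      have eq: "box a b \<inter> box c d = box m M" by (simp add: box_Int_box m_def M_def)
      have "(\<integral>x. indicator (box c d) x * (indicator (box a b) x * f x) \<partial>lebesgue) = (\<integral>x. indicator (box m M) x * f x \<partial>lebesgue)"
        unfolding eq[symmetric] by (intro Bochner_Integration.integral_cong) (auto simp: indicator_def)
      also have "\<dots> = 0"
      proof (cases "box m M = {}")
        case False
        have "box m M \<subseteq> cbox a b" using eq box_subset_cbox by blast
        then have "cbox m M \<subseteq> cbox a b" using False by (metis closed_cbox closure_box closure_minimal)
        then show ?thesis using ab by (intro box) blast
      qed simp
      finally show "(\<integral>x. indicator (box c d) x * (indicator (box a b) x * f x) \<partial>lebesgue) = 0" .
    qed
    moreover have "AE x in lebesgue. x \<notin> cbox a b - box a b"
    proof (rule AE_not_in)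
      have "negligible (cbox a b - box a b)" by (rule negligible_frontier_interval)
      then show "cbox a b - box a b \<in> null_sets lebesgue" by (simp add: negligible_iff_null_sets)
    qed
    ultimately show ?thesis by eventually_elim (auto simp: indicator_def split: if_splits)
  qed
  obtain D where D: "countable D" "D \<subseteq> Pow S" "\<And>X. X \<in> D \<Longrightarrow> \<exists>a b. X = cbox a b" "\<Union>D = S"
    using open_countable_Union_open_cbox[OF S] by metis
  have "\<forall>X\<in>D. AE x in lebesgue. x \<in> X \<longrightarrow> f x = 0"
  proof
    fix X assume X: "X \<in> D"
    then obtain a b where "X = cbox a b" using D(3) by blast
    then show "AE x in lebesgue. x \<in> X \<longrightarrow> f x = 0" using X D(2) loc[of a b] by blast
  qed
  then have "AE x in lebesgue. \<forall>X\<in>D. x \<in> X \<longrightarrow> f x = 0" by (simp only: AE_ball_countable[OF D(1)])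
  then have "AE x in lebesgue. x \<in> S \<longrightarrow> f x = 0" by eventually_elim (use D(4) in blast)
  then show ?thesis by (simp add: AE_lebesgue_on[OF Sl])
qed

lemma L2_Re: "u \<in> L2 S \<Longrightarrow> (\<lambda>x. complex_of_real (Re (u x))) \<in> L2 S"
  by (rule L2_bound[where g="\<lambda>x. (cmod (u x))\<^sup>2"]) (auto simp: L2_iff cmod_power2)

lemma L2_Im: "u \<in> L2 S \<Longrightarrow> (\<lambda>x. complex_of_real (Im (u x))) \<in> L2 S"
  by (rule L2_bound[where g="\<lambda>x. (cmod (u x))\<^sup>2"]) (auto simp: L2_iff cmod_power2)

text \<open>Test functions are real, so real and imaginary parts can be treated separately.\<close>

lemma fundamental_lemma:
  assumes S: "open S" and u: "u \<in> L2 S"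
    and zero: "\<And>\<phi>. test_function S \<phi> \<Longrightarrow> L2_inner S u (\<lambda>x. complex_of_real (\<phi> x)) = 0"
  shows "AE x in lebesgue_on S. u x = 0"
proof -
  have Sl: "S \<in> sets lebesgue" by (rule open_sets_lebesgue[OF S])
  note R = L2_Re[OF u] and I = L2_Im[OF u]
  have int: "integrable (lebesgue_on S) (\<lambda>x. u x * cnj (complex_of_real (\<phi> x)))" if "test_function S \<phi>" for \<phi>
    by (rule L2_integrable_mult[OF u test_function_in_L2(1)[OF Sl that]])
  have "AE x in lebesgue_on S. Re (u x) = 0"
  proof (rule fundamental_lemma_real[OF S R])
    fix \<phi> assume t: "test_function S \<phi>"
    have "(\<integral>x. Re (u x * cnj (complex_of_real (\<phi> x))) \<partial>lebesgue_on S) = 0"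
      using zero[OF t] integral_Re[OF int[OF t]] by (simp add: L2_inner_def)
    then show "(\<integral>x. \<phi> x * Re (u x) \<partial>lebesgue_on S) = 0" by (simp add: mult.commute)
  qed
  moreover have "AE x in lebesgue_on S. Im (u x) = 0"
  proof (rule fundamental_lemma_real[OF S I])
    fix \<phi> assume t: "test_function S \<phi>"
    have "(\<integral>x. Im (u x * cnj (complex_of_real (\<phi> x))) \<partial>lebesgue_on S) = 0"
      using zero[OF t] integral_Im[OF int[OF t]] by (simp add: L2_inner_def)
    then show "(\<integral>x. \<phi> x * Im (u x) \<partial>lebesgue_on S) = 0" by (simp add: mult.commute)
  qed
  ultimately show ?thesis by eventually_elim (simp add: complex_eq_iff)
qed

section \<open>Weak derivatives\<close>

lemma L2_inner_diff_left:
  "u \<in> L2 S \<Longrightarrow> v \<in> L2 S \<Longrightarrow> w \<in> L2 S \<Longrightarrow> L2_inner S (\<lambda>x. u x - v x) w = L2_inner S u w - L2_inner S v w"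
  unfolding L2_inner_def by (simp add: left_diff_distrib L2_integrable_mult)

lemma L2_inner_scale_right: "L2_inner S u (\<lambda>x. c * v x) = cnj c * L2_inner S u v"
  unfolding L2_inner_def by (simp add: mult.left_commute)

lemma L2_inner_eq_lsq:
  assumes S: "S \<in> sets lebesgue" and uv: "u \<in> L2 S" "v \<in> L2 S"
  shows "L2_inner S u v = Complex (inner (lsq_of S u) (lsq_of S v)) (inner (lsq_of S u) (lsq_of S (\<lambda>x. \<i> * v x)))"
  using L2_scale[OF uv(2), of \<i>] uv by (simp add: inner_lsq_of[OF S] L2_inner_scale_right complex_eq_iff)

lemma L2_inner_cong_lsq:
  assumes S: "S \<in> sets lebesgue" and "u \<in> L2 S" "u' \<in> L2 S" "v \<in> L2 S" "lsq_of S u = lsq_of S u'"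
  shows "L2_inner S u v = L2_inner S u' v"
  by (simp only: L2_inner_eq_lsq[OF S assms(2,4)] L2_inner_eq_lsq[OF S assms(3,4)] assms(5))

lemma L2_inner_tendsto:
  assumes S: "S \<in> sets lebesgue" and u: "\<And>n. u n \<in> L2 S" "l \<in> L2 S" "(\<lambda>n. lsq_of S (u n)) \<longlonglongrightarrow> lsq_of S l"
    and v: "v \<in> L2 S"
  shows "(\<lambda>n. L2_inner S (u n) v) \<longlonglongrightarrow> L2_inner S l v"
  unfolding L2_inner_eq_lsq[OF S u(1) v] L2_inner_eq_lsq[OF S u(2) v]
  by (intro tendsto_Complex tendsto_inner tendsto_const u(3))

lemma L2_inner_restrict:
  assumes S: "S \<in> sets lebesgue" "T \<in> sets lebesgue" "S \<subseteq> T" and z: "\<And>x. x \<in> T \<Longrightarrow> x \<notin> S \<Longrightarrow> u x * cnj (v x) = 0"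
  shows "L2_inner T u v = L2_inner S u v"
proof -
  have "(if x \<in> T then u x * cnj (v x) else 0) = (if x \<in> S then u x * cnj (v x) else 0)" for x
    using z[of x] S(3) by auto
  then show ?thesis unfolding L2_inner_def integral_cut[OF S(1), symmetric] integral_cut[OF S(2), symmetric] by simp
qed

lemma has_weak_derivative_unique:
  assumes O: "open \<Omega>" and g: "g \<in> L2 \<Omega>" "h \<in> L2 \<Omega>"
    and w: "has_weak_derivative \<Omega> e u g" "has_weak_derivative \<Omega> e u h"
  shows "AE x in lebesgue_on \<Omega>. g x = h x"
proof -
  have "AE x in lebesgue_on \<Omega>. g x - h x = 0"
  proof (rule fundamental_lemma[OF O L2_diff[OF g]])
    fix \<phi> assume t: "test_function \<Omega> \<phi>"
    have "L2_inner \<Omega> g (\<lambda>x. complex_of_real (\<phi> x)) = L2_inner \<Omega> h (\<lambda>x. complex_of_real (\<phi> x))"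
      using w t unfolding has_weak_derivative_iff by (metis neg_equal_iff_equal)
    then show "L2_inner \<Omega> (\<lambda>x. g x - h x) (\<lambda>x. complex_of_real (\<phi> x)) = 0"
      using L2_inner_diff_left[OF g test_function_in_L2(1)[OF open_sets_lebesgue[OF O] t]] by simp
  qed
  then show ?thesis by simp
qed

lemma has_weak_derivative_cong:
  assumes O: "open \<Omega>" and e: "e \<in> Basis" and L: "u \<in> L2 \<Omega>" "u' \<in> L2 \<Omega>" "g \<in> L2 \<Omega>" "g' \<in> L2 \<Omega>"
    and eq: "lsq_of \<Omega> u = lsq_of \<Omega> u'" "lsq_of \<Omega> g = lsq_of \<Omega> g'" and w: "has_weak_derivative \<Omega> e u g"
  shows "has_weak_derivative \<Omega> e u' g'"
proof -
  note S = open_sets_lebesgue[OF O]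
  show ?thesis
    using w unfolding has_weak_derivative_iff
    by (simp add: L2_inner_cong_lsq[OF S L(1,2) test_function_in_L2(2)[OF S _ e] eq(1)]
        L2_inner_cong_lsq[OF S L(3,4) test_function_in_L2(1)[OF S] eq(2)])
qed

lemma H1D:
  assumes "u \<in> H1 \<Omega>"
  shows "u \<in> L2 \<Omega>" "e \<in> Basis \<Longrightarrow> weak_derivative \<Omega> e u \<in> L2 \<Omega>"
    "e \<in> Basis \<Longrightarrow> has_weak_derivative \<Omega> e u (weak_derivative \<Omega> e u)"
proof -
  show "u \<in> L2 \<Omega>" using assms by (simp add: H1_def)
  have "weak_derivative \<Omega> e u \<in> L2 \<Omega> \<and> has_weak_derivative \<Omega> e u (weak_derivative \<Omega> e u)" if "e \<in> Basis" for e
  proof -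
    have "\<exists>g. g \<in> L2 \<Omega> \<and> has_weak_derivative \<Omega> e u g" using assms that unfolding H1_def by blast
    then show ?thesis unfolding weak_derivative_def by (rule someI_ex)
  qed
  then show "e \<in> Basis \<Longrightarrow> weak_derivative \<Omega> e u \<in> L2 \<Omega>"
    "e \<in> Basis \<Longrightarrow> has_weak_derivative \<Omega> e u (weak_derivative \<Omega> e u)" by blast+
qed

lemma H1I:
  assumes "u \<in> L2 \<Omega>" "\<And>e. e \<in> Basis \<Longrightarrow> g e \<in> L2 \<Omega>" "\<And>e. e \<in> Basis \<Longrightarrow> has_weak_derivative \<Omega> e u (g e)"
  shows "u \<in> H1 \<Omega>"
  using assms unfolding H1_def by blast

text \<open>Taken in \<open>lsq\<close>, where the choice made by \<open>weak_derivative\<close> no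
  longer matters, by \<open>grad_eqI\<close>.\<close>

definition grad :: "'a::euclidean_space set \<Rightarrow> 'a \<Rightarrow> ('a \<Rightarrow> complex) \<Rightarrow> 'a lsq" where
  "grad \<Omega> e u = lsq_of \<Omega> (weak_derivative \<Omega> e u)"

lemma grad_eqI:
  assumes O: "open \<Omega>" and "e \<in> Basis" "u \<in> H1 \<Omega>" "g \<in> L2 \<Omega>" "has_weak_derivative \<Omega> e u g"
  shows "grad \<Omega> e u = lsq_of \<Omega> g"
  unfolding grad_def lsq_of_eq_iff[OF open_sets_lebesgue[OF O] H1D(2)[OF assms(3,2)] assms(4)]
  by (rule has_weak_derivative_unique[OF O H1D(2)[OF assms(3,2)] assms(4) H1D(3)[OF assms(3,2)] assms(5)])

lemma has_weak_derivative_add: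
  assumes O: "open \<Omega>" and e: "e \<in> Basis" and L: "u \<in> L2 \<Omega>" "v \<in> L2 \<Omega>" "g \<in> L2 \<Omega>" "h \<in> L2 \<Omega>"
    and w: "has_weak_derivative \<Omega> e u g" "has_weak_derivative \<Omega> e v h"
  shows "has_weak_derivative \<Omega> e (\<lambda>x. u x + v x) (\<lambda>x. g x + h x)"
  using w unfolding has_weak_derivative_iff
  by (simp add: L2_inner_add_left[OF L(1,2) test_function_in_L2(2)[OF open_sets_lebesgue[OF O] _ e]]
      L2_inner_add_left[OF L(3,4) test_function_in_L2(1)[OF open_sets_lebesgue[OF O]]])

lemma has_weak_derivative_scale:
  "has_weak_derivative \<Omega> e u g \<Longrightarrow> has_weak_derivative \<Omega> e (\<lambda>x. c * u x) (\<lambda>x. c * g x)"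
  unfolding has_weak_derivative_iff by (simp add: L2_inner_scale_left)

context
  fixes \<Omega> :: "'a::euclidean_space set"
  assumes O: "open \<Omega>"
begin

lemma H1_add: "u \<in> H1 \<Omega> \<Longrightarrow> v \<in> H1 \<Omega> \<Longrightarrow> (\<lambda>x. u x + v x) \<in> H1 \<Omega>"
  by (rule H1I[where g="\<lambda>e x. weak_derivative \<Omega> e u x + weak_derivative \<Omega> e v x"])
    (simp_all add: L2_add H1D has_weak_derivative_add[OF O])

lemma H1_scale: "u \<in> H1 \<Omega> \<Longrightarrow> (\<lambda>x. c * u x) \<in> H1 \<Omega>"
  by (rule H1I[where g="\<lambda>e x. c * weak_derivative \<Omega> e u x"])
    (simp_all add: L2_scale H1D has_weak_derivative_scale)

lemma H1_diff: "u \<in> H1 \<Omega> \<Longrightarrow> v \<in> H1 \<Omega> \<Longrightarrow> (\<lambda>x. u x - v x) \<in> H1 \<Omega>"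
  using H1_add[OF _ H1_scale, of u v "-1"] by simp

lemma H1_zero: "(\<lambda>x. 0) \<in> H1 \<Omega>"
  by (rule H1I[where g="\<lambda>e x. 0"]) (simp_all add: has_weak_derivative_def)

lemma grad_add:
  "e \<in> Basis \<Longrightarrow> u \<in> H1 \<Omega> \<Longrightarrow> v \<in> H1 \<Omega> \<Longrightarrow> grad \<Omega> e (\<lambda>x. u x + v x) = grad \<Omega> e u + grad \<Omega> e v"
  unfolding grad_def[of \<Omega> e u] grad_def[of \<Omega> e v]
  by (subst lsq_of_add[symmetric, OF open_sets_lebesgue[OF O]])
    (simp_all add: H1D grad_eqI[OF O] H1_add L2_add has_weak_derivative_add[OF O])

lemma grad_scale:
  "e \<in> Basis \<Longrightarrow> u \<in> H1 \<Omega> \<Longrightarrow> grad \<Omega> e (\<lambda>x. c * u x) = lsq_of \<Omega> (\<lambda>x. c * weak_derivative \<Omega> e u x)"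
  by (simp add: H1D grad_eqI[OF O] H1_scale L2_scale has_weak_derivative_scale)

lemma grad_scaleR: "e \<in> Basis \<Longrightarrow> u \<in> H1 \<Omega> \<Longrightarrow> grad \<Omega> e (\<lambda>x. complex_of_real c * u x) = c *\<^sub>R grad \<Omega> e u"
  using lsq_of_scaleR[OF open_sets_lebesgue[OF O] H1D(2), of u e c]
  by (simp add: grad_scale) (simp add: grad_def scaleR_conv_of_real)

lemma grad_diff:
  "e \<in> Basis \<Longrightarrow> u \<in> H1 \<Omega> \<Longrightarrow> v \<in> H1 \<Omega> \<Longrightarrow> grad \<Omega> e (\<lambda>x. u x - v x) = grad \<Omega> e u - grad \<Omega> e v"
  using grad_add[of e u "\<lambda>x. complex_of_real (-1) * v x"] grad_scaleR[of e v "-1"] H1_scale[of v "-1"] by simp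

lemma grad_zero: "e \<in> Basis \<Longrightarrow> grad \<Omega> e (\<lambda>x. 0) = 0"
  using grad_scaleR[of e "\<lambda>x. 0" 0] H1_zero by simp

lemma grad_cong:
  assumes e: "e \<in> Basis" and u: "u \<in> H1 \<Omega>" "v \<in> H1 \<Omega>" "lsq_of \<Omega> u = lsq_of \<Omega> v"
  shows "grad \<Omega> e u = grad \<Omega> e v"
proof -
  have "has_weak_derivative \<Omega> e v (weak_derivative \<Omega> e u)"
    by (rule has_weak_derivative_cong[OF O e H1D(1)[OF u(1)] H1D(1)[OF u(2)] H1D(2)[OF u(1) e] H1D(2)[OF u(1) e] u(3) refl H1D(3)[OF u(1) e]])
  then show ?thesis using grad_eqI[OF O e u(2) H1D(2)[OF u(1) e]] by (simp add: grad_def[of \<Omega> e u])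
qed

text \<open>For a fixed test function both sides of the identity that defines a weak derivative are
  continuous in the norm of \<open>L2\<close>.\<close>

lemma H1_closed:
  assumes u: "\<And>n. u n \<in> H1 \<Omega>" and l: "l \<in> L2 \<Omega>" "(\<lambda>n. lsq_of \<Omega> (u n)) \<longlonglongrightarrow> lsq_of \<Omega> l"
    and g: "\<And>e. e \<in> Basis \<Longrightarrow> g e \<in> L2 \<Omega>" "\<And>e. e \<in> Basis \<Longrightarrow> (\<lambda>n. grad \<Omega> e (u n)) \<longlonglongrightarrow> lsq_of \<Omega> (g e)"
  shows "l \<in> H1 \<Omega>" "e \<in> Basis \<Longrightarrow> grad \<Omega> e l = lsq_of \<Omega> (g e)"
proof -
  note S = open_sets_lebesgue[OF O]
  have w: "has_weak_derivative \<Omega> e l (g e)" if e: "e \<in> Basis" for e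
    unfolding has_weak_derivative_iff
  proof (intro allI impI)
    fix \<phi> assume t: "test_function \<Omega> \<phi>"
    note t1 = test_function_in_L2(1)[OF S t] and t2 = test_function_in_L2(2)[OF S t e]
    have "(\<lambda>n. L2_inner \<Omega> (u n) (\<lambda>x. complex_of_real (frechet_derivative \<phi> (at x) e)))
        \<longlonglongrightarrow> L2_inner \<Omega> l (\<lambda>x. complex_of_real (frechet_derivative \<phi> (at x) e))"
      by (rule L2_inner_tendsto[OF S H1D(1)[OF u] l t2])
    moreover have "(\<lambda>n. - L2_inner \<Omega> (weak_derivative \<Omega> e (u n)) (\<lambda>x. complex_of_real (\<phi> x)))
        \<longlonglongrightarrow> - L2_inner \<Omega> (g e) (\<lambda>x. complex_of_real (\<phi> x))"
      by (intro tendsto_minus L2_inner_tendsto[OF S H1D(2)[OF u e] g(1)[OF e] g(2)[OF e, unfolded grad_def] t1])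
    moreover have "L2_inner \<Omega> (u n) (\<lambda>x. complex_of_real (frechet_derivative \<phi> (at x) e))
        = - L2_inner \<Omega> (weak_derivative \<Omega> e (u n)) (\<lambda>x. complex_of_real (\<phi> x))" for n
      using H1D(3)[OF u e] t unfolding has_weak_derivative_iff by blast
    ultimately show "L2_inner \<Omega> l (\<lambda>x. complex_of_real (frechet_derivative \<phi> (at x) e)) = - L2_inner \<Omega> (g e) (\<lambda>x. complex_of_real (\<phi> x))"
      by (simp only:) (rule LIMSEQ_unique)
  qed
  show l': "l \<in> H1 \<Omega>" by (rule H1I[OF l(1) g(1) w])
  show "e \<in> Basis \<Longrightarrow> grad \<Omega> e l = lsq_of \<Omega> (g e)" by (rule grad_eqI[OF O _ l' g(1) w])
qed

lemma Re_Dirichlet_form: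
  "u \<in> H1 \<Omega> \<Longrightarrow> v \<in> H1 \<Omega> \<Longrightarrow> Re (Dirichlet_form \<Omega> u v) = (\<Sum>e\<in>Basis. inner (grad \<Omega> e u) (grad \<Omega> e v))"
  unfolding Dirichlet_form_def Re_sum
  by (intro sum.cong refl) (simp add: grad_def inner_lsq_of[OF open_sets_lebesgue[OF O]] H1D(2))

lemma H1_norm_square:
  assumes u: "u \<in> H1 \<Omega>"
  shows "(H1_norm \<Omega> u)\<^sup>2 = (norm (lsq_of \<Omega> u))\<^sup>2 + (\<Sum>e\<in>Basis. (norm (grad \<Omega> e u))\<^sup>2)"
proof -
  have "Re (L2_inner \<Omega> u u + Dirichlet_form \<Omega> u u) = (norm (lsq_of \<Omega> u))\<^sup>2 + (\<Sum>e\<in>Basis. (norm (grad \<Omega> e u))\<^sup>2)"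
    using Re_Dirichlet_form[OF u u] inner_lsq_of[OF open_sets_lebesgue[OF O] H1D(1)[OF u] H1D(1)[OF u]]
    by (simp add: power2_norm_eq_inner)
  moreover have "0 \<le> (norm (lsq_of \<Omega> u))\<^sup>2 + (\<Sum>e\<in>Basis. (norm (grad \<Omega> e u))\<^sup>2)"
    by (intro add_nonneg_nonneg sum_nonneg) auto
  ultimately show ?thesis by (simp add: H1_norm_def)
qed

lemma H1_norm_nonneg: "u \<in> H1 \<Omega> \<Longrightarrow> 0 \<le> H1_norm \<Omega> u"
  using Re_Dirichlet_form[of u u] unfolding H1_norm_def
  by (simp add: Re_L2_inner_self sum_nonneg)

lemma norm_le_H1_norm:
  assumes u: "u \<in> H1 \<Omega>"
  shows "norm (lsq_of \<Omega> u) \<le> H1_norm \<Omega> u" "e \<in> Basis \<Longrightarrow> norm (grad \<Omega> e u) \<le> H1_norm \<Omega> u"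
proof -
  have "(norm (lsq_of \<Omega> u))\<^sup>2 \<le> (H1_norm \<Omega> u)\<^sup>2"
    unfolding H1_norm_square[OF u] using sum_nonneg[of Basis "\<lambda>e. (norm (grad \<Omega> e u))\<^sup>2"] by simp
  then show "norm (lsq_of \<Omega> u) \<le> H1_norm \<Omega> u" by (rule power2_le_imp_le[OF _ H1_norm_nonneg[OF u]])
  have "(norm (grad \<Omega> e u))\<^sup>2 \<le> (H1_norm \<Omega> u)\<^sup>2" if e: "e \<in> Basis"
  proof -
    have "(norm (grad \<Omega> e u))\<^sup>2 \<le> (\<Sum>e\<in>Basis. (norm (grad \<Omega> e u))\<^sup>2)"
      by (rule member_le_sum[OF e]) auto
    then show ?thesis
      unfolding H1_norm_square[OF u] using zero_le_power2[of "norm (lsq_of \<Omega> u)"] by linarith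
  qed
  then show "norm (grad \<Omega> e u) \<le> H1_norm \<Omega> u" if "e \<in> Basis"
    using that by (intro power2_le_imp_le[OF _ H1_norm_nonneg[OF u]])
qed

end

lemma test_function_subset: "test_function S \<phi> \<Longrightarrow> S \<subseteq> T \<Longrightarrow> test_function T \<phi>"
  unfolding test_function_def by blast

lemma test_function_0:
  assumes "test_function S \<phi>" "x \<notin> S"
  shows "\<phi> x = 0" "frechet_derivative \<phi> (at x) e = 0"
proof -
  obtain K where K: "compact K" "K \<subseteq> S" "\<And>x. x \<notin> K \<Longrightarrow> \<phi> x = 0"
    using assms(1) unfolding test_function_def by blast
  have "x \<notin> K" using K(2) assms(2) by blast
  then show "\<phi> x = 0" "frechet_derivative \<phi> (at x) e = 0"
    by (simp_all add: K(3) frechet_derivative_0_outside[OF compact_imp_closed[OF K(1)] K(3)])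
qed

text \<open>A test function on the smaller set is one on the larger set, and its integrals only see
  the smaller one.\<close>

lemma H1_subset:
  assumes O: "open \<Omega>" "open \<Omega>'" "\<Omega>' \<subseteq> \<Omega>" and u: "u \<in> H1 \<Omega>"
  shows "u \<in> H1 \<Omega>'" "e \<in> Basis \<Longrightarrow> grad \<Omega>' e u = lsq_of \<Omega>' (weak_derivative \<Omega> e u)"
    "e \<in> Basis \<Longrightarrow> weak_derivative \<Omega> e u \<in> L2 \<Omega>'"
proof -
  note S = open_sets_lebesgue[OF O(1)] and S' = open_sets_lebesgue[OF O(2)]
  have L: "v \<in> L2 \<Omega>'" if "v \<in> L2 \<Omega>" for v by (rule L2_subset[OF S' S O(3) that])
  have w: "has_weak_derivative \<Omega>' e u (weak_derivative \<Omega> e u)" if e: "e \<in> Basis" for e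
    unfolding has_weak_derivative_iff
  proof (intro allI impI)
    fix \<phi> assume t: "test_function \<Omega>' \<phi>"
    have "L2_inner \<Omega> u (\<lambda>x. complex_of_real (frechet_derivative \<phi> (at x) e)) = - L2_inner \<Omega> (weak_derivative \<Omega> e u) (\<lambda>x. complex_of_real (\<phi> x))"
      using H1D(3)[OF u e] test_function_subset[OF t O(3)] unfolding has_weak_derivative_iff by blast
    then show "L2_inner \<Omega>' u (\<lambda>x. complex_of_real (frechet_derivative \<phi> (at x) e)) = - L2_inner \<Omega>' (weak_derivative \<Omega> e u) (\<lambda>x. complex_of_real (\<phi> x))"
      using test_function_0[OF t] by (simp add: L2_inner_restrict[OF S' S O(3)])
  qed
  show u': "u \<in> H1 \<Omega>'" by (rule H1I[OF L[OF H1D(1)[OF u]] L[OF H1D(2)[OF u]] w])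
  show "weak_derivative \<Omega> e u \<in> L2 \<Omega>'" if "e \<in> Basis" by (rule L[OF H1D(2)[OF u that]])
  show "grad \<Omega>' e u = lsq_of \<Omega>' (weak_derivative \<Omega> e u)" if "e \<in> Basis"
    by (rule grad_eqI[OF O(2) that u' L[OF H1D(2)[OF u that]] w[OF that]])
qed

subsection \<open>Cutoff functions\<close>

lemma L2_mult_bounded:
  assumes u: "u \<in> L2 S" and f: "continuous_on UNIV f" and M: "\<And>x. \<bar>f x\<bar> \<le> M"
  shows "(\<lambda>x. complex_of_real (f x) * u x) \<in> L2 S"
proof (rule L2_bound)
  show "(\<lambda>x. complex_of_real (f x) * u x) \<in> borel_measurable (lebesgue_on S)"
    by (intro borel_measurable_times L2D(1)[OF u] measurable_lebesgue_on_continuous continuous_on_of_real f)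
  show "integrable (lebesgue_on S) (\<lambda>x. M\<^sup>2 * (cmod (u x))\<^sup>2)" by (intro integrable_mult_right L2D(2)[OF u])
  have "(cmod (complex_of_real (f x) * u x))\<^sup>2 \<le> M\<^sup>2 * (cmod (u x))\<^sup>2" for x
    using power_mono[OF M[of x] abs_ge_zero, of 2] by (simp add: norm_mult power_mult_distrib mult_right_mono)
  then show "AE x in lebesgue_on S. (cmod (complex_of_real (f x) * u x))\<^sup>2 \<le> M\<^sup>2 * (cmod (u x))\<^sup>2" by simp
qed

text \<open>The Leibniz rule combined with extension by zero from \<open>\<Omega>'\<close> to
  \<Omega>. Condition \<open>t\<close> is the point: multiplication by \<psi> turns test functions
  of the large domain into test functions of the small one, with which the weak derivative on
  \<open>\<Omega>'\<close> can be tested. For equal domains it is the ordinary product rule.\<close>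

lemma has_weak_derivative_cutoff:
  fixes \<psi> :: "'a::euclidean_space \<Rightarrow> real"
  assumes O: "open \<Omega>" "open \<Omega>'" "\<Omega>' \<subseteq> \<Omega>" and e: "e \<in> Basis"
    and \<psi>: "\<And>k. Ck k \<psi>" "\<And>x. \<bar>\<psi> x\<bar> \<le> M" "\<And>x. \<bar>frechet_derivative \<psi> (at x) e\<bar> \<le> M'"
    and t: "\<And>\<phi>. test_function \<Omega> \<phi> \<Longrightarrow> test_function \<Omega>' (\<lambda>x. if x \<in> \<Omega>' then \<psi> x * \<phi> x else 0)"
    and u: "u \<in> L2 \<Omega>'" "g \<in> L2 \<Omega>'" "has_weak_derivative \<Omega>' e u g"
  shows "(\<lambda>x. if x \<in> \<Omega>' then complex_of_real (\<psi> x) * u x else 0) \<in> L2 \<Omega>"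
    "(\<lambda>x. if x \<in> \<Omega>' then complex_of_real (\<psi> x) * g x + complex_of_real (frechet_derivative \<psi> (at x) e) * u x else 0) \<in> L2 \<Omega>"
    "has_weak_derivative \<Omega> e (\<lambda>x. if x \<in> \<Omega>' then complex_of_real (\<psi> x) * u x else 0)
       (\<lambda>x. if x \<in> \<Omega>' then complex_of_real (\<psi> x) * g x + complex_of_real (frechet_derivative \<psi> (at x) e) * u x else 0)"
proof -
  note S = open_sets_lebesgue[OF O(1)] and S' = open_sets_lebesgue[OF O(2)]
  have \<psi>c: "continuous_on UNIV \<psi>" by (rule Ck_continuous[OF \<psi>(1)])
  have d\<psi>c: "continuous_on UNIV (\<lambda>x. frechet_derivative \<psi> (at x) e)"
    by (rule Ck_continuous[OF Ck_SucD(2)[OF \<psi>(1)[of "Suc 0"] e]])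
  let ?\<psi> = "\<lambda>x. complex_of_real (\<psi> x)" and ?d\<psi> = "\<lambda>x. complex_of_real (frechet_derivative \<psi> (at x) e)"
  note L1 = L2_mult_bounded[OF u(1) \<psi>c \<psi>(2)] and L2' = L2_mult_bounded[OF u(2) \<psi>c \<psi>(2)]
    and L3 = L2_mult_bounded[OF u(1) d\<psi>c \<psi>(3)]
  have cut: "(\<lambda>x. if x \<in> \<Omega>' then v x else 0) \<in> L2 \<Omega>" if "v \<in> L2 \<Omega>'" for v
    by (rule L2_UNIV_restrict[OF S]) (simp add: cut_in_L2[OF S'] that)
  show "(\<lambda>x. if x \<in> \<Omega>' then ?\<psi> x * u x else 0) \<in> L2 \<Omega>" by (rule cut[OF L1])
  show "(\<lambda>x. if x \<in> \<Omega>' then ?\<psi> x * g x + ?d\<psi> x * u x else 0) \<in> L2 \<Omega>" by (rule cut[OF L2_add[OF L2' L3]])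
  show "has_weak_derivative \<Omega> e (\<lambda>x. if x \<in> \<Omega>' then ?\<psi> x * u x else 0)
       (\<lambda>x. if x \<in> \<Omega>' then ?\<psi> x * g x + ?d\<psi> x * u x else 0)"
    unfolding has_weak_derivative_iff
  proof (intro allI impI)
    fix \<phi> assume \<phi>: "test_function \<Omega> \<phi>"
    define \<Phi> where "\<Phi> x = (if x \<in> \<Omega>' then \<psi> x * \<phi> x else 0)" for x
    have t\<Phi>: "test_function \<Omega>' \<Phi>" unfolding \<Phi>_def[abs_def] by (rule t[OF \<phi>])
    let ?\<phi> = "\<lambda>x. complex_of_real (\<phi> x)" and ?d\<phi> = "\<lambda>x. complex_of_real (frechet_derivative \<phi> (at x) e)"
      and ?d\<Phi> = "\<lambda>x. complex_of_real (frechet_derivative \<Phi> (at x) e)"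
    have d\<Phi>: "frechet_derivative \<Phi> (at x) e = \<psi> x * frechet_derivative \<phi> (at x) e + frechet_derivative \<psi> (at x) e * \<phi> x"
      if x: "x \<in> \<Omega>'" for x
    proof (rule frechet_derivative_eqI[of \<Phi> "\<lambda>h. \<psi> x * frechet_derivative \<phi> (at x) h + frechet_derivative \<psi> (at x) h * \<phi> x"])
      show "(\<Phi> has_derivative (\<lambda>h. \<psi> x * frechet_derivative \<phi> (at x) h + frechet_derivative \<psi> (at x) h * \<phi> x)) (at x)"
        by (rule has_derivative_transform_within_open[OF has_derivative_mult[OF Ck_SucD(1)[OF \<psi>(1)[of "Suc 0"]] test_functionD(4)[OF \<phi>]] O(2) x])
          (simp add: \<Phi>_def)
    qed
    note T1 = test_function_in_L2(1)[OF S' \<phi>] and T2 = test_function_in_L2(2)[OF S' \<phi> e]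
      and T3 = test_function_in_L2(2)[OF S' t\<Phi> e]
    have "L2_inner \<Omega> (\<lambda>x. if x \<in> \<Omega>' then ?\<psi> x * u x else 0) ?d\<phi> = L2_inner \<Omega>' (\<lambda>x. if x \<in> \<Omega>' then ?\<psi> x * u x else 0) ?d\<phi>"
      by (rule L2_inner_restrict[OF S' S O(3)]) simp
    also have "\<dots> = L2_inner \<Omega>' (\<lambda>x. ?\<psi> x * u x) ?d\<phi>"
      unfolding L2_inner_def by (rule Bochner_Integration.integral_cong) auto
    also have "\<dots> = L2_inner \<Omega>' u ?d\<Phi> - L2_inner \<Omega>' (\<lambda>x. ?d\<psi> x * u x) ?\<phi>"
    proof -
      have "L2_inner \<Omega>' u ?d\<Phi> = (\<integral>x. (?\<psi> x * u x) * cnj (?d\<phi> x) + (?d\<psi> x * u x) * cnj (?\<phi> x) \<partial>lebesgue_on \<Omega>')"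
        unfolding L2_inner_def by (rule Bochner_Integration.integral_cong) (auto simp: d\<Phi> algebra_simps)
      also have "\<dots> = L2_inner \<Omega>' (\<lambda>x. ?\<psi> x * u x) ?d\<phi> + L2_inner \<Omega>' (\<lambda>x. ?d\<psi> x * u x) ?\<phi>"
        unfolding L2_inner_def by (intro Bochner_Integration.integral_add L2_integrable_mult L1 L3 T1 T2)
      finally show ?thesis by simp
    qed
    also have "L2_inner \<Omega>' u ?d\<Phi> = - L2_inner \<Omega>' g (\<lambda>x. complex_of_real (\<Phi> x))"
      using u(3) t\<Phi> unfolding has_weak_derivative_iff by blast
    also have "L2_inner \<Omega>' g (\<lambda>x. complex_of_real (\<Phi> x)) = L2_inner \<Omega>' (\<lambda>x. ?\<psi> x * g x) ?\<phi>"
      unfolding L2_inner_def by (rule Bochner_Integration.integral_cong) (auto simp: \<Phi>_def)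
    also have "- L2_inner \<Omega>' (\<lambda>x. ?\<psi> x * g x) ?\<phi> - L2_inner \<Omega>' (\<lambda>x. ?d\<psi> x * u x) ?\<phi>
        = - L2_inner \<Omega>' (\<lambda>x. ?\<psi> x * g x + ?d\<psi> x * u x) ?\<phi>"
      using L2_inner_add_left[OF L2' L3 T1] by simp
    also have "L2_inner \<Omega>' (\<lambda>x. ?\<psi> x * g x + ?d\<psi> x * u x) ?\<phi>
        = L2_inner \<Omega>' (\<lambda>x. if x \<in> \<Omega>' then ?\<psi> x * g x + ?d\<psi> x * u x else 0) ?\<phi>"
      unfolding L2_inner_def by (rule Bochner_Integration.integral_cong) auto
    also have "\<dots> = L2_inner \<Omega> (\<lambda>x. if x \<in> \<Omega>' then ?\<psi> x * g x + ?d\<psi> x * u x else 0) ?\<phi>"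
      by (rule L2_inner_restrict[OF S' S O(3), symmetric]) simp
    finally show "L2_inner \<Omega> (\<lambda>x. if x \<in> \<Omega>' then ?\<psi> x * u x else 0) ?d\<phi>
        = - L2_inner \<Omega> (\<lambda>x. if x \<in> \<Omega>' then ?\<psi> x * g x + ?d\<psi> x * u x else 0) ?\<phi>" .
  qed
qed

subsection \<open>Translations\<close>

definition shift_set :: "'a::euclidean_space \<Rightarrow> 'a set \<Rightarrow> 'a set" where
  "shift_set t S = {x. x - t \<in> S}"

lemma shift_set_vimage: "shift_set t S = (\<lambda>x. (- t) + x) -` S"
  by (auto simp: shift_set_def)

lemma shift_set_measurable: "S \<in> sets lebesgue \<Longrightarrow> shift_set t S \<in> sets lebesgue"
  using measurable_sets[OF translation_measurable[of "- t"], of S] by (simp add: shift_set_vimage)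

lemma open_shift_set: "open S \<Longrightarrow> open (shift_set t S)"
  unfolding shift_set_vimage by (intro open_vimage continuous_intros) auto

lemma L2_shift:
  assumes S: "S \<in> sets lebesgue" and u: "u \<in> L2 S"
  shows "(\<lambda>x. u (x - t)) \<in> L2 (shift_set t S)"
proof -
  let ?U = "\<lambda>x. if x \<in> S then u x else 0"
  have U: "?U \<in> L2 UNIV" by (simp add: cut_in_L2[OF S] u)
  have "(\<lambda>x. ?U (- t + x)) \<in> L2 UNIV"
    using measurable_compose[OF translation_measurable L2D(1)[OF U, unfolded lebesgue_on_UNIV], of "- t"]
      integrable_translation[OF L2D(2)[OF U, unfolded lebesgue_on_UNIV], of "- t"]
    by (simp add: L2_iff lebesgue_on_UNIV)
  then have "(\<lambda>x. if x \<in> shift_set t S then u (x - t) else 0) \<in> L2 UNIV"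
    by (simp add: shift_set_def cong: if_cong)
  then show ?thesis by (simp add: cut_in_L2 shift_set_measurable S)
qed

lemma L2_inner_shift:
  assumes S: "S \<in> sets lebesgue" and u: "u \<in> L2 S" "v \<in> L2 S"
  shows "L2_inner (shift_set t S) (\<lambda>x. u (x - t)) (\<lambda>x. v (x - t)) = L2_inner S u v"
proof -
  let ?f = "\<lambda>x. if x \<in> S then u x * cnj (v x) else 0"
  have "?f \<in> borel_measurable lebesgue"
    using L2_integrable_mult[OF u] integrable_cut[OF S, of "\<lambda>x. u x * cnj (v x)"] by auto
  then have "(\<integral>x. ?f (- t + x) \<partial>lebesgue) = (\<integral>x. ?f x \<partial>lebesgue)" by (rule integral_translation)
  then show ?thesis
    unfolding L2_inner_def integral_cut[OF S, symmetric] integral_cut[OF shift_set_measurable[OF S], symmetric]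
    by (simp add: shift_set_def cong: if_cong)
qed

lemma test_function_shift:
  assumes "test_function S \<phi>"
  shows "test_function (shift_set t S) (\<lambda>x. \<phi> (x - t))"
    "frechet_derivative (\<lambda>x. \<phi> (x - t)) (at x) e = frechet_derivative \<phi> (at (x - t)) e"
proof -
  have C: "Ck k \<phi>" for k by (rule test_functionD(1)[OF assms])
  obtain K where K: "compact K" "K \<subseteq> S" "\<And>x. x \<notin> K \<Longrightarrow> \<phi> x = 0"
    using assms unfolding test_function_def by blast
  show "test_function (shift_set t S) (\<lambda>x. \<phi> (x - t))"
  proof (rule test_functionI)
    show "Ck k (\<lambda>x. \<phi> (x - t))" for k using Ck_affine[OF C, of k 1 "- t"] by simp
    show "compact ((+) t ` K)" by (rule compact_translation[OF K(1)])
    show "(+) t ` K \<subseteq> shift_set t S" using K(2) by (auto simp: shift_set_def)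
    show "\<phi> (x - t) = 0" if "x \<notin> (+) t ` K" for x
    proof (rule K(3))
      show "x - t \<notin> K" using that image_eqI[of x "(+) t" "x - t" K] by auto
    qed
  qed
  show "frechet_derivative (\<lambda>x. \<phi> (x - t)) (at x) e = frechet_derivative \<phi> (at (x - t)) e"
    using frechet_derivative_affine[OF C[of "Suc 0"], of 1 "- t" x e] by simp
qed

lemma shift_set_shift_set: "shift_set s (shift_set t S) = shift_set (s + t) S"
  by (auto simp: shift_set_def diff_diff_eq)

lemma shift_set_0: "shift_set 0 S = S"
  by (simp add: shift_set_def)

lemma has_weak_derivative_shift:
  assumes S: "S \<in> sets lebesgue" and e: "e \<in> Basis" and u: "u \<in> L2 S" "g \<in> L2 S" "has_weak_derivative S e u g"
  shows "has_weak_derivative (shift_set t S) e (\<lambda>x. u (x - t)) (\<lambda>x. g (x - t))"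
  unfolding has_weak_derivative_iff
proof (intro allI impI)
  fix \<phi> assume \<phi>: "test_function (shift_set t S) \<phi>"
  have t: "test_function S (\<lambda>x. \<phi> (x + t))"
    using test_function_shift(1)[OF \<phi>, of "- t"] by (simp add: shift_set_shift_set shift_set_0)
  have d: "frechet_derivative (\<lambda>x. \<phi> (x + t)) (at x) e = frechet_derivative \<phi> (at (x + t)) e" for x
    using test_function_shift(2)[OF \<phi>, of "- t"] by simp
  note T1 = test_function_in_L2(1)[OF S t] and T2 = test_function_in_L2(2)[OF S t e]
  have "L2_inner (shift_set t S) (\<lambda>x. u (x - t)) (\<lambda>x. complex_of_real (frechet_derivative \<phi> (at x) e))
      = L2_inner S u (\<lambda>x. complex_of_real (frechet_derivative (\<lambda>x. \<phi> (x + t)) (at x) e))"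
    using L2_inner_shift[OF S u(1) T2, of t] by (simp add: d)
  also have "\<dots> = - L2_inner S g (\<lambda>x. complex_of_real (\<phi> (x + t)))"
    using u(3) t unfolding has_weak_derivative_iff by blast
  also have "L2_inner S g (\<lambda>x. complex_of_real (\<phi> (x + t))) = L2_inner (shift_set t S) (\<lambda>x. g (x - t)) (\<lambda>x. complex_of_real (\<phi> x))"
    using L2_inner_shift[OF S u(2) T1, of t] by simp
  finally show "L2_inner (shift_set t S) (\<lambda>x. u (x - t)) (\<lambda>x. complex_of_real (frechet_derivative \<phi> (at x) e))
      = - L2_inner (shift_set t S) (\<lambda>x. g (x - t)) (\<lambda>x. complex_of_real (\<phi> x))" .
qed

lemma H1_shift:
  assumes O: "open \<Omega>" and u: "u \<in> H1 \<Omega>"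
  shows "(\<lambda>x. u (x - t)) \<in> H1 (shift_set t \<Omega>)"
    "e \<in> Basis \<Longrightarrow> grad (shift_set t \<Omega>) e (\<lambda>x. u (x - t)) = lsq_of (shift_set t \<Omega>) (\<lambda>x. weak_derivative \<Omega> e u (x - t))"
proof -
  note S = open_sets_lebesgue[OF O]
  show u': "(\<lambda>x. u (x - t)) \<in> H1 (shift_set t \<Omega>)"
    by (rule H1I[OF L2_shift[OF S H1D(1)[OF u]] L2_shift[OF S H1D(2)[OF u]]
          has_weak_derivative_shift[OF S _ H1D(1)[OF u] H1D(2)[OF u] H1D(3)[OF u]]])
  show "grad (shift_set t \<Omega>) e (\<lambda>x. u (x - t)) = lsq_of (shift_set t \<Omega>) (\<lambda>x. weak_derivative \<Omega> e u (x - t))"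
    if e: "e \<in> Basis"
    by (rule grad_eqI[OF open_shift_set[OF O] e u' L2_shift[OF S H1D(2)[OF u e]]
          has_weak_derivative_shift[OF S e H1D(1)[OF u] H1D(2)[OF u e] H1D(3)[OF u e]]])
qed

lemma norm_lsq_of_shift:
  assumes S: "S \<in> sets lebesgue" and u: "u \<in> L2 S"
  shows "norm (lsq_of (shift_set t S) (\<lambda>x. u (x - t))) = norm (lsq_of S u)"
  by (simp add: norm_lsq_of[OF S u] norm_lsq_of[OF shift_set_measurable[OF S] L2_shift[OF S u]]
      L2_norm_def L2_inner_shift[OF S u u])

lemma H1_norm_shift:
  assumes O: "open \<Omega>" and u: "u \<in> H1 \<Omega>"
  shows "H1_norm (shift_set t \<Omega>) (\<lambda>x. u (x - t)) = H1_norm \<Omega> u"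
proof -
  note S = open_sets_lebesgue[OF O]
  have "(H1_norm (shift_set t \<Omega>) (\<lambda>x. u (x - t)))\<^sup>2 = (H1_norm \<Omega> u)\<^sup>2"
    unfolding H1_norm_square[OF O u] H1_norm_square[OF open_shift_set[OF O] H1_shift(1)[OF O u]]
    using norm_lsq_of_shift[OF S H1D(2)[OF u], of _ t]
    by (simp add: H1_shift(2)[OF O u] norm_lsq_of_shift[OF S H1D(1)[OF u]]) (simp add: grad_def)
  then show ?thesis
    using H1_norm_nonneg[OF O u] H1_norm_nonneg[OF open_shift_set[OF O] H1_shift(1)[OF O u], of t]
    by simp
qed

section \<open>Traces\<close>

definition e1 :: space where "e1 = (1, 0, 0)"
definition e2 :: space where "e2 = (0, 1, 0)"
definition e3 :: space where "e3 = (0, 0, 1)"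

lemma Basis_space: "(Basis :: space set) = {e1, e2, e3}"
  by (auto simp: Basis_prod_def e1_def e2_def e3_def zero_prod_def)

lemma e_in_Basis: "e1 \<in> Basis" "e2 \<in> Basis" "e3 \<in> Basis"
  by (simp_all add: Basis_space)

lemma sum_Basis_space: "(\<Sum>e\<in>(Basis::space set). f e) = f e1 + f e2 + (f e3 :: 'a::comm_monoid_add)"
  by (simp add: Basis_space e1_def e2_def e3_def add.assoc)

definition grad3 :: "space set \<Rightarrow> (space \<Rightarrow> complex) \<Rightarrow> space lsq \<times> space lsq \<times> space lsq" where
  "grad3 \<Omega> u = (grad \<Omega> e1 u, grad \<Omega> e2 u, grad \<Omega> e3 u)"

lemma sum_norm_grad: "(\<Sum>e\<in>Basis. (norm (grad \<Omega> e u))\<^sup>2) = (norm (grad3 \<Omega> u))\<^sup>2"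
  by (simp add: sum_Basis_space grad3_def norm_prod_def add.assoc)

definition restrict_plane :: "(space \<Rightarrow> complex) \<Rightarrow> plane \<Rightarrow> complex" where
  "restrict_plane U = (\<lambda>(x1, x2). U (x1, x2, 0))"

lemma free_surface_vimage: "free_surface \<Omega> = (\<lambda>y. (fst y, snd y, 0)) -` frontier \<Omega>"
  by (auto simp: free_surface_def)

lemma closed_free_surface: "closed (free_surface \<Omega>)"
  unfolding free_surface_vimage by (intro continuous_closed_vimage continuous_intros) simp

lemma free_surface_measurable: "free_surface \<Omega> \<in> sets lebesgue"
  by (intro sets_completionI_sets) (simp add: closed_free_surface)

lemma bounded_free_surface:
  assumes "bounded \<Omega>"
  shows "bounded (free_surface \<Omega>)"
proof -
  have "bounded (frontier \<Omega>)" 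
    using bounded_closure[OF assms] by (rule bounded_subset) (auto simp: frontier_def)
  then obtain B where B: "\<And>x. x \<in> frontier \<Omega> \<Longrightarrow> norm x \<le> B" unfolding bounded_iff by blast
  have "norm y \<le> B" if "y \<in> free_surface \<Omega>" for y
  proof -
    have "norm y = norm (fst y, snd y, 0::real)" by (simp add: norm_prod_def)
    also have "\<dots> \<le> B" using that by (intro B) (simp add: free_surface_vimage)
    finally show ?thesis .
  qed
  then show ?thesis unfolding bounded_iff by blast
qed

lemma bounded_on_compact:
  fixes f :: "'a::topological_space \<Rightarrow> 'b::real_normed_vector"
  assumes "compact K" "continuous_on K f"
  obtains M where "\<And>x. x \<in> K \<Longrightarrow> norm (f x) \<le> M"
proof -
  have "bounded (f ` K)" by (intro compact_imp_bounded compact_continuous_image assms)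
  then show ?thesis using that unfolding bounded_iff by blast
qed

locale bounded_domain =
  fixes \<Omega> :: "space set"
  assumes O: "open \<Omega>" and bdd: "bounded \<Omega>"
begin

lemma restrict_plane_L2:
  assumes "continuous_on (closure \<Omega>) U"
  shows "restrict_plane U \<in> L2 (free_surface \<Omega>)"
proof -
  have "compact (closure \<Omega>)" using bdd by simp
  then obtain M where M: "\<And>x. x \<in> closure \<Omega> \<Longrightarrow> cmod (U x) \<le> M" using bounded_on_compact[OF _ assms] by blast
  have sub: "(fst y, snd y, 0) \<in> closure \<Omega>" if "y \<in> free_surface \<Omega>" for y
    using that by (auto simp: free_surface_vimage frontier_def)
  have eq: "restrict_plane U = U \<circ> (\<lambda>y. (fst y, snd y, 0))" by (auto simp: restrict_plane_def)
  show ?thesis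
  proof (rule L2_bounded[OF free_surface_measurable])
    have "continuous_on (free_surface \<Omega>) (restrict_plane U)"
      unfolding eq using sub by (intro continuous_on_compose continuous_intros continuous_on_subset[OF assms]) auto
    then show "restrict_plane U \<in> borel_measurable (lebesgue_on (free_surface \<Omega>))"
      by (rule continuous_imp_measurable_on_sets_lebesgue[OF _ free_surface_measurable])
    show "free_surface \<Omega> \<in> lmeasurable"
      using closed_free_surface bounded_free_surface[OF bdd] by (intro lmeasurable_compact) (simp add: compact_eq_bounded_closed)
    show "cmod (restrict_plane U y) \<le> M" if "y \<in> free_surface \<Omega>" for y
      unfolding eq o_def by (rule M[OF sub[OF that]])
  qed auto
qed

text \<open>Function and gradient together carry the norm \<open>H1_norm\<close>; with the trace
  appended, having a trace becomes membership in a closed set of a Hilbert space.\<close>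

definition graph :: "(space \<Rightarrow> complex) \<Rightarrow> (plane \<Rightarrow> complex) \<Rightarrow> space lsq \<times> (space lsq \<times> space lsq \<times> space lsq) \<times> plane lsq" where
  "graph u g = (lsq_of \<Omega> u, grad3 \<Omega> u, lsq_of (free_surface \<Omega>) g)"

definition continuous_graph :: "(space lsq \<times> (space lsq \<times> space lsq \<times> space lsq) \<times> plane lsq) set" where
  "continuous_graph = {graph U (restrict_plane U) |U. U \<in> H1 \<Omega> \<and> continuous_on (closure \<Omega>) U}"

lemma graph_add:
  "u \<in> H1 \<Omega> \<Longrightarrow> v \<in> H1 \<Omega> \<Longrightarrow> g \<in> L2 (free_surface \<Omega>) \<Longrightarrow> h \<in> L2 (free_surface \<Omega>) \<Longrightarrow>
   graph (\<lambda>x. u x + v x) (\<lambda>y. g y + h y) = graph u g + graph v h"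
  by (simp add: graph_def grad3_def grad_add[OF O] e_in_Basis lsq_of_add[OF open_sets_lebesgue[OF O]]
      lsq_of_add[OF free_surface_measurable] H1D)

lemma graph_diff:
  "u \<in> H1 \<Omega> \<Longrightarrow> v \<in> H1 \<Omega> \<Longrightarrow> g \<in> L2 (free_surface \<Omega>) \<Longrightarrow> h \<in> L2 (free_surface \<Omega>) \<Longrightarrow>
   graph (\<lambda>x. u x - v x) (\<lambda>y. g y - h y) = graph u g - graph v h"
  by (simp add: graph_def grad3_def grad_diff[OF O] e_in_Basis lsq_of_diff[OF open_sets_lebesgue[OF O]]
      lsq_of_diff[OF free_surface_measurable] H1D)

lemma H1_norm_grad3: "u \<in> H1 \<Omega> \<Longrightarrow> (H1_norm \<Omega> u)\<^sup>2 = (norm (lsq_of \<Omega> u))\<^sup>2 + (norm (grad3 \<Omega> u))\<^sup>2"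
  by (simp add: H1_norm_square[OF O] sum_norm_grad)

lemma graph_tendsto_iff:
  assumes u: "\<And>n. u n \<in> H1 \<Omega>" "l \<in> H1 \<Omega>" and g: "\<And>n. g n \<in> L2 (free_surface \<Omega>)" "h \<in> L2 (free_surface \<Omega>)"
  shows "(\<lambda>n. graph (u n) (g n)) \<longlonglongrightarrow> graph l h \<longleftrightarrow>
    (\<lambda>n. H1_norm \<Omega> (\<lambda>x. u n x - l x)) \<longlonglongrightarrow> 0 \<and> (\<lambda>n. L2_norm (free_surface \<Omega>) (\<lambda>y. g n y - h y)) \<longlonglongrightarrow> 0"
    (is "?L \<longleftrightarrow> ?R")
proof -
  have eq: "(norm (graph (u n) (g n) - graph l h))\<^sup>2
      = (H1_norm \<Omega> (\<lambda>x. u n x - l x))\<^sup>2 + (L2_norm (free_surface \<Omega>) (\<lambda>y. g n y - h y))\<^sup>2" for n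
    unfolding graph_diff[OF u g, symmetric]
    by (simp add: graph_def norm_prod_def H1_norm_grad3[OF H1_diff[OF O u]] norm_lsq_of[OF free_surface_measurable L2_diff[OF g]])
  have H: "0 \<le> H1_norm \<Omega> (\<lambda>x. u n x - l x)" for n by (rule H1_norm_nonneg[OF O H1_diff[OF O u]])
  have L: "0 \<le> L2_norm (free_surface \<Omega>) (\<lambda>y. g n y - h y)" for n by (simp add: L2_norm_def Re_L2_inner_self)
  have N: "norm (graph (u n) (g n) - graph l h) = sqrt ((H1_norm \<Omega> (\<lambda>x. u n x - l x))\<^sup>2 + (L2_norm (free_surface \<Omega>) (\<lambda>y. g n y - h y))\<^sup>2)" for n
    unfolding eq[symmetric] by simp
  have "?L \<longleftrightarrow> (\<lambda>n. norm (graph (u n) (g n) - graph l h)) \<longlonglongrightarrow> 0"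
    unfolding tendsto_norm_zero_iff by (rule LIM_zero_iff[symmetric])
  also have "\<dots> \<longleftrightarrow> ?R"
  proof (intro iffI conjI)
    assume T: "(\<lambda>n. norm (graph (u n) (g n) - graph l h)) \<longlonglongrightarrow> 0"
    show "(\<lambda>n. H1_norm \<Omega> (\<lambda>x. u n x - l x)) \<longlonglongrightarrow> 0"
      by (rule Lim_null_comparison[OF _ T]) (simp add: N H real_le_rsqrt)
    show "(\<lambda>n. L2_norm (free_surface \<Omega>) (\<lambda>y. g n y - h y)) \<longlonglongrightarrow> 0"
      by (rule Lim_null_comparison[OF _ T]) (simp add: N L real_le_rsqrt)
  next
    assume R: ?R
    have "(\<lambda>n. sqrt ((H1_norm \<Omega> (\<lambda>x. u n x - l x))\<^sup>2 + (L2_norm (free_surface \<Omega>) (\<lambda>y. g n y - h y))\<^sup>2)) \<longlonglongrightarrow> sqrt (0\<^sup>2 + 0\<^sup>2)"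
      using R by (intro tendsto_intros) auto
    then show "(\<lambda>n. norm (graph (u n) (g n) - graph l h)) \<longlonglongrightarrow> 0" by (simp add: N)
  qed
  finally show ?thesis .
qed

text \<open>\<open>has_trace\<close> describes limits of continuous functions in the graph norm,
  that is, sequential closure. In this form limits of traces are again traces by general
  topology.\<close>

lemma has_trace_iff:
  "has_trace \<Omega> u g \<longleftrightarrow> u \<in> H1 \<Omega> \<and> g \<in> L2 (free_surface \<Omega>) \<and> graph u g \<in> closure continuous_graph"
proof (cases "u \<in> H1 \<Omega> \<and> g \<in> L2 (free_surface \<Omega>)")
  case True
  then have u: "u \<in> H1 \<Omega>" and g: "g \<in> L2 (free_surface \<Omega>)" by auto
  have rp: "(\<lambda>(x1, x2). U (x1, x2, 0) - g (x1, x2)) = (\<lambda>y. restrict_plane U y - g y)" for U :: "space \<Rightarrow> complex"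
    by (auto simp: restrict_plane_def)
  have "graph u g \<in> closure continuous_graph \<longleftrightarrow>
      (\<exists>U. (\<forall>n. U n \<in> H1 \<Omega> \<and> continuous_on (closure \<Omega>) (U n)) \<and> (\<lambda>n. graph (U n) (restrict_plane (U n))) \<longlonglongrightarrow> graph u g)"
  proof
    assume "graph u g \<in> closure continuous_graph"
    then obtain f where f: "\<And>n. f n \<in> continuous_graph" "f \<longlonglongrightarrow> graph u g" by (auto simp: closure_sequential)
    have "\<forall>n. \<exists>U. U \<in> H1 \<Omega> \<and> continuous_on (closure \<Omega>) U \<and> f n = graph U (restrict_plane U)"
      using f(1) unfolding continuous_graph_def by blast
    from choice[OF this] obtain U where U: "\<And>n. U n \<in> H1 \<Omega>" "\<And>n. continuous_on (closure \<Omega>) (U n)"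
      "\<And>n. f n = graph (U n) (restrict_plane (U n))" by blast
    have "f = (\<lambda>n. graph (U n) (restrict_plane (U n)))" by (rule ext) (rule U(3))
    then have "(\<lambda>n. graph (U n) (restrict_plane (U n))) \<longlonglongrightarrow> graph u g" using f(2) by simp
    then show "\<exists>U. (\<forall>n. U n \<in> H1 \<Omega> \<and> continuous_on (closure \<Omega>) (U n)) \<and> (\<lambda>n. graph (U n) (restrict_plane (U n))) \<longlonglongrightarrow> graph u g"
      using U(1,2) by blast
  next
    assume "\<exists>U. (\<forall>n. U n \<in> H1 \<Omega> \<and> continuous_on (closure \<Omega>) (U n)) \<and> (\<lambda>n. graph (U n) (restrict_plane (U n))) \<longlonglongrightarrow> graph u g"
    then obtain U where U: "\<And>n. U n \<in> H1 \<Omega> \<and> continuous_on (closure \<Omega>) (U n)"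
      and L: "(\<lambda>n. graph (U n) (restrict_plane (U n))) \<longlonglongrightarrow> graph u g" by blast
    have "\<forall>n. graph (U n) (restrict_plane (U n)) \<in> continuous_graph"
      using U unfolding continuous_graph_def by blast
    then show "graph u g \<in> closure continuous_graph"
      unfolding closure_sequential using L by (intro exI[of _ "\<lambda>n. graph (U n) (restrict_plane (U n))"]) simp
  qed
  also have "\<dots> \<longleftrightarrow> has_trace \<Omega> u g"
    unfolding has_trace_def rp
  proof -
    have eq: "(\<lambda>n. graph (U n) (restrict_plane (U n))) \<longlonglongrightarrow> graph u g \<longleftrightarrow>
        (\<lambda>n. H1_norm \<Omega> (\<lambda>x. U n x - u x)) \<longlonglongrightarrow> 0 \<and> (\<lambda>n. L2_norm (free_surface \<Omega>) (\<lambda>y. restrict_plane (U n) y - g y)) \<longlonglongrightarrow> 0"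
      if "\<forall>n. U n \<in> H1 \<Omega> \<and> continuous_on (closure \<Omega>) (U n)" for U :: "nat \<Rightarrow> space \<Rightarrow> complex"
      by (rule graph_tendsto_iff[OF _ u _ g]) (use that restrict_plane_L2 in blast)+
    have "(\<exists>U. (\<forall>n. U n \<in> H1 \<Omega> \<and> continuous_on (closure \<Omega>) (U n)) \<and> (\<lambda>n. graph (U n) (restrict_plane (U n))) \<longlonglongrightarrow> graph u g) \<longleftrightarrow>
      (\<exists>U. (\<forall>n. U n \<in> H1 \<Omega> \<and> continuous_on (closure \<Omega>) (U n)) \<and>
        (\<lambda>n. H1_norm \<Omega> (\<lambda>x. U n x - u x)) \<longlonglongrightarrow> 0 \<and> (\<lambda>n. L2_norm (free_surface \<Omega>) (\<lambda>y. restrict_plane (U n) y - g y)) \<longlonglongrightarrow> 0)"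
      by (intro ex_cong1 conj_cong refl eq)
    then show "(\<exists>U. (\<forall>n. U n \<in> H1 \<Omega> \<and> continuous_on (closure \<Omega>) (U n)) \<and> (\<lambda>n. graph (U n) (restrict_plane (U n))) \<longlonglongrightarrow> graph u g) \<longleftrightarrow>
      u \<in> H1 \<Omega> \<and> g \<in> L2 (free_surface \<Omega>) \<and> (\<exists>U. (\<forall>n. U n \<in> H1 \<Omega> \<and> continuous_on (closure \<Omega>) (U n)) \<and>
        (\<lambda>n. H1_norm \<Omega> (\<lambda>x. U n x - u x)) \<longlonglongrightarrow> 0 \<and> (\<lambda>n. L2_norm (free_surface \<Omega>) (\<lambda>y. restrict_plane (U n) y - g y)) \<longlonglongrightarrow> 0)"
      by (simp only: u g simp_thms)
  qed
  finally show ?thesis using u g by simp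
qed (auto simp: has_trace_def)

end

section \<open>Linearity, closedness, translation and uniqueness of traces\<close>

lemma norm_lsq_of_scale:
  assumes S: "S \<in> sets lebesgue" and u: "u \<in> L2 S"
  shows "norm (lsq_of S (\<lambda>x. c * u x)) = cmod c * norm (lsq_of S u)"
proof -
  have "(norm (lsq_of S (\<lambda>x. c * u x)))\<^sup>2 = (cmod c * norm (lsq_of S u))\<^sup>2"
    unfolding power_mult_distrib norm_lsq_of_square[OF S u] norm_lsq_of_square[OF S L2_scale[OF u]]
    by (simp add: norm_mult power_mult_distrib)
  then show ?thesis by (simp add: power2_eq_iff_nonneg)
qed

lemma shift_set_image: "shift_set t S = (+) t ` S"
  by (auto simp: shift_set_def image_iff) (metis add.commute diff_add_cancel)

lemma frontier_shift_set: "frontier (shift_set t S) = shift_set t (frontier (S::'a::euclidean_space set))"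
  unfolding shift_set_image by (rule frontier_translation)

lemma closure_shift_set: "closure (shift_set t S) = shift_set t (closure (S::'a::euclidean_space set))"
  unfolding shift_set_image by (rule closure_translation)

lemma free_surface_shift_set: "free_surface (shift_set (a, 0, 0) \<Omega>) = shift_set (a, 0) (free_surface \<Omega>)"
  unfolding free_surface_vimage frontier_shift_set by (auto simp: shift_set_def)

lemma has_traceD:
  assumes "has_trace \<Omega> u g"
  shows "u \<in> H1 \<Omega>" "g \<in> L2 (free_surface \<Omega>)"
  using assms by (simp_all add: has_trace_def)

lemma has_trace_sequence:
  "has_trace \<Omega> u g \<longleftrightarrow> u \<in> H1 \<Omega> \<and> g \<in> L2 (free_surface \<Omega>) \<and>
     (\<exists>U :: nat \<Rightarrow> space \<Rightarrow> complex. (\<forall>n. U n \<in> H1 \<Omega> \<and> continuous_on (closure \<Omega>) (U n)) \<and>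
        (\<lambda>n. H1_norm \<Omega> (\<lambda>x. U n x - u x)) \<longlonglongrightarrow> 0 \<and>
        (\<lambda>n. L2_norm (free_surface \<Omega>) (\<lambda>y. restrict_plane (U n) y - g y)) \<longlonglongrightarrow> 0)"
proof -
  have "(\<lambda>(x1, x2). V (x1, x2, 0) - g (x1, x2)) = (\<lambda>y. restrict_plane V y - g y)" for V
    by (auto simp: restrict_plane_def)
  then show ?thesis unfolding has_trace_def by simp
qed

context bounded_domain
begin

lemma grad_complex_scale:
  "e \<in> Basis \<Longrightarrow> u \<in> H1 \<Omega> \<Longrightarrow> norm (grad \<Omega> e (\<lambda>x. c * u x)) = cmod c * norm (grad \<Omega> e u)"
  by (simp add: grad_scale[OF O] norm_lsq_of_scale[OF open_sets_lebesgue[OF O]] H1D(2)) (simp add: grad_def)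

lemma H1_norm_scale:
  assumes u: "u \<in> H1 \<Omega>"
  shows "H1_norm \<Omega> (\<lambda>x. c * u x) = cmod c * H1_norm \<Omega> u"
proof -
  have "(H1_norm \<Omega> (\<lambda>x. c * u x))\<^sup>2 = (cmod c * H1_norm \<Omega> u)\<^sup>2"
    unfolding power_mult_distrib H1_norm_square[OF O u] H1_norm_square[OF O H1_scale[OF O u]]
    using norm_lsq_of_scale[OF open_sets_lebesgue[OF O] H1D(1)[OF u], of c] u
    by (simp add: grad_complex_scale power_mult_distrib distrib_left sum_distrib_left)
  then show ?thesis
    using H1_norm_nonneg[OF O u] H1_norm_nonneg[OF O H1_scale[OF O u]] by (simp add: power2_eq_iff_nonneg)
qed

lemma has_trace_continuous:
  assumes "U \<in> H1 \<Omega>" "continuous_on (closure \<Omega>) U"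
  shows "has_trace \<Omega> U (restrict_plane U)"
proof -
  have "graph U (restrict_plane U) \<in> continuous_graph" using assms unfolding continuous_graph_def by blast
  then show ?thesis unfolding has_trace_iff using assms(1) restrict_plane_L2[OF assms(2)] closure_subset by blast
qed

lemma has_trace_add:
  assumes t: "has_trace \<Omega> u g" "has_trace \<Omega> v h"
  shows "has_trace \<Omega> (\<lambda>x. u x + v x) (\<lambda>y. g y + h y)"
proof -
  have u: "u \<in> H1 \<Omega>" "v \<in> H1 \<Omega>" "g \<in> L2 (free_surface \<Omega>)" "h \<in> L2 (free_surface \<Omega>)"
    and c: "graph u g \<in> closure continuous_graph" "graph v h \<in> closure continuous_graph"
    using t by (auto simp: has_trace_iff)
  obtain a b where a: "\<forall>n. a n \<in> continuous_graph" "a \<longlonglongrightarrow> graph u g" and b: "\<forall>n. b n \<in> continuous_graph" "b \<longlonglongrightarrow> graph v h"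
    using c unfolding closure_sequential by blast
  have "x + y \<in> continuous_graph" if xy: "x \<in> continuous_graph" "y \<in> continuous_graph" for x y
  proof -
    obtain U V where U: "U \<in> H1 \<Omega>" "continuous_on (closure \<Omega>) U" "x = graph U (restrict_plane U)"
      and V: "V \<in> H1 \<Omega>" "continuous_on (closure \<Omega>) V" "y = graph V (restrict_plane V)"
      using xy unfolding continuous_graph_def by blast
    have eq: "(\<lambda>y. restrict_plane U y + restrict_plane V y) = restrict_plane (\<lambda>x. U x + V x)"
      by (auto simp: restrict_plane_def)
    have "x + y = graph (\<lambda>x. U x + V x) (restrict_plane (\<lambda>x. U x + V x))"
      unfolding U(3) V(3) eq[symmetric]
      by (rule graph_add[symmetric]) (intro U V restrict_plane_L2)+
    moreover have "(\<lambda>x. U x + V x) \<in> H1 \<Omega>" "continuous_on (closure \<Omega>) (\<lambda>x. U x + V x)"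
      by (intro H1_add O U V continuous_on_add)+
    ultimately show ?thesis unfolding continuous_graph_def by blast
  qed
  then have "\<forall>n. a n + b n \<in> continuous_graph" using a(1) b(1) by blast
  moreover have "(\<lambda>n. a n + b n) \<longlonglongrightarrow> graph u g + graph v h" by (intro tendsto_add a b)
  ultimately have "graph u g + graph v h \<in> closure continuous_graph"
    unfolding closure_sequential by (intro exI[of _ "\<lambda>n. a n + b n"] conjI)
  then show ?thesis
    unfolding has_trace_iff graph_add[OF u] by (intro conjI H1_add O L2_add u)
qed

lemma has_trace_scale:
  assumes t: "has_trace \<Omega> u g"
  shows "has_trace \<Omega> (\<lambda>x. c * u x) (\<lambda>y. c * g y)"
proof -
  obtain U where u: "u \<in> H1 \<Omega>" "g \<in> L2 (free_surface \<Omega>)" and U: "\<And>n. U n \<in> H1 \<Omega>" "\<And>n. continuous_on (closure \<Omega>) (U n)"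
    "(\<lambda>n. H1_norm \<Omega> (\<lambda>x. U n x - u x)) \<longlonglongrightarrow> 0" "(\<lambda>n. L2_norm (free_surface \<Omega>) (\<lambda>y. restrict_plane (U n) y - g y)) \<longlonglongrightarrow> 0"
    using t unfolding has_trace_sequence by blast
  have 1: "H1_norm \<Omega> (\<lambda>x. c * U n x - c * u x) = cmod c * H1_norm \<Omega> (\<lambda>x. U n x - u x)" for n
    unfolding right_diff_distrib[symmetric] by (rule H1_norm_scale[OF H1_diff[OF O U(1) u(1)]])
  have 2: "L2_norm (free_surface \<Omega>) (\<lambda>y. restrict_plane (\<lambda>x. c * U n x) y - c * g y)
      = cmod c * L2_norm (free_surface \<Omega>) (\<lambda>y. restrict_plane (U n) y - g y)" for n
  proof -
    have L: "(\<lambda>y. restrict_plane (U n) y - g y) \<in> L2 (free_surface \<Omega>)"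
      by (intro L2_diff restrict_plane_L2 U(2) u(2))
    have eq: "(\<lambda>y. restrict_plane (\<lambda>x. c * U n x) y - c * g y) = (\<lambda>y. c * (restrict_plane (U n) y - g y))"
      by (auto simp: restrict_plane_def right_diff_distrib)
    show ?thesis unfolding eq
      using norm_lsq_of_scale[OF free_surface_measurable L, of c]
      by (simp only: norm_lsq_of[OF free_surface_measurable L] norm_lsq_of[OF free_surface_measurable L2_scale[OF L]])
  qed
  show ?thesis
    unfolding has_trace_sequence
  proof (intro conjI exI[of _ "\<lambda>n x. c * U n x"] allI)
    show "(\<lambda>n. H1_norm \<Omega> (\<lambda>x. c * U n x - c * u x)) \<longlonglongrightarrow> 0"
      unfolding 1 using tendsto_mult_left[OF U(3), of "cmod c"] by simp
    show "(\<lambda>n. L2_norm (free_surface \<Omega>) (\<lambda>y. restrict_plane (\<lambda>x. c * U n x) y - c * g y)) \<longlonglongrightarrow> 0"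
      unfolding 2 using tendsto_mult_left[OF U(4), of "cmod c"] by simp
    show "(\<lambda>x. c * u x) \<in> H1 \<Omega>" by (rule H1_scale[OF O u(1)])
    show "(\<lambda>y. c * g y) \<in> L2 (free_surface \<Omega>)" by (rule L2_scale[OF u(2)])
    show "(\<lambda>x. c * U n x) \<in> H1 \<Omega>" for n by (rule H1_scale[OF O U(1)])
    show "continuous_on (closure \<Omega>) (\<lambda>x. c * U n x)" for n by (intro continuous_on_mult continuous_on_const U(2))
  qed
qed

lemma has_trace_diff:
  "has_trace \<Omega> u g \<Longrightarrow> has_trace \<Omega> v h \<Longrightarrow> has_trace \<Omega> (\<lambda>x. u x - v x) (\<lambda>y. g y - h y)"
  using has_trace_add[OF _ has_trace_scale, of u g v h "-1"] by simp

lemma has_trace_closed: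
  assumes t: "\<And>n. has_trace \<Omega> (u n) (g n)" and l: "l \<in> H1 \<Omega>" "h \<in> L2 (free_surface \<Omega>)"
    and lim: "(\<lambda>n. graph (u n) (g n)) \<longlonglongrightarrow> graph l h"
  shows "has_trace \<Omega> l h"
proof -
  have "graph (u n) (g n) \<in> closure continuous_graph" for n using t[of n] by (simp add: has_trace_iff)
  then have "graph l h \<in> closure continuous_graph" by (rule closed_sequentially[OF closed_closure _ lim])
  then show ?thesis using l by (simp add: has_trace_iff)
qed

lemma has_trace_cong:
  assumes t: "has_trace \<Omega> u g" and "v \<in> H1 \<Omega>" "h \<in> L2 (free_surface \<Omega>)"
    "lsq_of \<Omega> u = lsq_of \<Omega> v" "lsq_of (free_surface \<Omega>) g = lsq_of (free_surface \<Omega>) h"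
  shows "has_trace \<Omega> v h"
proof -
  have u: "u \<in> H1 \<Omega>" using t by (simp add: has_trace_iff)
  have "grad3 \<Omega> u = grad3 \<Omega> v"
    unfolding grad3_def using grad_cong[OF O _ u assms(2,4)] e_in_Basis by simp
  then have "graph u g = graph v h" unfolding graph_def using assms(4,5) by simp
  then show ?thesis using t assms(2,3) by (simp add: has_trace_iff)
qed

lemma bounded_domain_shift: "bounded_domain (shift_set t \<Omega>)"
proof
  show "open (shift_set t \<Omega>)" by (rule open_shift_set[OF O])
  show "bounded (shift_set t \<Omega>)" unfolding shift_set_image by (rule bounded_translation[OF bdd])
qed

lemma has_trace_shift:
  assumes t: "has_trace \<Omega> u g"
  shows "has_trace (shift_set (a, 0, 0) \<Omega>) (\<lambda>x. u (x - (a, 0, 0))) (\<lambda>y. g (y - (a, 0)))"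
proof -
  let ?t = "(a, 0, 0) :: space" and ?s = "(a, 0) :: plane"
  obtain U where u: "u \<in> H1 \<Omega>" "g \<in> L2 (free_surface \<Omega>)" and U: "\<And>n. U n \<in> H1 \<Omega>" "\<And>n. continuous_on (closure \<Omega>) (U n)"
    "(\<lambda>n. H1_norm \<Omega> (\<lambda>x. U n x - u x)) \<longlonglongrightarrow> 0" "(\<lambda>n. L2_norm (free_surface \<Omega>) (\<lambda>y. restrict_plane (U n) y - g y)) \<longlonglongrightarrow> 0"
    using t unfolding has_trace_sequence by blast
  have 2: "L2_norm (shift_set ?s (free_surface \<Omega>)) (\<lambda>y. restrict_plane (\<lambda>x. U n (x - ?t)) y - g (y - ?s))
      = L2_norm (free_surface \<Omega>) (\<lambda>y. restrict_plane (U n) y - g y)" for n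
  proof -
    have L: "(\<lambda>y. restrict_plane (U n) y - g y) \<in> L2 (free_surface \<Omega>)"
      by (intro L2_diff restrict_plane_L2 U(2) u(2))
    have eq: "(\<lambda>y. restrict_plane (\<lambda>x. U n (x - ?t)) y - g (y - ?s)) = (\<lambda>y. (\<lambda>y. restrict_plane (U n) y - g y) (y - ?s))"
      by (auto simp: restrict_plane_def)
    show ?thesis unfolding eq L2_norm_def L2_inner_shift[OF free_surface_measurable L L] ..
  qed
  show ?thesis
    unfolding has_trace_sequence free_surface_shift_set
  proof (intro conjI exI[of _ "\<lambda>n x. U n (x - ?t)"] allI)
    show "(\<lambda>n. H1_norm (shift_set ?t \<Omega>) (\<lambda>x. U n (x - ?t) - u (x - ?t))) \<longlonglongrightarrow> 0"
      using U(3) by (simp only: H1_norm_shift[OF O H1_diff[OF O U(1) u(1)]])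
    show "(\<lambda>n. L2_norm (shift_set ?s (free_surface \<Omega>)) (\<lambda>y. restrict_plane (\<lambda>x. U n (x - ?t)) y - g (y - ?s))) \<longlonglongrightarrow> 0"
      unfolding 2 using U(4) .
    show "(\<lambda>x. u (x - ?t)) \<in> H1 (shift_set ?t \<Omega>)" by (rule H1_shift[OF O u(1)])
    show "(\<lambda>y. g (y - ?s)) \<in> L2 (shift_set ?s (free_surface \<Omega>))" by (rule L2_shift[OF free_surface_measurable u(2)])
    show "(\<lambda>x. U n (x - ?t)) \<in> H1 (shift_set ?t \<Omega>)" for n by (rule H1_shift[OF O U(1)])
    show "continuous_on (closure (shift_set ?t \<Omega>)) (\<lambda>x. U n (x - ?t))" for n
      unfolding closure_shift_set
      by (rule continuous_on_compose2[OF U(2)]) (auto intro!: continuous_intros simp: shift_set_def)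
  qed
qed

text \<open>The constants are parameters so that all translated cells can share them: only uniform
  bounds can be summed over the infinitely many cells of the channel.\<close>

definition trace_bounds :: "real \<Rightarrow> real \<Rightarrow> bool" where
  "trace_bounds c C \<longleftrightarrow> 0 < c \<and> 0 < C \<and> (\<forall>u\<in>H1 \<Omega>. \<exists>g. has_trace \<Omega> u g) \<and>
    (\<forall>u g. has_trace \<Omega> u g \<longrightarrow> c * H1_norm \<Omega> u \<le> norm (grad3 \<Omega> u, lsq_of (free_surface \<Omega>) g) \<and>
      norm (grad3 \<Omega> u, lsq_of (free_surface \<Omega>) g) \<le> C * H1_norm \<Omega> u)"

lemma energy_norm:
  assumes "has_trace \<Omega> u g"
  shows "sqrt (Re (Dirichlet_form \<Omega> u u + L2_inner (free_surface \<Omega>) g g)) = norm (grad3 \<Omega> u, lsq_of (free_surface \<Omega>) g)"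
proof -
  have u: "u \<in> H1 \<Omega>" "g \<in> L2 (free_surface \<Omega>)" using assms by (auto simp: has_trace_iff)
  have "Re (Dirichlet_form \<Omega> u u + L2_inner (free_surface \<Omega>) g g) = (norm (grad3 \<Omega> u))\<^sup>2 + (norm (lsq_of (free_surface \<Omega>) g))\<^sup>2"
    using Re_Dirichlet_form[OF O u(1) u(1)] inner_lsq_of[OF free_surface_measurable u(2) u(2)]
    using sum_norm_grad[of \<Omega> u] unfolding power2_norm_eq_inner by simp
  then show ?thesis by (simp add: norm_prod_def)
qed

lemma trace_facts_imp_bounds:
  assumes "trace_facts \<Omega>"
  shows "\<exists>c C. trace_bounds c C"
proof -
  obtain c C where "0 < c" "0 < C" and cC: "\<forall>u\<in>H1 \<Omega>. \<forall>g. has_trace \<Omega> u g \<longrightarrow>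
        c * H1_norm \<Omega> u \<le> sqrt (Re (Dirichlet_form \<Omega> u u + L2_inner (free_surface \<Omega>) g g)) \<and>
        sqrt (Re (Dirichlet_form \<Omega> u u + L2_inner (free_surface \<Omega>) g g)) \<le> C * H1_norm \<Omega> u"
    using assms unfolding trace_facts_def by blast
  moreover have "\<forall>u\<in>H1 \<Omega>. \<exists>g. has_trace \<Omega> u g" using assms unfolding trace_facts_def by blast
  moreover have "u \<in> H1 \<Omega>" if "has_trace \<Omega> u g" for u g using that by (simp add: has_trace_iff)
  ultimately have "trace_bounds c C" unfolding trace_bounds_def using energy_norm by metis
  then show ?thesis by blast
qed

end

text \<open>Every function on the translated domain is the translate of one on \<Omega>, and
  translation preserves all norms involved, so the constants stay the same.\<close>

lemma (in bounded_domain) trace_bounds_shift: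
  assumes "trace_bounds c C"
  shows "bounded_domain.trace_bounds (shift_set (a, 0, 0) \<Omega>) c C"
proof -
  let ?t = "(a, 0, 0) :: space" and ?s = "(a, 0) :: plane"
  interpret sh: bounded_domain "shift_set ?t \<Omega>" by (rule bounded_domain_shift)
  have eq: "x - (- a, 0, 0) = x + ?t" "y - (- a, 0) = y + ?s" for x :: space and y :: plane
    by (simp_all add: prod_eq_iff)
  have z: "(- a, 0, 0) + ?t = 0" by (simp add: zero_prod_def)
  \<comment> \<open>Translation by \<open>- a\<close> undoes translation by \<open>a\<close>, so the
    one-sided lemma on translated traces gives both directions.\<close>
  have unshift: "has_trace \<Omega> (\<lambda>x. u (x + ?t)) (\<lambda>y. g (y + ?s))" if "has_trace (shift_set ?t \<Omega>) u g" for u g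
    using sh.has_trace_shift[OF that, of "- a"] unfolding shift_set_shift_set z shift_set_0 eq .
  have H1b: "(\<lambda>x. u (x + ?t)) \<in> H1 \<Omega>" if "u \<in> H1 (shift_set ?t \<Omega>)" for u
    using H1_shift(1)[OF sh.O that, of "(- a, 0, 0)"] unfolding shift_set_shift_set z shift_set_0 eq .
  have nrm: "norm (grad3 (shift_set ?t \<Omega>) u, lsq_of (free_surface (shift_set ?t \<Omega>)) g)
      = norm (grad3 \<Omega> (\<lambda>x. u (x + ?t)), lsq_of (free_surface \<Omega>) (\<lambda>y. g (y + ?s)))"
    "H1_norm (shift_set ?t \<Omega>) u = H1_norm \<Omega> (\<lambda>x. u (x + ?t))" if t: "has_trace (shift_set ?t \<Omega>) u g" for u g
  proof -
    let ?u = "\<lambda>x. u (x + ?t)" and ?g = "\<lambda>y. g (y + ?s)"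
    have b: "?u \<in> H1 \<Omega>" "?g \<in> L2 (free_surface \<Omega>)" using unshift[OF t] by (auto simp: has_trace_iff)
    show H: "H1_norm (shift_set ?t \<Omega>) u = H1_norm \<Omega> ?u" using H1_norm_shift[OF O b(1), of ?t] by simp
    have "norm (lsq_of (shift_set ?t \<Omega>) u) = norm (lsq_of \<Omega> ?u)"
      using norm_lsq_of_shift[OF open_sets_lebesgue[OF O] H1D(1)[OF b(1)], of ?t] by simp
    moreover have "u \<in> H1 (shift_set ?t \<Omega>)" using t by (simp add: has_trace_def)
    ultimately have "(norm (grad3 (shift_set ?t \<Omega>) u))\<^sup>2 = (norm (grad3 \<Omega> ?u))\<^sup>2"
      using H H1_norm_grad3[OF b(1)] sh.H1_norm_grad3[of u] by simp
    moreover have "norm (lsq_of (free_surface (shift_set ?t \<Omega>)) g) = norm (lsq_of (free_surface \<Omega>) ?g)"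
      using norm_lsq_of_shift[OF free_surface_measurable b(2), of ?s] by (simp add: free_surface_shift_set)
    ultimately show "norm (grad3 (shift_set ?t \<Omega>) u, lsq_of (free_surface (shift_set ?t \<Omega>)) g)
      = norm (grad3 \<Omega> ?u, lsq_of (free_surface \<Omega>) ?g)" by (simp add: norm_prod_def)
  qed
  show ?thesis
    unfolding sh.trace_bounds_def
  proof (intro conjI ballI allI impI)
    show "0 < c" "0 < C" using assms by (auto simp: trace_bounds_def)
    fix u assume "u \<in> H1 (shift_set ?t \<Omega>)"
    then obtain g where "has_trace \<Omega> (\<lambda>x. u (x + ?t)) g" using H1b assms unfolding trace_bounds_def by blast
    from has_trace_shift[OF this, of a] show "\<exists>g. has_trace (shift_set ?t \<Omega>) u g" by auto
  next
    fix u g assume t: "has_trace (shift_set ?t \<Omega>) u g"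
    show "c * H1_norm (shift_set ?t \<Omega>) u \<le> norm (grad3 (shift_set ?t \<Omega>) u, lsq_of (free_surface (shift_set ?t \<Omega>)) g)"
      "norm (grad3 (shift_set ?t \<Omega>) u, lsq_of (free_surface (shift_set ?t \<Omega>)) g) \<le> C * H1_norm (shift_set ?t \<Omega>) u"
      unfolding nrm[OF t] using assms unshift[OF t] unfolding trace_bounds_def by blast+
  qed
qed

context bounded_domain
begin

text \<open>The difference of two traces is a trace of the zero function, and the upper bound makes
  it vanish.\<close>

lemma trace_unique:
  assumes b: "trace_bounds c C" and t: "has_trace \<Omega> u g" "has_trace \<Omega> u h"
  shows "lsq_of (free_surface \<Omega>) g = lsq_of (free_surface \<Omega>) h"
proof -
  have L: "g \<in> L2 (free_surface \<Omega>)" "h \<in> L2 (free_surface \<Omega>)" using t by (auto simp: has_trace_iff)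
  have "has_trace \<Omega> (\<lambda>x. 0) (\<lambda>y. g y - h y)" using has_trace_diff[OF t] by simp
  then have "norm (grad3 \<Omega> (\<lambda>x. 0), lsq_of (free_surface \<Omega>) (\<lambda>y. g y - h y)) \<le> C * H1_norm \<Omega> (\<lambda>x. 0)"
    using b unfolding trace_bounds_def by blast
  moreover have "H1_norm \<Omega> (\<lambda>x. 0) = 0" using H1_norm_scale[OF H1_zero[OF O], of 0] by simp
  ultimately have "lsq_of (free_surface \<Omega>) (\<lambda>y. g y - h y) = 0" by (simp add: prod_eq_iff zero_prod_def)
  then show ?thesis by (simp add: lsq_of_diff[OF free_surface_measurable L])
qed

end

section \<open>Restriction to strips and integer shifts\<close>

text \<open>Half-open slabs, so that the strips partition everything exactly; the type covers space
  and free surface alike.\<close>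

definition strip :: "int \<Rightarrow> (real \<times> 'a::euclidean_space) set" where
  "strip j = {x. \<lfloor>fst x\<rfloor> = j}"

lemma strip_measurable: "strip j \<in> sets lebesgue"
proof -
  have "strip j = {x::real \<times> 'a. of_int j \<le> fst x} \<inter> {x. fst x < of_int j + 1}"
    by (auto simp: strip_def floor_eq_iff)
  moreover have "closed {x::real \<times> 'a. of_int j \<le> fst x}" by (intro closed_Collect_le continuous_intros)
  moreover have "open {x::real \<times> 'a. fst x < of_int j + 1}" by (intro open_Collect_less continuous_intros)
  ultimately have "strip j \<in> sets (borel :: (real \<times> 'a) measure)" by auto
  then show ?thesis by (intro sets_completionI_sets) simp
qed

text \<open>Given through the chosen representative; \<open>rstr_lsq_of\<close> shows that any other
  representative would do.\<close>

definition rstr :: "int \<Rightarrow> (real \<times> 'a::euclidean_space) lsq \<Rightarrow> (real \<times> 'a) lsq" where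
  "rstr j X = lsq_of (strip j) (rep_lsq X)"

definition shf :: "int \<Rightarrow> (real \<times> 'a::euclidean_space) lsq \<Rightarrow> (real \<times> 'a) lsq" where
  "shf n X = lsq_of UNIV (\<lambda>x. rep_lsq X (x - (of_int n, 0)))"

lemma UNIV_lebesgue: "UNIV \<in> sets lebesgue"
  using sets.top[of lebesgue] by simp

lemma rep_lsq: "rep_lsq X \<in> L2 UNIV" "lsq_of UNIV (rep_lsq X) = X"
proof -
  have "lsq_rel (rep_lsq X) (rep_lsq X)" by (rule Quotient_rep_reflp[OF Quotient_lsq])
  then show "rep_lsq X \<in> L2 UNIV" by (simp add: lsq_rel_def)
  show "lsq_of UNIV (rep_lsq X) = X" by (simp add: lsq_of_def Quotient_abs_rep[OF Quotient_lsq])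
qed

lemma rep_lsq_of:
  assumes S: "S \<in> sets lebesgue" and u: "u \<in> L2 S"
  shows "AE x in lebesgue. rep_lsq (lsq_of S u) x = (if x \<in> S then u x else 0)"
proof -
  have "lsq_of UNIV (rep_lsq (lsq_of S u)) = lsq_of UNIV (\<lambda>x. if x \<in> S then u x else 0)"
    using rep_lsq(2) lsq_of_cut[OF S] by metis
  moreover have "(\<lambda>x. if x \<in> S then u x else 0) \<in> L2 UNIV" by (simp add: cut_in_L2[OF S] u)
  ultimately have "AE x in lebesgue_on UNIV. rep_lsq (lsq_of S u) x = (if x \<in> S then u x else 0)"
    using lsq_of_eq_iff[OF UNIV_lebesgue rep_lsq(1)] by blast
  then show ?thesis unfolding lebesgue_on_UNIV .
qed

lemma rstr_lsq_of:
  assumes S: "S \<in> sets lebesgue" and u: "u \<in> L2 S"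
  shows "rstr j (lsq_of S u) = lsq_of (S \<inter> strip j) u"
proof -
  let ?X = "lsq_of S u" and ?v = "\<lambda>x. if x \<in> S then u x else 0"
  have v: "?v \<in> L2 (strip j)" by (rule L2_UNIV_restrict[OF strip_measurable]) (simp add: cut_in_L2[OF S] u)
  have "lsq_of (strip j) (rep_lsq ?X) = lsq_of (strip j) ?v"
    unfolding lsq_of_eq_iff[OF strip_measurable L2_UNIV_restrict[OF strip_measurable rep_lsq(1)] v] AE_lebesgue_on[OF strip_measurable]
    using rep_lsq_of[OF S u] by eventually_elim simp
  also have "(\<lambda>x. if x \<in> strip j then ?v x else 0) = (\<lambda>x. if x \<in> S \<inter> strip j then u x else 0)" by auto
  then have "lsq_of (strip j) ?v = lsq_of (S \<inter> strip j) u" unfolding lsq_of_def by simp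
  finally show ?thesis by (simp add: rstr_def)
qed

lemma shf_lsq_of:
  assumes S: "S \<in> sets lebesgue" and u: "u \<in> L2 S"
  shows "shf n (lsq_of S u) = lsq_of (shift_set (of_int n, 0) S) (\<lambda>x. u (x - (of_int n, 0)))"
proof -
  let ?t = "(of_int n, 0) :: real \<times> 'a" and ?X = "lsq_of S u" and ?v = "\<lambda>x. if x \<in> S then u x else 0"
  have sU: "shift_set t UNIV = UNIV" for t :: "real \<times> 'a" by (simp add: shift_set_def)
  have v: "?v \<in> L2 UNIV" by (simp add: cut_in_L2[OF S] u)
  have 1: "(\<lambda>x. ?v (x - ?t)) \<in> L2 UNIV" "(\<lambda>x. rep_lsq ?X (x - ?t)) \<in> L2 UNIV"
    using L2_shift[OF UNIV_lebesgue v, of ?t] L2_shift[OF UNIV_lebesgue rep_lsq(1), of ?X ?t] by (simp_all add: sU)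
  have "lsq_of UNIV (\<lambda>x. rep_lsq ?X (x - ?t)) = lsq_of UNIV (\<lambda>x. ?v (x - ?t))"
    unfolding lsq_of_eq_iff[OF UNIV_lebesgue 1(2,1)] lebesgue_on_UNIV
    using AE_translation[OF rep_lsq_of[OF S u], of "- ?t"] unfolding uminus_add_conv_diff .
  also have "\<dots> = lsq_of (shift_set ?t S) (\<lambda>x. u (x - ?t))"
    unfolding lsq_of_def by (simp add: shift_set_def)
  finally show ?thesis by (simp add: shf_def)
qed

lemma linear_rstr: "linear (rstr j)"
proof (rule linearI)
  fix X Y :: "(real \<times> 'a) lsq" and c :: real
  obtain f g where f: "f \<in> L2 UNIV" "X = lsq_of UNIV f" and g: "g \<in> L2 UNIV" "Y = lsq_of UNIV g"
    using lsq_representative by metis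
  note U = UNIV_lebesgue and r = rstr_lsq_of[OF UNIV_lebesgue] and S = L2_UNIV_restrict[OF strip_measurable]
  show "rstr j (X + Y) = rstr j X + rstr j Y"
    unfolding f(2) g(2) lsq_of_add[OF U f(1) g(1), symmetric] r[OF L2_add[OF f(1) g(1)]] r[OF f(1)] r[OF g(1)]
    by (simp add: lsq_of_add[OF strip_measurable] S f(1) g(1))
  show "rstr j (c *\<^sub>R X) = c *\<^sub>R rstr j X"
    unfolding f(2) lsq_of_scaleR[OF U f(1), symmetric] r[OF L2_scaleR[OF f(1)]] r[OF f(1)]
    by (simp add: lsq_of_scaleR[OF strip_measurable] S f(1))
qed

lemma shf_UNIV: "f \<in> L2 UNIV \<Longrightarrow> shf n (lsq_of UNIV f) = lsq_of UNIV (\<lambda>x. f (x - (of_int n, 0)))"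
  using shf_lsq_of[OF UNIV_lebesgue, of f n] by (simp add: shift_set_def)

lemma L2_shift_UNIV: "f \<in> L2 UNIV \<Longrightarrow> (\<lambda>x. f (x - t)) \<in> L2 UNIV"
  using L2_shift[OF UNIV_lebesgue, of f t] by (simp add: shift_set_def)

lemma linear_shf: "linear (shf n)"
proof (rule linearI)
  fix X Y :: "(real \<times> 'a) lsq" and c :: real
  obtain f g where f: "f \<in> L2 UNIV" "X = lsq_of UNIV f" and g: "g \<in> L2 UNIV" "Y = lsq_of UNIV g"
    using lsq_representative by metis
  note U = UNIV_lebesgue
  show "shf n (X + Y) = shf n X + shf n Y"
    unfolding f(2) g(2) lsq_of_add[OF U f(1) g(1), symmetric] shf_UNIV[OF L2_add[OF f(1) g(1)]] shf_UNIV[OF f(1)] shf_UNIV[OF g(1)]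
    by (simp add: lsq_of_add[OF U] L2_shift_UNIV f(1) g(1))
  show "shf n (c *\<^sub>R X) = c *\<^sub>R shf n X"
    unfolding f(2) lsq_of_scaleR[OF U f(1), symmetric] shf_UNIV[OF L2_scaleR[OF f(1)]] shf_UNIV[OF f(1)]
    by (simp add: lsq_of_scaleR[OF U] L2_shift_UNIV f(1))
qed

lemma inner_shf: "inner (shf n X) (shf n Y) = inner X Y"
proof -
  obtain f g where f: "f \<in> L2 UNIV" "X = lsq_of UNIV f" and g: "g \<in> L2 UNIV" "Y = lsq_of UNIV g"
    using lsq_representative by metis
  show ?thesis
    unfolding f(2) g(2) shf_UNIV[OF f(1)] shf_UNIV[OF g(1)]
    using L2_inner_shift[OF UNIV_lebesgue f(1) g(1), of "(of_int n, 0)"]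
    by (simp add: inner_lsq_of[OF UNIV_lebesgue] L2_shift_UNIV f(1) g(1) shift_set_def)
qed

lemma shf_shf: "shf m (shf n X) = shf (m + n) X"
proof -
  obtain f where f: "f \<in> L2 UNIV" "X = lsq_of UNIV f" using lsq_representative by metis
  have "x - (of_int m, 0) - (of_int n, 0) = x - (of_int (m + n), 0)" for x :: "real \<times> 'a"
    by (simp add: prod_eq_iff)
  then show ?thesis unfolding f(2) by (simp only: shf_UNIV[OF f(1)] shf_UNIV[OF L2_shift_UNIV[OF f(1)]])
qed

lemma shf_0: "shf 0 X = X"
proof -
  obtain f where f: "f \<in> L2 UNIV" "X = lsq_of UNIV f" using lsq_representative by metis
  show ?thesis unfolding f(2) shf_UNIV[OF f(1)] by (simp add: zero_prod_def[symmetric])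
qed

lemma strip_disjoint: "i \<noteq> j \<Longrightarrow> strip i \<inter> strip j = {}"
  by (auto simp: strip_def)

lemma lsq_of_empty: "lsq_of {} u = 0"
  unfolding lsq_of_def zero_lsq_def by simp

lemma rstr_rstr: "rstr i (rstr j X) = (if i = j then rstr j X else 0)"
proof -
  obtain f where f: "f \<in> L2 UNIV" "X = lsq_of UNIV f" using lsq_representative by metis
  have "rstr i (rstr j X) = lsq_of (strip j \<inter> strip i) f"
    unfolding f(2) rstr_lsq_of[OF UNIV_lebesgue f(1)]
    by (simp add: rstr_lsq_of[OF strip_measurable] L2_UNIV_restrict[OF strip_measurable f(1)])
  then show ?thesis
    unfolding f(2) rstr_lsq_of[OF UNIV_lebesgue f(1)]
    by (simp add: strip_disjoint lsq_of_empty)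
qed

lemma rstr_sym: "inner (rstr j X) Y = inner X (rstr j Y)"
proof -
  obtain f g where f: "f \<in> L2 UNIV" "X = lsq_of UNIV f" and g: "g \<in> L2 UNIV" "Y = lsq_of UNIV g"
    using lsq_representative by metis
  let ?c = "\<lambda>f x. if x \<in> strip j then f x else 0"
  have c: "?c f \<in> L2 UNIV" "?c g \<in> L2 UNIV" using L2_UNIV_restrict[OF strip_measurable] f(1) g(1)
    by (simp_all add: cut_in_L2[OF strip_measurable])
  have r: "rstr j X = lsq_of UNIV (?c f)" "rstr j Y = lsq_of UNIV (?c g)"
    unfolding f(2) g(2) rstr_lsq_of[OF UNIV_lebesgue f(1)] rstr_lsq_of[OF UNIV_lebesgue g(1)]
    by (simp_all add: lsq_of_cut[OF strip_measurable])
  have "L2_inner UNIV (?c f) g = L2_inner UNIV f (?c g)"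
    unfolding L2_inner_def by (rule Bochner_Integration.integral_cong) auto
  then show ?thesis unfolding r unfolding f(2) g(2) by (simp add: inner_lsq_of[OF UNIV_lebesgue] f(1) g(1) c)
qed

lemma rstr_shf: "rstr j (shf n X) = shf n (rstr (j - n) X)"
proof -
  obtain f where f: "f \<in> L2 UNIV" "X = lsq_of UNIV f" using lsq_representative by metis
  have s: "shift_set (of_int n, 0) (strip (j - n)) = (strip j :: (real \<times> 'a) set)"
    by (auto simp: shift_set_def strip_def)
  have "rstr j (shf n X) = lsq_of (strip j) (\<lambda>x. f (x - (of_int n, 0)))"
    unfolding f(2) shf_UNIV[OF f(1)] rstr_lsq_of[OF UNIV_lebesgue L2_shift_UNIV[OF f(1)]] by simp
  also have "\<dots> = shf n (rstr (j - n) X)"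
    unfolding f(2) rstr_lsq_of[OF UNIV_lebesgue f(1)]
    by (simp add: shf_lsq_of[OF strip_measurable] L2_UNIV_restrict[OF strip_measurable f(1)] s)
  finally show ?thesis .
qed

text \<open>Countable additivity of the integral of the squared modulus over the strips, enumerated
  by \<open>int_decode\<close>.\<close>

lemma Parseval_rstr: "((\<lambda>j. (norm (rstr j X))\<^sup>2) has_sum (norm X)\<^sup>2) UNIV"
proof -
  obtain f where f: "f \<in> L2 UNIV" "X = lsq_of UNIV f" using lsq_representative by metis
  let ?h = "\<lambda>x. (cmod (f x))\<^sup>2"
  have int: "integrable lebesgue ?h" using L2D(2)[OF f(1)] by (simp add: lebesgue_on_UNIV)
  have n: "(norm (rstr j X))\<^sup>2 = set_lebesgue_integral lebesgue (strip j) ?h" for j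
  proof -
    have "(norm (rstr j X))\<^sup>2 = (\<integral>x. ?h x \<partial>lebesgue_on (strip j))"
      unfolding f(2) rstr_lsq_of[OF UNIV_lebesgue f(1)]
      by (simp add: norm_lsq_of_square[OF strip_measurable L2_UNIV_restrict[OF strip_measurable f(1)]])
    moreover have "(\<lambda>x. indicator (strip j) x *\<^sub>R ?h x) = (\<lambda>x. if x \<in> strip j then ?h x else 0)"
      by (auto simp: indicator_def)
    ultimately show ?thesis unfolding set_lebesgue_integral_def integral_cut[OF strip_measurable, symmetric]
      by simp
  qed
  have N: "(norm X)\<^sup>2 = set_lebesgue_integral lebesgue UNIV ?h"
    unfolding f(2) norm_lsq_of_square[OF UNIV_lebesgue f(1)] by (simp add: lebesgue_on_UNIV set_lebesgue_integral_def)
  let ?A = "\<lambda>n. strip (int_decode n) :: (real \<times> 'a) set"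
  have si: "set_integrable lebesgue A ?h" if "A \<in> sets lebesgue" for A
    unfolding set_integrable_def by (rule integrable_mult_indicator[OF that int])
  have A_UN: "(\<Union>n. ?A n) = UNIV"
  proof safe
    fix x :: "real \<times> 'a"
    have "x \<in> ?A (int_encode \<lfloor>fst x\<rfloor>)" by (simp add: strip_def)
    then show "x \<in> (\<Union>n. ?A n)" by blast
  qed simp
  have dis: "?A i \<inter> ?A j = {}" if "i \<noteq> j" for i j
    using that by (intro strip_disjoint) (simp add: inj_eq[OF inj_int_decode])
  have "set_lebesgue_integral lebesgue (\<Union>n. ?A n) ?h = (\<Sum>n. set_lebesgue_integral lebesgue (?A n) ?h)"
    by (rule lebesgue_integral_countable_add[OF strip_measurable dis]) (simp_all add: A_UN si UNIV_lebesgue)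
  then have sum: "(norm X)\<^sup>2 = (\<Sum>n. (norm (rstr (int_decode n) X))\<^sup>2)" unfolding A_UN N n .
  have "summable (\<lambda>n. (norm (rstr (int_decode n) X))\<^sup>2)"
  proof (rule summableI_nonneg_bounded)
    fix m
    have "(\<Sum>n<m. (norm (rstr (int_decode n) X))\<^sup>2) = set_lebesgue_integral lebesgue (\<Union>n<m. ?A n) ?h"
      unfolding n
      by (rule set_integral_finite_Union[symmetric])
        (use dis in \<open>auto simp: disjoint_family_on_def intro: si strip_measurable\<close>)
    also have "\<dots> \<le> set_lebesgue_integral lebesgue UNIV ?h"
      unfolding set_lebesgue_integral_def
      by (intro integral_mono si[unfolded set_integrable_def] sets.finite_UN UNIV_lebesgue)
        (auto simp: strip_measurable indicator_def)
    finally show "(\<Sum>n<m. (norm (rstr (int_decode n) X))\<^sup>2) \<le> (norm X)\<^sup>2" unfolding N .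
  qed simp
  then have "(\<lambda>n. (norm (rstr (int_decode n) X))\<^sup>2) sums (norm X)\<^sup>2" "summable (\<lambda>n. norm ((norm (rstr (int_decode n) X))\<^sup>2))"
    using sum by (simp_all add: sums_iff)
  then have "((\<lambda>n. (norm (rstr (int_decode n) X))\<^sup>2) has_sum (norm X)\<^sup>2) UNIV"
    by (intro norm_summable_imp_has_sum)
  then show ?thesis
    by (subst (asm) has_sum_reindex_bij_betw[OF bij_int_decode, of "\<lambda>j. (norm (rstr j X))\<^sup>2"])
qed

lemma norm_lsq_of_restrict_le:
  assumes S: "S \<in> sets lebesgue" and f: "f \<in> L2 UNIV"
  shows "norm (lsq_of S f) \<le> norm (lsq_of UNIV f)"
proof -
  have "(norm (lsq_of S f))\<^sup>2 = (\<integral>x. (if x \<in> S then (cmod (f x))\<^sup>2 else 0) \<partial>lebesgue)"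
    by (simp only: norm_lsq_of_square[OF S L2_UNIV_restrict[OF S f]] integral_cut[OF S])
  also have "\<dots> \<le> (\<integral>x. (cmod (f x))\<^sup>2 \<partial>lebesgue)"
  proof (rule integral_mono)
    show "integrable lebesgue (\<lambda>x. (cmod (f x))\<^sup>2)" using L2D(2)[OF f] by (simp add: lebesgue_on_UNIV)
    show "integrable lebesgue (\<lambda>x. if x \<in> S then (cmod (f x))\<^sup>2 else 0)"
      unfolding integrable_cut[OF S] by (rule L2D(2)[OF L2_UNIV_restrict[OF S f]])
  qed simp
  also have "\<dots> = (norm (lsq_of UNIV f))\<^sup>2"
    by (simp only: norm_lsq_of_square[OF UNIV_lebesgue f] lebesgue_on_UNIV)
  finally show ?thesis by (rule power2_le_imp_le) simp
qed

text \<open>Restricting a candidate limit to \<open>S\<close> does not increase its distance from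
  functions supported in \<open>S\<close>, so the restriction is the limit as well.\<close>

lemma lsq_of_limit:
  assumes S: "S \<in> sets lebesgue" and u: "\<And>n::nat. u n \<in> L2 S" and lim: "(\<lambda>n. lsq_of S (u n)) \<longlonglongrightarrow> Z"
  obtains l where "l \<in> L2 S" "Z = lsq_of S l"
proof -
  obtain f where f: "f \<in> L2 UNIV" "Z = lsq_of UNIV f" using lsq_representative by metis
  have fS: "f \<in> L2 S" by (rule L2_UNIV_restrict[OF S f(1)])
  have le: "norm (lsq_of S (u n) - lsq_of S f) \<le> norm (lsq_of S (u n) - Z)" for n
  proof -
    let ?v = "\<lambda>x. (if x \<in> S then u n x else 0) - f x"
    have c: "(\<lambda>x. if x \<in> S then u n x else 0) \<in> L2 UNIV" by (simp add: cut_in_L2[OF S] u)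
    have v: "?v \<in> L2 UNIV" by (rule L2_diff[OF c f(1)])
    have "lsq_of S (u n) - lsq_of S f = lsq_of S ?v"
      unfolding lsq_of_diff[OF S u fS, symmetric] unfolding lsq_of_def by (rule arg_cong[where f=abs_lsq]) auto
    moreover have "lsq_of S (u n) - Z = lsq_of UNIV ?v"
      unfolding f(2) lsq_of_cut[OF S, of "u n"] by (rule lsq_of_diff[OF UNIV_lebesgue c f(1), symmetric])
    ultimately show ?thesis using norm_lsq_of_restrict_le[OF S v] by simp
  qed
  have "(\<lambda>n. lsq_of S (u n) - Z) \<longlonglongrightarrow> 0" using lim by (simp add: LIM_zero)
  from tendsto_norm_zero[OF this] have "(\<lambda>n. lsq_of S (u n) - lsq_of S f) \<longlonglongrightarrow> 0"
    by (rule Lim_null_comparison[rotated]) (use le in simp)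
  then have "(\<lambda>n. lsq_of S (u n)) \<longlonglongrightarrow> lsq_of S f" by (simp add: LIM_zero_cancel)
  then have "Z = lsq_of S f" using lim LIMSEQ_unique by blast
  then show ?thesis using that fS by blast
qed

lemma lsq_of_cong_set:
  assumes S: "S \<in> sets lebesgue" "T \<in> sets lebesgue" and u: "u \<in> L2 S" "v \<in> L2 T"
    and eq: "AE x in lebesgue. (if x \<in> S then u x else 0) = (if x \<in> T then v x else 0)"
  shows "lsq_of S u = lsq_of T v"
proof -
  have "lsq_of UNIV (\<lambda>x. if x \<in> S then u x else 0) = lsq_of UNIV (\<lambda>x. if x \<in> T then v x else 0)"
    using eq by (subst lsq_of_eq_iff[OF UNIV_lebesgue]) (simp_all only: cut_in_L2[OF S(1)] cut_in_L2[OF S(2)] u lebesgue_on_UNIV)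
  then show ?thesis using lsq_of_cut[OF S(1), of u] lsq_of_cut[OF S(2), of v] by simp
qed

lemma AE_fst_neq: "AE x::real \<times> 'a::euclidean_space in lebesgue. fst x \<noteq> a"
proof -
  have "(1, 0) \<in> (Basis :: (real \<times> 'a) set)" by (simp add: Basis_prod_def)
  then have "negligible {x::real \<times> 'a. x \<bullet> (1, 0) = a}" by (rule negligible_standard_hyperplane)
  then have "{x::real \<times> 'a. x \<bullet> (1, 0) = a} \<in> null_sets lebesgue" by (simp add: negligible_iff_null_sets)
  from AE_not_in[OF this] show ?thesis by (simp add: inner_prod_def)
qed

text \<open>Off this null set the part of the channel, or of its free surface, in a strip is exactly
  one cell, or the surface of one cell.\<close>

lemma AE_fst_not_Ints: "AE x::real \<times> 'a::euclidean_space in lebesgue. fst x \<notin> \<int>"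
proof -
  have "AE x::real \<times> 'a in lebesgue. \<forall>j::int. fst x \<noteq> of_int j" unfolding AE_all_countable by (intro allI AE_fst_neq)
  then show ?thesis by eventually_elim (auto simp: Ints_def)
qed

instance lsq :: (euclidean_space) banach ..

text \<open>The pieces are mutually orthogonal, so square summability of their norms makes the
  series converge, and each strip restriction sees a single term of it.\<close>

lemma glue_strips:
  fixes Y :: "int \<Rightarrow> (real \<times> 'a::euclidean_space) lsq"
  assumes "(\<lambda>j. (norm (rstr j (Y j)))\<^sup>2) summable_on UNIV"
  obtains X where "\<And>j. rstr j X = rstr j (Y j)"
proof -
  define Z where "Z n = rstr (int_decode n) (Y (int_decode n))" for n
  have orth: "inner (Z m) (Z n) = 0" if "m \<noteq> n" for m n
  proof -
    have "int_decode m \<noteq> int_decode n" using that by (simp add: inj_eq[OF inj_int_decode])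
    then show ?thesis unfolding Z_def by (simp add: rstr_sym rstr_rstr)
  qed
  have "(\<lambda>n. (norm (Z n))\<^sup>2) summable_on UNIV"
    unfolding Z_def using assms summable_on_reindex_bij_betw[OF bij_int_decode, of "\<lambda>j. (norm (rstr j (Y j)))\<^sup>2"] by simp
  then have summ: "summable (\<lambda>n. (norm (Z n))\<^sup>2)" by (rule summable_on_imp_summable)
  have sq: "(norm (\<Sum>i\<in>F. Z i))\<^sup>2 = (\<Sum>i\<in>F. (norm (Z i))\<^sup>2)" if "finite F" for F
  proof -
    have "inner (\<Sum>i\<in>F. Z i) (\<Sum>i\<in>F. Z i) = (\<Sum>j\<in>F. \<Sum>i\<in>F. inner (Z i) (Z j))"
      by (simp only: inner_sum_left inner_sum_right)
    also have "\<dots> = (\<Sum>j\<in>F. \<Sum>i\<in>F. if i = j then (norm (Z j))\<^sup>2 else 0)"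
      by (intro sum.cong refl) (auto simp: orth power2_norm_eq_inner)
    also have "\<dots> = (\<Sum>j\<in>F. (norm (Z j))\<^sup>2)" using that by simp
    finally show ?thesis by (simp add: power2_norm_eq_inner)
  qed
  have "summable Z"
    unfolding summable_Cauchy
  proof (intro allI impI)
    fix e :: real assume "e > 0"
    then have "0 < e\<^sup>2" by simp
    then obtain N where N: "\<And>m n. m \<ge> N \<Longrightarrow> norm (\<Sum>i=m..<n. (norm (Z i))\<^sup>2) < e\<^sup>2"
      using summ unfolding summable_Cauchy by blast
    have "norm (sum Z {m..<n}) < e" if "m \<ge> N" for m n
    proof (rule power_less_imp_less_base)
      show "(norm (sum Z {m..<n}))\<^sup>2 < e\<^sup>2" using N[OF that, of n] sq[of "{m..<n}"] by (simp add: sum_nonneg)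
    qed (use \<open>e > 0\<close> in simp)
    then show "\<exists>N. \<forall>m\<ge>N. \<forall>n. norm (sum Z {m..<n}) < e" by (intro exI[of _ N]) simp
  qed
  then have sums: "(\<lambda>N. \<Sum>n<N. Z n) \<longlonglongrightarrow> suminf Z" using summable_LIMSEQ by blast
  have bl: "bounded_linear (rstr j :: (real \<times> 'a) lsq \<Rightarrow> _)" for j
  proof (rule bounded_linear_intro[where K=1])
    show "norm (rstr j x) \<le> norm x * 1" for x :: "(real \<times> 'a) lsq"
    proof -
      obtain f where f: "f \<in> L2 UNIV" "x = lsq_of UNIV f" using lsq_representative by metis
      show ?thesis unfolding f(2) rstr_lsq_of[OF UNIV_lebesgue f(1)]
        using norm_lsq_of_restrict_le[OF strip_measurable f(1)] by simp
    qed
  qed (simp_all add: linear_add[OF linear_rstr] linear_scale[OF linear_rstr])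
  have "rstr j (suminf Z) = rstr j (Y j)" for j
  proof (rule LIMSEQ_unique[OF bounded_linear.tendsto[OF bl sums]])
    define k where "k = int_encode j"
    have Zr: "rstr j (Z n) = (if n = k then rstr j (Y j) else 0)" for n
    proof (cases "n = k")
      case True
      then show ?thesis by (simp add: Z_def k_def rstr_rstr)
    next
      case False
      then have "int_decode n \<noteq> j" unfolding k_def by (metis int_decode_inverse)
      then show ?thesis using False by (simp add: Z_def rstr_rstr)
    qed
    have "rstr j (\<Sum>n<N. Z n) = rstr j (Y j)" if "N > k" for N
      using that by (simp add: linear_sum[OF linear_rstr] Zr)
    then have "\<forall>\<^sub>F N in sequentially. rstr j (\<Sum>n<N. Z n) = rstr j (Y j)"
      unfolding eventually_sequentially by (intro exI[of _ "Suc k"]) auto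
    then show "(\<lambda>N. rstr j (\<Sum>n<N. Z n)) \<longlonglongrightarrow> rstr j (Y j)" by (rule tendsto_eventually)
  qed
  then show ?thesis by (rule that)
qed

section \<open>The Hilbert space of pairs of gradient and trace\<close>

type_synonym energy_space = "(space lsq \<times> space lsq \<times> space lsq) \<times> plane lsq"

lemma bounded_linear_rstr: "bounded_linear (rstr j)"
proof (rule bounded_linear_intro[where K=1])
  show "norm (rstr j x) \<le> norm x * 1" for x :: "(real \<times> 'x::euclidean_space) lsq"
  proof -
    have "(norm (rstr j x))\<^sup>2 \<le> (norm x)\<^sup>2"
      using has_sum_mono2[OF has_sum_finite[of "{j}"] Parseval_rstr[of x]] by simp
    then show ?thesis by (simp add: abs_le_square_iff[symmetric])
  qed
qed (simp_all add: linear_add[OF linear_rstr] linear_scale[OF linear_rstr])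

lemma norm_square_Parseval: "(norm X)\<^sup>2 = (\<Sum>\<^sub>\<infinity>j. (norm (rstr j X))\<^sup>2)" "(\<lambda>j. (norm (rstr j X))\<^sup>2) summable_on UNIV"
  using infsumI[OF Parseval_rstr[of X]] has_sum_imp_summable[OF Parseval_rstr[of X]] by simp_all

lemma lsq_eq_of_rstr: "(\<And>j. rstr j X = rstr j Y) \<Longrightarrow> X = Y"
proof -
  assume eq: "\<And>j. rstr j X = rstr j Y"
  have "(norm (X - Y))\<^sup>2 = (\<Sum>\<^sub>\<infinity>j. (norm (rstr j (X - Y)))\<^sup>2)" by (rule norm_square_Parseval(1))
  also have "\<dots> = 0" by (simp add: linear_diff[OF linear_rstr] eq)
  finally show ?thesis by simp
qed

text \<open>The energy does not contain the function itself. The bound with \<open>K\<close> makes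
  the functions Cauchy along with their energies, and closedness of weak derivatives identifies the
  gradient part of the limit. The lemma serves the channel and the cell alike.\<close>

lemma H1_limit:
  fixes u :: "nat \<Rightarrow> space \<Rightarrow> complex" and g :: "nat \<Rightarrow> 'b::euclidean_space \<Rightarrow> complex"
  assumes O: "open \<Omega>" and S: "S \<in> sets lebesgue" and u: "\<And>n. u n \<in> H1 \<Omega>" and g: "\<And>n. g n \<in> L2 S"
    and lim: "(\<lambda>n. (grad3 \<Omega> (u n), lsq_of S (g n))) \<longlonglongrightarrow> X" and K: "0 < K"
      "\<And>m n. norm (lsq_of \<Omega> (u m) - lsq_of \<Omega> (u n)) \<le> K * norm ((grad3 \<Omega> (u m), lsq_of S (g m)) - (grad3 \<Omega> (u n), lsq_of S (g n)))"
  obtains l h where "l \<in> H1 \<Omega>" "h \<in> L2 S" "X = (grad3 \<Omega> l, lsq_of S h)" "(\<lambda>n. lsq_of \<Omega> (u n)) \<longlonglongrightarrow> lsq_of \<Omega> l"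
proof -
  note Om = open_sets_lebesgue[OF O]
  have "Cauchy (\<lambda>n. lsq_of \<Omega> (u n))"
  proof (rule CauchyI)
    fix e :: real assume "e > 0"
    then have "e / K > 0" using K(1) by simp
    from CauchyD[OF LIMSEQ_imp_Cauchy[OF lim] this]
    obtain M where M: "\<forall>m\<ge>M. \<forall>n\<ge>M. norm ((grad3 \<Omega> (u m), lsq_of S (g m)) - (grad3 \<Omega> (u n), lsq_of S (g n))) < e / K" ..
    have "norm (lsq_of \<Omega> (u m) - lsq_of \<Omega> (u n)) < e" if "m \<ge> M" "n \<ge> M" for m n
    proof -
      have "K * norm ((grad3 \<Omega> (u m), lsq_of S (g m)) - (grad3 \<Omega> (u n), lsq_of S (g n))) < K * (e / K)"
        using M that K(1) by (intro mult_strict_left_mono) blast+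
      then show ?thesis using K(2)[of m n] K(1) by simp
    qed
    then have "\<forall>m\<ge>M. \<forall>n\<ge>M. norm (lsq_of \<Omega> (u m) - lsq_of \<Omega> (u n)) < e" by simp
    then show "\<exists>M. \<forall>m\<ge>M. \<forall>n\<ge>M. norm (lsq_of \<Omega> (u m) - lsq_of \<Omega> (u n)) < e" by (rule exI)
  qed
  then obtain Z where Z: "(\<lambda>n. lsq_of \<Omega> (u n)) \<longlonglongrightarrow> Z" using Cauchy_convergent unfolding convergent_def by metis
  obtain l where l: "l \<in> L2 \<Omega>" "Z = lsq_of \<Omega> l" using lsq_of_limit[OF Om H1D(1)[OF u] Z] .
  obtain A1 A2 A3 D where X: "X = ((A1, A2, A3), D)" by (metis surj_pair)
  have G: "(\<lambda>n. grad \<Omega> e1 (u n)) \<longlonglongrightarrow> A1" "(\<lambda>n. grad \<Omega> e2 (u n)) \<longlonglongrightarrow> A2" "(\<lambda>n. grad \<Omega> e3 (u n)) \<longlonglongrightarrow> A3"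
    and GD: "(\<lambda>n. lsq_of S (g n)) \<longlonglongrightarrow> D"
    using tendsto_fst[OF tendsto_fst[OF lim]] tendsto_fst[OF tendsto_snd[OF tendsto_fst[OF lim]]]
      tendsto_snd[OF tendsto_snd[OF tendsto_fst[OF lim]]] tendsto_snd[OF lim]
    by (simp_all add: X grad3_def)
  have ex: "\<exists>d. d \<in> L2 \<Omega> \<and> A = lsq_of \<Omega> d" if "(\<lambda>n. grad \<Omega> e (u n)) \<longlonglongrightarrow> A" "e \<in> Basis" for A e
    using lsq_of_limit[OF Om H1D(2)[OF u that(2)] that(1)[unfolded grad_def]] by blast
  obtain d1 d2 d3 where d: "d1 \<in> L2 \<Omega>" "A1 = lsq_of \<Omega> d1" "d2 \<in> L2 \<Omega>" "A2 = lsq_of \<Omega> d2"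
    "d3 \<in> L2 \<Omega>" "A3 = lsq_of \<Omega> d3"
    using ex[OF G(1) e_in_Basis(1)] ex[OF G(2) e_in_Basis(2)] ex[OF G(3) e_in_Basis(3)] by blast
  define d where "d e = (if e = e1 then d1 else if e = e2 then d2 else d3)" for e :: space
  have ne: "e1 \<noteq> e2" "e1 \<noteq> e3" "e2 \<noteq> e3" by (simp_all add: e1_def e2_def e3_def)
  have dL: "d e \<in> L2 \<Omega>" for e using \<open>d1 \<in> L2 \<Omega>\<close> \<open>d2 \<in> L2 \<Omega>\<close> \<open>d3 \<in> L2 \<Omega>\<close> by (simp add: d_def)
  have dT: "(\<lambda>n. grad \<Omega> e (u n)) \<longlonglongrightarrow> lsq_of \<Omega> (d e)" if "e \<in> Basis" for e
    using that G ne unfolding d(2,4,6) by (auto simp: Basis_space d_def)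
  have lH: "l \<in> H1 \<Omega>" and lg: "\<And>e. e \<in> Basis \<Longrightarrow> grad \<Omega> e l = lsq_of \<Omega> (d e)"
    using H1_closed[OF O u l(1) Z[unfolded l(2)] dL dT] by blast+
  obtain h where h: "h \<in> L2 S" "D = lsq_of S h" using lsq_of_limit[OF S g GD] .
  have "X = (grad3 \<Omega> l, lsq_of S h)" unfolding X grad3_def d(2,4,6) h(2) using lg e_in_Basis ne by (simp add: d_def)
  then show ?thesis by (rule that[OF lH h(1) _ Z[unfolded l(2)]])
qed

definition trace_part :: "energy_space \<Rightarrow> energy_space" where
  "trace_part X = (0, snd X)"

definition shift_energy :: "int \<Rightarrow> energy_space \<Rightarrow> energy_space" where
  "shift_energy n = (\<lambda>((a, b, c), d). ((shf n a, shf n b, shf n c), shf n d))"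

definition restrict_energy :: "int \<Rightarrow> energy_space \<Rightarrow> energy_space" where
  "restrict_energy j = (\<lambda>((a, b, c), d). ((rstr j a, rstr j b, rstr j c), rstr j d))"

lemmas linear_shf_simps = linear_add[OF linear_shf] linear_scale[OF linear_shf] linear_0[OF linear_shf]
lemmas linear_rstr_simps = linear_add[OF linear_rstr] linear_scale[OF linear_rstr] linear_0[OF linear_rstr]

lemma inner_energy_space: "inner (X :: energy_space) Y = inner (fst (fst X)) (fst (fst Y)) +
    inner (fst (snd (fst X))) (fst (snd (fst Y))) + inner (snd (snd (fst X))) (snd (snd (fst Y))) + inner (snd X) (snd Y)"
  by (simp add: inner_prod_def)

text \<open>\<open>trace_part\<close> only erases components, so it commutes with shifts and
  restrictions, which act on all four components in the same way.\<close>

global_interpretation energy: strip_decomposition trace_part shift_energy restrict_energy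
proof (intro strip_decomposition.intro orthogonal_projector.intro strip_decomposition_axioms.intro)
  fix X Y :: energy_space and m n i j :: int
  obtain a b c d where X: "X = ((a, b, c), d)" by (metis surj_pair)
  obtain a' b' c' d' where Y: "Y = ((a', b', c'), d')" by (metis surj_pair)
  show "linear trace_part" by (rule linearI) (auto simp: trace_part_def zero_prod_def)
  show "inner (trace_part X) Y = inner X (trace_part Y)" by (simp add: X Y trace_part_def)
  show "trace_part (trace_part X) = trace_part X" by (simp add: trace_part_def)
  show "linear (shift_energy n)" by (rule linearI) (auto simp: shift_energy_def linear_shf_simps)
  show "inner (shift_energy n X) (shift_energy n Y) = inner X Y" by (simp add: X Y shift_energy_def inner_shf)
  show "shift_energy m (shift_energy n X) = shift_energy (m + n) X" by (simp add: X shift_energy_def shf_shf)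
  show "shift_energy 0 X = X" by (simp add: X shift_energy_def shf_0)
  show "shift_energy n (trace_part X) = trace_part (shift_energy n X)"
    by (simp add: X shift_energy_def trace_part_def zero_prod_def linear_shf_simps)
  show "linear (restrict_energy j)" by (rule linearI) (auto simp: restrict_energy_def linear_rstr_simps)
  show "inner (restrict_energy j X) Y = inner X (restrict_energy j Y)" by (simp add: X Y restrict_energy_def rstr_sym)
  show "restrict_energy i (restrict_energy j X) = (if i = j then restrict_energy j X else 0)"
    by (simp add: X restrict_energy_def rstr_rstr zero_prod_def)
  show "restrict_energy j (trace_part X) = trace_part (restrict_energy j X)"
    by (simp add: X restrict_energy_def trace_part_def zero_prod_def linear_rstr_simps)
  show "restrict_energy j (shift_energy n X) = shift_energy n (restrict_energy (j - n) X)"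
    by (simp add: X restrict_energy_def shift_energy_def rstr_shf)
  have "((\<lambda>j. ((norm (rstr j a))\<^sup>2 + ((norm (rstr j b))\<^sup>2 + (norm (rstr j c))\<^sup>2)) + (norm (rstr j d))\<^sup>2) has_sum
      (((norm a)\<^sup>2 + ((norm b)\<^sup>2 + (norm c)\<^sup>2)) + (norm d)\<^sup>2)) UNIV"
    by (intro has_sum_add Parseval_rstr)
  then show "((\<lambda>j. (norm (restrict_energy j X))\<^sup>2) has_sum (norm X)\<^sup>2) UNIV"
    by (simp add: X restrict_energy_def norm_prod_def)
qed

section \<open>The channel\<close>

text \<open>Half balls of a common radius \<open>r0\<close> at the two aperture centres express that
  the cell fills one side of the wall there; the bound \<open>r0 \<le> - snd P\<close> keeps these
  balls below the free surface.\<close>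

locale channel_geometry =
  fixes W :: "space set" and P :: plane and \<theta> :: "plane set" and r0 :: real
  assumes open_cell: "open (cell W)" and bounded_cell: "bounded (cell W)"
    and open_\<theta>: "open \<theta>"
    and r0: "0 < r0" "r0 \<le> - snd P"
    and half_ball_0: "\<And>x. dist x (0, P) < r0 \<Longrightarrow> 0 < fst x \<Longrightarrow> x \<in> cell W"
    and half_ball_1: "\<And>x. dist x (1, P) < r0 \<Longrightarrow> fst x < 1 \<Longrightarrow> x \<in> cell W"
begin

abbreviation Om :: "int \<Rightarrow> space set" where "Om \<equiv> translated_cell W"

lemma Om_shift: "Om j = shift_set (of_int j, 0, 0) (cell W)"
  by (auto simp: translated_cell_def shift_set_def)

lemma Om_0: "Om 0 = cell W"
  by (auto simp: translated_cell_def)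

lemma Om_Om: "Om (i + j) = shift_set (of_int i, 0, 0) (Om j)"
  by (simp add: Om_shift shift_set_shift_set)

lemma open_Om: "open (Om j)"
  unfolding Om_shift by (rule open_shift_set[OF open_cell])

lemma Om_coords:
  assumes "x \<in> Om j"
  shows "of_int j < fst x" "fst x < of_int j + 1" "snd (snd x) < 0"
  using assms by (auto simp: translated_cell_def cell_def)

lemma Om_strip: "Om j \<subseteq> strip j"
proof
  fix x assume "x \<in> Om j"
  from Om_coords[OF this] have "\<lfloor>fst x\<rfloor> = j" by (intro floor_unique) auto
  then show "x \<in> strip j" by (simp add: strip_def)
qed

lemma Om_disjoint: "i \<noteq> j \<Longrightarrow> Om i \<inter> Om j = {}"
  using Om_strip[of i] Om_strip[of j] strip_disjoint[of i j] by blast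

lemma closure_Om_coords: "x \<in> closure (Om j) \<Longrightarrow> of_int j \<le> fst x \<and> fst x \<le> of_int j + 1 \<and> snd (snd x) \<le> 0"
proof -
  let ?S = "{x::space. of_int j \<le> fst x} \<inter> {x. fst x \<le> of_int j + 1} \<inter> {x. snd (snd x) \<le> 0}"
  have "closed ?S" by (intro closed_Int closed_Collect_le continuous_intros)
  moreover have "Om j \<subseteq> ?S" using Om_coords by (auto intro: less_imp_le)
  ultimately have "closure (Om j) \<subseteq> ?S" by (rule closure_minimal[rotated])
  then show "x \<in> closure (Om j) \<Longrightarrow> of_int j \<le> fst x \<and> fst x \<le> of_int j + 1 \<and> snd (snd x) \<le> 0" by blast
qed

lemma half_ball_left:
  assumes "dist x (of_int j, P) < r0" "of_int j < fst x"
  shows "x \<in> Om j"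
proof -
  have "dist (x - (of_int j, 0, 0)) (0, P) = dist x (of_int j, P)"
    unfolding dist_norm by (rule arg_cong[where f=norm]) (simp add: prod_eq_iff)
  then have "x - (of_int j, 0, 0) \<in> cell W" using assms by (intro half_ball_0) auto
  then show ?thesis by (simp add: Om_shift shift_set_def)
qed

lemma half_ball_right:
  assumes "dist x (of_int j, P) < r0" "fst x < of_int j"
  shows "x \<in> Om (j - 1)"
proof -
  have "dist (x - (of_int (j - 1), 0, 0)) (1, P) = dist x (of_int j, P)"
    unfolding dist_norm by (rule arg_cong[where f=norm]) (simp add: prod_eq_iff)
  then have "x - (of_int (j - 1), 0, 0) \<in> cell W" using assms by (intro half_ball_1) auto
  then show ?thesis by (simp add: Om_shift shift_set_def)
qed

end

text \<open>Smallness of \<epsilon> is expressed geometrically: the scaled aperture lies within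
  distance \<open>r0\<close> of its centre, hence between two half balls.\<close>

locale narrow_channel = channel_geometry +
  fixes \<epsilon> :: real
  assumes \<epsilon>: "0 < \<epsilon>" "\<And>y. y \<in> \<theta> \<Longrightarrow> norm (\<epsilon> *\<^sub>R y) < r0"
begin

abbreviation Pi_\<epsilon> :: "space set" where "Pi_\<epsilon> \<equiv> channel W P \<theta> \<epsilon>"
abbreviation Gam :: "plane set" where "Gam \<equiv> free_surface Pi_\<epsilon>"
abbreviation gam :: "int \<Rightarrow> plane set" where "gam j \<equiv> free_surface (Om j)"

lemma aperture_iff: "x \<in> aperture P \<theta> \<epsilon> j \<longleftrightarrow> fst x = of_int j \<and> (1 / \<epsilon>) *\<^sub>R (snd x - P) \<in> \<theta>"
  by (cases x) (simp add: aperture_def)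

lemma aperture_dist:
  assumes "x \<in> aperture P \<theta> \<epsilon> j"
  shows "dist x (of_int j, P) < r0"
    "\<And>\<rho>. (\<And>y. y \<in> \<theta> \<Longrightarrow> norm (\<epsilon> *\<^sub>R y) < \<rho>) \<Longrightarrow> norm (x - (of_int j, P)) < \<rho>"
proof -
  have y: "(1 / \<epsilon>) *\<^sub>R (snd x - P) \<in> \<theta>" "fst x = of_int j" using assms by (auto simp: aperture_iff)
  have "norm (x - (of_int j, P)) = norm (\<epsilon> *\<^sub>R ((1 / \<epsilon>) *\<^sub>R (snd x - P)))"
    using \<epsilon>(1) y(2) by (simp add: norm_prod_def)
  then show *: "\<And>\<rho>. (\<And>y. y \<in> \<theta> \<Longrightarrow> norm (\<epsilon> *\<^sub>R y) < \<rho>) \<Longrightarrow> norm (x - (of_int j, P)) < \<rho>"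
    using y(1) by metis
  show "dist x (of_int j, P) < r0" unfolding dist_norm by (rule *[OF \<epsilon>(2)])
qed

lemma Om_subset: "Om j \<subseteq> Pi_\<epsilon>"
  unfolding channel_def by blast

lemma channel_cases:
  assumes "x \<in> Pi_\<epsilon>"
  obtains j where "x \<in> Om j" | j where "x \<in> aperture P \<theta> \<epsilon> j"
  using assms unfolding channel_def by blast

lemma aperture_negative: "x \<in> aperture P \<theta> \<epsilon> j \<Longrightarrow> snd (snd x) < 0"
proof -
  assume "x \<in> aperture P \<theta> \<epsilon> j"
  from aperture_dist(1)[OF this] have "dist (snd (snd x)) (snd P) < r0"
    using dist_snd_le[of x "(of_int j, P)"] dist_snd_le[of "snd x" P] by simp
  then show ?thesis using r0(2) by (simp add: dist_real_def)
qed

text \<open>The ball of radius \<open>r0\<close> at the centre of an aperture, cut by the open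
  cylinder over the aperture, is covered by the aperture and the half balls of the two adjacent
  cells.\<close>

lemma open_channel: "open Pi_\<epsilon>"
proof (subst open_subopen, intro ballI)
  fix x assume "x \<in> Pi_\<epsilon>"
  then show "\<exists>T. open T \<and> x \<in> T \<and> T \<subseteq> Pi_\<epsilon>"
  proof (cases rule: channel_cases)
    case (1 j)
    then show ?thesis using open_Om Om_subset by blast
  next
    case (2 j)
    let ?T = "ball (of_int j, P) r0 \<inter> (\<lambda>x. (1 / \<epsilon>) *\<^sub>R (snd x - P)) -` \<theta> :: space set"
    have "open ?T" by (intro open_Int open_ball open_vimage open_\<theta> continuous_intros)
    moreover have "x \<in> ?T" using aperture_dist(1)[OF 2] 2 by (simp add: aperture_iff dist_commute)
    moreover have "?T \<subseteq> Pi_\<epsilon>"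
    proof
      fix y assume y: "y \<in> ?T"
      then have d: "dist y (of_int j, P) < r0" by (simp add: dist_commute)
      consider "fst y = of_int j" | "fst y < of_int j" | "of_int j < fst y" by linarith
      then show "y \<in> Pi_\<epsilon>"
      proof cases
        case 1
        then have "y \<in> aperture P \<theta> \<epsilon> j" using y by (simp add: aperture_iff)
        then show ?thesis unfolding channel_def by blast
      qed (use half_ball_left[OF d] half_ball_right[OF d] Om_subset in blast)+
    qed
    ultimately show ?thesis by blast
  qed
qed

lemma channel_negative: "x \<in> Pi_\<epsilon> \<Longrightarrow> snd (snd x) < 0"
  by (erule channel_cases) (auto dest: Om_coords aperture_negative)

lemma channel_strip: "x \<in> Pi_\<epsilon> \<Longrightarrow> fst x \<notin> \<int> \<Longrightarrow> x \<in> strip j \<longleftrightarrow> x \<in> Om j"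
proof (erule channel_cases)
  fix i assume "x \<in> Om i"
  moreover from this have "x \<in> strip i" using Om_strip by blast
  ultimately show "x \<in> strip j \<longleftrightarrow> x \<in> Om j" using Om_strip[of j] by (auto simp: strip_def)
qed (auto simp: aperture_iff)

lemma shift_channel: "shift_set (of_int n, 0, 0) Pi_\<epsilon> = Pi_\<epsilon>"
proof -
  have 1: "x \<in> Pi_\<epsilon> \<longleftrightarrow> (\<exists>j. x \<in> Om j \<or> x \<in> aperture P \<theta> \<epsilon> j)" for x by (auto simp: channel_def)
  have O: "x - (of_int n, 0, 0) \<in> Om j \<longleftrightarrow> x \<in> Om (n + j)" for x j unfolding Om_Om[of n j] by (simp add: shift_set_def)
  have A: "x - (of_int n, 0, 0) \<in> aperture P \<theta> \<epsilon> j \<longleftrightarrow> x \<in> aperture P \<theta> \<epsilon> (n + j)" for x j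
    by (auto simp: aperture_iff zero_prod_def[symmetric])
  have s: "(\<exists>j. Q (n + j)) \<longleftrightarrow> (\<exists>j. Q j)" for Q :: "int \<Rightarrow> bool" by (metis add_diff_cancel_left' diff_add_cancel add.commute)
  have "x - (of_int n, 0, 0) \<in> Pi_\<epsilon> \<longleftrightarrow> x \<in> Pi_\<epsilon>" for x
    unfolding 1 O A by (rule s)
  then show ?thesis by (auto simp: shift_set_def)
qed

text \<open>Aperture points are limits of cell points, and the cells form a locally finite family:
  those with points within distance 1 of \<open>x\<close> are indexed by the finite set
  \<open>F\<close>, and closures commute with finite unions.\<close>

lemma closure_channel: "x \<in> closure Pi_\<epsilon> \<Longrightarrow> \<exists>j. x \<in> closure (Om j)"
proof -
  assume x: "x \<in> closure Pi_\<epsilon>"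
  have "Pi_\<epsilon> \<subseteq> closure (\<Union>j. Om j)"
  proof
    fix y assume "y \<in> Pi_\<epsilon>"
    then show "y \<in> closure (\<Union>j. Om j)"
    proof (cases rule: channel_cases)
      case (1 j)
      then have "y \<in> (\<Union>j. Om j)" by blast
      then show ?thesis by (rule subsetD[OF closure_subset])
    next
      case (2 j)
      show ?thesis
        unfolding closure_approachable
      proof (intro allI impI)
        fix e :: real assume e: "e > 0"
        \<comment> \<open>Small enough to stay near \<open>y\<close> and inside the half ball, so
          that moving by \<open>d\<close> in the first coordinate enters cell
          \<open>j\<close>.\<close>
        define d where "d = min e (r0 - dist y (of_int j, P)) / 2"
        have d: "0 < d" "d < e" "dist y (of_int j, P) + d < r0"
          using e aperture_dist(1)[OF 2] by (auto simp: d_def min_def field_simps)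
        let ?z = "y + (d, 0)"
        have "dist ?z (of_int j, P) \<le> dist ?z y + dist y (of_int j, P)" by (rule dist_triangle)
        also have "dist ?z y = d" using d(1) by (simp add: dist_norm norm_prod_def)
        finally have "dist ?z (of_int j, P) < r0" using d(3) by simp
        then have "?z \<in> Om j" using 2 d(1) by (intro half_ball_left) (auto simp: aperture_iff)
        moreover have "dist ?z y < e" using d by (simp add: dist_norm norm_prod_def)
        ultimately show "\<exists>z\<in>\<Union>j. Om j. dist z y < e" by blast
      qed
    qed
  qed
  then have "closure Pi_\<epsilon> \<subseteq> closure (\<Union>j. Om j)" by (rule closure_minimal) simp
  then have "x \<in> closure (\<Union>j. Om j)" using x by (rule subsetD)
  define F where "F = {\<lfloor>fst x\<rfloor> - 2 .. \<lfloor>fst x\<rfloor> + 2}"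
  have "x \<in> closure (\<Union>j\<in>F. Om j)"
    unfolding closure_approachable
  proof (intro allI impI)
    fix e :: real assume e: "e > 0"
    then obtain y where y: "y \<in> (\<Union>j. Om j)" "dist y x < min e 1"
      using \<open>x \<in> closure (\<Union>j. Om j)\<close> unfolding closure_approachable by (metis zero_less_one min_less_iff_conj)
    then obtain j where j: "y \<in> Om j" by blast
    have "\<bar>fst y - fst x\<bar> < 1" using dist_fst_le[of y x] y(2) by (simp add: dist_real_def)
    then have "j \<in> F" using Om_coords(1,2)[OF j] unfolding F_def by (simp add: floor_le_iff le_floor_iff) linarith
    then show "\<exists>y\<in>\<Union>j\<in>F. Om j. dist y x < e" using j y(2) by auto
  qed
  moreover have "closure (\<Union>j\<in>F. Om j) \<subseteq> (\<Union>j\<in>F. closure (Om j))"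
  proof (rule closure_minimal)
    show "(\<Union>j\<in>F. Om j) \<subseteq> (\<Union>j\<in>F. closure (Om j))" by (intro UN_mono subset_refl closure_subset)
    show "closed (\<Union>j\<in>F. closure (Om j))" by (intro closed_UN ballI closed_closure) (simp add: F_def)
  qed
  ultimately show ?thesis by blast
qed

text \<open>Points with third coordinate 0 lie outside the open sets in question, so there frontier
  and closure agree and \<open>closure_channel\<close> applies.\<close>

lemma Gam_eq: "Gam = (\<Union>j. gam j)"
proof -
  have "(\<exists>j. z \<in> frontier (Om j)) \<longleftrightarrow> z \<in> frontier Pi_\<epsilon>" if z: "snd (snd z) = 0" for z
  proof -
    have n: "z \<notin> Pi_\<epsilon>" "z \<notin> Om j" for j using channel_negative[of z] Om_coords(3)[of z j] z by auto
    have "z \<in> frontier (Om j) \<longleftrightarrow> z \<in> closure (Om j)" for j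
      using n(2) by (simp add: frontier_def interior_open[OF open_Om])
    moreover have "z \<in> frontier Pi_\<epsilon> \<longleftrightarrow> z \<in> closure Pi_\<epsilon>"
      using n(1) by (simp add: frontier_def interior_open[OF open_channel])
    ultimately show ?thesis using closure_channel[of z] closure_mono[OF Om_subset] by blast
  qed
  from this[of "(_, _, 0)"] show ?thesis by (auto simp: free_surface_def)
qed

lemma gam_coords: "y \<in> gam j \<Longrightarrow> of_int j \<le> fst y \<and> fst y \<le> of_int j + 1"
  using closure_Om_coords[of "(fst y, snd y, 0)" j] by (auto simp: free_surface_vimage frontier_def)

lemma gam_strip: "fst y \<notin> \<int> \<Longrightarrow> y \<in> gam j \<Longrightarrow> y \<in> strip j"
proof -
  assume y: "fst y \<notin> \<int>" "y \<in> gam j"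
  have "fst y \<noteq> of_int j + 1" using y(1) by (metis Ints_of_int of_int_1 of_int_add)
  then have "\<lfloor>fst y\<rfloor> = j" using gam_coords[OF y(2)] by (intro floor_unique) auto
  then show ?thesis by (simp add: strip_def)
qed

lemma Gam_strip: "fst y \<notin> \<int> \<Longrightarrow> y \<in> Gam \<and> y \<in> strip j \<longleftrightarrow> y \<in> gam j"
  using gam_strip[of y] unfolding Gam_eq by (auto simp: strip_def)

lemma shift_Gam: "shift_set (of_int n, 0) Gam = Gam"
  using free_surface_shift_set[of "of_int n" Pi_\<epsilon>] by (simp add: shift_channel)

lemma Pi_measurable: "Pi_\<epsilon> \<in> sets lebesgue" and Om_measurable: "Om j \<in> sets lebesgue"
  and Gam_measurable: "Gam \<in> sets lebesgue" and gam_measurable: "gam j \<in> sets lebesgue"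
  by (simp_all add: open_sets_lebesgue open_channel open_Om free_surface_measurable)

lemma rstr_Pi:
  assumes u: "u \<in> L2 Pi_\<epsilon>"
  shows "rstr j (lsq_of Pi_\<epsilon> u) = lsq_of (Om j) u"
proof -
  have "rstr j (lsq_of Pi_\<epsilon> u) = lsq_of (Pi_\<epsilon> \<inter> strip j) u" by (rule rstr_lsq_of[OF Pi_measurable u])
  also have "\<dots> = lsq_of (Om j) u"
  proof (rule lsq_of_cong_set)
    show m: "Pi_\<epsilon> \<inter> strip j \<in> sets lebesgue" "Om j \<in> sets lebesgue"
      by (intro sets.Int Pi_measurable strip_measurable Om_measurable)+
    show "u \<in> L2 (Pi_\<epsilon> \<inter> strip j)" "u \<in> L2 (Om j)"
      by (rule L2_subset[OF m(1) Pi_measurable _ u], blast) (rule L2_subset[OF m(2) Pi_measurable Om_subset u])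
    show "AE x in lebesgue. (if x \<in> Pi_\<epsilon> \<inter> strip j then u x else 0) = (if x \<in> Om j then u x else 0)"
      using AE_fst_not_Ints
    proof eventually_elim
      fix x :: space assume "fst x \<notin> \<int>"
      then show "(if x \<in> Pi_\<epsilon> \<inter> strip j then u x else 0) = (if x \<in> Om j then u x else 0)"
        using channel_strip[of x j] Om_subset[of j] by (cases "x \<in> Pi_\<epsilon>") auto
    qed
  qed
  finally show ?thesis .
qed

lemma gam_subset: "gam j \<subseteq> Gam"
  unfolding Gam_eq by blast

lemma rstr_gam:
  assumes g: "g \<in> L2 (gam j)"
  shows "rstr j (lsq_of (gam j) g) = lsq_of (gam j) g"
proof -
  have "rstr j (lsq_of (gam j) g) = lsq_of (gam j \<inter> strip j) g" by (rule rstr_lsq_of[OF gam_measurable g])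
  also have "\<dots> = lsq_of (gam j) g"
  proof (rule lsq_of_cong_set)
    show m: "gam j \<inter> strip j \<in> sets lebesgue" "gam j \<in> sets lebesgue"
      by (intro sets.Int strip_measurable gam_measurable)+
    show "g \<in> L2 (gam j \<inter> strip j)" "g \<in> L2 (gam j)" using L2_subset[OF m(1) m(2) _ g] g by auto
    show "AE y in lebesgue. (if y \<in> gam j \<inter> strip j then g y else 0) = (if y \<in> gam j then g y else 0)"
      using AE_fst_not_Ints
    proof eventually_elim
      fix y :: plane assume "fst y \<notin> \<int>"
      then show "(if y \<in> gam j \<inter> strip j then g y else 0) = (if y \<in> gam j then g y else 0)"
        using gam_strip[of y j] by simp
    qed
  qed
  finally show ?thesis .
qed

lemma rstr_Gam:
  assumes g: "g \<in> L2 Gam"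
  shows "rstr j (lsq_of Gam g) = lsq_of (gam j) g"
proof -
  have "rstr j (lsq_of Gam g) = lsq_of (Gam \<inter> strip j) g" by (rule rstr_lsq_of[OF Gam_measurable g])
  also have "\<dots> = lsq_of (gam j) g"
  proof (rule lsq_of_cong_set)
    show m: "Gam \<inter> strip j \<in> sets lebesgue" "gam j \<in> sets lebesgue"
      by (intro sets.Int Gam_measurable strip_measurable gam_measurable)+
    show "g \<in> L2 (Gam \<inter> strip j)" "g \<in> L2 (gam j)"
      by (rule L2_subset[OF m(1) Gam_measurable _ g], blast) (rule L2_subset[OF m(2) Gam_measurable gam_subset g])
    show "AE y in lebesgue. (if y \<in> Gam \<inter> strip j then g y else 0) = (if y \<in> gam j then g y else 0)"
      using AE_fst_not_Ints
    proof eventually_elim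
      fix y :: plane assume "fst y \<notin> \<int>"
      then have "(y \<in> Gam \<and> y \<in> strip j) = (y \<in> gam j)" by (rule Gam_strip)
      then show "(if y \<in> Gam \<inter> strip j then g y else 0) = (if y \<in> gam j then g y else 0)" by simp
    qed
  qed
  finally show ?thesis .
qed

end

section \<open>Energies\<close>

locale cell_traces = channel_geometry +
  fixes c C :: real
  assumes cell_bounds: "bounded_domain.trace_bounds (cell W) c C"
begin

lemma bounded_domain_Om: "bounded_domain (Om j)"
proof
  show "open (Om j)" by (rule open_Om)
  show "bounded (Om j)" unfolding Om_shift shift_set_image by (rule bounded_translation[OF bounded_cell])
qed

lemma Om_bounds: "bounded_domain.trace_bounds (Om j) c C"
proof -
  interpret bounded_domain "cell W" by unfold_locales (rule open_cell bounded_cell)+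
  show ?thesis unfolding Om_shift by (rule trace_bounds_shift[OF cell_bounds])
qed

definition cell_energy :: "int \<Rightarrow> (space \<Rightarrow> complex) \<Rightarrow> (plane \<Rightarrow> complex) \<Rightarrow> energy_space" where
  "cell_energy j u g = (grad3 (Om j) u, lsq_of (free_surface (Om j)) g)"

lemma Om_trace_exists: "u \<in> H1 (Om j) \<Longrightarrow> \<exists>g. has_trace (Om j) u g"
  using Om_bounds[of j] unfolding bounded_domain.trace_bounds_def[OF bounded_domain_Om] by blast

lemma Om_norm:
  assumes "has_trace (Om j) u g"
  shows "c * H1_norm (Om j) u \<le> norm (cell_energy j u g)" "norm (cell_energy j u g) \<le> C * H1_norm (Om j) u"
  using assms Om_bounds[of j] unfolding bounded_domain.trace_bounds_def[OF bounded_domain_Om] cell_energy_def by blast+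

lemma c_pos: "0 < c" "0 < C"
  using Om_bounds[of 0] unfolding bounded_domain.trace_bounds_def[OF bounded_domain_Om] by blast+

lemma has_trace_shift_Om:
  assumes "has_trace (Om j) u g"
  shows "has_trace (Om (n + j)) (\<lambda>x. u (x - (of_int n, 0, 0))) (\<lambda>y. g (y - (of_int n, 0)))"
  unfolding Om_Om by (rule bounded_domain.has_trace_shift[OF bounded_domain_Om assms])

lemma cell_energy_shift:
  assumes "has_trace (Om j) u g"
  shows "cell_energy (n + j) (\<lambda>x. u (x - (of_int n, 0, 0))) (\<lambda>y. g (y - (of_int n, 0))) = shift_energy n (cell_energy j u g)"
proof -
  have u: "u \<in> H1 (Om j)" "g \<in> L2 (free_surface (Om j))" using assms by (auto simp: has_trace_def)
  have "grad (Om (n + j)) e (\<lambda>x. u (x - (of_int n, 0, 0))) = shf n (grad (Om j) e u)" if "e \<in> Basis" for e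
    unfolding Om_Om H1_shift(2)[OF open_Om u(1) that]
    unfolding grad_def shf_lsq_of[OF open_sets_lebesgue[OF open_Om] H1D(2)[OF u(1) that]]
    by (simp add: zero_prod_def)
  moreover have "lsq_of (free_surface (Om (n + j))) (\<lambda>y. g (y - (of_int n, 0))) = shf n (lsq_of (free_surface (Om j)) g)"
    unfolding Om_Om free_surface_shift_set shf_lsq_of[OF free_surface_measurable u(2)] ..
  ultimately show ?thesis by (simp add: cell_energy_def grad3_def shift_energy_def e_in_Basis)
qed

end

section \<open>Traces and energies of functions on the whole channel\<close>

locale channel_traces = narrow_channel W P \<theta> r0 \<epsilon> + cell_traces W P \<theta> r0 c C
  for W P \<theta> r0 \<epsilon> c C
begin

abbreviation ctr :: "(space \<Rightarrow> complex) \<Rightarrow> plane \<Rightarrow> complex" where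
  "ctr \<equiv> channel_trace W P \<theta> \<epsilon>"

lemma H1_Om: "u \<in> H1 Pi_\<epsilon> \<Longrightarrow> u \<in> H1 (Om j)"
  by (rule H1_subset(1)[OF open_channel open_Om Om_subset])

lemma rstr_grad:
  assumes u: "u \<in> H1 Pi_\<epsilon>" and e: "e \<in> Basis"
  shows "rstr j (grad Pi_\<epsilon> e u) = grad (Om j) e u"
  unfolding H1_subset(2)[OF open_channel open_Om Om_subset u e] grad_def[of Pi_\<epsilon>]
  by (rule rstr_Pi[OF H1D(2)[OF u e]])

text \<open>The traces on the single cells are glued along the strips. Their squares are summable
  because the common constant \<open>C\<close> bounds each of them by the \<open>H1_norm\<close> on
  its cell, and the squares of the latter add up over the channel.\<close>

lemma channel_trace_exists:
  assumes u: "u \<in> H1 Pi_\<epsilon>"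
  shows "\<exists>g. g \<in> L2 Gam \<and> (\<forall>j. has_trace (Om j) u g)"
proof -
  have "\<forall>j. \<exists>g. has_trace (Om j) u g" using Om_trace_exists[OF H1_Om[OF u]] by blast
  from choice[OF this] obtain g where g: "\<And>j. has_trace (Om j) u (g j)" by blast
  have gL: "g j \<in> L2 (gam j)" for j using g[of j] by (simp add: has_trace_def)
  define Y where "Y j = lsq_of (gam j) (g j)" for j
  have Yr: "rstr j (Y j) = Y j" for j unfolding Y_def by (rule rstr_gam[OF gL])
  \<comment> \<open>The squared cell norms, written through \<open>rstr\<close> so that Parseval
    shows their summability.\<close>
  define B where "B j = C\<^sup>2 * ((norm (rstr j (lsq_of Pi_\<epsilon> u)))\<^sup>2 + ((norm (rstr j (grad Pi_\<epsilon> e1 u)))\<^sup>2 +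
    ((norm (rstr j (grad Pi_\<epsilon> e2 u)))\<^sup>2 + (norm (rstr j (grad Pi_\<epsilon> e3 u)))\<^sup>2)))" for j
  have B: "B summable_on UNIV" unfolding B_def
    by (intro summable_on_cmult_right summable_on_add norm_square_Parseval)
  have le: "(norm (Y j))\<^sup>2 \<le> B j" for j
  proof -
    have "norm (Y j) \<le> norm (cell_energy j u (g j))"
      unfolding cell_energy_def Y_def norm_prod_def by (simp add: real_le_rsqrt)
    also have "\<dots> \<le> C * H1_norm (Om j) u" by (rule Om_norm(2)[OF g])
    finally have "(norm (Y j))\<^sup>2 \<le> (C * H1_norm (Om j) u)\<^sup>2" by (intro power_mono) auto
    also have "\<dots> = B j"
      unfolding power_mult_distrib H1_norm_square[OF open_Om H1_Om[OF u]] B_def sum_Basis_space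
      by (simp add: rstr_Pi[OF H1D(1)[OF u]] rstr_grad[OF u] e_in_Basis)
    finally show ?thesis .
  qed
  have "(\<lambda>j. (norm (rstr j (Y j)))\<^sup>2) summable_on UNIV"
    unfolding Yr by (rule summable_on_comparison_test[OF B]) (use le in auto)
  then obtain X where X: "\<And>j. rstr j X = rstr j (Y j)" by (rule glue_strips) blast
  obtain f where f: "f \<in> L2 UNIV" "X = lsq_of UNIV f" using lsq_representative by metis
  have fG: "f \<in> L2 Gam" "f \<in> L2 (gam j)" for j
    by (rule L2_UNIV_restrict[OF Gam_measurable f(1)], rule L2_UNIV_restrict[OF gam_measurable f(1)])
  have eq: "lsq_of (gam j) f = lsq_of (gam j) (g j)" for j
  proof -
    have "lsq_of (strip j) f = lsq_of (gam j) (g j)"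
      using X[of j] Yr[of j] unfolding f(2) Y_def by (simp add: rstr_lsq_of[OF UNIV_lebesgue f(1)])
    then have "lsq_of UNIV (\<lambda>x. if x \<in> strip j then f x else 0) = lsq_of UNIV (\<lambda>x. if x \<in> gam j then g j x else 0)"
      by (simp only: lsq_of_cut[OF strip_measurable] lsq_of_cut[OF gam_measurable])
    moreover have "(\<lambda>x. if x \<in> strip j then f x else 0) \<in> L2 UNIV" "(\<lambda>x. if x \<in> gam j then g j x else 0) \<in> L2 UNIV"
      by (simp_all only: cut_in_L2[OF strip_measurable] cut_in_L2[OF gam_measurable] gL L2_UNIV_restrict[OF strip_measurable f(1)])
    ultimately have AE: "AE x in lebesgue. (if x \<in> strip j then f x else 0) = (if x \<in> gam j then g j x else 0)"
      by (simp only: lsq_of_eq_iff[OF UNIV_lebesgue] lebesgue_on_UNIV)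
    show ?thesis
    proof (rule lsq_of_cong_set[OF gam_measurable gam_measurable fG(2) gL])
      show "AE x in lebesgue. (if x \<in> gam j then f x else 0) = (if x \<in> gam j then g j x else 0)"
        using AE AE_fst_not_Ints
      proof eventually_elim
        fix y :: plane assume 1: "(if y \<in> strip j then f y else 0) = (if y \<in> gam j then g j y else 0)" and "fst y \<notin> \<int>"
        then have "y \<in> gam j \<Longrightarrow> y \<in> strip j" by (intro gam_strip)
        then show "(if y \<in> gam j then f y else 0) = (if y \<in> gam j then g j y else 0)" using 1 by (auto split: if_splits)
      qed
    qed
  qed
  have "has_trace (Om j) u f" for j
    by (rule bounded_domain.has_trace_cong[OF bounded_domain_Om g H1_Om[OF u] fG(2) refl eq[symmetric]])
  then show ?thesis using fG(1) by blast
qed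

lemma channel_trace:
  assumes u: "u \<in> H1 Pi_\<epsilon>"
  shows "ctr u \<in> L2 Gam" "has_trace (Om j) u (ctr u)"
proof -
  have "ctr u \<in> L2 Gam \<and> (\<forall>j. has_trace (Om j) u (ctr u))"
    unfolding channel_trace_def by (rule someI_ex[OF channel_trace_exists[OF u]])
  then show "ctr u \<in> L2 Gam" "has_trace (Om j) u (ctr u)" by blast+
qed

lemma channel_trace_eqI:
  assumes "g \<in> L2 Gam" "\<And>j. has_trace (Om j) u g" and u: "u \<in> H1 Pi_\<epsilon>"
  shows "lsq_of Gam (ctr u) = lsq_of Gam g"
proof (rule lsq_eq_of_rstr)
  show "rstr j (lsq_of Gam (ctr u)) = rstr j (lsq_of Gam g)" for j
    unfolding rstr_Gam[OF assms(1)] rstr_Gam[OF channel_trace(1)[OF u]]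
    by (rule bounded_domain.trace_unique[OF bounded_domain_Om Om_bounds channel_trace(2)[OF u] assms(2)])
qed

definition energy :: "(space \<Rightarrow> complex) \<Rightarrow> energy_space" where
  "energy u = (grad3 Pi_\<epsilon> u, lsq_of Gam (ctr u))"

lemma energy_eqI:
  assumes "u \<in> H1 Pi_\<epsilon>" "g \<in> L2 Gam" "\<And>j. has_trace (Om j) u g"
  shows "energy u = (grad3 Pi_\<epsilon> u, lsq_of Gam g)"
  unfolding energy_def channel_trace_eqI[OF assms(2,3,1)] ..

lemma restrict_energy_energy:
  assumes u: "u \<in> H1 Pi_\<epsilon>"
  shows "restrict_energy j (energy u) = cell_energy j u (ctr u)"
  by (simp add: restrict_energy_def energy_def cell_energy_def grad3_def rstr_grad[OF u] e_in_Basis rstr_Gam[OF channel_trace(1)[OF u]])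

lemma energy_add:
  assumes u: "u \<in> H1 Pi_\<epsilon>" and v: "v \<in> H1 Pi_\<epsilon>"
  shows "energy (\<lambda>x. u x + v x) = energy u + energy v"
proof -
  have "energy (\<lambda>x. u x + v x) = (grad3 Pi_\<epsilon> (\<lambda>x. u x + v x), lsq_of Gam (\<lambda>y. ctr u y + ctr v y))"
    by (intro energy_eqI H1_add[OF open_channel] u v L2_add channel_trace bounded_domain.has_trace_add[OF bounded_domain_Om])
  then show ?thesis
    by (simp add: energy_def grad3_def grad_add[OF open_channel] u v e_in_Basis lsq_of_add[OF Gam_measurable] channel_trace)
qed

lemma energy_scale:
  assumes u: "u \<in> H1 Pi_\<epsilon>"
  shows "energy (\<lambda>x. k * u x) = (grad3 Pi_\<epsilon> (\<lambda>x. k * u x), lsq_of Gam (\<lambda>y. k * ctr u y))"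
  by (intro energy_eqI H1_scale[OF open_channel] u L2_scale channel_trace bounded_domain.has_trace_scale[OF bounded_domain_Om])

lemma energy_scaleR:
  assumes u: "u \<in> H1 Pi_\<epsilon>"
  shows "energy (\<lambda>x. complex_of_real k * u x) = k *\<^sub>R energy u"
  unfolding energy_scale[OF u]
  by (simp add: energy_def grad3_def grad_scaleR[OF open_channel] u e_in_Basis
      lsq_of_scaleR[OF Gam_measurable, unfolded scaleR_conv_of_real] channel_trace)

lemma energy_diff:
  assumes u: "u \<in> H1 Pi_\<epsilon>" and v: "v \<in> H1 Pi_\<epsilon>"
  shows "energy (\<lambda>x. u x - v x) = energy u - energy v"
proof -
  have "energy (\<lambda>x. u x + complex_of_real (-1) * v x) = energy u + (-1) *\<^sub>R energy v"
    unfolding energy_scaleR[OF v, symmetric] by (rule energy_add[OF u H1_scale[OF open_channel v]])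
  then show ?thesis by simp
qed

text \<open>The lower bound holds on every cell with the same \<open>c\<close>, so it can be squared
  and summed over the strips. This is what allows a function on the channel to be recovered from its
  energy.\<close>

lemma norm_lsq_Pi_le:
  assumes u: "u \<in> H1 Pi_\<epsilon>"
  shows "norm (lsq_of Pi_\<epsilon> u) \<le> (1 / c) * norm (energy u)"
proof -
  have "(norm (lsq_of Pi_\<epsilon> u))\<^sup>2 \<le> (1 / c)\<^sup>2 * (norm (energy u))\<^sup>2"
  proof (rule has_sum_mono[OF Parseval_rstr has_sum_cmult_right[OF energy.Parseval]])
    fix j
    have t: "has_trace (Om j) u (ctr u)" by (rule channel_trace(2)[OF u])
    have "norm (rstr j (lsq_of Pi_\<epsilon> u)) \<le> H1_norm (Om j) u"
      unfolding rstr_Pi[OF H1D(1)[OF u]] by (rule norm_le_H1_norm(1)[OF open_Om H1_Om[OF u]])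
    also have "\<dots> \<le> (1 / c) * norm (restrict_energy j (energy u))"
      using Om_norm(1)[OF t] c_pos(1) unfolding restrict_energy_energy[OF u] by (simp add: field_simps)
    finally show "(norm (rstr j (lsq_of Pi_\<epsilon> u)))\<^sup>2 \<le> (1 / c)\<^sup>2 * (norm (restrict_energy j (energy u)))\<^sup>2"
      unfolding power_mult_distrib[symmetric] by (intro power_mono) auto
  qed
  then have "(norm (lsq_of Pi_\<epsilon> u))\<^sup>2 \<le> ((1 / c) * norm (energy u))\<^sup>2" by (simp only: power_mult_distrib)
  then show ?thesis by (rule power2_le_imp_le) (use c_pos in simp)
qed

definition energy_range :: "energy_space set" where
  "energy_range = energy ` H1 Pi_\<epsilon>"

text \<open>\<open>H1_limit\<close> provides the limit function with its gradient; that the limit of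
  the traces is its trace is checked cell by cell, where the graph of the trace is closed.\<close>

lemma energy_range_closed: "closed_subspace energy_range"
proof -
  have "subspace energy_range"
    unfolding subspace_def energy_range_def
  proof (intro conjI ballI allI)
    have "energy (\<lambda>x. complex_of_real 0 * 0) = 0 *\<^sub>R energy (\<lambda>x. 0)"
      by (rule energy_scaleR[OF H1_zero[OF open_channel]])
    then have "energy (\<lambda>x. 0) = 0" by simp
    then show "0 \<in> energy ` H1 Pi_\<epsilon>" using H1_zero[OF open_channel] by (metis imageI)
    fix X Y assume "X \<in> energy ` H1 Pi_\<epsilon>" "Y \<in> energy ` H1 Pi_\<epsilon>"
    then obtain u v where u: "u \<in> H1 Pi_\<epsilon>" "X = energy u" and v: "v \<in> H1 Pi_\<epsilon>" "Y = energy v" by blast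
    show "X + Y \<in> energy ` H1 Pi_\<epsilon>"
      unfolding u(2) v(2) energy_add[OF u(1) v(1), symmetric] by (intro imageI H1_add[OF open_channel] u v)
  next
    fix k X assume "X \<in> energy ` H1 Pi_\<epsilon>"
    then obtain u where u: "u \<in> H1 Pi_\<epsilon>" "X = energy u" by blast
    show "k *\<^sub>R X \<in> energy ` H1 Pi_\<epsilon>"
      unfolding u(2) energy_scaleR[OF u(1), symmetric] by (intro imageI H1_scale[OF open_channel] u)
  qed
  moreover have "X \<in> energy_range" if f: "\<forall>n. f n \<in> energy_range" and lim: "f \<longlonglongrightarrow> X" for f X
  proof -
    have "\<forall>n. \<exists>u. u \<in> H1 Pi_\<epsilon> \<and> f n = energy u" using f unfolding energy_range_def by blast
    from choice[OF this] obtain u where u: "\<And>n. u n \<in> H1 Pi_\<epsilon>" and fu: "\<And>n. f n = energy (u n)" by blast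
    have f_eq: "f = (\<lambda>n. energy (u n))" by (rule ext) (rule fu)
    have lim': "(\<lambda>n. energy (u n)) \<longlonglongrightarrow> X" using lim unfolding f_eq .
    have bound: "norm (lsq_of Pi_\<epsilon> (u m) - lsq_of Pi_\<epsilon> (u n)) \<le> (1 / c) * norm (energy (u m) - energy (u n))" for m n
      unfolding lsq_of_diff[OF Pi_measurable H1D(1)[OF u] H1D(1)[OF u], symmetric] energy_diff[OF u u, symmetric]
      by (rule norm_lsq_Pi_le[OF H1_diff[OF open_channel u u]])
    have "0 < 1 / c" using c_pos by simp
    from H1_limit[OF open_channel Gam_measurable u channel_trace(1)[OF u] lim'[unfolded energy_def] this bound[unfolded energy_def]]
    obtain l h where lH: "l \<in> H1 Pi_\<epsilon>" and h: "h \<in> L2 Gam" and X: "X = (grad3 Pi_\<epsilon> l, lsq_of Gam h)"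
      and Z: "(\<lambda>n. lsq_of Pi_\<epsilon> (u n)) \<longlonglongrightarrow> lsq_of Pi_\<epsilon> l" .
    note lim'' = lim'[unfolded energy_def X grad3_def]
    note lim3 = tendsto_fst[OF tendsto_fst[OF lim'']] tendsto_fst[OF tendsto_snd[OF tendsto_fst[OF lim'']]]
        tendsto_snd[OF tendsto_snd[OF tendsto_fst[OF lim'']]]
    have G: "(\<lambda>n. grad Pi_\<epsilon> e (u n)) \<longlonglongrightarrow> grad Pi_\<epsilon> e l" if "e \<in> Basis" for e
      using that lim3 unfolding Basis_space fst_conv snd_conv by auto
    have GD: "(\<lambda>n. lsq_of Gam (ctr (u n))) \<longlonglongrightarrow> lsq_of Gam h" using tendsto_snd[OF lim''] by simp
    have hj: "h \<in> L2 (gam j)" for j by (rule L2_subset[OF gam_measurable Gam_measurable gam_subset h])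
    have "has_trace (Om j) l h" for j
    proof (rule bounded_domain.has_trace_closed[OF bounded_domain_Om channel_trace(2)[OF u] H1_Om[OF lH] hj])
      have 1: "(\<lambda>n. lsq_of (Om j) (u n)) \<longlonglongrightarrow> lsq_of (Om j) l"
        using bounded_linear.tendsto[OF bounded_linear_rstr Z, of j]
        unfolding rstr_Pi[OF H1D(1)[OF u]] rstr_Pi[OF H1D(1)[OF lH]] .
      have 2: "(\<lambda>n. grad (Om j) e (u n)) \<longlonglongrightarrow> grad (Om j) e l" if e: "e \<in> Basis" for e
        using bounded_linear.tendsto[OF bounded_linear_rstr G[OF e], of j]
        unfolding rstr_grad[OF u e] rstr_grad[OF lH e] .
      have 3: "(\<lambda>n. lsq_of (gam j) (ctr (u n))) \<longlonglongrightarrow> lsq_of (gam j) h"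
        using bounded_linear.tendsto[OF bounded_linear_rstr GD, of j]
        unfolding rstr_Gam[OF channel_trace(1)[OF u]] rstr_Gam[OF h] .
      show "(\<lambda>n. bounded_domain.graph (Om j) (u n) (ctr (u n))) \<longlonglongrightarrow> bounded_domain.graph (Om j) l h"
        unfolding bounded_domain.graph_def[OF bounded_domain_Om] grad3_def
        by (rule tendsto_Pair[OF 1 tendsto_Pair[OF tendsto_Pair[OF 2[OF e_in_Basis(1)]
            tendsto_Pair[OF 2[OF e_in_Basis(2)] 2[OF e_in_Basis(3)]]] 3]])
    qed
    then have "energy l = X" unfolding X by (intro energy_eqI lH h)
    then show ?thesis unfolding energy_range_def using lH by blast
  qed
  then have "closed energy_range" unfolding closed_sequential_limits by blast
  ultimately show ?thesis unfolding closed_subspace_def by (intro conjI)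
qed

lemma energy_shift:
  assumes u: "u \<in> H1 Pi_\<epsilon>"
  shows "(\<lambda>x. u (x - (of_int n, 0, 0))) \<in> H1 Pi_\<epsilon>" "energy (\<lambda>x. u (x - (of_int n, 0, 0))) = shift_energy n (energy u)"
proof -
  let ?u = "\<lambda>x. u (x - (of_int n, 0, 0))" and ?g = "\<lambda>y. ctr u (y - (of_int n, 0))"
  show uH: "?u \<in> H1 Pi_\<epsilon>" using H1_shift(1)[OF open_channel u, of "(of_int n, 0, 0)"] by (simp only: shift_channel)
  have gL: "?g \<in> L2 Gam"
    using L2_shift[OF Gam_measurable channel_trace(1)[OF u], of "(of_int n, 0)"] by (simp only: shift_Gam)
  have "has_trace (Om (n + (j - n))) ?u ?g" for j by (rule has_trace_shift_Om[OF channel_trace(2)[OF u]])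
  then have "energy ?u = (grad3 Pi_\<epsilon> ?u, lsq_of Gam ?g)" by (intro energy_eqI uH gL) simp
  moreover have "grad Pi_\<epsilon> e ?u = shf n (grad Pi_\<epsilon> e u)" if "e \<in> Basis" for e
    using H1_shift(2)[OF open_channel u that, of "(of_int n, 0, 0)"]
    unfolding shift_channel grad_def[of Pi_\<epsilon> e u] shf_lsq_of[OF Pi_measurable H1D(2)[OF u that]]
    by (simp add: zero_prod_def shift_channel)
  moreover have "lsq_of Gam ?g = shf n (lsq_of Gam (ctr u))"
    unfolding shf_lsq_of[OF Gam_measurable channel_trace(1)[OF u]] shift_Gam ..
  ultimately show "energy ?u = shift_energy n (energy u)"
    by (simp add: energy_def shift_energy_def grad3_def e_in_Basis)
qed

lemma energy_range_shift:
  assumes "X \<in> energy_range"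
  shows "shift_energy n X \<in> energy_range"
proof -
  obtain u where u: "u \<in> H1 Pi_\<epsilon>" "X = energy u" using assms unfolding energy_range_def by blast
  show ?thesis unfolding u(2) energy_range_def energy_shift(2)[OF u(1), symmetric] by (rule imageI[OF energy_shift(1)[OF u(1)]])
qed

end

section \<open>Energies of functions on a single cell\<close>

context cell_traces
begin

text \<open>The space \<open>C\<close> of the overview; the same for every \<epsilon>, since nothing
  is prescribed at the apertures.\<close>

definition cell_energies :: "energy_space set" where
  "cell_energies = {cell_energy 0 u g |u g. has_trace (Om 0) u g}"

lemma cell_energies_iff: "X \<in> cell_energies \<longleftrightarrow> (\<exists>u g. has_trace (Om 0) u g \<and> X = cell_energy 0 u g)"
  unfolding cell_energies_def by blast

lemma cell_energy_add:
  assumes "has_trace (Om j) u g" "has_trace (Om j) v h"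
  shows "cell_energy j (\<lambda>x. u x + v x) (\<lambda>y. g y + h y) = cell_energy j u g + cell_energy j v h"
  using has_traceD[OF assms(1)] has_traceD[OF assms(2)]
  by (simp add: cell_energy_def grad3_def grad_add[OF open_Om] e_in_Basis lsq_of_add[OF free_surface_measurable])

lemma cell_energy_scaleR:
  assumes "has_trace (Om j) u g"
  shows "cell_energy j (\<lambda>x. complex_of_real k * u x) (\<lambda>y. complex_of_real k * g y) = k *\<^sub>R cell_energy j u g"
  using has_traceD[OF assms]
  by (simp add: cell_energy_def grad3_def grad_scaleR[OF open_Om] e_in_Basis
      lsq_of_scaleR[OF free_surface_measurable, unfolded scaleR_conv_of_real])

lemma cell_energy_diff:
  assumes "has_trace (Om j) u g" "has_trace (Om j) v h"
  shows "cell_energy j (\<lambda>x. u x - v x) (\<lambda>y. g y - h y) = cell_energy j u g - cell_energy j v h"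
  using has_traceD[OF assms(1)] has_traceD[OF assms(2)]
  by (simp add: cell_energy_def grad3_def grad_diff[OF open_Om] e_in_Basis lsq_of_diff[OF free_surface_measurable])

lemma norm_lsq_cell_le:
  assumes t: "has_trace (Om j) u g"
  shows "norm (lsq_of (Om j) u) \<le> (1 / c) * norm (cell_energy j u g)"
proof -
  have "norm (lsq_of (Om j) u) \<le> H1_norm (Om j) u" by (rule norm_le_H1_norm(1)[OF open_Om has_traceD(1)[OF t]])
  also have "\<dots> \<le> (1 / c) * norm (cell_energy j u g)" using Om_norm(1)[OF t] c_pos(1) by (simp add: field_simps)
  finally show ?thesis .
qed

lemma cell_energies_closed: "closed_subspace cell_energies"
proof -
  have "subspace cell_energies"
    unfolding subspace_def
  proof (intro conjI ballI allI)
    obtain g where "has_trace (Om 0) (\<lambda>x. 0) g" using Om_trace_exists[OF H1_zero[OF open_Om]] by blast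
    note t = this
    have "has_trace (Om 0) (\<lambda>x. complex_of_real 0 * 0) (\<lambda>y. complex_of_real 0 * g y)"
      by (rule bounded_domain.has_trace_scale[OF bounded_domain_Om t])
    moreover have "cell_energy 0 (\<lambda>x. complex_of_real 0 * 0) (\<lambda>y. complex_of_real 0 * g y) = 0 *\<^sub>R cell_energy 0 (\<lambda>x. 0) g"
      by (rule cell_energy_scaleR[OF t])
    ultimately show "0 \<in> cell_energies" unfolding cell_energies_iff by (intro exI conjI) auto
    fix X Y assume "X \<in> cell_energies" "Y \<in> cell_energies"
    then obtain u g v h where u: "has_trace (Om 0) u g" "X = cell_energy 0 u g" and v: "has_trace (Om 0) v h" "Y = cell_energy 0 v h"
      unfolding cell_energies_iff by blast
    show "X + Y \<in> cell_energies"
      unfolding u(2) v(2) cell_energy_add[OF u(1) v(1), symmetric] cell_energies_iff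
      using bounded_domain.has_trace_add[OF bounded_domain_Om u(1) v(1)] by (intro exI conjI) (assumption, rule refl)
  next
    fix k X assume "X \<in> cell_energies"
    then obtain u g where u: "has_trace (Om 0) u g" "X = cell_energy 0 u g" unfolding cell_energies_iff by blast
    show "k *\<^sub>R X \<in> cell_energies"
      unfolding u(2) cell_energy_scaleR[OF u(1), symmetric] cell_energies_iff
      using bounded_domain.has_trace_scale[OF bounded_domain_Om u(1)] by (intro exI conjI) (assumption, rule refl)
  qed
  moreover have "X \<in> cell_energies" if f: "\<forall>n. f n \<in> cell_energies" and lim: "f \<longlonglongrightarrow> X" for f X
  proof -
    have "\<forall>n. \<exists>p. has_trace (Om 0) (fst p) (snd p) \<and> f n = cell_energy 0 (fst p) (snd p)"
      using f unfolding cell_energies_iff by simp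
    from choice[OF this] obtain p where "\<forall>n. has_trace (Om 0) (fst (p n)) (snd (p n)) \<and> f n = cell_energy 0 (fst (p n)) (snd (p n))" ..
    then have "\<exists>u g. \<forall>n. has_trace (Om 0) (u n) (g n) \<and> f n = cell_energy 0 (u n) (g n)"
      by (intro exI[of _ "\<lambda>n. fst (p n)"] exI[of _ "\<lambda>n. snd (p n)"])
    then obtain u g where ug: "\<And>n. has_trace (Om 0) (u n) (g n)" and fu: "\<And>n. f n = cell_energy 0 (u n) (g n)" by blast
    have f_eq: "f = (\<lambda>n. cell_energy 0 (u n) (g n))" by (rule ext) (rule fu)
    have lim': "(\<lambda>n. cell_energy 0 (u n) (g n)) \<longlonglongrightarrow> X" using lim unfolding f_eq .
    have u: "u n \<in> H1 (Om 0)" and gn: "g n \<in> L2 (free_surface (Om 0))" for n by (rule has_traceD[OF ug])+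
    have bound: "norm (lsq_of (Om 0) (u m) - lsq_of (Om 0) (u n)) \<le> (1 / c) * norm (cell_energy 0 (u m) (g m) - cell_energy 0 (u n) (g n))" for m n
      unfolding lsq_of_diff[OF open_sets_lebesgue[OF open_Om] H1D(1)[OF u] H1D(1)[OF u], symmetric] cell_energy_diff[OF ug ug, symmetric]
      by (rule norm_lsq_cell_le[OF bounded_domain.has_trace_diff[OF bounded_domain_Om ug ug]])
    have "0 < 1 / c" using c_pos by simp
    from H1_limit[OF open_Om free_surface_measurable u gn lim'[unfolded cell_energy_def] this bound[unfolded cell_energy_def]]
    obtain l h where lH: "l \<in> H1 (Om 0)" and h: "h \<in> L2 (free_surface (Om 0))"
      and X: "X = (grad3 (Om 0) l, lsq_of (free_surface (Om 0)) h)" and Z: "(\<lambda>n. lsq_of (Om 0) (u n)) \<longlonglongrightarrow> lsq_of (Om 0) l" .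
    have "has_trace (Om 0) l h"
    proof (rule bounded_domain.has_trace_closed[OF bounded_domain_Om ug lH h])
      show "(\<lambda>n. bounded_domain.graph (Om 0) (u n) (g n)) \<longlonglongrightarrow> bounded_domain.graph (Om 0) l h"
        unfolding bounded_domain.graph_def[OF bounded_domain_Om]
        by (rule tendsto_Pair[OF Z lim'[unfolded cell_energy_def X]])
    qed
    moreover have "X = cell_energy 0 l h" unfolding X cell_energy_def ..
    ultimately show ?thesis unfolding cell_energies_iff by (intro exI conjI)
  qed
  then have "closed cell_energies" unfolding closed_sequential_limits by blast
  ultimately show ?thesis unfolding closed_subspace_def by (intro conjI)
qed

text \<open>A bounded energy means a bounded \<open>H1_norm\<close>, with factor
  \<open>1 / c\<close>, so the compactness clause of \<open>trace_facts\<close> applies to the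
  underlying functions.\<close>

lemma cell_energies_compact:
  assumes facts: "trace_facts (cell W)"
  shows "energy.compact_on cell_energies"
proof -
  have "\<exists>r h. strict_mono r \<and> (\<lambda>n. trace_part (x (r n))) \<longlonglongrightarrow> h"
    if x: "\<forall>n::nat. x n \<in> cell_energies \<and> norm (x n) \<le> 1" for x
  proof -
    have "\<forall>n. \<exists>p. has_trace (Om 0) (fst p) (snd p) \<and> x n = cell_energy 0 (fst p) (snd p)"
      using x unfolding cell_energies_iff by simp
    from choice[OF this] obtain p where "\<forall>n. has_trace (Om 0) (fst (p n)) (snd (p n)) \<and> x n = cell_energy 0 (fst (p n)) (snd (p n))" ..
    then have "\<exists>u g. \<forall>n. has_trace (Om 0) (u n) (g n) \<and> x n = cell_energy 0 (u n) (g n)"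
      by (intro exI[of _ "\<lambda>n. fst (p n)"] exI[of _ "\<lambda>n. snd (p n)"])
    then obtain u g where ug: "\<And>n. has_trace (Om 0) (u n) (g n)" and xu: "\<And>n. x n = cell_energy 0 (u n) (g n)" by blast
    have bound: "H1_norm (Om 0) (u n) \<le> 1 / c" for n
    proof -
      have "c * H1_norm (Om 0) (u n) \<le> norm (x n)" unfolding xu by (rule Om_norm(1)[OF ug])
      also have "\<dots> \<le> 1" using x by blast
      finally show ?thesis using c_pos by (simp add: field_simps)
    qed
    have "\<forall>u g M. (\<forall>n::nat. u n \<in> H1 (Om 0) \<and> has_trace (Om 0) (u n) (g n) \<and> H1_norm (Om 0) (u n) \<le> M) \<longrightarrow>
        (\<exists>r h. strict_mono r \<and> h \<in> L2 (free_surface (Om 0)) \<and>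
           (\<lambda>n. L2_norm (free_surface (Om 0)) (\<lambda>y. g (r n) y - h y)) \<longlonglongrightarrow> 0)"
      using facts unfolding trace_facts_def Om_0 by (elim conjE)
    then have "\<exists>r h. strict_mono r \<and> h \<in> L2 (free_surface (Om 0)) \<and>
           (\<lambda>n. L2_norm (free_surface (Om 0)) (\<lambda>y. g (r n) y - h y)) \<longlonglongrightarrow> 0"
      by (elim allE[of _ u] allE[of _ g] allE[of _ "1 / c"] impE) (intro allI conjI has_traceD(1)[OF ug] ug bound)
    then obtain r h where rh: "strict_mono r" "h \<in> L2 (free_surface (Om 0))"
      "(\<lambda>n. L2_norm (free_surface (Om 0)) (\<lambda>y. g (r n) y - h y)) \<longlonglongrightarrow> 0" by blast
    have "(\<lambda>n. norm (lsq_of (free_surface (Om 0)) (g (r n)) - lsq_of (free_surface (Om 0)) h)) \<longlonglongrightarrow> 0"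
      unfolding lsq_of_diff[OF free_surface_measurable has_traceD(2)[OF ug] rh(2), symmetric]
        norm_lsq_of[OF free_surface_measurable L2_diff[OF has_traceD(2)[OF ug] rh(2)]] by (rule rh(3))
    then have "(\<lambda>n. lsq_of (free_surface (Om 0)) (g (r n))) \<longlonglongrightarrow> lsq_of (free_surface (Om 0)) h"
      by (rule LIM_zero_cancel[OF tendsto_norm_zero_cancel])
    then have "(\<lambda>n. trace_part (x (r n))) \<longlonglongrightarrow> (0, lsq_of (free_surface (Om 0)) h)"
      unfolding xu trace_part_def cell_energy_def snd_conv by (intro tendsto_Pair tendsto_const)
    with rh(1) show ?thesis by (intro exI conjI)
  qed
  then show ?thesis unfolding energy.compact_on_def by (intro allI impI)
qed

end

context channel_traces
begin

lemma restrict_cell_energies: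
  assumes "X \<in> cell_energies"
  shows "restrict_energy 0 X = X"
proof -
  obtain u g where u: "has_trace (Om 0) u g" "X = cell_energy 0 u g" using assms unfolding cell_energies_iff by blast
  have "rstr 0 (grad (Om 0) e u) = grad (Om 0) e u" if e: "e \<in> Basis" for e
  proof -
    have "Om 0 \<inter> strip 0 = Om 0" using Om_strip[of 0] by blast
    then show ?thesis unfolding grad_def rstr_lsq_of[OF Om_measurable H1D(2)[OF has_traceD(1)[OF u(1)] e]] by simp
  qed
  then show ?thesis
    by (simp add: u(2) restrict_energy_def cell_energy_def grad3_def e_in_Basis rstr_gam[OF has_traceD(2)[OF u(1)]])
qed

text \<open>Restricting a function of the channel to one cell forgets the matching at the apertures,
  and a shift moves the result to cell 0.\<close>

lemma energy_range_subset: "energy_range \<subseteq> energy.cell_sum cell_energies"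
proof
  fix X assume "X \<in> energy_range"
  then obtain u where u: "u \<in> H1 Pi_\<epsilon>" "X = energy u" unfolding energy_range_def by blast
  have "shift_energy (- j) (restrict_energy j X) \<in> cell_energies" for j
  proof -
    let ?u = "\<lambda>x. u (x - (of_int (- j), 0, 0))" and ?g = "\<lambda>y. ctr u (y - (of_int (- j), 0))"
    note t = channel_trace(2)[OF u(1), of j]
    have "has_trace (Om (- j + j)) ?u ?g" "shift_energy (- j) (restrict_energy j X) = cell_energy (- j + j) ?u ?g"
      unfolding u(2) restrict_energy_energy[OF u(1)]
      by (rule has_trace_shift_Om[OF t], rule cell_energy_shift[OF t, symmetric])
    then show ?thesis unfolding cell_energies_iff by (intro exI[of _ ?u] exI[of _ ?g]) simp
  qed
  then show "X \<in> energy.cell_sum cell_energies" unfolding energy.cell_sum_def by blast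
qed

end

section \<open>Linear independence of traces\<close>

lemma integrable_continuous_compact_support:
  fixes f :: "'a::euclidean_space \<Rightarrow> real"
  assumes f: "continuous_on UNIV f" and K: "compact K" "\<And>x. x \<notin> K \<Longrightarrow> f x = 0"
  shows "integrable lebesgue f"
proof -
  obtain M where M: "0 \<le> M" "\<And>x. \<bar>f x\<bar> \<le> M" using bounded_of_compact_support[OF f K] by blast
  have "f \<in> borel_measurable (lebesgue_on UNIV)" by (rule measurable_lebesgue_on_continuous[OF f])
  then show ?thesis
    using lmeasurable_compact[OF K(1)] M K(2)
    by (intro integrableI_bounded_set[of K _ _ M]) (auto simp: fmeasurable_def lebesgue_on_UNIV)
qed

text \<open>Difference quotients have integral zero by translation invariance; the mean value
  theorem dominates them by a constant on a bounded set.\<close>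

lemma integral_frechet_derivative_test_function:
  fixes \<phi> :: "'a::euclidean_space \<Rightarrow> real"
  assumes \<phi>: "test_function S \<phi>" and e: "e \<in> Basis"
  shows "(\<integral>x. frechet_derivative \<phi> (at x) e \<partial>lebesgue) = 0"
proof -
  obtain K where K: "compact K" "\<And>x. x \<notin> K \<Longrightarrow> \<phi> x = 0" using \<phi> by (auto simp: test_function_def)
  let ?d = "\<lambda>x. frechet_derivative \<phi> (at x) e"
  have d0: "?d x = 0" if "x \<notin> K" for x by (rule frechet_derivative_0_outside[OF compact_imp_closed[OF K(1)] K(2) that])
  obtain M where M: "0 \<le> M" "\<And>x. \<bar>?d x\<bar> \<le> M"
    using bounded_of_compact_support[OF test_functionD(3)[OF \<phi> e] K(1) d0] by blast
  obtain R where R: "\<And>x. x \<in> K \<Longrightarrow> norm x \<le> R" using compact_imp_bounded[OF K(1)] unfolding bounded_iff by blast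
  define t where "t n = 1 / real (Suc n)" for n
  have t: "0 < t n" "t n \<le> 1" for n by (simp_all add: t_def)
  let ?s = "\<lambda>n x. (\<phi> (t n *\<^sub>R e + x) - \<phi> x) / t n"
  have i\<phi>: "integrable lebesgue \<phi>" by (rule integrable_continuous_compact_support[OF test_functionD(2)[OF \<phi>] K])
  note i\<phi>' = integrable_translation[OF i\<phi>]
  have line: "((\<lambda>r. \<phi> (r *\<^sub>R e + x)) has_real_derivative ?d (r *\<^sub>R e + x)) (at r)" for x r
  proof -
    have "((\<lambda>r. \<phi> (r *\<^sub>R e + x)) has_derivative (\<lambda>h. frechet_derivative \<phi> (at (r *\<^sub>R e + x)) (h *\<^sub>R e))) (at r)"
      by (rule has_derivative_compose[OF _ test_functionD(4)[OF \<phi>], of "\<lambda>r. r *\<^sub>R e + x"]) (auto intro!: derivative_eq_intros)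
    then show ?thesis
    proof (rule has_derivative_imp_has_field_derivative)
      show "h * ?d (r *\<^sub>R e + x) = frechet_derivative \<phi> (at (r *\<^sub>R e + x)) (h *\<^sub>R e)" for h
        using linear_scale[OF has_derivative_linear[OF test_functionD(4)[OF \<phi>]], of "r *\<^sub>R e + x" h e] by simp
    qed
  qed
  have mvt: "\<exists>z. 0 < z \<and> z < t n \<and> ?s n x = ?d (z *\<^sub>R e + x)" for n x
  proof -
    obtain z where "0 < z" "z < t n" "\<phi> (t n *\<^sub>R e + x) - \<phi> (0 *\<^sub>R e + x) = (t n - 0) * ?d (z *\<^sub>R e + x)"
      using MVT2[OF t(1)[of n], of "\<lambda>r. \<phi> (r *\<^sub>R e + x)" "\<lambda>r. ?d (r *\<^sub>R e + x)"] line by blast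
    then show ?thesis using t(1)[of n] by (intro exI[of _ z]) (simp add: field_simps)
  qed
  have "(\<lambda>n. \<integral>x. ?s n x \<partial>lebesgue) \<longlonglongrightarrow> (\<integral>x. ?d x \<partial>lebesgue)"
  \<comment> \<open>The step widths \<open>t n\<close> are at most 1, so the quotients vanish
    farther than 1 from \<open>K\<close>, which lies in the ball of radius \<open>R\<close>.\<close>
  proof (rule integral_dominated_convergence[where w="\<lambda>x. M * indicator (cball 0 (R + 1)) x"])
    show "?d \<in> borel_measurable lebesgue"
      using measurable_lebesgue_on_continuous[OF test_functionD(3)[OF \<phi> e], of UNIV] by (simp add: lebesgue_on_UNIV)
    show "?s n \<in> borel_measurable lebesgue" for n
      using i\<phi> i\<phi>' by (intro borel_measurable_divide borel_measurable_diff borel_measurable_const borel_measurable_integrable)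
    show "integrable lebesgue (\<lambda>x::'a. M * indicator (cball 0 (R + 1)) x)"
      using lmeasurable_cball[of "0::'a" "R + 1"] by (intro integrable_mult_right integrable_real_indicator) (auto simp: fmeasurable_def)
    show "AE x in lebesgue. (\<lambda>n. ?s n x) \<longlonglongrightarrow> ?d x"
    proof (rule AE_I2)
      fix x
      have "((\<lambda>h. (\<phi> ((0 + h) *\<^sub>R e + x) - \<phi> (0 *\<^sub>R e + x)) / h) \<longlongrightarrow> ?d (0 *\<^sub>R e + x)) (at 0)"
        using line[of x 0] by (rule DERIV_D)
      moreover have "filterlim t (at 0) sequentially"
        unfolding t_def filterlim_at using LIMSEQ_Suc[OF lim_1_over_n] by simp
      ultimately have "(\<lambda>n. (\<phi> ((0 + t n) *\<^sub>R e + x) - \<phi> (0 *\<^sub>R e + x)) / t n) \<longlonglongrightarrow> ?d (0 *\<^sub>R e + x)"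
        by (rule filterlim_compose)
      then show "(\<lambda>n. ?s n x) \<longlonglongrightarrow> ?d x" by simp
    qed
    show "AE x in lebesgue. norm (?s n x) \<le> M * indicator (cball 0 (R + 1)) x" for n
    proof (rule AE_I2)
      fix x
      obtain z where z: "0 < z" "z < t n" "?s n x = ?d (z *\<^sub>R e + x)" using mvt by blast
      show "norm (?s n x) \<le> M * indicator (cball 0 (R + 1)) x"
      proof (cases "z *\<^sub>R e + x \<in> K")
        case True
        have "norm x \<le> norm (z *\<^sub>R e + x) + norm (z *\<^sub>R e)" using norm_triangle_ineq4[of "z *\<^sub>R e + x" "z *\<^sub>R e"] by simp
        also have "\<dots> \<le> R + 1" using R[OF True] z t(2)[of n] e by simp
        finally show ?thesis using M(2) z(3) by simp
      next
        case False
        then have "?s n x = 0" unfolding z(3) by (rule d0)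
        then have "norm (?s n x) = 0" by (simp only: norm_zero)
        then show ?thesis using M(1) by (simp only:) simp
      qed
    qed
  qed
  moreover have "(\<integral>x. ?s n x \<partial>lebesgue) = 0" for n
    using integral_translation[OF borel_measurable_integrable[OF i\<phi>], of "t n *\<^sub>R e"] by (simp add: Bochner_Integration.integral_diff[OF i\<phi>' i\<phi>])
  ultimately have "(\<lambda>n. 0) \<longlonglongrightarrow> (\<integral>x. ?d x \<partial>lebesgue)" by (simp only:)
  from LIMSEQ_unique[OF this tendsto_const] show ?thesis .
qed

text \<open>Integration by parts: the derivative of the product with a test function of \<Omega>
  integrates to zero. The support inside \<Omega> comes from that second factor.\<close>

lemma H1_test_function:
  fixes \<psi> :: "'a::euclidean_space \<Rightarrow> real"
  assumes O: "open \<Omega>" and \<psi>: "test_function S \<psi>"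
  shows "(\<lambda>x. complex_of_real (\<psi> x)) \<in> H1 \<Omega>"
proof (rule H1I)
  note Om = open_sets_lebesgue[OF O]
  show "(\<lambda>x. complex_of_real (\<psi> x)) \<in> L2 \<Omega>" by (rule test_function_in_L2(1)[OF Om \<psi>])
  fix e :: 'a assume e: "e \<in> Basis"
  let ?d = "\<lambda>f x. frechet_derivative f (at x) e"
  show "(\<lambda>x. complex_of_real (?d \<psi> x)) \<in> L2 \<Omega>" by (rule test_function_in_L2(2)[OF Om \<psi> e])
  show "has_weak_derivative \<Omega> e (\<lambda>x. complex_of_real (\<psi> x)) (\<lambda>x. complex_of_real (?d \<psi> x))"
    unfolding has_weak_derivative_def
  proof (intro allI impI)
    fix \<phi> assume \<phi>: "test_function \<Omega> \<phi>"
    obtain K where K: "compact K" "K \<subseteq> \<Omega>" "\<And>x. x \<notin> K \<Longrightarrow> \<phi> x = 0" using \<phi> unfolding test_function_def by blast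
    have d0: "?d \<phi> x = 0" if "x \<notin> K" for x by (rule frechet_derivative_0_outside[OF compact_imp_closed[OF K(1)] K(3) that])
    have prod: "?d (\<lambda>x. \<psi> x * \<phi> x) x = \<psi> x * ?d \<phi> x + ?d \<psi> x * \<phi> x" for x
      by (rule frechet_derivative_mult_smooth[OF test_functionD(1)[OF \<psi>] test_functionD(1)[OF \<phi>]])
    have i1: "integrable lebesgue (\<lambda>x. \<psi> x * ?d \<phi> x)"
      by (rule integrable_continuous_compact_support[OF _ K(1)])
        (auto intro!: continuous_intros test_functionD(2)[OF \<psi>] test_functionD(3)[OF \<phi> e] simp: d0)
    have i2: "integrable lebesgue (\<lambda>x. ?d \<psi> x * \<phi> x)"
      by (rule integrable_continuous_compact_support[OF _ K(1)])
        (auto intro!: continuous_intros test_functionD(2)[OF \<phi>] test_functionD(3)[OF \<psi> e] simp: K(3))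
    have "(\<integral>x. \<psi> x * ?d \<phi> x \<partial>lebesgue) + (\<integral>x. ?d \<psi> x * \<phi> x \<partial>lebesgue) = (\<integral>x. ?d (\<lambda>x. \<psi> x * \<phi> x) x \<partial>lebesgue)"
      unfolding prod by (rule Bochner_Integration.integral_add[OF i1 i2, symmetric])
    also have "\<dots> = 0"
      by (rule integral_frechet_derivative_test_function[OF test_function_mult[OF \<phi> test_functionD(1)[OF \<psi>]] e])
    finally have sum: "(\<integral>x. \<psi> x * ?d \<phi> x \<partial>lebesgue) = - (\<integral>x. ?d \<psi> x * \<phi> x \<partial>lebesgue)" by simp
    have "?d \<phi> x *\<^sub>R complex_of_real (\<psi> x) = (if x \<in> \<Omega> then ?d \<phi> x *\<^sub>R complex_of_real (\<psi> x) else 0)"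
      "\<phi> x *\<^sub>R complex_of_real (?d \<psi> x) = (if x \<in> \<Omega> then \<phi> x *\<^sub>R complex_of_real (?d \<psi> x) else 0)" for x
      using d0 K by auto
    then have "(\<integral>x. ?d \<phi> x *\<^sub>R complex_of_real (\<psi> x) \<partial>lebesgue_on \<Omega>) = (\<integral>x. ?d \<phi> x *\<^sub>R complex_of_real (\<psi> x) \<partial>lebesgue)"
      "(\<integral>x. \<phi> x *\<^sub>R complex_of_real (?d \<psi> x) \<partial>lebesgue_on \<Omega>) = (\<integral>x. \<phi> x *\<^sub>R complex_of_real (?d \<psi> x) \<partial>lebesgue)"
      unfolding integral_cut[OF Om, symmetric] by simp_all
    moreover have "(\<integral>x. ?d \<phi> x *\<^sub>R complex_of_real (\<psi> x) \<partial>lebesgue) = complex_of_real (\<integral>x. \<psi> x * ?d \<phi> x \<partial>lebesgue)"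
      "(\<integral>x. \<phi> x *\<^sub>R complex_of_real (?d \<psi> x) \<partial>lebesgue) = complex_of_real (\<integral>x. ?d \<psi> x * \<phi> x \<partial>lebesgue)"
      unfolding integral_complex_of_real[symmetric] by (simp_all add: scaleR_conv_of_real mult.commute)
    ultimately show "(\<integral>x. ?d \<phi> x *\<^sub>R complex_of_real (\<psi> x) \<partial>lebesgue_on \<Omega>) = - (\<integral>x. \<phi> x *\<^sub>R complex_of_real (?d \<psi> x) \<partial>lebesgue_on \<Omega>)"
      by (simp add: sum)
  qed
qed

text \<open>A nonzero polynomial has finitely many roots, and each root accounts only for the null
  set where the first coordinate takes that value.\<close>

lemma polynomial_AE_zero:
  fixes S :: "(real \<times> 'a::euclidean_space) set"
  assumes S: "S \<in> sets lebesgue" "0 < measure lebesgue S"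
    and zero: "AE y in lebesgue_on S. (\<Sum>i\<le>n. a i * fst y ^ i) = 0" and "i \<le> n"
  shows "a i = (0::real)"
proof (rule ccontr)
  assume "a i \<noteq> 0"
  then have "finite {x. (\<Sum>i\<le>n. a i * x ^ i) = 0}" unfolding polyfun_finite_roots using \<open>i \<le> n\<close> by blast
  then have "AE y::real \<times> 'a in lebesgue. \<forall>x\<in>{x. (\<Sum>i\<le>n. a i * x ^ i) = 0}. fst y \<noteq> x"
    unfolding AE_finite_all[OF \<open>finite _\<close>] by (intro ballI AE_fst_neq)
  moreover have "AE y in lebesgue. y \<in> S \<longrightarrow> (\<Sum>i\<le>n. a i * fst y ^ i) = 0" using zero unfolding AE_lebesgue_on[OF S(1)] .
  ultimately have "AE y in lebesgue. y \<notin> S" by eventually_elim auto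
  then have "S \<in> null_sets lebesgue" using S(1) by (simp add: AE_iff_null_sets)
  then show False using S(2) by (simp add: measure_eq_0_null_sets)
qed

lemma lsq_of_sum:
  assumes S: "S \<in> sets lebesgue" and f: "\<And>i. i \<in> I \<Longrightarrow> f i \<in> L2 S" and "finite I"
  shows "(\<lambda>x. \<Sum>i\<in>I. f i x) \<in> L2 S \<and> lsq_of S (\<lambda>x. \<Sum>i\<in>I. f i x) = (\<Sum>i\<in>I. lsq_of S (f i))"
  using \<open>finite I\<close> f
proof (induction I)
  case empty
  then show ?case by (simp add: lsq_of_zero[OF S])
next
  case (insert i I)
  have "(\<lambda>x. \<Sum>i\<in>I. f i x) \<in> L2 S" "lsq_of S (\<lambda>x. \<Sum>i\<in>I. f i x) = (\<Sum>i\<in>I. lsq_of S (f i))" "f i \<in> L2 S"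
    using insert by blast+
  then show ?case using insert(1,2) by (simp add: L2_add lsq_of_add[OF S])
qed

text \<open>Stated for an indexed family, so that coinciding members count as dependent and the
  family has exactly \<open>n + 1\<close> elements.\<close>

lemma too_many_in_span:
  fixes t :: "nat \<Rightarrow> 'b::real_vector"
  assumes indep: "\<And>a i. (\<Sum>i\<le>n. a i *\<^sub>R t i) = 0 \<Longrightarrow> i \<le> n \<Longrightarrow> a i = 0"
    and F: "finite F" "t ` {..n} \<subseteq> span F"
  shows "n < card F"
proof -
  have inj: "inj_on t {..n}"
  proof (rule inj_onI, rule ccontr)
    fix i j assume ij: "i \<in> {..n}" "j \<in> {..n}" "t i = t j" "i \<noteq> j"
    let ?a = "\<lambda>k. (if k = i then 1 else 0) - (if k = j then 1 else 0 :: real)"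
    have "(\<Sum>k\<le>n. ?a k *\<^sub>R t k) = (\<Sum>k\<le>n. if k = i then t k else 0) - (\<Sum>k\<le>n. if k = j then t k else 0)"
      unfolding sum_subtractf[symmetric] by (intro sum.cong) auto
    also have "\<dots> = 0" using ij by simp
    finally have "?a i = 0" by (rule indep) (use ij in simp)
    then show False using ij by simp
  qed
  have "independent (t ` {..n})"
  proof (rule independent_if_scalars_zero)
    fix f x assume s: "(\<Sum>x\<in>t ` {..n}. f x *\<^sub>R x) = 0" and "x \<in> t ` {..n}"
    then obtain i where i: "i \<le> n" "x = t i" by auto
    have "(\<Sum>k\<le>n. f (t k) *\<^sub>R t k) = 0" using s sum.reindex[OF inj, of "\<lambda>x. f x *\<^sub>R x"] by (simp add: o_def)
    then show "f x = 0" unfolding i(2) by (rule indep[of "\<lambda>k. f (t k)"]) (rule i(1))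
  qed simp
  then have "card (t ` {..n}) \<le> card F" using independent_span_bound[OF F(1) _ F(2)] by blast
  then show ?thesis by (simp add: card_image[OF inj])
qed

lemma test_function_plateau:
  fixes a :: "'a::euclidean_space"
  assumes s: "0 < s"
  shows "test_function UNIV (\<lambda>x. plateau (s *\<^sub>R x + a))"
proof (rule test_functionI)
  let ?K = "cbox ((- 1 / s) *\<^sub>R (a + 2 *\<^sub>R \<Sum>Basis)) ((- 1 / s) *\<^sub>R (a - 2 *\<^sub>R \<Sum>Basis))"
  show "Ck k (\<lambda>x. plateau (s *\<^sub>R x + a))" for k by (rule Ck_affine[OF Ck_plateau])
  show "compact ?K" by (rule compact_cbox)
  fix x assume x: "x \<notin> ?K"
  obtain e where e: "e \<in> Basis"
      "\<not> ((- 1 / s) * (a \<bullet> e + 2 * (\<Sum>Basis \<bullet> e)) \<le> x \<bullet> e \<and> x \<bullet> e \<le> (- 1 / s) * (a \<bullet> e - 2 * (\<Sum>Basis \<bullet> e)))"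
    using x unfolding mem_box inner_scaleR_left inner_add_left inner_diff_left by blast
  have "2 \<le> \<bar>(s *\<^sub>R x + a) \<bullet> e\<bar>"
    using e(2) s unfolding inner_sum_Basis[OF e(1)] inner_add_left inner_scaleR_left by (auto simp: field_simps abs_if)
  then show "plateau (s *\<^sub>R x + a) = 0" by (rule plateau_eq_0[OF e(1)])
qed simp

context cell_traces
begin

text \<open>Powers of the first coordinate, cut off away from the cell, are test functions; on a
  free surface of positive measure no nontrivial combination of them vanishes almost
  everywhere.\<close>

lemma trace_part_infinite_dim:
  assumes pos: "0 < measure lebesgue (free_surface (Om 0))" and F: "finite F"
  shows "\<not> trace_part ` cell_energies \<subseteq> span F"
proof
  assume sub: "trace_part ` cell_energies \<subseteq> span F"
  let ?\<gamma> = "free_surface (Om 0)"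
  obtain B where B: "\<forall>x\<in>closure (Om 0). norm x \<le> B"
    using bounded_closure[OF bounded_domain.bdd[OF bounded_domain_Om[of 0]]] unfolding bounded_iff ..
  \<comment> \<open>Scaling by \<open>1 / R\<close> brings the closed cell into the cube where
    \<open>plateau\<close> is 1; the maximum keeps \<open>R\<close> positive.\<close>
  define R where "R = max B 1"
  have R: "0 < R" "\<And>x. x \<in> closure (Om 0) \<Longrightarrow> norm x \<le> R" using B unfolding R_def by force+
  define \<psi> where "\<psi> k x = (x \<bullet> e1) ^ k * plateau ((1 / R) *\<^sub>R x + 0)" for k and x :: space
  have test: "test_function UNIV (\<psi> k)" for k
  proof -
    have "test_function UNIV (\<lambda>x. (\<Prod>i<k. (\<lambda>t::real. t) (x \<bullet> e1)) * plateau ((1 / R) *\<^sub>R x + 0))"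
      by (intro test_function_mult[OF test_function_plateau] Ck_prod Ck_real_inner Ck_ident) (use R(1) in simp)
    then show ?thesis unfolding \<psi>_def by simp
  qed
  define f where "f k y = complex_of_real (fst y ^ k)" for k and y :: plane
  have fr: "restrict_plane (\<lambda>x. complex_of_real (\<psi> k x)) y = f k y" if "y \<in> ?\<gamma>" for k y
  proof -
    obtain a b where y: "y = (a, b)" by (cases y)
    have "(a, b, 0) \<in> closure (Om 0)" using that unfolding y free_surface_def frontier_def by simp
    then have n: "norm (a, b, 0::real) \<le> R" by (rule R(2))
    have "plateau ((1 / R) *\<^sub>R (a, b, 0::real) + 0) = 1"
    proof (rule plateau_eq_1)
      fix e :: space assume e: "e \<in> Basis"
      have "\<bar>(a, b, 0) \<bullet> e\<bar> \<le> R" using Basis_le_norm[OF e, of "(a, b, 0)"] n by linarith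
      then show "\<bar>((1 / R) *\<^sub>R (a, b, 0) + 0) \<bullet> e\<bar> \<le> 1" using R(1) by (simp add: abs_mult field_simps del: scaleR_Pair)
    qed
    then show ?thesis by (simp add: restrict_plane_def y f_def \<psi>_def e1_def)
  qed
  have tr: "has_trace (Om 0) (\<lambda>x. complex_of_real (\<psi> k x)) (restrict_plane (\<lambda>x. complex_of_real (\<psi> k x)))" for k
    by (rule bounded_domain.has_trace_continuous[OF bounded_domain_Om H1_test_function[OF open_Om test]])
      (intro continuous_on_of_real continuous_on_subset[OF test_functionD(2)[OF test]] subset_UNIV)
  have S: "?\<gamma> \<in> sets lebesgue" by (rule free_surface_measurable)
  have fL: "f k \<in> L2 ?\<gamma>" and eq: "lsq_of ?\<gamma> (restrict_plane (\<lambda>x. complex_of_real (\<psi> k x))) = lsq_of ?\<gamma> (f k)" for k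
  proof -
    have cut: "(\<lambda>y. if y \<in> ?\<gamma> then restrict_plane (\<lambda>x. complex_of_real (\<psi> k x)) y else 0) = (\<lambda>y. if y \<in> ?\<gamma> then f k y else 0)"
      using fr by auto
    show "f k \<in> L2 ?\<gamma>" using has_traceD(2)[OF tr[of k]] unfolding cut_in_L2[OF S, symmetric] cut .
    show "lsq_of ?\<gamma> (restrict_plane (\<lambda>x. complex_of_real (\<psi> k x))) = lsq_of ?\<gamma> (f k)" unfolding lsq_of_cut[OF S] cut ..
  qed
  define t where "t k = (0::space lsq \<times> space lsq \<times> space lsq, lsq_of ?\<gamma> (f k))" for k
  have "t k \<in> trace_part ` cell_energies" for k
  proof (rule image_eqI)
    show "cell_energy 0 (\<lambda>x. complex_of_real (\<psi> k x)) (restrict_plane (\<lambda>x. complex_of_real (\<psi> k x))) \<in> cell_energies"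
      unfolding cell_energies_iff using tr by blast
    show "t k = trace_part (cell_energy 0 (\<lambda>x. complex_of_real (\<psi> k x)) (restrict_plane (\<lambda>x. complex_of_real (\<psi> k x))))"
      by (simp add: t_def trace_part_def cell_energy_def eq)
  qed
  then have "t ` {..card F} \<subseteq> span F" using sub by blast
  then have "card F < card F"
  proof (rule too_many_in_span[OF _ F, rotated])
    fix a i assume s: "(\<Sum>i\<le>card F. a i *\<^sub>R t i) = 0" and i: "i \<le> card F"
    have aL: "(\<lambda>y. a i *\<^sub>R f i y) \<in> L2 ?\<gamma>" for i by (rule L2_scaleR[OF fL])
    note sum = lsq_of_sum[OF S aL, of "{..card F}", simplified]
    have "snd (\<Sum>i\<le>card F. a i *\<^sub>R t i) = (\<Sum>i\<le>card F. a i *\<^sub>R lsq_of ?\<gamma> (f i))"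
      unfolding snd_sum t_def by simp
    then have "(\<Sum>i\<le>card F. a i *\<^sub>R lsq_of ?\<gamma> (f i)) = 0" using s by simp
    then have "lsq_of ?\<gamma> (\<lambda>y. \<Sum>i\<le>card F. a i *\<^sub>R f i y) = lsq_of ?\<gamma> (\<lambda>y. 0)"
      using sum by (simp add: lsq_of_scaleR[OF S fL] lsq_of_zero[OF S])
    then have "AE y in lebesgue_on ?\<gamma>. (\<Sum>i\<le>card F. a i *\<^sub>R f i y) = 0"
      using lsq_of_eq_iff[OF S conjunct1[OF sum] zero_in_L2] by simp
    moreover have "(\<Sum>i\<le>card F. a i *\<^sub>R f i y) = complex_of_real (\<Sum>i\<le>card F. a i * fst y ^ i)" for y
      by (simp add: f_def scaleR_conv_of_real)
    ultimately have "AE y in lebesgue_on ?\<gamma>. (\<Sum>i\<le>card F. a i * fst y ^ i) = 0" by (simp only: of_real_eq_0_iff)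
    then show "a i = 0" by (rule polynomial_AE_zero[OF S pos _ i])
  qed
  then show False by simp
qed

end

section \<open>Functions vanishing near the apertures\<close>

text \<open>The cutoff lemma for equal domains. The two terms of the product rule are kept apart
  because they are estimated in different ways.\<close>

lemma H1_mult_test_function:
  fixes \<kappa> :: "'a::euclidean_space \<Rightarrow> real"
  assumes O: "open \<Omega>" and \<kappa>: "test_function S \<kappa>" and u: "u \<in> H1 \<Omega>"
  shows "(\<lambda>x. complex_of_real (\<kappa> x) * u x) \<in> H1 \<Omega>"
    "e \<in> Basis \<Longrightarrow> (\<lambda>x. complex_of_real (\<kappa> x) * weak_derivative \<Omega> e u x) \<in> L2 \<Omega>"
    "e \<in> Basis \<Longrightarrow> (\<lambda>x. complex_of_real (frechet_derivative \<kappa> (at x) e) * u x) \<in> L2 \<Omega>"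
    "e \<in> Basis \<Longrightarrow> grad \<Omega> e (\<lambda>x. complex_of_real (\<kappa> x) * u x) =
      lsq_of \<Omega> (\<lambda>x. complex_of_real (\<kappa> x) * weak_derivative \<Omega> e u x) +
      lsq_of \<Omega> (\<lambda>x. complex_of_real (frechet_derivative \<kappa> (at x) e) * u x)"
proof -
  note Om = open_sets_lebesgue[OF O]
  obtain K where K: "compact K" "\<And>x. x \<notin> K \<Longrightarrow> \<kappa> x = 0" using \<kappa> by (auto simp: test_function_def)
  obtain M where M: "\<And>x. \<bar>\<kappa> x\<bar> \<le> M" using bounded_of_compact_support[OF test_functionD(2)[OF \<kappa>] K] by blast
  let ?w = "\<lambda>x. complex_of_real (\<kappa> x) * u x"
  let ?A = "\<lambda>e x. complex_of_real (\<kappa> x) * weak_derivative \<Omega> e u x"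
  let ?B = "\<lambda>e x. complex_of_real (frechet_derivative \<kappa> (at x) e) * u x"
  have d: "?A e \<in> L2 \<Omega> \<and> ?B e \<in> L2 \<Omega> \<and> ?w \<in> L2 \<Omega> \<and> has_weak_derivative \<Omega> e ?w (\<lambda>x. ?A e x + ?B e x)" if e: "e \<in> Basis" for e
  proof -
    let ?d = "\<lambda>x. frechet_derivative \<kappa> (at x) e"
    have d0: "?d x = 0" if "x \<notin> K" for x by (rule frechet_derivative_0_outside[OF compact_imp_closed[OF K(1)] K(2) that])
    obtain M' where M': "\<And>x. \<bar>?d x\<bar> \<le> M'"
      using bounded_of_compact_support[OF test_functionD(3)[OF \<kappa> e] K(1) d0] by blast
    have t: "test_function \<Omega> (\<lambda>x. if x \<in> \<Omega> then \<kappa> x * \<phi> x else 0)" if \<phi>: "test_function \<Omega> \<phi>" for \<phi>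
    proof -
      have "(\<lambda>x. if x \<in> \<Omega> then \<kappa> x * \<phi> x else 0) = (\<lambda>x. \<kappa> x * \<phi> x)" using test_function_0(1)[OF \<phi>] by auto
      then show ?thesis using test_function_mult[OF \<phi> test_functionD(1)[OF \<kappa>]] by simp
    qed
    have A: "?A e \<in> L2 \<Omega>" by (rule L2_mult_bounded[OF H1D(2)[OF u e] test_functionD(2)[OF \<kappa>] M])
    have B: "?B e \<in> L2 \<Omega>" by (rule L2_mult_bounded[OF H1D(1)[OF u] test_functionD(3)[OF \<kappa> e] M'])
    have w: "?w \<in> L2 \<Omega>" by (rule L2_mult_bounded[OF H1D(1)[OF u] test_functionD(2)[OF \<kappa>] M])
    note c = has_weak_derivative_cutoff[OF O O subset_refl e test_functionD(1)[OF \<kappa>] M M' t H1D(1)[OF u] H1D(2)[OF u e] H1D(3)[OF u e]]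
    have "has_weak_derivative \<Omega> e ?w (\<lambda>x. ?A e x + ?B e x)"
    proof (rule has_weak_derivative_cong[OF O e c(1) w c(2) L2_add[OF A B] _ _ c(3)])
      show "lsq_of \<Omega> (\<lambda>x. if x \<in> \<Omega> then ?w x else 0) = lsq_of \<Omega> ?w"
        "lsq_of \<Omega> (\<lambda>x. if x \<in> \<Omega> then ?A e x + ?B e x else 0) = lsq_of \<Omega> (\<lambda>x. ?A e x + ?B e x)"
        unfolding lsq_of_def by (simp_all cong: if_cong)
    qed
    with A B w show ?thesis by (intro conjI)
  qed
  have w: "?w \<in> L2 \<Omega>" by (rule L2_mult_bounded[OF H1D(1)[OF u] test_functionD(2)[OF \<kappa>] M])
  show H: "?w \<in> H1 \<Omega>"
    by (rule H1I[OF w, of "\<lambda>e x. ?A e x + ?B e x"]) (use d L2_add in blast)+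
  show "?A e \<in> L2 \<Omega>" "?B e \<in> L2 \<Omega>" if "e \<in> Basis" for e using d[OF that] by blast+
  show "grad \<Omega> e ?w = lsq_of \<Omega> (?A e) + lsq_of \<Omega> (?B e)" if e: "e \<in> Basis" for e
  proof -
    note de = d[OF e]
    have "grad \<Omega> e ?w = lsq_of \<Omega> (\<lambda>x. ?A e x + ?B e x)"
      by (rule grad_eqI[OF O e H L2_add]) (use de in blast)+
    then show ?thesis using de by (simp add: lsq_of_add[OF Om])
  qed
qed

text \<open>\<open>plateau\<close> rescaled around \<open>p\<close>: equal to 1 on a cube of half
  side \<open>1 / (n + 1)\<close>, and 0 outside one of half side
  \<open>2 / (n + 1)\<close>.\<close>

definition cutoff :: "'a::euclidean_space \<Rightarrow> nat \<Rightarrow> 'a \<Rightarrow> real" where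
  "cutoff p n x = plateau (real (Suc n) *\<^sub>R x + (- real (Suc n)) *\<^sub>R p)"

lemma test_function_cutoff: "test_function UNIV (cutoff p n)"
  unfolding cutoff_def[abs_def] by (rule test_function_plateau) simp

lemma cutoff_bounds: "0 \<le> cutoff p n x" "cutoff p n x \<le> 1"
  unfolding cutoff_def by (rule plateau_bounds)+

lemma cutoff_inner: "(real (Suc n) *\<^sub>R x + (- real (Suc n)) *\<^sub>R p) \<bullet> e = real (Suc n) * ((x - p) \<bullet> e)"
  by (simp add: inner_diff_left inner_add_left algebra_simps del: of_nat_Suc)

lemma cutoff_eq_0:
  assumes "e \<in> Basis" "2 \<le> real (Suc n) * \<bar>(x - p) \<bullet> e\<bar>"
  shows "cutoff p n x = 0"
  unfolding cutoff_def by (rule plateau_eq_0[OF assms(1)]) (use assms(2) in \<open>simp only: cutoff_inner abs_mult abs_of_nat\<close>)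

lemma cutoff_eq_1:
  assumes "real (Suc n) * norm (x - p) \<le> 1"
  shows "cutoff p n x = 1"
  unfolding cutoff_def
proof (rule plateau_eq_1)
  fix e :: 'a assume e: "e \<in> Basis"
  have "real (Suc n) * \<bar>(x - p) \<bullet> e\<bar> \<le> real (Suc n) * norm (x - p)" by (intro mult_left_mono Basis_le_norm[OF e]) simp
  then show "\<bar>(real (Suc n) *\<^sub>R x + (- real (Suc n)) *\<^sub>R p) \<bullet> e\<bar> \<le> 1"
    unfolding cutoff_inner abs_mult abs_of_nat using assms by linarith
qed

text \<open>Scaling the argument by \<open>n + 1\<close> multiplies the derivatives of one fixed
  compactly supported function by that factor.\<close>

lemma cutoff_derivative_bound:
  fixes p :: "'a::euclidean_space"
  assumes e: "e \<in> Basis"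
  obtains M where "0 \<le> M" "\<And>n x. \<bar>frechet_derivative (cutoff p n) (at x) e\<bar> \<le> real (Suc n) * M"
proof -
  have t: "test_function UNIV (plateau :: 'a \<Rightarrow> real)" using test_function_plateau[of 1 0] by simp
  then obtain K where K: "compact K" "\<And>x. x \<notin> K \<Longrightarrow> plateau (x::'a) = 0" by (auto simp: test_function_def)
  have d0: "frechet_derivative plateau (at x) e = 0" if "x \<notin> K" for x
    by (rule frechet_derivative_0_outside[OF compact_imp_closed[OF K(1)] K(2) that])
  obtain M where M: "0 \<le> M" "\<And>x. \<bar>frechet_derivative plateau (at x) e\<bar> \<le> M"
    using bounded_of_compact_support[OF test_functionD(3)[OF t e] K(1) d0] by blast
  have "\<bar>frechet_derivative (cutoff p n) (at x) e\<bar> \<le> real (Suc n) * M" for n x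
    unfolding cutoff_def[abs_def] frechet_derivative_affine[OF Ck_plateau]
    by (simp add: abs_mult mult_left_mono M(2) del: of_nat_Suc)
  with M(1) show ?thesis by (rule that)
qed

text \<open>A point of three-dimensional space has capacity zero. For bounded \<open>u\<close> the
  squared modulus of the term with the differentiated cutoff is of order \<open>n\<^sup>2\<close> on
  a cube of volume of order \<open>1 / n ^ 3\<close>; the other term tends to 0 by dominated
  convergence, as the cutoffs eventually vanish at every point other than \<open>p\<close>.\<close>

lemma grad_cutoff_tendsto_0:
  fixes \<Omega> :: "space set"
  assumes O: "open \<Omega>" and u: "u \<in> H1 \<Omega>" "\<And>x. x \<in> \<Omega> \<Longrightarrow> cmod (u x) \<le> B" and e: "e \<in> Basis"
  shows "(\<lambda>n. grad \<Omega> e (\<lambda>x. complex_of_real (cutoff p n x) * u x)) \<longlonglongrightarrow> 0"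
proof -
  note Om = open_sets_lebesgue[OF O]
  note m = H1_mult_test_function[OF O test_function_cutoff u(1)]
  let ?g = "weak_derivative \<Omega> e u"
  have gL: "?g \<in> L2 \<Omega>" by (rule H1D(2)[OF u(1) e])
  have A: "(\<lambda>n. lsq_of \<Omega> (\<lambda>x. complex_of_real (cutoff p n x) * ?g x)) \<longlonglongrightarrow> 0"
  proof -
    have "(\<lambda>n. \<integral>x. (cmod (complex_of_real (cutoff p n x) * ?g x))\<^sup>2 \<partial>lebesgue_on \<Omega>) \<longlonglongrightarrow> (\<integral>x. 0 \<partial>lebesgue_on \<Omega>)"
    proof (rule integral_dominated_convergence[where w="\<lambda>x. (cmod (?g x))\<^sup>2"])
      show "(\<lambda>x. (cmod (complex_of_real (cutoff p n x) * ?g x))\<^sup>2) \<in> borel_measurable (lebesgue_on \<Omega>)" for n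
        by (rule borel_measurable_integrable[OF L2D(2)[OF m(2)[OF e]]])
      show "integrable (lebesgue_on \<Omega>) (\<lambda>x. (cmod (?g x))\<^sup>2)" by (rule L2D(2)[OF gL])
      have "AE x in lebesgue. x \<noteq> p" using AE_not_in[of "{p}" lebesgue] by simp
      then have "AE x in lebesgue_on \<Omega>. x \<noteq> p" unfolding AE_lebesgue_on[OF Om] by eventually_elim simp
      then show "AE x in lebesgue_on \<Omega>. (\<lambda>n. (cmod (complex_of_real (cutoff p n x) * ?g x))\<^sup>2) \<longlonglongrightarrow> 0"
      proof eventually_elim
        fix x assume "x \<noteq> p"
        then obtain d where d: "d \<in> Basis" "(x - p) \<bullet> d \<noteq> 0" using euclidean_all_zero_iff[of "x - p"] by auto
        obtain N where N: "2 / \<bar>(x - p) \<bullet> d\<bar> < real N" using reals_Archimedean2 by blast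
        have "cutoff p n x = 0" if "n \<ge> N" for n
        proof (rule cutoff_eq_0[OF d(1)])
          have "2 / \<bar>(x - p) \<bullet> d\<bar> \<le> real (Suc n)" using N that by simp
          then show "2 \<le> real (Suc n) * \<bar>(x - p) \<bullet> d\<bar>" using d(2) by (simp add: field_simps del: of_nat_Suc)
        qed
        then have "eventually (\<lambda>n. (cmod (complex_of_real (cutoff p n x) * ?g x))\<^sup>2 = 0) sequentially"
          unfolding eventually_sequentially by (intro exI[of _ N]) simp
        then show "(\<lambda>n. (cmod (complex_of_real (cutoff p n x) * ?g x))\<^sup>2) \<longlonglongrightarrow> 0" by (rule tendsto_eventually)
      qed
      show "AE x in lebesgue_on \<Omega>. norm ((cmod (complex_of_real (cutoff p n x) * ?g x))\<^sup>2) \<le> (cmod (?g x))\<^sup>2" for n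
      proof (rule AE_I2)
        fix x
        have "(cutoff p n x)\<^sup>2 \<le> 1" using cutoff_bounds[of p n x] by (simp add: power_le_one)
        then show "norm ((cmod (complex_of_real (cutoff p n x) * ?g x))\<^sup>2) \<le> (cmod (?g x))\<^sup>2"
          by (simp add: norm_mult power_mult_distrib mult_left_le_one_le)
      qed
    qed simp
    then have "(\<lambda>n. (norm (lsq_of \<Omega> (\<lambda>x. complex_of_real (cutoff p n x) * ?g x)))\<^sup>2) \<longlonglongrightarrow> 0"
      unfolding norm_lsq_of_square[OF Om m(2)[OF e]] by simp
    from tendsto_real_sqrt[OF this] show ?thesis by (simp add: tendsto_norm_zero_iff)
  qed
  have Bz: "(\<lambda>n. lsq_of \<Omega> (\<lambda>x. complex_of_real (frechet_derivative (cutoff p n) (at x) e) * u x)) \<longlonglongrightarrow> 0"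
  proof -
    obtain M where M: "0 \<le> M" "\<And>n x. \<bar>frechet_derivative (cutoff p n) (at x) e\<bar> \<le> real (Suc n) * M"
      using cutoff_derivative_bound[OF e] by blast
    let ?f = "\<lambda>n x. complex_of_real (frechet_derivative (cutoff p n) (at x) e) * u x"
    \<comment> \<open>The factor 64 is the volume factor of a cube of side
      \<open>4 / (n + 1)\<close>; after multiplication by the squared derivative bound one factor
      \<open>1 / (n + 1)\<close> is left.\<close>
    have le: "(norm (lsq_of \<Omega> (?f n)))\<^sup>2 \<le> 64 * (M * B)\<^sup>2 * (1 / real (Suc n))" for n
    proof -
      let ?r = "2 / real (Suc n)"
      let ?Q = "cbox (p - ?r *\<^sub>R \<Sum>Basis) (p + ?r *\<^sub>R \<Sum>Basis)"
      have out: "cutoff p n x = 0" if x: "x \<notin> ?Q" for x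
      proof -
        obtain d where d: "d \<in> Basis"
          "\<not> (p \<bullet> d - ?r * (\<Sum>Basis \<bullet> d) \<le> x \<bullet> d \<and> x \<bullet> d \<le> p \<bullet> d + ?r * (\<Sum>Basis \<bullet> d))"
          using x unfolding mem_box inner_add_left inner_diff_left inner_scaleR_left by blast
        have "?r \<le> \<bar>(x - p) \<bullet> d\<bar>" using d(2) unfolding inner_sum_Basis[OF d(1)] inner_diff_left by linarith
        then show ?thesis by (intro cutoff_eq_0[OF d(1)]) (simp add: field_simps)
      qed
      have vol: "measure lebesgue ?Q = 64 * (1 / real (Suc n)) ^ 3"
      proof -
        have "measure lebesgue ?Q = (\<Prod>d\<in>(Basis::space set). (p + ?r *\<^sub>R \<Sum>Basis) \<bullet> d - (p - ?r *\<^sub>R \<Sum>Basis) \<bullet> d)"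
          by (subst measure_completion) (auto intro!: content_cbox ballI simp: inner_add_left inner_diff_left simp del: Basis_zero)
        also have "\<dots> = (\<Prod>d\<in>(Basis::space set). 4 / real (Suc n))"
          by (rule prod.cong) (simp_all add: inner_add_left inner_diff_left)
        also have "\<dots> = 64 * (1 / real (Suc n)) ^ 3" by (simp add: power_divide eval_nat_numeral)
        finally show ?thesis .
      qed
      have "(norm (lsq_of \<Omega> (?f n)))\<^sup>2 = (\<integral>x. (if x \<in> \<Omega> then (cmod (?f n x))\<^sup>2 else 0) \<partial>lebesgue)"
        unfolding norm_lsq_of_square[OF Om m(3)[OF e]] integral_cut[OF Om] ..
      also have "\<dots> \<le> (\<integral>x. (real (Suc n) * M * B)\<^sup>2 * indicator ?Q x \<partial>lebesgue)"
      proof (rule integral_mono)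
        show "integrable lebesgue (\<lambda>x. if x \<in> \<Omega> then (cmod (?f n x))\<^sup>2 else 0)"
          unfolding integrable_cut[OF Om] by (rule L2D(2)[OF m(3)[OF e]])
        show "integrable lebesgue (\<lambda>x::space. (real (Suc n) * M * B)\<^sup>2 * indicator ?Q x)"
          using lmeasurable_cbox by (intro integrable_mult_right integrable_real_indicator) (auto simp: fmeasurable_def)
        fix x :: space
        show "(if x \<in> \<Omega> then (cmod (?f n x))\<^sup>2 else 0) \<le> (real (Suc n) * M * B)\<^sup>2 * indicator ?Q x"
        proof (cases "x \<in> \<Omega> \<and> x \<in> ?Q")
          case True
          have "cmod (?f n x) = \<bar>frechet_derivative (cutoff p n) (at x) e\<bar> * cmod (u x)" by (simp add: norm_mult)
          also have "\<dots> \<le> (real (Suc n) * M) * B" using True u(2) M by (intro mult_mono) auto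
          finally have "(cmod (?f n x))\<^sup>2 \<le> (real (Suc n) * M * B)\<^sup>2" by (intro power_mono) auto
          then show ?thesis using True by simp
        next
          case False
          have "frechet_derivative (cutoff p n) (at x) e = 0" if "x \<notin> ?Q"
            by (rule frechet_derivative_0_outside[OF closed_cbox out that])
          then show ?thesis using False by auto
        qed
      qed
      also have "\<dots> = (real (Suc n) * M * B)\<^sup>2 * (64 * (1 / real (Suc n)) ^ 3)"
        using vol by simp
      also have "\<dots> = 64 * (M * B)\<^sup>2 * (1 / real (Suc n))"
        by (simp add: power_mult_distrib power3_eq_cube power2_eq_square field_simps del: of_nat_Suc)
      finally show ?thesis .
    qed
    have "(\<lambda>n. 64 * (M * B)\<^sup>2 * (1 / real (Suc n))) \<longlonglongrightarrow> 64 * (M * B)\<^sup>2 * 0"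
      by (intro tendsto_mult_left LIMSEQ_Suc[OF lim_1_over_n])
    then have "(\<lambda>n. 64 * (M * B)\<^sup>2 * (1 / real (Suc n))) \<longlonglongrightarrow> 0" by simp
    then have "(\<lambda>n. (norm (lsq_of \<Omega> (?f n)))\<^sup>2) \<longlonglongrightarrow> 0"
      by (rule tendsto_sandwich[OF _ _ tendsto_const, rotated 2]) (intro always_eventually allI le zero_le_power2)+
    from tendsto_real_sqrt[OF this] show ?thesis by (simp add: tendsto_norm_zero_iff)
  qed
  show ?thesis unfolding m(4)[OF e] using tendsto_add[OF A Bz] by simp
qed

section \<open>Cutting functions off at both ends of the cell\<close>

context channel_geometry
begin

definition ends_cutoff :: "nat \<Rightarrow> space \<Rightarrow> real" where
  "ends_cutoff n x = cutoff (0, P) n x + cutoff (1, P) n x"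

lemma test_function_ends_cutoff: "test_function UNIV (ends_cutoff n)"
proof -
  obtain K L where K: "compact K" "\<And>x. x \<notin> K \<Longrightarrow> cutoff (0::real, P) n x = 0" and L: "compact L" "\<And>x. x \<notin> L \<Longrightarrow> cutoff (1::real, P) n x = 0"
    using test_function_cutoff[of "(0::real, P)" n] test_function_cutoff[of "(1::real, P)" n] by (auto simp: test_function_def)
  show ?thesis
  proof (rule test_functionI)
    show "Ck k (ends_cutoff n)" for k
      unfolding ends_cutoff_def[abs_def] by (intro Ck_add test_functionD(1)[OF test_function_cutoff])
    show "compact (K \<union> L)" by (rule compact_Un[OF K(1) L(1)])
    show "ends_cutoff n x = 0" if "x \<notin> K \<union> L" for x using that K(2) L(2) by (simp add: ends_cutoff_def)
  qed simp
qed

text \<open>The two centres differ by 1 in the first coordinate, so for \<open>n \<ge> 2\<close> the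
  other cutoff vanishes at points within \<open>1 / (n + 1)\<close> of one centre, and the sum does
  not exceed 1 there.\<close>

lemma ends_cutoff_eq_1:
  assumes n: "2 \<le> n" and a: "a \<in> {0, 1}" and x: "norm (x - (a, P)) \<le> 1 / real (Suc n)"
  shows "ends_cutoff n x = 1"
proof -
  have "\<bar>fst x - a\<bar> \<le> norm (x - (a, P))" using norm_fst_le[of "fst x - a" "snd x - P"] by (cases x) simp
  then have "real (Suc n) * \<bar>fst x - a\<bar> \<le> real (Suc n) * norm (x - (a, P))" by (intro mult_left_mono) simp_all
  moreover have nx: "real (Suc n) * norm (x - (a, P)) \<le> 1" using x by (simp add: field_simps del: of_nat_Suc)
  ultimately have fx: "real (Suc n) * \<bar>fst x - a\<bar> \<le> 1" by linarith
  have one: "cutoff (a, P) n x = 1" by (rule cutoff_eq_1[OF nx])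
  have "real (Suc n) = real (Suc n) * \<bar>(fst x - a) - (fst x - (1 - a))\<bar>" using a by auto
  also have "\<dots> \<le> real (Suc n) * (\<bar>fst x - a\<bar> + \<bar>fst x - (1 - a)\<bar>)" by (intro mult_left_mono abs_triangle_ineq4) simp
  also have "\<dots> \<le> 1 + real (Suc n) * \<bar>fst x - (1 - a)\<bar>" using fx unfolding distrib_left by simp
  finally have "2 \<le> real (Suc n) * \<bar>fst x - (1 - a)\<bar>" using n by linarith
  moreover have "(x - (1 - a, P)) \<bullet> e1 = fst x - (1 - a)" by (simp add: e1_def inner_prod_def)
  ultimately have "cutoff (1 - a, P) n x = 0" by (intro cutoff_eq_0[OF e_in_Basis(1)]) simp
  with one a show ?thesis by (auto simp: ends_cutoff_def)
qed

text \<open>The centres have depth \<open>- snd P\<close>, so for large \<open>n\<close> the cutoffs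
  do not reach the free surface and leave the trace unchanged.\<close>

lemma ends_cutoff_surface:
  assumes n: "2 \<le> real (Suc n) * \<bar>snd P\<bar>"
  shows "ends_cutoff n (a, b, 0) = 0"
proof -
  have "((a, b, 0) - (c, P)) \<bullet> e3 = - snd P" for c by (simp add: e3_def inner_prod_def)
  then have "cutoff (c, P) n (a, b, 0) = 0" for c using n by (intro cutoff_eq_0[OF e_in_Basis(3)]) (simp only: abs_minus_cancel)
  then show ?thesis by (simp add: ends_cutoff_def)
qed

end

context narrow_channel
begin

text \<open>Inside the channel, the closure of cell 0 exceeds the cell only by points of the two end
  apertures. Near these \<open>ends_cutoff n\<close> is 1, so the product has compact support in the
  cell. This is where the aperture must be small compared with
  \<open>1 / real (Suc n)\<close>.\<close>

lemma test_function_restrict_cell: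
  assumes n: "2 \<le> n" and small: "\<And>y. y \<in> \<theta> \<Longrightarrow> norm (\<epsilon> *\<^sub>R y) < 1 / real (Suc n)" and \<phi>: "test_function Pi_\<epsilon> \<phi>"
  shows "test_function (Om 0) (\<lambda>x. if x \<in> Om 0 then (1 - ends_cutoff n x) * \<phi> x else 0)" (is "test_function _ ?f")
proof -
  obtain K where K: "compact K" "K \<subseteq> Pi_\<epsilon>" "\<And>x. x \<notin> K \<Longrightarrow> \<phi> x = 0" using \<phi> unfolding test_function_def by blast
  let ?B = "ball (0, P) (1 / real (Suc n)) \<union> ball (1, P) (1 / real (Suc n))"
  \<comment> \<open>Removing the open balls removes the apertures and keeps the set compact; on the
    balls the product is zero anyway.\<close>
  let ?K = "K \<inter> closure (Om 0) - ?B"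
  have cK: "compact ?K"
    by (intro compact_diff compact_Int_closed[OF K(1)] closed_closure open_Un open_ball)
  have sub: "?K \<subseteq> Om 0"
  proof
    fix x assume x: "x \<in> ?K"
    then have "x \<in> Pi_\<epsilon>" using K(2) by blast
    then show "x \<in> Om 0"
    proof (cases rule: channel_cases)
      case (1 j)
      \<comment> \<open>An open cell disjoint from cell 0 does not meet its closure either.\<close>
      have "j = 0"
      proof (rule ccontr)
        assume "j \<noteq> 0"
        then have "Om j \<inter> Om 0 = {}" by (rule Om_disjoint)
        then have "Om j \<inter> closure (Om 0) = {}" unfolding open_Int_closure_eq_empty[OF open_Om] .
        then show False using 1 x by blast
      qed
      then show ?thesis using 1 by simp
    next
      case (2 j)
      have "fst x = of_int j" using 2 unfolding aperture_iff by blast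
      moreover have "0 \<le> fst x \<and> fst x \<le> 1" using closure_Om_coords[of x 0] x by simp
      ultimately have "real_of_int j \<in> {0, 1}" by (auto simp: of_int_le_1_iff)
      moreover have "norm (x - (of_int j, P)) < 1 / real (Suc n)" by (rule aperture_dist(2)[OF 2 small])
      ultimately have "x \<in> ?B" by (auto simp: dist_norm norm_minus_commute)
      then show ?thesis using x by blast
    qed
  qed
  have zero: "?f x = 0" if x: "x \<notin> ?K" for x
  proof (cases "x \<in> Om 0 \<and> x \<in> K")
    case True
    then have "x \<in> ?B" using x closure_subset[of "Om 0"] by auto
    then obtain a :: real where a: "a \<in> {0, 1}" "dist (a, P) x < 1 / real (Suc n)" unfolding Un_iff mem_ball by auto
    have "ends_cutoff n x = 1"
      by (rule ends_cutoff_eq_1[OF n a(1)]) (use a(2) in \<open>simp add: dist_norm norm_minus_commute del: of_nat_Suc\<close>)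
    then show ?thesis by simp
  qed (use K(3) in auto)
  have "Ck k ?f" for k
  proof (rule Ck_local)
    fix x
    show "\<exists>g U. open U \<and> x \<in> U \<and> (\<forall>y\<in>U. ?f y = g y) \<and> Ck k g"
    proof (cases "x \<in> Om 0")
      case True
      have "Ck k (\<lambda>x. (1 - ends_cutoff n x) * \<phi> x)"
        by (intro Ck_mult Ck_diff Ck_const test_functionD(1)[OF test_function_ends_cutoff] test_functionD(1)[OF \<phi>])
      then show ?thesis
        by (intro exI[of _ "\<lambda>x. (1 - ends_cutoff n x) * \<phi> x"] exI[of _ "Om 0"]) (use True open_Om in auto)
    next
      case False
      then have "x \<in> - ?K" using sub by blast
      moreover have "open (- ?K)" using compact_imp_closed[OF cK] by (rule open_Compl)
      ultimately show ?thesis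
        by (intro exI[of _ "\<lambda>x. 0"] exI[of _ "- ?K"] conjI ballI Ck_const zero) auto
    qed
  qed
  then show ?thesis using cK sub zero by (rule test_functionI)
qed

text \<open>The cutoff lemma with cell 0 inside the channel: a function that is damped to zero near
  both apertures continues by zero into the rest of the channel.\<close>

lemma H1_extension:
  assumes n: "2 \<le> n" and small: "\<And>y. y \<in> \<theta> \<Longrightarrow> norm (\<epsilon> *\<^sub>R y) < 1 / real (Suc n)" and u: "u \<in> H1 (Om 0)"
  shows "(\<lambda>x. if x \<in> Om 0 then complex_of_real (1 - ends_cutoff n x) * u x else 0) \<in> H1 Pi_\<epsilon>"
proof -
  let ?\<psi> = "\<lambda>x. 1 - ends_cutoff n x"
  note t = test_function_ends_cutoff[of n]
  obtain K where K: "compact K" "\<And>x. x \<notin> K \<Longrightarrow> ends_cutoff n x = 0" using t by (auto simp: test_function_def)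
  obtain M where M: "\<And>x. \<bar>ends_cutoff n x\<bar> \<le> M" using bounded_of_compact_support[OF test_functionD(2)[OF t] K] by blast
  have M': "\<bar>?\<psi> x\<bar> \<le> 1 + M" for x using M[of x] by linarith
  have \<psi>: "Ck k ?\<psi>" for k by (intro Ck_diff Ck_const test_functionD(1)[OF t])
  have tt: "test_function (Om 0) (\<lambda>x. if x \<in> Om 0 then ?\<psi> x * \<phi> x else 0)" if "test_function Pi_\<epsilon> \<phi>" for \<phi>
    by (rule test_function_restrict_cell[OF n small that])
  have d: "frechet_derivative ?\<psi> (at x) e = - frechet_derivative (ends_cutoff n) (at x) e" for x e
    by (rule frechet_derivative_eqI[of ?\<psi> "\<lambda>h. - frechet_derivative (ends_cutoff n) (at x) h"])
      (use has_derivative_diff[OF has_derivative_const test_functionD(4)[OF t]] in simp)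
  have main: "(\<lambda>x. if x \<in> Om 0 then complex_of_real (?\<psi> x) * u x else 0) \<in> L2 Pi_\<epsilon> \<and>
     (\<exists>g\<in>L2 Pi_\<epsilon>. has_weak_derivative Pi_\<epsilon> e (\<lambda>x. if x \<in> Om 0 then complex_of_real (?\<psi> x) * u x else 0) g)"
    if e: "e \<in> Basis" for e
  proof -
    have d0: "frechet_derivative (ends_cutoff n) (at x) e = 0" if "x \<notin> K" for x
      by (rule frechet_derivative_0_outside[OF compact_imp_closed[OF K(1)] K(2) that])
    obtain N where N: "\<And>x. \<bar>frechet_derivative (ends_cutoff n) (at x) e\<bar> \<le> N"
      using bounded_of_compact_support[OF test_functionD(3)[OF t e] K(1) d0] by blast
    have N': "\<bar>frechet_derivative ?\<psi> (at x) e\<bar> \<le> N" for x unfolding d abs_minus_cancel by (rule N)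
    note c = has_weak_derivative_cutoff[OF open_channel open_Om Om_subset e \<psi> M' N' tt
        H1D(1)[OF u] H1D(2)[OF u e] H1D(3)[OF u e]]
    show ?thesis by (rule conjI, rule c(1), assumption, rule bexI, rule c(3), assumption, rule c(2), assumption)
  qed
  show ?thesis unfolding H1_def mem_Collect_eq by (intro conjI ballI) (rule conjunct1[OF main[OF e_in_Basis(1)]], rule conjunct2[OF main])
qed

end

context cell_traces
begin

text \<open>The upper trace bound controls the energy by the \<open>H1_norm\<close>, which vanishes
  for the zero function.\<close>

lemma cell_energy_eq_0:
  assumes t: "has_trace (Om j) u g" and u: "\<And>x. x \<in> Om j \<Longrightarrow> u x = 0"
  shows "cell_energy j u g = 0"
proof -
  note uH = has_traceD(1)[OF t] and z = H1_zero[OF open_Om[of j]]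
  have eq: "lsq_of (Om j) u = lsq_of (Om j) (\<lambda>x. 0)" unfolding lsq_of_def using u by (simp cong: if_cong)
  have 0: "lsq_of (Om j) u = 0" unfolding eq by (rule lsq_of_zero[OF open_sets_lebesgue[OF open_Om]])
  have "grad (Om j) e u = 0" if "e \<in> Basis" for e
    using grad_cong[OF open_Om that uH z eq] grad_zero[OF open_Om that] by simp
  then have "(H1_norm (Om j) u)\<^sup>2 = 0" unfolding H1_norm_square[OF open_Om uH] using 0 by simp
  then have "norm (cell_energy j u g) \<le> 0" using Om_norm(2)[OF t] by simp
  then show ?thesis by simp
qed

end

context channel_traces
begin

text \<open>A vector of the energy space is determined by its strip components: in strip 0 the two
  functions agree, and in all other strips both components are zero.\<close>

lemma cell_energy_in_range:
  assumes v: "v \<in> H1 Pi_\<epsilon>" "\<And>x. x \<notin> Om 0 \<Longrightarrow> v x = 0" and w: "has_trace (Om 0) w g" "\<And>x. x \<in> Om 0 \<Longrightarrow> v x = w x"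
  shows "cell_energy 0 w g \<in> energy_range"
proof -
  have R: "restrict_energy j (energy v) = restrict_energy j (cell_energy 0 w g)" for j
  proof (cases "j = 0")
    case True
    note t = channel_trace(2)[OF v(1), of 0]
    have "cell_energy 0 (\<lambda>x. v x - w x) (\<lambda>y. ctr v y - g y) = 0"
      by (rule cell_energy_eq_0[OF bounded_domain.has_trace_diff[OF bounded_domain_Om t w(1)]]) (simp add: w(2))
    then have "cell_energy 0 v (ctr v) = cell_energy 0 w g" unfolding cell_energy_diff[OF t w(1)] by simp
    moreover have "restrict_energy 0 (cell_energy 0 w g) = cell_energy 0 w g"
      by (rule restrict_cell_energies) (use w(1) in \<open>auto simp: cell_energies_iff\<close>)
    ultimately show ?thesis using restrict_energy_energy[OF v(1), of 0] True by simp
  next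
    case False
    have "restrict_energy j (energy v) = 0"
      unfolding restrict_energy_energy[OF v(1)]
    proof (rule cell_energy_eq_0[OF channel_trace(2)[OF v(1)]])
      fix x assume "x \<in> Om j"
      then have "x \<notin> Om 0" using Om_disjoint[OF False] by blast
      then show "v x = 0" by (rule v(2))
    qed
    moreover have "restrict_energy 0 (cell_energy 0 w g) = cell_energy 0 w g"
      by (rule restrict_cell_energies) (use w(1) in \<open>auto simp: cell_energies_iff\<close>)
    then have "restrict_energy j (cell_energy 0 w g) = 0" using energy.R_R[of j 0 "cell_energy 0 w g"] False by simp
    ultimately show ?thesis by simp
  qed
  have "norm (restrict_energy j (energy v - cell_energy 0 w g)) \<le> 0 * norm (restrict_energy j (0 :: energy_space))" for j
    unfolding linear_diff[OF energy.linear_R] R by simp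
  then have "norm (energy v - cell_energy 0 w g) \<le> 0 * norm (0 :: energy_space)"
    by (rule energy.norm_le_if_R_le[OF order_refl])
  then have "cell_energy 0 w g = energy v" by simp
  then show ?thesis unfolding energy_range_def using v(1) by (rule image_eqI)
qed

end

context cell_traces
begin

text \<open>The capacity estimate calls for a bounded function, so \<open>u\<close> is replaced by a
  function continuous up to the boundary, as the definition of the trace provides. Subtracting its
  part near the aperture centres changes only the gradient, and that by little; the remainder
  extends by zero to the channel for all small \<epsilon>.\<close>

lemma cell_energies_dense:
  assumes \<theta>: "bounded \<theta>" and y: "y \<in> cell_energies" and \<eta>: "0 < \<eta>"
  shows "\<exists>d\<in>cell_energies. norm (y - d) \<le> \<eta> \<and>
    (\<exists>e>0. \<forall>\<epsilon>. 0 < \<epsilon> \<and> \<epsilon> < e \<longrightarrow> d \<in> channel_traces.energy_range W P \<theta> \<epsilon>)"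
proof -
  obtain u g where t: "has_trace (Om 0) u g" and yu: "y = cell_energy 0 u g" using y unfolding cell_energies_iff by blast
  obtain U where U: "\<forall>n. U n \<in> H1 (Om 0) \<and> continuous_on (closure (Om 0)) (U n)"
    and Ulim: "(\<lambda>n. H1_norm (Om 0) (\<lambda>x. U n x - u x)) \<longlonglongrightarrow> 0"
    using t unfolding has_trace_sequence by (elim conjE exE)
  have "(\<lambda>n. C * H1_norm (Om 0) (\<lambda>x. U n x - u x)) \<longlonglongrightarrow> C * 0" by (rule tendsto_mult_left[OF Ulim])
  then have "eventually (\<lambda>n. C * H1_norm (Om 0) (\<lambda>x. U n x - u x) < \<eta> / 2) sequentially"
    by (rule order_tendstoD) (use \<eta> in simp)
  then obtain m where m: "C * H1_norm (Om 0) (\<lambda>x. U m x - u x) < \<eta> / 2" unfolding eventually_sequentially by blast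
  define V where "V = U m"
  have V: "V \<in> H1 (Om 0)" "continuous_on (closure (Om 0)) V" using U unfolding V_def by blast+
  have tV: "has_trace (Om 0) V (restrict_plane V)" by (rule bounded_domain.has_trace_continuous[OF bounded_domain_Om V])
  have near1: "norm (y - cell_energy 0 V (restrict_plane V)) < \<eta> / 2"
  proof -
    have "norm (y - cell_energy 0 V (restrict_plane V)) = norm (cell_energy 0 V (restrict_plane V) - y)" by (rule norm_minus_commute)
    also have "\<dots> = norm (cell_energy 0 (\<lambda>x. V x - u x) (\<lambda>z. restrict_plane V z - g z))"
      unfolding yu cell_energy_diff[OF tV t] ..
    also have "\<dots> \<le> C * H1_norm (Om 0) (\<lambda>x. V x - u x)"
      by (rule Om_norm(2)[OF bounded_domain.has_trace_diff[OF bounded_domain_Om tV t]])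
    also have "\<dots> < \<eta> / 2" unfolding V_def by (rule m)
    finally show ?thesis .
  qed
  have "compact (closure (Om 0))" using bounded_domain.bdd[OF bounded_domain_Om] by (simp add: compact_closure)
  then obtain B where B: "\<And>x. x \<in> closure (Om 0) \<Longrightarrow> cmod (V x) \<le> B" using bounded_on_compact V(2) by blast
  have VB: "cmod (V x) \<le> B" if "x \<in> Om 0" for x by (rule B) (use that closure_subset in blast)
  define w where "w n x = complex_of_real (ends_cutoff n x) * V x" for n x
  have w_eq: "w n = (\<lambda>x. complex_of_real (cutoff (0, P) n x) * V x + complex_of_real (cutoff (1, P) n x) * V x)" for n
    unfolding w_def ends_cutoff_def by (simp add: fun_eq_iff algebra_simps)
  note h = H1_mult_test_function(1)[OF open_Om test_function_cutoff V(1)]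
  have wH: "w n \<in> H1 (Om 0)" for n unfolding w_eq by (intro H1_add[OF open_Om] h)
  have wlim: "(\<lambda>n. grad (Om 0) e (w n)) \<longlonglongrightarrow> 0" if e: "e \<in> Basis" for e
    unfolding w_eq grad_add[OF open_Om e h h]
    using tendsto_add[OF grad_cutoff_tendsto_0[OF open_Om V(1) VB e] grad_cutoff_tendsto_0[OF open_Om V(1) VB e]] by simp
  have "(\<lambda>n. grad3 (Om 0) (w n)) \<longlonglongrightarrow> (0, 0, 0)"
    unfolding grad3_def by (intro tendsto_Pair wlim e_in_Basis)
  then have "(\<lambda>n. norm (grad3 (Om 0) (w n))) \<longlonglongrightarrow> 0" by (simp only: tendsto_norm_zero_iff zero_prod_def)
  then have "eventually (\<lambda>n. norm (grad3 (Om 0) (w n)) < \<eta> / 2) sequentially" by (rule order_tendstoD) (use \<eta> in simp)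
  then obtain n1 where n1: "\<And>n. n \<ge> n1 \<Longrightarrow> norm (grad3 (Om 0) (w n)) < \<eta> / 2" unfolding eventually_sequentially by blast
  have P: "0 < \<bar>snd P\<bar>" using r0 by linarith
  obtain n2 where n2: "2 / \<bar>snd P\<bar> < real n2" using reals_Archimedean2 by blast
  \<comment> \<open>The 2 separates the two cutoffs, \<open>n1\<close> makes the gradient small, and
    \<open>n2\<close> keeps the cutoffs away from the free surface.\<close>
  define n where "n = max 2 (max n1 n2)"
  have n: "2 \<le> n" "n1 \<le> n" "n2 \<le> n" unfolding n_def by simp_all
  have "2 / \<bar>snd P\<bar> \<le> real (Suc n)" using n2 n(3) by simp
  then have nP: "2 \<le> real (Suc n) * \<bar>snd P\<bar>" using P by (simp add: field_simps del: of_nat_Suc)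
  define z where "z x = V x - w n x" for x
  have wc: "continuous_on (closure (Om 0)) (w n)"
    unfolding w_def[abs_def] by (intro continuous_on_mult V(2) continuous_on_of_real
        continuous_on_subset[OF test_functionD(2)[OF test_function_ends_cutoff] subset_UNIV])
  have zH: "z \<in> H1 (Om 0)" unfolding z_def[abs_def] by (rule H1_diff[OF open_Om V(1) wH])
  have zc: "continuous_on (closure (Om 0)) z" unfolding z_def[abs_def] by (intro continuous_on_diff V(2) wc)
  have "restrict_plane z = restrict_plane V"
    unfolding restrict_plane_def z_def w_def by (auto simp: fun_eq_iff ends_cutoff_surface[OF nP])
  then have tz: "has_trace (Om 0) z (restrict_plane V)"
    using bounded_domain.has_trace_continuous[OF bounded_domain_Om zH zc] by simp
  let ?d = "cell_energy 0 z (restrict_plane V)"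
  have "cell_energy 0 V (restrict_plane V) - ?d = cell_energy 0 (\<lambda>x. V x - z x) (\<lambda>y. restrict_plane V y - restrict_plane V y)"
    by (rule cell_energy_diff[OF tV tz, symmetric])
  also have "\<dots> = (grad3 (Om 0) (w n), 0)"
    by (simp add: cell_energy_def z_def[abs_def] lsq_of_zero[OF free_surface_measurable])
  finally have "norm (cell_energy 0 V (restrict_plane V) - ?d) < \<eta> / 2" using n1[OF n(2)] by (simp add: norm_Pair)
  then have "norm (y - ?d) \<le> \<eta>"
    using norm_triangle_ineq[of "y - cell_energy 0 V (restrict_plane V)" "cell_energy 0 V (restrict_plane V) - ?d"] near1 by simp
  moreover have "?d \<in> cell_energies" unfolding cell_energies_iff using tz by blast
  moreover have "\<exists>e>0. \<forall>\<epsilon>. 0 < \<epsilon> \<and> \<epsilon> < e \<longrightarrow> ?d \<in> channel_traces.energy_range W P \<theta> \<epsilon>"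
  proof -
    obtain D where D: "0 < D" "\<And>y. y \<in> \<theta> \<Longrightarrow> norm y \<le> D" using \<theta> unfolding bounded_pos by blast
    \<comment> \<open>The apertures must fit both into the half balls of the geometry and into the
      region where the cutoff is 1.\<close>
    let ?r = "min r0 (1 / real (Suc n))"
    have "?d \<in> channel_traces.energy_range W P \<theta> \<epsilon>" if \<epsilon>: "0 < \<epsilon>" "\<epsilon> < ?r / D" for \<epsilon>
    proof -
      have small: "norm (\<epsilon> *\<^sub>R y) < ?r" if "y \<in> \<theta>" for y
      proof -
        have "norm (\<epsilon> *\<^sub>R y) \<le> \<epsilon> * D" using D(2)[OF that] \<epsilon>(1) by (simp add: mult_left_mono)
        also have "\<dots> < ?r" using \<epsilon>(2) D(1) by (simp only: pos_less_divide_eq)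
        finally show ?thesis .
      qed
      interpret channel_traces W P \<theta> r0 \<epsilon> c C
        by unfold_locales (use \<epsilon>(1) small in auto)
      have small': "norm (\<epsilon> *\<^sub>R y) < 1 / real (Suc n)" if "y \<in> \<theta>" for y using small[OF that] by linarith
      show ?thesis
        by (rule cell_energy_in_range[OF H1_extension[OF n(1) small' V(1)] _ tz])
          (simp_all add: z_def w_def algebra_simps)
    qed
    moreover have "0 < ?r / D" using D(1) r0 by simp
    ultimately show ?thesis by blast
  qed
  ultimately show ?thesis by blast
qed

end

section \<open>The essential spectrum\<close>

context channel_traces
begin

abbreviation ip :: "space form" where "ip \<equiv> channel_inner W P \<theta> \<epsilon>"

lemma surface_form_eq:
  assumes u: "u \<in> H1 Pi_\<epsilon>" and v: "v \<in> H1 Pi_\<epsilon>"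
  shows "surface_form W P \<theta> \<epsilon> u v =
    Complex (inner (trace_part (energy u)) (energy v)) (inner (trace_part (energy u)) (energy (\<lambda>x. \<i> * v x)))"
  unfolding surface_form_def L2_inner_eq_lsq[OF Gam_measurable channel_trace(1)[OF u] channel_trace(1)[OF v]] energy_scale[OF v]
  by (simp add: energy_def trace_part_def inner_energy_space)

lemma channel_inner_eq:
  assumes u: "u \<in> H1 Pi_\<epsilon>" and v: "v \<in> H1 Pi_\<epsilon>"
  shows "ip u v = Complex (inner (energy u) (energy v)) (inner (energy u) (energy (\<lambda>x. \<i> * v x)))"
proof -
  have "L2_inner Pi_\<epsilon> (weak_derivative Pi_\<epsilon> e u) (weak_derivative Pi_\<epsilon> e v) =
      Complex (inner (grad Pi_\<epsilon> e u) (grad Pi_\<epsilon> e v)) (inner (grad Pi_\<epsilon> e u) (grad Pi_\<epsilon> e (\<lambda>x. \<i> * v x)))"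
    if e: "e \<in> Basis" for e
    unfolding L2_inner_eq_lsq[OF Pi_measurable H1D(2)[OF u e] H1D(2)[OF v e]] grad_scale[OF open_channel e v] grad_def[of _ e u] grad_def[of _ e v] ..
  note d = this[OF e_in_Basis(1)] this[OF e_in_Basis(2)] this[OF e_in_Basis(3)]
  show ?thesis
    unfolding channel_inner_def Dirichlet_form_def sum_Basis_space d surface_form_eq[OF u v]
    by (simp add: complex_eq_iff inner_energy_space energy_def trace_part_def grad3_def)
qed

lemma form_dist_eq:
  assumes u: "u \<in> H1 Pi_\<epsilon>" and v: "v \<in> H1 Pi_\<epsilon>"
  shows "form_dist ip u v = norm (energy u - energy v)"
proof -
  have d: "(\<lambda>x. u x - v x) \<in> H1 Pi_\<epsilon>" by (rule H1_diff[OF open_channel u v])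
  show ?thesis unfolding form_dist_def channel_inner_eq[OF d d] by (simp add: energy_diff[OF u v] norm_eq_sqrt_inner)
qed

lemma energy_range_obtain:
  assumes "X \<in> energy_range"
  obtains u where "u \<in> H1 Pi_\<epsilon>" "X = energy u"
  using assms unfolding energy_range_def by blast

lemma energy_in_range: "u \<in> H1 Pi_\<epsilon> \<Longrightarrow> energy u \<in> energy_range"
  unfolding energy_range_def by (rule imageI)

lemma energy_zero: "energy (\<lambda>x. 0) = 0"
  using energy_scaleR[OF H1_zero[OF open_channel], of 0] by simp

text \<open>A complex identity of forms amounts to real ones, tested with \<open>v\<close> and with
  \<open>\<i> * v\<close>; since both belong to the space, the operator is the compression of
  \<open>trace_part\<close> in terms of energies.\<close>

lemma is_water_wave_operator_iff:
  "is_water_wave_operator W P \<theta> \<epsilon> B \<longleftrightarrow>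
    (\<forall>u\<in>H1 Pi_\<epsilon>. B u \<in> H1 Pi_\<epsilon> \<and> energy (B u) = proj energy_range (trace_part (energy u)))"
proof -
  have "(\<forall>v\<in>H1 Pi_\<epsilon>. ip w v = surface_form W P \<theta> \<epsilon> u v) \<longleftrightarrow> energy w = proj energy_range (trace_part (energy u))"
    if u: "u \<in> H1 Pi_\<epsilon>" and w: "w \<in> H1 Pi_\<epsilon>" for u w
  proof
    assume eq: "\<forall>v\<in>H1 Pi_\<epsilon>. ip w v = surface_form W P \<theta> \<epsilon> u v"
    have "proj energy_range (trace_part (energy u)) = energy w"
    proof (rule proj_eqI[OF energy_range_closed energy_in_range[OF w]])
      fix Z assume "Z \<in> energy_range"
      then obtain v where v: "v \<in> H1 Pi_\<epsilon>" "Z = energy v" by (rule energy_range_obtain)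
      have "ip w v = surface_form W P \<theta> \<epsilon> u v" by (rule bspec[OF eq v(1)])
      then show "inner (energy w) Z = inner (trace_part (energy u)) Z"
        unfolding channel_inner_eq[OF w v(1)] surface_form_eq[OF u v(1)] v(2) by simp
    qed
    then show "energy w = proj energy_range (trace_part (energy u))" by (rule sym)
  next
    assume eq: "energy w = proj energy_range (trace_part (energy u))"
    show "\<forall>v\<in>H1 Pi_\<epsilon>. ip w v = surface_form W P \<theta> \<epsilon> u v"
    proof
      fix v assume v: "v \<in> H1 Pi_\<epsilon>"
      have "inner (energy w) (energy v) = inner (trace_part (energy u)) (energy v)" if "v \<in> H1 Pi_\<epsilon>" for v
        unfolding eq by (rule inner_proj[OF energy_range_closed energy_in_range[OF that]])
      note this[OF v] this[OF H1_scale[OF open_channel v, of \<i>]]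
      then show "ip w v = surface_form W P \<theta> \<epsilon> u v"
        unfolding channel_inner_eq[OF w v] surface_form_eq[OF u v] by (simp only:)
    qed
  qed
  then show ?thesis unfolding is_water_wave_operator_def by blast
qed

lemma water_wave_operator_exists: "\<exists>B. is_water_wave_operator W P \<theta> \<epsilon> B"
proof -
  have "\<forall>u. \<exists>w. w \<in> H1 Pi_\<epsilon> \<and> energy w = proj energy_range (trace_part (energy u))"
  proof
    fix u
    have "proj energy_range (trace_part (energy u)) \<in> energy_range" by (rule proj_in[OF energy_range_closed])
    then obtain w where "w \<in> H1 Pi_\<epsilon>" "proj energy_range (trace_part (energy u)) = energy w" by (rule energy_range_obtain)
    then show "\<exists>w. w \<in> H1 Pi_\<epsilon> \<and> energy w = proj energy_range (trace_part (energy u))" by (intro exI[of _ w] conjI) simp_all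
  qed
  from choice[OF this] obtain B where "\<forall>u. B u \<in> H1 Pi_\<epsilon> \<and> energy (B u) = proj energy_range (trace_part (energy u))" ..
  then show ?thesis unfolding is_water_wave_operator_iff by (intro exI[of _ B]) simp
qed

text \<open>A complex combination of \<open>F\<close> is a real combination of the functions
  \<open>f\<close> and \<open>\<i> * f\<close>, so finite complex dimension becomes finite real
  dimension of the energies.\<close>

lemma lin_comb_energy:
  assumes "finite F" "F \<subseteq> H1 Pi_\<epsilon>"
  shows "lin_comb k F \<in> H1 Pi_\<epsilon> \<and> energy (lin_comb k F) \<in> span (energy ` F \<union> (\<lambda>f. energy (\<lambda>x. \<i> * f x)) ` F)"
  using assms
proof (induction F)
  case empty
  then show ?case by (simp add: lin_comb_def H1_zero[OF open_channel] energy_zero)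
next
  case (insert f F)
  let ?S = "\<lambda>F. span (energy ` F \<union> (\<lambda>f. energy (\<lambda>x. \<i> * f x)) ` F)"
  have f: "f \<in> H1 Pi_\<epsilon>" using insert.prems by blast
  have IH: "lin_comb k F \<in> H1 Pi_\<epsilon>" "energy (lin_comb k F) \<in> ?S F" using insert by blast+
  have fi: "(\<lambda>x. \<i> * f x) \<in> H1 Pi_\<epsilon>" by (rule H1_scale[OF open_channel f])
  have eq: "lin_comb k (insert f F) = (\<lambda>x. (complex_of_real (Re (k f)) * f x + complex_of_real (Im (k f)) * (\<i> * f x)) + lin_comb k F x)"
  proof
    fix x
    have "complex_of_real (Re (k f)) * f x + complex_of_real (Im (k f)) * (\<i> * f x) = (complex_of_real (Re (k f)) + \<i> * complex_of_real (Im (k f))) * f x"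
      by (simp add: algebra_simps)
    also have "\<dots> = k f * f x" by (simp only: complex_eq[symmetric])
    finally show "lin_comb k (insert f F) x = (complex_of_real (Re (k f)) * f x + complex_of_real (Im (k f)) * (\<i> * f x)) + lin_comb k F x"
      using insert(1,2) by (simp add: lin_comb_def)
  qed
  have a: "(\<lambda>x. complex_of_real (Re (k f)) * f x) \<in> H1 Pi_\<epsilon>" "(\<lambda>x. complex_of_real (Im (k f)) * (\<i> * f x)) \<in> H1 Pi_\<epsilon>"
    by (rule H1_scale[OF open_channel f], rule H1_scale[OF open_channel fi])
  have "energy (lin_comb k (insert f F)) = (Re (k f) *\<^sub>R energy f + Im (k f) *\<^sub>R energy (\<lambda>x. \<i> * f x)) + energy (lin_comb k F)"
    unfolding eq energy_add[OF H1_add[OF open_channel a] IH(1)] energy_add[OF a] energy_scaleR[OF f] energy_scaleR[OF fi] ..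
  also have "\<dots> \<in> ?S (insert f F)"
  proof (intro span_add span_scale)
    show "energy f \<in> ?S (insert f F)" "energy (\<lambda>x. \<i> * f x) \<in> ?S (insert f F)" by (intro span_base; simp)+
    have "?S F \<subseteq> ?S (insert f F)" by (rule span_mono) auto
    then show "energy (lin_comb k F) \<in> ?S (insert f F)" using IH(2) by (rule subsetD)
  qed
  finally show ?case unfolding eq by (intro conjI H1_add[OF open_channel] a IH(1)) (simp only: eq)
qed

text \<open>A Fredholm operator of this kind has a shift-invariant kernel of finite dimension, which
  is zero; with closed range it is then surjective, which excludes an approximate eigenvalue.
  Conversely a bound from below gives a bijection of energies, and the empty family \<open>F\<close>
  witnesses both finiteness conditions.\<close>

lemma Fredholm_iff:
  assumes B: "is_water_wave_operator W P \<theta> \<epsilon> B"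
  shows "Fredholm (H1 Pi_\<epsilon>) ip (\<lambda>u x. B u x - complex_of_real m * u x) \<longleftrightarrow> \<not> energy.approx_eigenvalue energy_range m"
    (is "Fredholm _ _ ?A \<longleftrightarrow> _")
proof -
  let ?H = energy_range
  note H = energy_range_closed and z = H1_zero[OF open_channel]
  have Bu: "B u \<in> H1 Pi_\<epsilon>" "energy (B u) = proj ?H (trace_part (energy u))" if "u \<in> H1 Pi_\<epsilon>" for u
    using B that unfolding is_water_wave_operator_iff by blast+
  have A: "?A u \<in> H1 Pi_\<epsilon>" "energy (?A u) = energy.shifted ?H m (energy u)" if u: "u \<in> H1 Pi_\<epsilon>" for u
  proof -
    note mu = H1_scale[OF open_channel u, of "complex_of_real m"]
    show "?A u \<in> H1 Pi_\<epsilon>" by (rule H1_diff[OF open_channel Bu(1)[OF u] mu])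
    show "energy (?A u) = energy.shifted ?H m (energy u)"
      unfolding energy_diff[OF Bu(1)[OF u] mu] energy_scaleR[OF u] Bu(2)[OF u] energy.shifted_def ..
  qed
  have dA: "form_dist ip (?A u) v = norm (energy.shifted ?H m (energy u) - energy v)" if "u \<in> H1 Pi_\<epsilon>" "v \<in> H1 Pi_\<epsilon>" for u v
    unfolding form_dist_eq[OF A(1)[OF that(1)] that(2)] A(2)[OF that(1)] ..
  show ?thesis
  proof
    assume F: "Fredholm (H1 Pi_\<epsilon>) ip ?A"
    obtain F where F1: "finite F" "F \<subseteq> H1 Pi_\<epsilon>"
      and F2: "\<forall>u\<in>H1 Pi_\<epsilon>. form_dist ip (?A u) (\<lambda>_. 0) = 0 \<longrightarrow> (\<exists>k. form_dist ip u (lin_comb k F) = 0)"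
      using F unfolding Fredholm_def by (elim conjE exE)
    have F3: "\<forall>w v. (\<forall>n::nat. w n \<in> H1 Pi_\<epsilon>) \<and> v \<in> H1 Pi_\<epsilon> \<and> (\<lambda>n. form_dist ip (?A (w n)) v) \<longlonglongrightarrow> 0 \<longrightarrow>
        (\<exists>u\<in>H1 Pi_\<epsilon>. form_dist ip (?A u) v = 0)"
      using F unfolding Fredholm_def by (elim conjE)
    let ?E = "energy ` F \<union> (\<lambda>f. energy (\<lambda>x. \<i> * f x)) ` F"
    have ker: "X \<in> span ?E" if X: "X \<in> ?H" "energy.shifted ?H m X = 0" for X
    proof -
      obtain u where u: "u \<in> H1 Pi_\<epsilon>" "X = energy u" using X(1) by (rule energy_range_obtain)
      have "form_dist ip (?A u) (\<lambda>_. 0) = 0" unfolding dA[OF u(1) z] energy_zero using X(2) u(2) by simp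
      then obtain k where k: "form_dist ip u (lin_comb k F) = 0" using F2 u(1) by blast
      note l = lin_comb_energy[OF F1, of k]
      have "energy u = energy (lin_comb k F)" using k unfolding form_dist_eq[OF u(1) conjunct1[OF l]] by simp
      then show ?thesis using conjunct2[OF l] u(2) by simp
    qed
    have inj: "X = 0" if X: "X \<in> ?H" "energy.shifted ?H m X = 0" for X
    proof (rule energy.shift_invariant_finite_dim)
      show "finite ?E" using F1(1) by simp
      show "shift_energy n X \<in> span ?E" for n
      proof (rule ker[OF energy_range_shift[OF X(1)]])
        have "energy.shifted ?H m (shift_energy n X) = shift_energy n (energy.shifted ?H m X)"
          by (rule energy.S_shifted[OF H]) (rule energy_range_shift)
        then show "energy.shifted ?H m (shift_energy n X) = 0" unfolding X(2) linear_0[OF energy.linear_S] .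
      qed
    qed
    have "energy.shifted ?H m ` ?H = ?H"
    proof (rule energy.closed_range_shifted_surj[OF H inj])
      fix w v assume w: "\<And>n::nat. w n \<in> ?H" and v: "v \<in> ?H" and lim: "(\<lambda>n. energy.shifted ?H m (w n)) \<longlonglongrightarrow> v"
      obtain v' where v': "v' \<in> H1 Pi_\<epsilon>" "v = energy v'" using v by (rule energy_range_obtain)
      have "\<forall>n. \<exists>u. u \<in> H1 Pi_\<epsilon> \<and> w n = energy u" using w unfolding energy_range_def by blast
      from choice[OF this] obtain u where u: "\<And>n. u n \<in> H1 Pi_\<epsilon>" and wu: "\<And>n. w n = energy (u n)" by blast
      have "(\<lambda>n. norm (energy.shifted ?H m (energy (u n)) - energy v')) \<longlonglongrightarrow> 0"
        using tendsto_norm[OF LIM_zero[OF lim]] unfolding wu v'(2) by simp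
      then have "(\<lambda>n. form_dist ip (?A (u n)) v') \<longlonglongrightarrow> 0" unfolding dA[OF u v'(1)] .
      then obtain y where y: "y \<in> H1 Pi_\<epsilon>" "form_dist ip (?A y) v' = 0" using F3 u v'(1) by blast
      then have "energy.shifted ?H m (energy y) = v" unfolding dA[OF y(1) v'(1)] v'(2) by simp
      with energy_in_range[OF y(1)] show "\<exists>u\<in>?H. energy.shifted ?H m u = v" by (rule rev_bexI)
    qed
    then show "\<not> energy.approx_eigenvalue ?H m" using energy.approx_eigenvalue_not_surj[OF H] by blast
  next
    assume n: "\<not> energy.approx_eigenvalue ?H m"
    obtain d where d: "0 < d" "\<And>X. X \<in> ?H \<Longrightarrow> d * norm X \<le> norm (energy.shifted ?H m X)"
      using energy.not_approx_eigenvalueD[OF n] by blast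
    have surj: "\<exists>u\<in>H1 Pi_\<epsilon>. form_dist ip (?A u) v = 0" if v: "v \<in> H1 Pi_\<epsilon>" for v
    proof -
      have "energy v \<in> energy.shifted ?H m ` ?H"
        unfolding energy.not_approx_eigenvalue_surj[OF H n] by (rule energy_in_range[OF v])
      then obtain X where X: "energy v = energy.shifted ?H m X" "X \<in> ?H" by (rule imageE)
      obtain u where u: "u \<in> H1 Pi_\<epsilon>" "X = energy u" using X(2) by (rule energy_range_obtain)
      have "form_dist ip (?A u) v = 0" unfolding dA[OF u(1) v] X(1) u(2) by simp
      then show ?thesis using u(1) by (rule bexI)
    qed
    have l: "lin_comb k {} = (\<lambda>x. 0)" for k :: "(space \<Rightarrow> complex) \<Rightarrow> complex" by (simp add: lin_comb_def)
    show "Fredholm (H1 Pi_\<epsilon>) ip ?A"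
      unfolding Fredholm_def
    proof (intro conjI allI impI)
      have "form_dist ip u (lin_comb k {}) = 0" if u: "u \<in> H1 Pi_\<epsilon>" "form_dist ip (?A u) (\<lambda>_. 0) = 0" for u k
      proof -
        have "d * norm (energy u) \<le> 0" using d(2)[OF energy_in_range[OF u(1)]] u(2) unfolding dA[OF u(1) z] energy_zero by simp
        then have "energy u = 0" using d(1) by (simp add: mult_le_0_iff)
        then show ?thesis unfolding l form_dist_eq[OF u(1) z] energy_zero by simp
      qed
      then show "\<exists>F. finite F \<and> F \<subseteq> H1 Pi_\<epsilon> \<and>
          (\<forall>u\<in>H1 Pi_\<epsilon>. form_dist ip (?A u) (\<lambda>_. 0) = 0 \<longrightarrow> (\<exists>k. form_dist ip u (lin_comb k F) = 0))"
        by (intro exI[of _ "{}"] conjI ballI impI exI) simp_all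
      show "\<exists>u\<in>H1 Pi_\<epsilon>. form_dist ip (?A u) v = 0"
        if "(\<forall>n::nat. w n \<in> H1 Pi_\<epsilon>) \<and> v \<in> H1 Pi_\<epsilon> \<and> (\<lambda>n. form_dist ip (?A (w n)) v) \<longlonglongrightarrow> 0" for w v
        using that by (intro surj) blast
      have "\<exists>u\<in>H1 Pi_\<epsilon>. \<exists>k. form_dist ip v (\<lambda>x. ?A u x + lin_comb k {} x) = 0" if v: "v \<in> H1 Pi_\<epsilon>" for v
      proof -
        obtain u where u: "u \<in> H1 Pi_\<epsilon>" "form_dist ip (?A u) v = 0" using surj[OF v] by (rule bexE)
        have "form_dist ip v (?A u) = form_dist ip (?A u) v"
          unfolding form_dist_eq[OF v A(1)[OF u(1)]] form_dist_eq[OF A(1)[OF u(1)] v] by (rule norm_minus_commute)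
        then have "form_dist ip v (\<lambda>x. ?A u x + lin_comb k {} x) = 0" for k unfolding l using u(2) by simp
        with u(1) show ?thesis by blast
      qed
      then show "\<exists>F. finite F \<and> F \<subseteq> H1 Pi_\<epsilon> \<and>
          (\<forall>v\<in>H1 Pi_\<epsilon>. \<exists>u\<in>H1 Pi_\<epsilon>. \<exists>k. form_dist ip v (\<lambda>x. ?A u x + lin_comb k F x) = 0)"
        by (intro exI[of _ "{}"] conjI) simp_all
    qed
  qed
qed

text \<open>By \<open>Fredholm_iff\<close> every admissible \<open>B\<close> gives the same
  condition, and one exists because the projection to the closed range of energies can be lifted to
  functions.\<close>

lemma water_wave_essential_spectrum_eq:
  "water_wave_essential_spectrum W P \<theta> \<epsilon> = {l. 0 \<le> l \<and> energy.approx_eigenvalue energy_range (1 / (1 + l))}"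
proof -
  have "(\<exists>B. is_water_wave_operator W P \<theta> \<epsilon> B \<and> complex_of_real m \<in> essential_spectrum (H1 Pi_\<epsilon>) ip B) \<longleftrightarrow>
      energy.approx_eigenvalue energy_range m" for m
  proof -
    have "complex_of_real m \<in> essential_spectrum (H1 Pi_\<epsilon>) ip B \<longleftrightarrow> energy.approx_eigenvalue energy_range m"
      if "is_water_wave_operator W P \<theta> \<epsilon> B" for B
      unfolding essential_spectrum_def mem_Collect_eq Fredholm_iff[OF that] by simp
    then show ?thesis using water_wave_operator_exists by blast
  qed
  then show ?thesis unfolding water_wave_essential_spectrum_def by (simp only:)
qed

end

section \<open>From the geometry of the channel to the abstract perturbation result\<close>

theorem corollary3p2:
  fixes W :: "(real \<times> real \<times> real) set"
    and P :: "real \<times> real"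
    and \<theta> :: "(real \<times> real) set"
  assumes "open W" and "connected W" and "compact (closure W)" and "Lipschitz_boundary W"
    and "\<And>a. a \<in> {0, 1} \<Longrightarrow>
           simply_connected (slice W a) \<and> 0 < measure lebesgue (slice W a) \<and> P \<in> slice W a"
    and "snd P < 0"
    and "connected (cell W)" and "0 < measure lebesgue (free_surface (cell W))"
    and "trace_facts (cell W)"
    and "open \<theta>" and "connected \<theta>" and "bounded \<theta>" and "0 \<in> \<theta>" and "C2_boundary \<theta>"
    and "\<And>a. a \<in> {0, 1} \<Longrightarrow> {a} \<times> closure ((\<lambda>y. 2 *\<^sub>R y + P) ` \<theta>) \<subseteq> frontier (cell W)"
    and "(SUP y\<in>\<theta>. snd y + snd P) < 0"
    and "\<exists>N0. open N0 \<and> {0} \<times> ((\<lambda>y. y + P) ` closure \<theta>) \<subseteq> N0 \<and>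
           N0 \<inter> {x. fst x = 0} \<subseteq> frontier (cell W) \<and> N0 \<inter> {x. fst x > 0} \<subseteq> cell W"
    and "\<exists>N1. open N1 \<and> {1} \<times> ((\<lambda>y. y + P) ` closure \<theta>) \<subseteq> N1 \<and>
           N1 \<inter> {x. fst x = 1} \<subseteq> frontier (cell W) \<and> N1 \<inter> {x. fst x < 1} \<subseteq> cell W"
  shows "\<forall>N::nat. \<exists>\<epsilon>N>0. \<forall>\<epsilon>. 0 < \<epsilon> \<and> \<epsilon> < \<epsilon>N \<longrightarrow>
           has_at_least_gaps N (water_wave_essential_spectrum W P \<theta> \<epsilon>)"
proof
  fix N :: nat
  note W = assms(1,3) and P = assms(6) and surface = assms(8) and facts = assms(9)
    and \<theta> = assms(10,12,13) and N0 = assms(17) and N1 = assms(18)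
  have open_cell: "open (cell W)"
  proof -
    have "cell W = W \<inter> {x. snd (snd x) < 0} \<inter> {x. 0 < fst x} \<inter> {x. fst x < 1}"
      unfolding cell_def by auto
    moreover have "open {x::space. snd (snd x) < 0}" "open {x::space. 0 < fst x}" "open {x::space. fst x < 1}"
      by (intro open_Collect_less continuous_intros)+
    ultimately show ?thesis using W(1) by (simp add: open_Int)
  qed
  have bounded_cell: "bounded (cell W)"
    by (rule bounded_subset[OF compact_imp_bounded[OF W(2)]]) (use closure_subset[of W] in \<open>auto simp: cell_def\<close>)
  have "0 + P \<in> (\<lambda>y. y + P) ` closure \<theta>" using \<theta>(3) closure_subset by (intro imageI) blast
  then have P\<theta>: "(a, P) \<in> {a} \<times> ((\<lambda>y. y + P) ` closure \<theta>)" for a :: real by simp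
  obtain M0 where M0: "open M0" "(0, P) \<in> M0" "M0 \<inter> {x. fst x > 0} \<subseteq> cell W" using N0 P\<theta>[of 0] by blast
  obtain M1 where M1: "open M1" "(1, P) \<in> M1" "M1 \<inter> {x. fst x < 1} \<subseteq> cell W" using N1 P\<theta>[of 1] by blast
  obtain a where a: "0 < a" "ball (0, P) a \<subseteq> M0" using M0(1,2) open_contains_ball by blast
  obtain b where b: "0 < b" "ball (1, P) b \<subseteq> M1" using M1(1,2) open_contains_ball by blast
  \<comment> \<open>One radius for both ends: the balls stay inside the given neighbourhoods and
    below the free surface.\<close>
  define r0 where "r0 = min (min a b) (- snd P)"
  have r0: "0 < r0" "r0 \<le> a" "r0 \<le> b" "r0 \<le> - snd P" using a(1) b(1) P unfolding r0_def by simp_all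
  have half0: "x \<in> cell W" if "dist x (0, P) < r0" "0 < fst x" for x
  proof -
    have "x \<in> ball (0, P) a" using that(1) r0(2) by (simp add: dist_commute)
    then show ?thesis using a(2) M0(3) that(2) by blast
  qed
  have half1: "x \<in> cell W" if "dist x (1, P) < r0" "fst x < 1" for x
  proof -
    have "x \<in> ball (1, P) b" using that(1) r0(3) by (simp add: dist_commute)
    then show ?thesis using b(2) M1(3) that(2) by blast
  qed
  interpret channel_geometry W P \<theta> r0
    by unfold_locales (fact open_cell bounded_cell \<theta>(1) r0(1) r0(4) half0 half1)+
  interpret cell: bounded_domain "cell W" by unfold_locales (fact open_cell bounded_cell)+
  obtain c C where "cell.trace_bounds c C" using cell.trace_facts_imp_bounds[OF facts] by blast
  then interpret cell_traces W P \<theta> r0 c C by unfold_locales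
  obtain D where D: "0 < D" "\<And>y. y \<in> \<theta> \<Longrightarrow> norm y \<le> D" using \<theta>(2) unfolding bounded_pos by blast
  \<comment> \<open>Since \<open>D\<close> bounds \<theta>, every smaller \<epsilon> keeps the
    scaled aperture within \<open>r0\<close> of its centre.\<close>
  define \<epsilon>0 where "\<epsilon>0 = r0 / D"
  have \<epsilon>0: "0 < \<epsilon>0" using r0(1) D(1) by (simp add: \<epsilon>0_def)
  have channel: "channel_traces W P \<theta> r0 \<epsilon> c C" if \<epsilon>: "0 < \<epsilon>" "\<epsilon> < \<epsilon>0" for \<epsilon>
  proof unfold_locales
    show "norm (\<epsilon> *\<^sub>R y) < r0" if "y \<in> \<theta>" for y
    proof -
      have "norm (\<epsilon> *\<^sub>R y) \<le> \<epsilon> * D" using D(2)[OF that] \<epsilon>(1) by (simp add: mult_left_mono)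
      also have "\<dots> < r0" using \<epsilon>(2) D(1) unfolding \<epsilon>0_def by (simp only: pos_less_divide_eq)
      finally show ?thesis .
    qed
  qed (fact \<epsilon>(1))
  let ?H = "channel_traces.energy_range W P \<theta>"
  have "\<exists>e>0. \<forall>\<epsilon>. 0 < \<epsilon> \<and> \<epsilon> < e \<longrightarrow>
      has_at_least_gaps N {l. 0 \<le> l \<and> energy.approx_eigenvalue (?H \<epsilon>) (1 / (1 + l))}"
  proof (rule energy.gaps_of_perturbed_cells[OF cell_energies_closed _ cell_energies_compact[OF facts] _ \<epsilon>0])
    \<comment> \<open>The energies of the cell do not depend on \<epsilon>, so any admissible value
      can be used to invoke the lemma about the channel.\<close>
    show "restrict_energy 0 x = x" if "x \<in> cell_energies" for x
      using channel_traces.restrict_cell_energies[OF channel[of "\<epsilon>0 / 2"] that] \<epsilon>0 by simp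
    show "\<not> trace_part ` cell_energies \<subseteq> span F" if "finite F" for F
      by (rule trace_part_infinite_dim[OF _ that]) (use surface in \<open>simp add: Om_0\<close>)
    show "closed_subspace (?H \<epsilon>)" if "0 < \<epsilon>" "\<epsilon> < \<epsilon>0" for \<epsilon>
      by (rule channel_traces.energy_range_closed[OF channel[OF that]])
    show "shift_energy n x \<in> ?H \<epsilon>" if "0 < \<epsilon>" "\<epsilon> < \<epsilon>0" "x \<in> ?H \<epsilon>" for \<epsilon> n x
      by (rule channel_traces.energy_range_shift[OF channel[OF that(1,2)] that(3)])
    show "?H \<epsilon> \<subseteq> energy.cell_sum cell_energies" if "0 < \<epsilon>" "\<epsilon> < \<epsilon>0" for \<epsilon>
      by (rule channel_traces.energy_range_subset[OF channel[OF that]])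
    show "\<exists>d\<in>cell_energies. norm (y - d) \<le> \<eta> \<and> (\<exists>e>0. \<forall>\<epsilon>. 0 < \<epsilon> \<and> \<epsilon> < e \<longrightarrow> d \<in> ?H \<epsilon>)"
      if "y \<in> cell_energies" "0 < \<eta>" for y \<eta>
      by (rule cell_energies_dense[OF \<theta>(2) that])
  qed
  then obtain e where e: "0 < e" "\<And>\<epsilon>. 0 < \<epsilon> \<Longrightarrow> \<epsilon> < e \<Longrightarrow>
      has_at_least_gaps N {l. 0 \<le> l \<and> energy.approx_eigenvalue (?H \<epsilon>) (1 / (1 + l))}" by blast
  have "has_at_least_gaps N (water_wave_essential_spectrum W P \<theta> \<epsilon>)" if "0 < \<epsilon>" "\<epsilon> < min e \<epsilon>0" for \<epsilon>
  proof -
    have ch: "channel_traces W P \<theta> r0 \<epsilon> c C" using channel[of \<epsilon>] that by simp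
    show ?thesis unfolding channel_traces.water_wave_essential_spectrum_eq[OF ch] using e(2)[of \<epsilon>] that by simp
  qed
  then show "\<exists>\<epsilon>N>0. \<forall>\<epsilon>. 0 < \<epsilon> \<and> \<epsilon> < \<epsilon>N \<longrightarrow> has_at_least_gaps N (water_wave_essential_spectrum W P \<theta> \<epsilon>)"
    by (intro exI[of _ "min e \<epsilon>0"] conjI allI impI) (use e(1) \<epsilon>0 in simp, blast)
qed

end
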